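(* Let $\sharp\in\{cy,ra\}$ and assume (ER$\sharp$), (NE) and (TRI), at equilibrium $\boldsymbol\zeta=0$. Then, for any initial state $\rho$, the random vectors $\frac1{\sqrt{N\tau_\sharp}}\big(\mathcal Q^N_{\mathcal R}(\sharp)-\mathbb E(\mathcal Q^N_{\mathcal R}(\sharp))\big)$ converge in distribution as $N\to\infty$ to a centered Gaussian with covariance matrix $(D^\sharp_{jk})_{1\le j,k\le M}$, where $D^{cy}_{jk}=L^{cy}_{jk}+L^{rcy}_{jk}$ and $D^{ra}_{jk}=2L^{ra}_{jk}$.
   Context: Setting: finite-dimensional $\mathcal H_{\mathcal S},\mathcal H_{\mathcal E_j}$ ($j=1..M$, $M\ge2$), self-adjoint $H_{\mathcal S},H_{\mathcal E_j}$, $V_j$ (on $\mathcal H_{\mathcal S}\otimes\mathcal H_{\mathcal E_j}$), $\tau_j>0$, $T=\sum\tau_j$, $U_j=e^{-i\tau_j(H_{\mathcal S}\otimes\mathrm{Id}+\mathrm{Id}\otimes H_{\mathcal E_j}+V_j)}$; $\beta_{\rm ref}>0$, for $\boldsymbol\zeta\in\mathbb R^M$, $\beta_j=\beta_{\rm ref}-\zeta_j$, $\rho_{\mathcal E_j}$ Gibbs state of $H_{\mathcal E_j}$ at $\beta_j$; $\mathcal L_j(\rho)=\mathrm{Tr}_{\mathcal H_{\mathcal E_j}}(U_j(\rho\otimes\rho_{\mathcal E_j})U_j^* )$ with dual $\mathcal L_j^*$; $\mathcal L_{cy}=\mathcal L_M\circ\cdots\circ\mathcal L_1$, $\mathcal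 L_{rcy}=\mathcal L_1\circ\cdots\circ\mathcal L_M$, $\mathcal L_{ra}=\frac1M\sum\mathcal L_j$. Primitive: products of $n$ Kraus operators span all operators for some $n$. (ER$\sharp$): $\mathcal L_{\sharp,\boldsymbol\zeta}$ primitive for some $\boldsymbol\zeta$; $\rho^\sharp_{+,\boldsymbol\zeta}$ its unique invariant state. (NE): some $\zeta\mapsto\rho_{+,\zeta}$ with $U_j(\rho_{+,\zeta}\otimes\rho_{\mathcal E_j,\zeta})U_j^*=\rho_{+,\zeta}\otimes\rho_{\mathcal E_j,\zeta}$ for all $j,\zeta$ ($\rho_{\mathcal E_j,\zeta}$ Gibbs at $\beta_{\rm ref}-\zeta$). (TRI): antiunitary involutions $\theta,\theta_{\mathcal E_j}$ commuting with $H_{\mathcal S}$, resp. $H_{\mathcal E_j}$, with $\theta\otimes\theta_{\mathcal E_j}$ commuting with $V_j$. Fluxes $\Phi_j=-\frac1T\mathrm{Tr}_{\mathcal H_{\mathcal E_j}}((\mathrm{Id}\otimes\rho_{\mathcal E_j})(U_j^*(\mathrm{Id}\otimes H_{\mathcal E_j})U_j-\mathrm{Id}\otimes H_{\mathcal E_j}))$, $\Phi^{cy}_j=\mathcal L_1^*\circ\cdots\circ\mathcal L_{j-1}^*(\Phi_j)$, $\Phi^{rcy}_j=\mathcal L_M^*\circ\cdots\circ\mathcal L_{j+1}^*(\Phi_j)$, $\Phi^{ra}_j=\Phi_j$. Kinetic coefficients $L^\sharp_{jk}=\partial_{\zeta_k}\mathrm{Tr}(\rho^\sharp_{+,\boldsymbol\zeta}\Phi^\sharp_{j,\boldsymbol\zeta})|_{\boldsymbol\zeta=0}$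 for $\sharp\in\{cy,rcy,ra\}$. Full counting statistics: for $\mathbf j=(j_n)$, $N$, probes $\mathcal E^n$ copies of $\mathcal E_{j_n}$, $U_n$ copy of $U_{j_n}$, $S^n=\beta_{j_n}H_{\mathcal E^n}$, $\rho^N_{tot}=\rho\otimes\rho_{\mathcal E^1}\otimes\cdots\otimes\rho_{\mathcal E^N}$; for $\mathbf s=((s_n,s'_n))$ with $s_n,s'_n\in\mathrm{sp}(S^n)$, $\mathcal U^{\mathbf s}_N=\Pi_{s'_N}(S^N)U_N\Pi_{s_N}(S^N)\cdots\Pi_{s'_1}(S^1)U_1\Pi_{s_1}(S^1)$, $\mathbb P_{\mathbf j}(\mathbf s)=\mathrm{Tr}(\mathcal U^{\mathbf s}_N\rho^N_{tot}\mathcal U^{\mathbf s*}_N)$; entropy increments $\mathcal S^N_{\mathcal R_j}(\mathbf j)=\sum_{n\le N,j_n=j}(s'_n-s_n)$ and energy increments $\mathcal Q^N_{\mathcal R_j}(\mathbf j)=-\beta_j^{-1}\mathcal S^N_{\mathcal R_j}(\mathbf j)$. Cyclic: $\mathbf j^{cy}$ with $j^{cy}_{k+nM}=k$, $\mathcal Q^N_{\mathcal R}(cy)=\mathcal Q^{NM}_{\mathcal R}(\mathbf j^{cy})$ under $\mathbb P_{\mathbf j^{cy}}$, $\tau_{cy}=T$. Random: $\mathcal Q^N_{\mathcal R}(ra)=\mathcal Q^N_{\mathcal R}(\mathbf j)$ under $\mathcal P(\mathbf j)\mathbb P_{\mathbf j}(\mathbf s)$, $\mathcal P$ the product of uniform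 measures on $\{1..M\}^{\mathbb N^*}$, $\tau_{ra}=T/M$. *)

theory Defs
  imports "HOL-Probability.Probability" "Jordan_Normal_Form.Matrix"
begin

definition adj :: "complex mat \<Rightarrow> complex mat" where
  "adj A = Matrix.mat (dim_col A) (dim_row A) (\<lambda>(i,j). cnj (A $$ (j,i)))"

definition ip :: "complex vec \<Rightarrow> complex vec \<Rightarrow> complex" where
  "ip u v = (\<Sum>i<dim_vec u. cnj (u $ i) * v $ i)"

definition mtrace :: "complex mat \<Rightarrow> complex" where
  "mtrace A = (\<Sum>i<dim_row A. A $$ (i,i))"

definition hermitian :: "nat \<Rightarrow> complex mat \<Rightarrow> bool" where
  "hermitian d A \<longleftrightarrow> A \<in> carrier_mat d d \<and> adj A = A"

definition psd :: "nat \<Rightarrow> complex mat \<Rightarrow> bool" where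
  "psd d A \<longleftrightarrow> hermitian d A \<and> (\<forall>v\<in>carrier_vec d. 0 \<le> Re (ip v (A *\<^sub>v v)))"

definition state :: "nat \<Rightarrow> complex mat \<Rightarrow> bool" where
  "state d \<rho> \<longleftrightarrow> psd d \<rho> \<and> mtrace \<rho> = 1"

definition mexp :: "complex mat \<Rightarrow> complex mat" where
  "mexp A = Matrix.mat (dim_row A) (dim_col A)
     (\<lambda>(i,j). \<Sum>k. (A ^\<^sub>m k) $$ (i,j) / of_nat (fact k))"

text \<open>tensor (Kronecker) product; basis index of e_a \<otimes> f_b is a * dim(second) + b\<close>
definition kron :: "complex mat \<Rightarrow> complex mat \<Rightarrow> complex mat" where
  "kron A B = Matrix.mat (dim_row A * dim_row B) (dim_col A * dim_col B)
     (\<lambda>(i,j). A $$ (i div dim_row B, j div dim_col B) * B $$ (i mod dim_row B, j mod dim_col B))"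

definition ptrace2 :: "nat \<Rightarrow> nat \<Rightarrow> complex mat \<Rightarrow> complex mat" where
  "ptrace2 m n X = Matrix.mat m m (\<lambda>(a,a'). \<Sum>b<n. X $$ (a*n+b, a'*n+b))"

definition gibbs :: "complex mat \<Rightarrow> real \<Rightarrow> complex mat" where
  "gibbs H \<beta> = (1 / mtrace (mexp (complex_of_real (-\<beta>) \<cdot>\<^sub>m H))) \<cdot>\<^sub>m mexp (complex_of_real (-\<beta>) \<cdot>\<^sub>m H)"

definition spec :: "nat \<Rightarrow> complex mat \<Rightarrow> real set" where
  "spec d A = {s. \<exists>v\<in>carrier_vec d. v \<noteq> 0\<^sub>v d \<and> A *\<^sub>v v = complex_of_real s \<cdot>\<^sub>v v}"

definition specproj :: "nat \<Rightarrow> complex mat \<Rightarrow> real \<Rightarrow> complex mat" where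
  "specproj d A s = (THE P. P \<in> carrier_mat d d \<and> P * P = P \<and> adj P = P \<and>
      (\<forall>v\<in>carrier_vec d. P *\<^sub>v v = v \<longleftrightarrow> A *\<^sub>v v = complex_of_real s \<cdot>\<^sub>v v))"

definition dual_map :: "nat \<Rightarrow> (complex mat \<Rightarrow> complex mat) \<Rightarrow> complex mat \<Rightarrow> complex mat" where
  "dual_map d L X = (THE Y. Y \<in> carrier_mat d d \<and>
      (\<forall>\<rho>\<in>carrier_mat d d. mtrace (L \<rho> * X) = mtrace (\<rho> * Y)))"

definition kraus_family :: "nat \<Rightarrow> (complex mat \<Rightarrow> complex mat) \<Rightarrow> complex mat list \<Rightarrow> bool" where
  "kraus_family d L Ks \<longleftrightarrow> set Ks \<subseteq> carrier_mat d d \<and>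
     (\<forall>\<rho>\<in>carrier_mat d d. L \<rho> \<in> carrier_mat d d \<and>
        (\<forall>r<d. \<forall>c<d. L \<rho> $$ (r,c) = (\<Sum>i<length Ks. (Ks!i * \<rho> * adj (Ks!i)) $$ (r,c))))"

definition word_prod :: "nat \<Rightarrow> complex mat list \<Rightarrow> nat list \<Rightarrow> complex mat" where
  "word_prod d Ks w = foldr (\<lambda>i P. Ks!i * P) w (1\<^sub>m d)"

definition primitive :: "nat \<Rightarrow> (complex mat \<Rightarrow> complex mat) \<Rightarrow> bool" where
  "primitive d L \<longleftrightarrow> (\<exists>Ks. kraus_family d L Ks \<and>
     (\<exists>n. \<forall>A\<in>carrier_mat d d. \<exists>c :: nat list \<Rightarrow> complex.
        \<forall>r<d. \<forall>s<d. A $$ (r,s) =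
          (\<Sum>w\<in>{w. length w = n \<and> set w \<subseteq> {..<length Ks}}. c w * word_prod d Ks w $$ (r,s))))"

definition antiunitary :: "nat \<Rightarrow> (complex vec \<Rightarrow> complex vec) \<Rightarrow> bool" where
  "antiunitary d \<theta> \<longleftrightarrow>
     (\<forall>v\<in>carrier_vec d. \<theta> v \<in> carrier_vec d) \<and>
     (\<forall>u\<in>carrier_vec d. \<forall>v\<in>carrier_vec d. \<forall>a b.
        \<theta> (a \<cdot>\<^sub>v u + b \<cdot>\<^sub>v v) = cnj a \<cdot>\<^sub>v \<theta> u + cnj b \<cdot>\<^sub>v \<theta> v) \<and>
     (\<forall>u\<in>carrier_vec d. \<forall>v\<in>carrier_vec d. ip (\<theta> u) (\<theta> v) = cnj (ip u v)) \<and>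
     (\<forall>w\<in>carrier_vec d. \<exists>v\<in>carrier_vec d. \<theta> v = w)"

definition involution :: "nat \<Rightarrow> (complex vec \<Rightarrow> complex vec) \<Rightarrow> bool" where
  "involution d \<theta> \<longleftrightarrow> (\<forall>v\<in>carrier_vec d. \<theta> (\<theta> v) = v)"

definition commutes :: "nat \<Rightarrow> (complex vec \<Rightarrow> complex vec) \<Rightarrow> complex mat \<Rightarrow> bool" where
  "commutes d \<theta> A \<longleftrightarrow> (\<forall>v\<in>carrier_vec d. \<theta> (A *\<^sub>v v) = A *\<^sub>v \<theta> v)"

text \<open>the antilinear extension of (u \<otimes> v) \<mapsto> theta u \<otimes> thetaE v\<close>
definition tensor_anti :: "nat \<Rightarrow> nat \<Rightarrow> (complex vec \<Rightarrow> complex vec) \<Rightarrow> (complex vec \<Rightarrow> complex vec)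
    \<Rightarrow> complex vec \<Rightarrow> complex vec" where
  "tensor_anti m n \<theta> \<theta>E w = Matrix.vec (m*n) (\<lambda>i. \<Sum>a<m. \<Sum>b<n.
      cnj (w $ (a*n+b)) * \<theta> (unit_vec m a) $ (i div n) * \<theta>E (unit_vec n b) $ (i mod n))"

text \<open>Reservoirs are indexed by 1..nres. sdim, edim j are dim H_S, dim H_E_j.\<close>
record qsys =
  sdim :: nat
  edim :: "nat \<Rightarrow> nat"
  hS :: "complex mat"
  hE :: "nat \<Rightarrow> complex mat"
  vint :: "nat \<Rightarrow> complex mat"
  tau :: "nat \<Rightarrow> real"
  nres :: nat
  bref :: real

definition standing :: "qsys \<Rightarrow> bool" where
  "standing Q \<longleftrightarrow> nres Q \<ge> 2 \<and> sdim Q > 0 \<and> hermitian (sdim Q) (hS Q) \<and> bref Q > 0 \<and>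
     (\<forall>j\<in>{1..nres Q}. edim Q j > 0 \<and> hermitian (edim Q j) (hE Q j) \<and>
        hermitian (sdim Q * edim Q j) (vint Q j) \<and> tau Q j > 0)"

definition Ttot :: "qsys \<Rightarrow> real" where
  "Ttot Q = (\<Sum>j=1..nres Q. tau Q j)"

definition Uop :: "qsys \<Rightarrow> nat \<Rightarrow> complex mat" where
  "Uop Q j = mexp ((- \<i> * complex_of_real (tau Q j)) \<cdot>\<^sub>m
      (kron (hS Q) (1\<^sub>m (edim Q j)) + kron (1\<^sub>m (sdim Q)) (hE Q j) + vint Q j))"

definition beta :: "qsys \<Rightarrow> (nat \<Rightarrow> real) \<Rightarrow> nat \<Rightarrow> real" where
  "beta Q \<zeta> j = bref Q - \<zeta> j"

definition rhoE :: "qsys \<Rightarrow> (nat \<Rightarrow> real) \<Rightarrow> nat \<Rightarrow> complex mat" where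
  "rhoE Q \<zeta> j = gibbs (hE Q j) (beta Q \<zeta> j)"

definition Lch :: "qsys \<Rightarrow> (nat \<Rightarrow> real) \<Rightarrow> nat \<Rightarrow> complex mat \<Rightarrow> complex mat" where
  "Lch Q \<zeta> j \<rho> = ptrace2 (sdim Q) (edim Q j) (Uop Q j * kron \<rho> (rhoE Q \<zeta> j) * adj (Uop Q j))"

definition Ldual :: "qsys \<Rightarrow> (nat \<Rightarrow> real) \<Rightarrow> nat \<Rightarrow> complex mat \<Rightarrow> complex mat" where
  "Ldual Q \<zeta> j = dual_map (sdim Q) (Lch Q \<zeta> j)"

datatype scheme = Cy | Rcy | Ra

definition Lsh :: "qsys \<Rightarrow> scheme \<Rightarrow> (nat \<Rightarrow> real) \<Rightarrow> complex mat \<Rightarrow> complex mat" where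
  "Lsh Q sh \<zeta> \<rho> = (case sh of
      Cy \<Rightarrow> foldl (\<lambda>r j. Lch Q \<zeta> j r) \<rho> [1..<nres Q + 1]
    | Rcy \<Rightarrow> foldl (\<lambda>r j. Lch Q \<zeta> j r) \<rho> (rev [1..<nres Q + 1])
    | Ra \<Rightarrow> Matrix.mat (sdim Q) (sdim Q) (\<lambda>(a,b).
              (1 / of_nat (nres Q)) * (\<Sum>j=1..nres Q. Lch Q \<zeta> j \<rho> $$ (a,b))))"

definition Phi :: "qsys \<Rightarrow> (nat \<Rightarrow> real) \<Rightarrow> nat \<Rightarrow> complex mat" where
  "Phi Q \<zeta> j = complex_of_real (- 1 / Ttot Q) \<cdot>\<^sub>m
     ptrace2 (sdim Q) (edim Q j)
       (kron (1\<^sub>m (sdim Q)) (rhoE Q \<zeta> j) *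
         (adj (Uop Q j) * kron (1\<^sub>m (sdim Q)) (hE Q j) * Uop Q j - kron (1\<^sub>m (sdim Q)) (hE Q j)))"

definition Phish :: "qsys \<Rightarrow> scheme \<Rightarrow> (nat \<Rightarrow> real) \<Rightarrow> nat \<Rightarrow> complex mat" where
  "Phish Q sh \<zeta> j = (case sh of
      Cy \<Rightarrow> foldr (\<lambda>k X. Ldual Q \<zeta> k X) [1..<j] (Phi Q \<zeta> j)
    | Rcy \<Rightarrow> foldr (\<lambda>k X. Ldual Q \<zeta> k X) (rev [j+1..<nres Q + 1]) (Phi Q \<zeta> j)
    | Ra \<Rightarrow> Phi Q \<zeta> j)"

definition rho_plus :: "qsys \<Rightarrow> scheme \<Rightarrow> (nat \<Rightarrow> real) \<Rightarrow> complex mat" where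
  "rho_plus Q sh \<zeta> = (THE \<rho>. state (sdim Q) \<rho> \<and> Lsh Q sh \<zeta> \<rho> = \<rho>)"

definition kinetic :: "qsys \<Rightarrow> scheme \<Rightarrow> nat \<Rightarrow> nat \<Rightarrow> real" where
  "kinetic Q sh j k = deriv (\<lambda>t. Re (mtrace (rho_plus Q sh ((\<lambda>_. 0)(k := t)) *
                                          Phish Q sh ((\<lambda>_. 0)(k := t)) j))) 0"

definition Dcov :: "qsys \<Rightarrow> scheme \<Rightarrow> nat \<Rightarrow> nat \<Rightarrow> real" where
  "Dcov Q sh j k = (case sh of
      Cy \<Rightarrow> kinetic Q Cy j k + kinetic Q Rcy j k
    | Rcy \<Rightarrow> kinetic Q Rcy j k + kinetic Q Cy j k
    | Ra \<Rightarrow> 2 * kinetic Q Ra j k)"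

definition tau_sh :: "qsys \<Rightarrow> scheme \<Rightarrow> real" where
  "tau_sh Q sh = (case sh of Ra \<Rightarrow> Ttot Q / real (nres Q) | _ \<Rightarrow> Ttot Q)"

definition ER :: "qsys \<Rightarrow> scheme \<Rightarrow> bool" where
  "ER Q sh \<longleftrightarrow> (\<exists>\<zeta>. primitive (sdim Q) (Lsh Q sh \<zeta>))"

definition NE :: "qsys \<Rightarrow> bool" where
  "NE Q \<longleftrightarrow> (\<exists>\<rho>p :: real \<Rightarrow> complex mat. \<forall>z::real. state (sdim Q) (\<rho>p z) \<and>
      (\<forall>j\<in>{1..nres Q}.
         Uop Q j * kron (\<rho>p z) (gibbs (hE Q j) (bref Q - z)) * adj (Uop Q j)
           = kron (\<rho>p z) (gibbs (hE Q j) (bref Q - z))))"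

definition TRI :: "qsys \<Rightarrow> bool" where
  "TRI Q \<longleftrightarrow> (\<exists>\<theta>. antiunitary (sdim Q) \<theta> \<and> involution (sdim Q) \<theta> \<and> commutes (sdim Q) \<theta> (hS Q) \<and>
     (\<forall>j\<in>{1..nres Q}. \<exists>\<theta>E. antiunitary (edim Q j) \<theta>E \<and> involution (edim Q j) \<theta>E \<and>
         commutes (edim Q j) \<theta>E (hE Q j) \<and>
         commutes (sdim Q * edim Q j) (tensor_anti (sdim Q) (edim Q j) \<theta> \<theta>E) (vint Q j)))"

text \<open>Operators on H_S \<otimes> H_E^1 \<otimes> ... \<otimes> H_E^N are kernels on the product basis,
  indexed by (a, b) with a < dim H_S and b n < dim H_E^n for 1 \<le> n \<le> N (b n = 0 otherwise).
  js is the schedule (js n = index j_n of the reservoir of which probe n is a copy).\<close>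
type_synonym idx = "nat \<times> (nat \<Rightarrow> nat)"
type_synonym op = "idx \<Rightarrow> idx \<Rightarrow> complex"

definition idxset :: "qsys \<Rightarrow> (nat \<Rightarrow> nat) \<Rightarrow> nat \<Rightarrow> idx set" where
  "idxset Q js N = {(a,b). a < sdim Q \<and>
     (\<forall>n. (n \<in> {1..N} \<longrightarrow> b n < edim Q (js n)) \<and> (n \<notin> {1..N} \<longrightarrow> b n = 0))}"

definition opmul :: "idx set \<Rightarrow> op \<Rightarrow> op \<Rightarrow> op" where
  "opmul I A B = (\<lambda>x y. \<Sum>z\<in>I. A x z * B z y)"

definition opid :: op where "opid = (\<lambda>x y. if x = y then 1 else 0)"

definition opadj :: "op \<Rightarrow> op" where "opadj A = (\<lambda>x y. cnj (A y x))"

definition optr :: "idx set \<Rightarrow> op \<Rightarrow> complex" where "optr I A = (\<Sum>x\<in>I. A x x)"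

definition liftU :: "qsys \<Rightarrow> (nat \<Rightarrow> nat) \<Rightarrow> nat \<Rightarrow> complex mat \<Rightarrow> op" where
  "liftU Q js n W = (\<lambda>(a,b) (a',b'). if (\<forall>m. m \<noteq> n \<longrightarrow> b m = b' m)
       then W $$ (a * edim Q (js n) + b n, a' * edim Q (js n) + b' n) else 0)"

definition liftE :: "nat \<Rightarrow> complex mat \<Rightarrow> op" where
  "liftE n P = (\<lambda>(a,b) (a',b'). if a = a' \<and> (\<forall>m. m \<noteq> n \<longrightarrow> b m = b' m)
       then P $$ (b n, b' n) else 0)"

definition rho_tot :: "qsys \<Rightarrow> (nat \<Rightarrow> real) \<Rightarrow> (nat \<Rightarrow> nat) \<Rightarrow> nat \<Rightarrow> complex mat \<Rightarrow> op" where
  "rho_tot Q \<zeta> js N \<rho> = (\<lambda>(a,b) (a',b').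
      \<rho> $$ (a,a') * (\<Prod>n\<in>{1..N}. rhoE Q \<zeta> (js n) $$ (b n, b' n)))"

definition Sn :: "qsys \<Rightarrow> (nat \<Rightarrow> real) \<Rightarrow> (nat \<Rightarrow> nat) \<Rightarrow> nat \<Rightarrow> complex mat" where
  "Sn Q \<zeta> js n = complex_of_real (beta Q \<zeta> (js n)) \<cdot>\<^sub>m hE Q (js n)"

definition PiS :: "qsys \<Rightarrow> (nat \<Rightarrow> real) \<Rightarrow> (nat \<Rightarrow> nat) \<Rightarrow> nat \<Rightarrow> real \<Rightarrow> op" where
  "PiS Q \<zeta> js n s = liftE n (specproj (edim Q (js n)) (Sn Q \<zeta> js n) s)"

primrec Ucal :: "qsys \<Rightarrow> (nat \<Rightarrow> real) \<Rightarrow> (nat \<Rightarrow> nat) \<Rightarrow> nat \<Rightarrow> (nat \<Rightarrow> real \<times> real) \<Rightarrow> nat \<Rightarrow> op" where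
  "Ucal Q \<zeta> js N s 0 = opid"
| "Ucal Q \<zeta> js N s (Suc n) =
     opmul (idxset Q js N) (PiS Q \<zeta> js (Suc n) (snd (s (Suc n))))
      (opmul (idxset Q js N) (liftU Q js (Suc n) (Uop Q (js (Suc n))))
        (opmul (idxset Q js N) (PiS Q \<zeta> js (Suc n) (fst (s (Suc n)))) (Ucal Q \<zeta> js N s n)))"

definition prob :: "qsys \<Rightarrow> (nat \<Rightarrow> real) \<Rightarrow> complex mat \<Rightarrow> (nat \<Rightarrow> nat) \<Rightarrow> nat \<Rightarrow> (nat \<Rightarrow> real \<times> real) \<Rightarrow> real" where
  "prob Q \<zeta> \<rho> js N s = (let I = idxset Q js N; U = Ucal Q \<zeta> js N s N in
      Re (optr I (opmul I (opmul I U (rho_tot Q \<zeta> js N \<rho>)) (opadj U))))"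

definition Sset :: "qsys \<Rightarrow> (nat \<Rightarrow> real) \<Rightarrow> (nat \<Rightarrow> nat) \<Rightarrow> nat \<Rightarrow> (nat \<Rightarrow> real \<times> real) set" where
  "Sset Q \<zeta> js N = {s. \<forall>n. (n \<in> {1..N} \<longrightarrow>
        fst (s n) \<in> spec (edim Q (js n)) (Sn Q \<zeta> js n) \<and> snd (s n) \<in> spec (edim Q (js n)) (Sn Q \<zeta> js n))
      \<and> (n \<notin> {1..N} \<longrightarrow> s n = (0,0))}"

definition Qvec :: "qsys \<Rightarrow> (nat \<Rightarrow> real) \<Rightarrow> (nat \<Rightarrow> nat) \<Rightarrow> nat \<Rightarrow> (nat \<Rightarrow> real \<times> real) \<Rightarrow> nat \<Rightarrow> real" where
  "Qvec Q \<zeta> js N s = (\<lambda>j. if j \<in> {1..nres Q} then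
      - (1 / beta Q \<zeta> j) * (\<Sum>n\<in>{n\<in>{1..N}. js n = j}. snd (s n) - fst (s n)) else 0)"

definition jcy :: "qsys \<Rightarrow> nat \<Rightarrow> nat" where
  "jcy Q n = (if n = 0 then 0 else (n - 1) mod nres Q + 1)"

definition Jset :: "qsys \<Rightarrow> nat \<Rightarrow> (nat \<Rightarrow> nat) set" where
  "Jset Q N = {js. \<forall>n. (n \<in> {1..N} \<longrightarrow> js n \<in> {1..nres Q}) \<and> (n \<notin> {1..N} \<longrightarrow> js n = 0)}"

definition Exp :: "qsys \<Rightarrow> scheme \<Rightarrow> (nat \<Rightarrow> real) \<Rightarrow> complex mat \<Rightarrow> nat \<Rightarrow> ((nat \<Rightarrow> real) \<Rightarrow> real) \<Rightarrow> real" where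
  "Exp Q sh \<zeta> \<rho> N g = (case sh of
      Ra \<Rightarrow> (\<Sum>js\<in>Jset Q N. (1 / real (nres Q) ^ N) *
               (\<Sum>s\<in>Sset Q \<zeta> js N. prob Q \<zeta> \<rho> js N s * g (Qvec Q \<zeta> js N s)))
    | _ \<Rightarrow> (\<Sum>s\<in>Sset Q \<zeta> (jcy Q) (N * nres Q).
               prob Q \<zeta> \<rho> (jcy Q) (N * nres Q) s * g (Qvec Q \<zeta> (jcy Q) (N * nres Q) s)))"

definition RM :: "nat \<Rightarrow> (nat \<Rightarrow> real) set" where
  "RM M = {x. \<forall>i. i \<notin> {1..M} \<longrightarrow> x i = 0}"

end

theory Submission
  imports Defs "HOL-Computational_Algebra.Fundamental_Theorem_Algebra" "HOL-Real_Asymp.Real_Asymp"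
begin

text \<open>In an eigenbasis of the probe Hamiltonians each channel becomes a sum over Kraus operators
  \<open>K b' b\<close> labelled by the incoming and outgoing energy level \<open>b\<close>, \<open>b'\<close> of the probe. At \<open>\<zeta> = 0\<close> (NE) is
  detailed balance between these operators and a faithful state \<open>r\<close>. The characteristic function of
  the energy increments is the trace of a power of the channel with weights multiplied by phases;
  expanding the leading eigenvalue to second order gives the central limit theorem, with variance
  expressed by a bilinear form \<open>kap\<close>. Linear response expresses the kinetic coefficients by the same
  form: \<open>L\<^sub>j\<^sub>k\<close> is \<open>kap h\<^sub>j h\<^sub>k\<close> up to the duration of a step. Time reversal maps the operators of
  the cyclic scheme to those of the reversed cycle and transposes \<open>kap\<close>, whence the covariance is
  \<open>kap h\<^sub>j h\<^sub>k + kap h\<^sub>k h\<^sub>j\<close>, that is \<open>L\<^sup>c\<^sup>y + L\<^sup>r\<^sup>c\<^sup>y\<close>; in the random scheme the two summands agree.\<close>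

section \<open>Infinite matrices of bounded support\<close>

text \<open>The function h_j is the energy of a probe of reservoir j minus its Gibbs mean. It is at
  once the quantity that is counted and the logarithmic derivative of the Gibbs weights in
  \<zeta>_j; this is why fluctuations and linear response lead to the same form. Two obstacles shape
  the proof. Ergodicity is assumed at some \<zeta> that need not be 0, and for the cyclic scheme it
  is assumed for the forward cycle alone. Hence primitivity is weakened to irreducibility, which
  does not depend on the positive weights, and the ergodicity of the reversed cycle is deduced from
  that of the forward one by time reversal and detailed balance. Secondly, the increments are
  centered at their exact means and tested on all bounded continuous functions, so characteristic
  functions at scale 1 / sqrt N do not suffice: a first-order expansion with an error uniform in N
  gives bounded means and second moments of order N. No spectral perturbation theory enters; the
  perturbative statements come from solving Poisson equations for the dual channel, which is linear
  algebra in finite dimension.\<close>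

text \<open>Rectangular matrices of all sizes live in one non-unital ring, so that no dimension side
  conditions occur in algebraic manipulations.\<close>
typedef fm = "{f :: nat => nat => complex. \<exists>n. \<forall>i j. f i j \<noteq> 0 \<longrightarrow> i < n \<and> j < n}"
  morphisms ent Abs_fm
  by (intro exI[of _ "\<lambda>_ _. 0"]) auto

setup_lifting type_definition_fm

lemma fm_eqI: "(\<And>i j. ent X i j = ent Y i j) ==> X = Y"
  by (metis ent_inject ext)

lemma ent_bound: "\<exists>n. \<forall>i j. ent X i j \<noteq> 0 \<longrightarrow> i < n \<and> j < n"
  using ent[of X] by auto

lemma finite_row: "finite {k. ent X i k \<noteq> 0}"
proof -
  obtain n where "\<forall>i j. ent X i j \<noteq> 0 \<longrightarrow> i < n \<and> j < n" using ent_bound[of X] by blast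
  then show ?thesis by (auto intro!: finite_subset[OF _ finite_lessThan[of n]])
qed

text \<open>The corner that plays the part of the m-by-n matrices. Columns, isometries and square
  matrices of different spaces thus share one type, and sizes are recalled only where an identity
  \<open>fid\<close> must be absorbed or a space must be finite-dimensional.\<close>

definition crn :: "nat => nat => fm set" where
  "crn m n = {X. \<forall>i j. ent X i j \<noteq> 0 \<longrightarrow> i < m \<and> j < n}"

lemma crnD1: "X \<in> crn m n ==> m \<le> i ==> ent X i j = 0"
  and crnD2: "X \<in> crn m n ==> n \<le> j ==> ent X i j = 0"
  unfolding crn_def by force+

lemma crnI: "(\<And>i j. i \<ge> m \<or> j \<ge> n ==> ent X i j = 0) ==> X \<in> crn m n"
  unfolding crn_def using not_less by blast

lemma crn_ex: "\<exists>n. X \<in> crn n n"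
  using ent_bound[of X] unfolding crn_def by auto

lemma crn_mono: "X \<in> crn m n ==> m \<le> m' ==> n \<le> n' ==> X \<in> crn m' n'"
  unfolding crn_def by force

lemma crn_ex2: "\<exists>n. X \<in> crn n n \<and> Y \<in> crn n n"
proof -
  obtain a b where "X \<in> crn a a" "Y \<in> crn b b" using crn_ex by meson
  then show ?thesis by (intro exI[of _ "max a b"]) (auto elim!: crn_mono)
qed

definition mk :: "nat => nat => (nat => nat => complex) => fm" where
  "mk m n f = Abs_fm (\<lambda>i j. if i < m \<and> j < n then f i j else 0)"

lemma ent_mk [simp]: "ent (mk m n f) i j = (if i < m \<and> j < n then f i j else 0)"
  unfolding mk_def by (subst Abs_fm_inverse) (auto intro!: exI[of _ "max m n"])

lemma mk_crn [simp]: "mk m n f \<in> crn m n" by (rule crnI) auto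

instantiation fm :: ab_group_add
begin

lift_definition zero_fm :: fm is "\<lambda>_ _. 0" by auto
lift_definition plus_fm :: "fm => fm => fm" is "\<lambda>f g i j. f i j + g i j"
proof -
  fix f g :: "nat => nat => complex"
  assume "\<exists>n. \<forall>i j. f i j \<noteq> 0 \<longrightarrow> i < n \<and> j < n" "\<exists>n. \<forall>i j. g i j \<noteq> 0 \<longrightarrow> i < n \<and> j < n"
  then obtain a b where "\<forall>i j. f i j \<noteq> 0 \<longrightarrow> i < a \<and> j < a" "\<forall>i j. g i j \<noteq> 0 \<longrightarrow> i < b \<and> j < b"
    by blast
  then show "\<exists>n. \<forall>i j. f i j + g i j \<noteq> 0 \<longrightarrow> i < n \<and> j < n"
    by (intro exI[of _ "max a b"]) (metis add_cancel_right_right less_max_iff_disj)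
qed
lift_definition uminus_fm :: "fm => fm" is "\<lambda>f i j. - f i j" by auto
definition minus_fm :: "fm => fm => fm" where "minus_fm X Y = X + (- Y)"

instance
proof
  fix a b c :: fm
  show "a + b + c = a + (b + c)" by transfer (simp add: add.assoc)
  show "a + b = b + a" by transfer (simp add: add.commute)
  show "0 + a = a" by transfer simp
  show "- a + a = 0" by transfer simp
  show "a - b = a + - b" by (rule minus_fm_def)
qed
end

lemma ent_0 [simp]: "ent 0 i j = 0" by transfer simp
lemma ent_add [simp]: "ent (X + Y) i j = ent X i j + ent Y i j" by transfer simp
lemma ent_uminus [simp]: "ent (- X) i j = - ent X i j" by transfer simp
lemma ent_diff [simp]: "ent (X - Y) i j = ent X i j - ent Y i j"
  unfolding minus_fm_def ent_add ent_uminus by simp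
lemma ent_sum [simp]: "ent (sum f A) i j = (\<Sum>a\<in>A. ent (f a) i j)"
  by (induction A rule: infinite_finite_induct) auto

instantiation fm :: times
begin
text \<open>Summing over the finite support of a row of the left factor avoids choosing a size;
  \<open>ent_mult\<close> replaces this set by any range that is large enough.\<close>

lift_definition times_fm :: "fm => fm => fm" is "\<lambda>f g i j. \<Sum>k\<in>{k. f i k \<noteq> 0}. f i k * g k j"
proof -
  fix f g :: "nat => nat => complex"
  assume "\<exists>n. \<forall>i j. f i j \<noteq> 0 \<longrightarrow> i < n \<and> j < n" "\<exists>n. \<forall>i j. g i j \<noteq> 0 \<longrightarrow> i < n \<and> j < n"
  then obtain a b where a: "\<forall>i j. f i j \<noteq> 0 \<longrightarrow> i < a \<and> j < a"
      and b: "\<forall>i j. g i j \<noteq> 0 \<longrightarrow> i < b \<and> j < b"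
    by blast
  show "\<exists>n. \<forall>i j. (\<Sum>k\<in>{k. f i k \<noteq> 0}. f i k * g k j) \<noteq> 0 \<longrightarrow> i < n \<and> j < n"
  proof (intro exI[of _ "max a b"] allI impI)
    fix i j assume "(\<Sum>k\<in>{k. f i k \<noteq> 0}. f i k * g k j) \<noteq> 0"
    then obtain k where "f i k * g k j \<noteq> 0" by (meson sum.neutral)
    then show "i < max a b \<and> j < max a b" using a b by (metis less_max_iff_disj mult_eq_0_iff)
  qed
qed
instance ..
end

lemma ent_mult0: "ent (X * Y) i j = (\<Sum>k\<in>{k. ent X i k \<noteq> 0}. ent X i k * ent Y k j)"
  by transfer simp

lemma ent_mult: assumes "\<And>k. k \<ge> n ==> ent X i k = 0 \<or> ent Y k j = 0"
  shows "ent (X * Y) i j = (\<Sum>k<n. ent X i k * ent Y k j)"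
proof -
  have z: "ent X i k \<noteq> 0 ==> ent Y k j \<noteq> 0 ==> k < n" for k using assms[of k] by (meson not_less)
  have "(\<Sum>k\<in>{k. ent X i k \<noteq> 0}. ent X i k * ent Y k j) =
      (\<Sum>k\<in>{k. ent X i k \<noteq> 0} \<inter> {..<n}. ent X i k * ent Y k j)"
    by (rule sum.mono_neutral_right[OF finite_row]) (auto dest: z)
  also have "\<dots> = (\<Sum>k<n. ent X i k * ent Y k j)"
    by (rule sum.mono_neutral_left) auto
  finally show ?thesis by (simp add: ent_mult0)
qed

lemma ent_multL: "X \<in> crn m n ==> ent (X * Y) i j = (\<Sum>k<n. ent X i k * ent Y k j)"
  by (rule ent_mult) (simp add: crnD2)
lemma ent_multR: "Y \<in> crn n m ==> ent (X * Y) i j = (\<Sum>k<n. ent X i k * ent Y k j)"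
  by (rule ent_mult) (simp add: crnD1)

instance fm :: ring
proof
  fix X Y Z :: fm
  obtain n m where X: "X \<in> crn n n" and Y: "Y \<in> crn m m" using crn_ex by meson
  show "X * Y * Z = X * (Y * Z)"
  proof (rule fm_eqI)
    fix i j
    have XY: "ent (X * Y) i k = (\<Sum>l<n. ent X i l * ent Y l k)" for k using X by (rule ent_multL)
    have "ent (X * Y * Z) i j = (\<Sum>k<m. ent (X * Y) i k * ent Z k j)"
    proof (rule ent_mult)
      fix k assume "k \<ge> m" then show "ent (X * Y) i k = 0 \<or> ent Z k j = 0"
        by (simp add: XY crnD2[OF Y])
    qed
    also have "\<dots> = (\<Sum>k<m. \<Sum>l<n. ent X i l * ent Y l k * ent Z k j)"
      by (simp add: XY sum_distrib_right)
    also have "\<dots> = (\<Sum>l<n. \<Sum>k<m. ent X i l * ent Y l k * ent Z k j)" by (rule sum.swap)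
    also have "\<dots> = ent (X * (Y * Z)) i j"
      by (simp add: ent_multL[OF X] ent_multL[OF Y] sum_distrib_left mult.assoc)
    finally show "ent (X * Y * Z) i j = ent (X * (Y * Z)) i j" .
  qed
  obtain p where p: "X \<in> crn p p" "Y \<in> crn p p" using crn_ex2 by blast
  have "X + Y \<in> crn p p" using p by (auto intro!: crnI simp: crnD1 crnD2)
  then show "(X + Y) * Z = X * Z + Y * Z"
    by (intro fm_eqI) (simp add: ent_multL[OF p(1)] ent_multL[OF p(2)] ent_multL sum.distrib ring_distribs)
  show "X * (Y + Z) = X * Y + X * Z"
    by (intro fm_eqI) (simp add: ent_multL[OF X] sum.distrib ring_distribs)
qed

section \<open>Scalar action, adjoint, trace and matrix units\<close>

lift_definition smul :: "complex => fm => fm" (infixr \<open>*.\<close> 75) is "\<lambda>c f i j. c * f i j" by auto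
lift_definition fadj :: "fm => fm" is "\<lambda>f i j. cnj (f j i)" by auto
definition ftr :: "fm => complex" where "ftr X = (\<Sum>i\<in>{i. ent X i i \<noteq> 0}. ent X i i)"
definition fid :: "nat => fm" where "fid n = mk n n (\<lambda>i j. if i = j then 1 else 0)"
definition fE :: "nat => nat => fm" where
  "fE a b = mk (Suc a) (Suc b) (\<lambda>i j. if i = a \<and> j = b then 1 else 0)"

lemma ent_smul [simp]: "ent (c *. X) i j = c * ent X i j" by transfer simp
lemma ent_fadj [simp]: "ent (fadj X) i j = cnj (ent X j i)" by transfer simp
lemma ent_fid [simp]: "ent (fid n) i j = (if i = j \<and> i < n then 1 else 0)" unfolding fid_def by auto
lemma ent_fE [simp]: "ent (fE a b) i j = (if i = a \<and> j = b then 1 else 0)" unfolding fE_def by auto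

lemma smul_vs: "vector_space smul"
  by standard (auto intro!: fm_eqI simp: algebra_simps)
interpretation fm: vector_space smul by (rule smul_vs)

lemma smul_mult_left [simp]: "(c *. X) * Y = c *. (X * Y)"
proof (rule fm_eqI)
  fix i j
  obtain n where "X \<in> crn n n" using crn_ex by blast
  moreover then have "c *. X \<in> crn n n" by (auto intro!: crnI simp: crnD1 crnD2)
  ultimately show "ent ((c *. X) * Y) i j = ent (c *. (X * Y)) i j"
    by (simp add: ent_multL sum_distrib_left mult.assoc)
qed
lemma smul_mult_right [simp]: "X * (c *. Y) = c *. (X * Y)"
proof (rule fm_eqI)
  fix i j
  obtain n where "X \<in> crn n n" using crn_ex by blast
  then show "ent (X * (c *. Y)) i j = ent (c *. (X * Y)) i j"
    by (simp add: ent_multL sum_distrib_left mult.left_commute)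
qed

lemma smul_sum_left: "sum f A *. X = (\<Sum>a\<in>A. f a *. X)" by (rule fm.scale_sum_left)
lemma smul_sum_right: "c *. sum f A = (\<Sum>a\<in>A. c *. f a)" by (rule fm.scale_sum_right)

lemma fadj_fadj [simp]: "fadj (fadj X) = X" by (rule fm_eqI) simp
lemma fadj_0 [simp]: "fadj 0 = 0" by (rule fm_eqI) simp
lemma fadj_add: "fadj (X + Y) = fadj X + fadj Y" by (rule fm_eqI) simp
lemma fadj_diff: "fadj (X - Y) = fadj X - fadj Y" by (rule fm_eqI) simp
lemma fadj_smul: "fadj (c *. X) = cnj c *. fadj X" by (rule fm_eqI) simp
lemma fadj_sum: "fadj (sum f A) = (\<Sum>a\<in>A. fadj (f a))"
  by (induction A rule: infinite_finite_induct) (auto simp: fadj_add)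
lemma fadj_fid [simp]: "fadj (fid n) = fid n" by (rule fm_eqI) auto
lemma fadj_fE [simp]: "fadj (fE a b) = fE b a" by (rule fm_eqI) auto
lemma crn_fadj [simp]: "X \<in> crn m n ==> fadj X \<in> crn n m" by (auto intro!: crnI simp: crnD1 crnD2)
lemma fadj_mult: "fadj (X * Y) = fadj Y * fadj X"
proof (rule fm_eqI)
  fix i j obtain n where X: "X \<in> crn n n" using crn_ex by blast
  then show "ent (fadj (X * Y)) i j = ent (fadj Y * fadj X) i j"
    by (simp add: ent_multL[OF X] ent_multR[OF crn_fadj[OF X]] mult.commute)
qed
lemmas fadj_simps = fadj_add fadj_diff fadj_smul fadj_sum fadj_mult

lemma crn_0 [simp]: "0 \<in> crn m n" by (rule crnI) simp
lemma crn_add [simp]: "X \<in> crn m n ==> Y \<in> crn m n ==> X + Y \<in> crn m n"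
  and crn_diff [simp]: "X \<in> crn m n ==> Y \<in> crn m n ==> X - Y \<in> crn m n"
  and crn_uminus [simp]: "X \<in> crn m n ==> - X \<in> crn m n"
  and crn_smul [simp]: "X \<in> crn m n ==> c *. X \<in> crn m n"
  by (auto intro!: crnI simp: crnD1 crnD2)
lemma crn_sum [simp]: "(\<And>a. a \<in> A ==> f a \<in> crn m n) ==> sum f A \<in> crn m n"
  by (induction A rule: infinite_finite_induct) auto
lemma crn_fid [simp]: "fid n \<in> crn n n" by (rule crnI) auto
lemma crn_fE [simp]: "a < m ==> b < n ==> fE a b \<in> crn m n" by (rule crnI) auto
lemma crn_mult [simp]:
  assumes X: "X \<in> crn m k" and Y: "Y \<in> crn k' n"
  shows "X * Y \<in> crn m n"
proof (rule crnI)
  fix i j assume "m \<le> i \<or> n \<le> j"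
  then have "ent X i l * ent Y l j = 0" for l using crnD1[OF X, of i l] crnD2[OF Y, of j l] by auto
  then show "ent (X * Y) i j = 0" unfolding ent_multL[OF X] by (intro sum.neutral) blast
qed
lemma fid_multL [simp]: assumes X: "X \<in> crn m n" shows "fid m * X = X"
proof (rule fm_eqI)
  fix i j
  have "ent (fid m * X) i j = (\<Sum>k<m. if i = k then ent X k j else 0)"
    unfolding ent_multL[OF crn_fid] by (rule sum.cong) auto
  then show "ent (fid m * X) i j = ent X i j" using crnD1[OF X, of i j] by (cases "i < m") auto
qed
lemma fid_multR [simp]: assumes X: "X \<in> crn m n" shows "X * fid n = X"
proof (rule fm_eqI)
  fix i j
  have "ent (X * fid n) i j = (\<Sum>k<n. if k = j then ent X i k else 0)"
    unfolding ent_multL[OF X] by (rule sum.cong) auto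
  then show "ent (X * fid n) i j = ent X i j" using crnD2[OF X, of j i] by (cases "j < n") auto
qed

lemma ftr_eq: "(\<And>i. i \<ge> n ==> ent X i i = 0) ==> ftr X = (\<Sum>i<n. ent X i i)"
  unfolding ftr_def by (rule sum.mono_neutral_left) (auto simp: not_less[symmetric])
lemma ftr_crn: "X \<in> crn m n ==> ftr X = (\<Sum>i<m. ent X i i)"
  by (rule ftr_eq) (simp add: crnD1)
lemma ftr_0 [simp]: "ftr 0 = 0" by (simp add: ftr_def)
lemma ftr_add: "ftr (X + Y) = ftr X + ftr Y"
proof -
  obtain n where n: "X \<in> crn n n" "Y \<in> crn n n" using crn_ex2 by blast
  then show ?thesis by (simp add: ftr_crn[OF n(1)] ftr_crn[OF n(2)] ftr_crn[OF crn_add[OF n]] sum.distrib)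
qed
lemma ftr_smul: "ftr (c *. X) = c * ftr X"
proof -
  obtain n where n: "X \<in> crn n n" using crn_ex by blast
  then show ?thesis by (simp add: ftr_crn[OF n(1)] ftr_crn[OF crn_smul[OF n]] sum_distrib_left)
qed
lemma ftr_diff: "ftr (X - Y) = ftr X - ftr Y"
proof -
  have "X - Y = X + (-1) *. Y" by (rule fm_eqI) simp
  then show ?thesis by (simp only: ftr_add ftr_smul) simp
qed
lemma ftr_sum: "ftr (sum f A) = (\<Sum>a\<in>A. ftr (f a))"
  by (induction A rule: infinite_finite_induct) (auto simp: ftr_add)
lemma ftr_fadj: "ftr (fadj X) = cnj (ftr X)"
proof -
  obtain n where n: "X \<in> crn n n" using crn_ex by blast
  then show ?thesis by (simp add: ftr_crn[OF n(1)] ftr_crn[OF crn_fadj[OF n]])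
qed
lemma ftr_fid [simp]: "ftr (fid n) = of_nat n" by (simp add: ftr_crn[OF crn_fid])
lemma ftr_comm: "ftr (X * Y) = ftr (Y * X)"
proof -
  obtain n where n: "X \<in> crn n n" "Y \<in> crn n n" using crn_ex2 by blast
  have "ftr (X * Y) = (\<Sum>i<n. \<Sum>k<n. ent X i k * ent Y k i)"
    by (simp add: ftr_crn[OF crn_mult[OF n]] ent_multL[OF n(1)])
  also have "\<dots> = (\<Sum>k<n. \<Sum>i<n. ent X i k * ent Y k i)" by (rule sum.swap)
  also have "\<dots> = ftr (Y * X)"
    by (simp add: ftr_crn[OF crn_mult[OF n(2,1)]] ent_multL[OF n(2)] mult.commute)
  finally show ?thesis .
qed
lemmas ftr_simps = ftr_add ftr_diff ftr_smul ftr_sum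

text \<open>Scalar estimates of traces, which positivity provides, become estimates of matrices
  through this evaluation of entries.\<close>

lemma ftr_fE: "ftr (fE a b * X) = ent X b a"
proof -
  have "ent (fE a b * X) i j = (if i = a then ent X b j else 0)" for i j
    by (simp add: ent_multL[OF crn_fE[of a "Suc a" b "Suc b"]] if_distrib[of "\<lambda>x. x * _"] cong: if_cong)
  then show ?thesis
    by (subst ftr_eq[of "Suc a"]) (auto)
qed
lemma fm_eq_fE: "X \<in> crn m n ==> X = (\<Sum>a<m. \<Sum>b<n. ent X a b *. fE a b)"
proof (rule fm_eqI)
  fix i j assume X: "X \<in> crn m n"
  have "(\<Sum>a<m. \<Sum>b<n. ent X a b * (if i = a \<and> j = b then 1 else 0)) =
     (\<Sum>a<m. if i = a then (\<Sum>b<n. if j = b then ent X i j else 0) else 0)"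
    by (intro sum.cong) (auto simp: if_distrib cong: if_cong)
  also have "\<dots> = (\<Sum>b<n. if j = b then ent X i j else 0)" using crnD1[OF X, of i j]
    by (cases "i < m") auto
  also have "\<dots> = ent X i j" using crnD2[OF X, of j i] by (cases "j < n") auto
  finally show "ent X i j = ent (\<Sum>a<m. \<Sum>b<n. ent X a b *. fE a b) i j" by simp
qed

text \<open>Nondegeneracy of the trace pairing, tested with matrix units. It identifies matrices
  that are known only by duality, such as fixed points of a channel.\<close>

lemma ftr_eqI: "X \<in> crn m n ==> Y \<in> crn m n ==> (\<And>W. W \<in> crn n m ==> ftr (W * X) = ftr (W * Y)) ==> X = Y"
proof (rule fm_eqI)
  fix i j assume X: "X \<in> crn m n" and Y: "Y \<in> crn m n" and
    e: "\<And>W. W \<in> crn n m ==> ftr (W * X) = ftr (W * Y)"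
  show "ent X i j = ent Y i j"
  proof (cases "i < m \<and> j < n")
    case True then show ?thesis using e[of "fE j i"] by (simp add: ftr_fE)
  next
    case False then show ?thesis using X Y by (metis crnD1 crnD2 not_less)
  qed
qed

section \<open>Positivity\<close>

lemma ftr_sq: "ftr (fadj X * X) = (\<Sum>(i,j)\<in>{(i,j). ent X i j \<noteq> 0}. of_real ((cmod (ent X i j))\<^sup>2))"
proof -
  obtain n where n: "X \<in> crn n n" using crn_ex by blast
  have "ftr (fadj X * X) = (\<Sum>i<n. \<Sum>k<n. cnj (ent X k i) * ent X k i)"
    using n by (simp add: ftr_crn[OF crn_mult[OF crn_fadj[OF n] n]] ent_multR[OF n])
  also have "\<dots> = (\<Sum>k<n. \<Sum>i<n. of_real ((cmod (ent X k i))\<^sup>2))"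
    by (subst sum.swap) (simp add: complex_norm_square mult.commute del: of_real_power)
  also have "\<dots> = (\<Sum>(i,j)\<in>{..<n}\<times>{..<n}. of_real ((cmod (ent X i j))\<^sup>2))"
    by (rule sum.cartesian_product)
  also have "\<dots> = (\<Sum>(i,j)\<in>{(i,j). ent X i j \<noteq> 0}. of_real ((cmod (ent X i j))\<^sup>2))"
    using n by (intro sum.mono_neutral_right) (auto simp: crn_def)
  finally show ?thesis .
qed

lemma finite_supp: "finite {(i,j). ent X i j \<noteq> 0}"
proof -
  obtain n where n: "X \<in> crn n n" using crn_ex by blast
  then have "{(i,j). ent X i j \<noteq> 0} \<subseteq> {..<n} \<times> {..<n}" by (auto simp: crn_def)
  then show ?thesis by (rule finite_subset) simp
qed

lemma ftr_sq_Re: "Re (ftr (fadj X * X)) \<ge> 0" and ftr_sq_Im: "Im (ftr (fadj X * X)) = 0"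
  and ftr_sq_0: "Re (ftr (fadj X * X)) = 0 ==> X = 0"
proof -
  show "Re (ftr (fadj X * X)) \<ge> 0" unfolding ftr_sq by (auto simp: Re_sum intro!: sum_nonneg)
  show "Im (ftr (fadj X * X)) = 0" unfolding ftr_sq by (auto simp: Im_sum intro!: sum.neutral)
  assume "Re (ftr (fadj X * X)) = 0"
  then have "(\<Sum>(i,j)\<in>{(i,j). ent X i j \<noteq> 0}. (cmod (ent X i j))\<^sup>2) = 0"
    unfolding ftr_sq by (simp add: Re_sum case_prod_unfold)
  then have "\<forall>p\<in>{(i,j). ent X i j \<noteq> 0}. (case p of (i,j) => (cmod (ent X i j))\<^sup>2) = 0"
    by (subst (asm) sum_nonneg_eq_0_iff) (use finite_supp in auto)
  then show "X = 0" by (intro fm_eqI) auto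
qed

text \<open>Tested on matrices V of any size instead of vectors: the trace is the sum of the
  quadratic form over the columns of V, and conjugation by another matrix becomes a substitution for
  V.\<close>

definition fpsd :: "fm => bool" where
  "fpsd X \<longleftrightarrow> fadj X = X \<and> (\<forall>V. 0 \<le> Re (ftr (fadj V * X * V)))"

lemma fpsd_adj: "fpsd X ==> fadj X = X" by (simp add: fpsd_def)
lemma fpsdD: "fpsd X ==> 0 \<le> Re (ftr (fadj V * X * V))" by (simp add: fpsd_def)
lemma fpsd_conj: "fpsd X ==> fpsd (K * X * fadj K)"
proof -
  assume X: "fpsd X"
  have "0 \<le> Re (ftr (fadj V * (K * X * fadj K) * V))" for V
    using fpsdD[OF X, of "fadj K * V"] by (simp add: fadj_mult mult.assoc)
  then show ?thesis using X by (simp add: fpsd_def fadj_mult mult.assoc)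
qed
lemma fpsd_sq: "fpsd (X * fadj X)"
proof -
  have "0 \<le> Re (ftr (fadj V * (X * fadj X) * V))" for V
    using ftr_sq_Re[of "fadj X * V"] by (simp add: fadj_mult mult.assoc)
  then show ?thesis by (simp add: fpsd_def fadj_mult)
qed
lemma fpsd_add: "fpsd X ==> fpsd Y ==> fpsd (X + Y)"
  by (auto simp: fpsd_def fadj_simps ring_distribs ftr_simps)
lemma fpsd_0: "fpsd 0" by (simp add: fpsd_def)
lemma fpsd_smul: "fpsd X ==> 0 \<le> c ==> fpsd (of_real c *. X)"
  by (auto simp: fpsd_def fadj_simps ftr_simps)
lemma fpsd_sum: "(\<And>a. a \<in> A ==> fpsd (f a)) ==> fpsd (sum f A)"
  by (induction A rule: infinite_finite_induct) (auto simp: fpsd_add fpsd_0)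

text \<open>Expand the nonnegative quadratic polynomial $\epsilon\mapsto\langle V+\epsilon XV, X(V+\epsilon XV)\rangle$
  at small negative $\epsilon$.\<close>
lemma fpsd_ker: assumes X: "fpsd X" and 0: "Re (ftr (fadj V * X * V)) = 0" shows "X * V = 0"
proof -
  have XX: "fadj X = X" using X by (rule fpsd_adj)
  define W where "W = X * V"
  define p q where "p = Re (ftr (fadj W * W))" and "q = Re (ftr (fadj W * X * W))"
  have "0 \<le> 2 * e * p + e\<^sup>2 * q" for e :: real
  proof -
    have "0 \<le> Re (ftr (fadj (V + of_real e *. W) * X * (V + of_real e *. W)))" using X by (rule fpsdD)
    also have "fadj (V + of_real e *. W) * X * (V + of_real e *. W) =
        fadj V * X * V + of_real e *. (fadj W * W) + of_real e *. (fadj W * W) + of_real (e\<^sup>2) *. (fadj W * X * W)"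
      by (simp add: W_def fadj_simps XX algebra_simps power2_eq_square fm.scale_right_distrib fm.scale_scale)
    finally show ?thesis using 0 by (simp add: ftr_simps p_def q_def)
  qed note quad = this
  have p0: "p \<ge> 0" unfolding p_def by (rule ftr_sq_Re)
  have "p = 0"
  proof (rule ccontr)
    assume "p \<noteq> 0" then have p: "p > 0" using p0 by simp
    \<comment> \<open>This e is negative with |e q| <= p, so 2 p + e q stays positive and the
      quadratic polynomial, equal to e (2 p + e q), becomes negative.\<close>
    define e where "e = - p / (\<bar>q\<bar> + 1)"
    have "e < 0" using p by (simp add: e_def divide_neg_pos)
    have "2 * e * p + e\<^sup>2 * q = e * (2 * p + e * q)" by (simp add: power2_eq_square algebra_simps)
    moreover have "2 * p + e * q > 0"
    proof -
      have "\<bar>e * q\<bar> = p * (\<bar>q\<bar> / (\<bar>q\<bar> + 1))" using p by (simp add: e_def abs_mult)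
      also have "\<dots> \<le> p * 1" using p by (intro mult_left_mono) auto
      finally show ?thesis using p by linarith
    qed
    ultimately have "2 * e * p + e\<^sup>2 * q < 0" using \<open>e < 0\<close> by (simp add: mult_neg_pos)
    then show False using quad[of e] by simp
  qed
  then show ?thesis using ftr_sq_0[of W] by (simp add: p_def W_def)
qed

section \<open>Entrywise norm and trace estimates\<close>

definition nrm :: "fm => real" where "nrm X = (\<Sum>(i,j)\<in>{(i,j). ent X i j \<noteq> 0}. cmod (ent X i j))"

lemma nrm_crn: "X \<in> crn m n ==> nrm X = (\<Sum>i<m. \<Sum>j<n. cmod (ent X i j))"
  unfolding nrm_def sum.cartesian_product
  by (intro sum.mono_neutral_left) (auto simp: crn_def)
lemma nrm_nonneg: "nrm X \<ge> 0" unfolding nrm_def by (auto intro!: sum_nonneg)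
lemma nrm_add: "nrm (X + Y) \<le> nrm X + nrm Y"
proof -
  obtain n where n: "X \<in> crn n n" "Y \<in> crn n n" using crn_ex2 by blast
  have "nrm (X + Y) \<le> (\<Sum>i<n. \<Sum>j<n. cmod (ent X i j) + cmod (ent Y i j))"
    unfolding nrm_crn[OF crn_add[OF n]] by (auto intro!: sum_mono norm_triangle_ineq)
  then show ?thesis by (simp add: nrm_crn[OF n(1)] nrm_crn[OF n(2)] sum.distrib)
qed
lemma nrm_smul: "nrm (c *. X) = cmod c * nrm X"
proof -
  obtain n where n: "X \<in> crn n n" using crn_ex by blast
  show ?thesis by (simp add: nrm_crn[OF n(1)] nrm_crn[OF crn_smul[OF n]] norm_mult sum_distrib_left)
qed
lemma nrm_ent: "cmod (ent X i j) \<le> nrm X"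
proof (cases "ent X i j = 0")
  case False
  then show ?thesis unfolding nrm_def
    using member_le_sum[of "(i,j)" "{(i,j). ent X i j \<noteq> 0}" "\<lambda>(i,j). cmod (ent X i j)"]
    by (auto simp: finite_supp)
qed (simp add: nrm_nonneg)
lemma nrm_0_iff: "nrm X = 0 \<longleftrightarrow> X = 0"
proof
  assume "nrm X = 0" then show "X = 0" using nrm_ent[of X] by (intro fm_eqI) simp
qed (simp add: nrm_def)
lemma nrm_0 [simp]: "nrm 0 = 0" by (simp add: nrm_def)
lemma nrm_sum: "nrm (sum f A) \<le> (\<Sum>a\<in>A. nrm (f a))"
proof (induction A rule: infinite_finite_induct)
  case (insert x F) then show ?case using nrm_add[of "f x" "sum f F"] by simp
qed auto
lemma nrm_diff: "nrm (X - Y) \<le> nrm X + nrm Y"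
proof -
  have "X - Y = X + (-1) *. Y" by (rule fm_eqI) simp
  then show ?thesis using nrm_add[of X "(-1) *. Y"] by (simp only: nrm_smul) simp
qed
lemma ftr_nrm: "cmod (ftr (X * Y)) \<le> nrm X * nrm Y"
proof -
  obtain n where n: "X \<in> crn n n" "Y \<in> crn n n" using crn_ex2 by blast
  have "cmod (ftr (X * Y)) \<le> (\<Sum>i<n. \<Sum>k<n. cmod (ent X i k) * cmod (ent Y k i))"
    unfolding ftr_crn[OF crn_mult[OF n]] ent_multL[OF n(1)]
    by (intro order_trans[OF norm_sum] sum_mono) (auto simp: norm_mult intro!: order_trans[OF norm_sum])
  also have "\<dots> \<le> (\<Sum>i<n. \<Sum>k<n. cmod (ent X i k) * nrm Y)"
    by (intro sum_mono mult_left_mono nrm_ent) auto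
  finally show ?thesis by (simp add: nrm_crn[OF n(1)] sum_distrib_right)
qed

text \<open>Entries of a positive matrix are bounded by its trace: test with $E_{ii}$ and with
  $E_{ii}+cE_{ji}$, $|c|=1$.\<close>
lemma fpsd_ent: assumes X: "fpsd X" shows "cmod (ent X i j) \<le> Re (ftr X)"
proof -
  have XX: "fadj X = X" using X by (rule fpsd_adj)
  have c0: "ftr (fE a b * X * fE b' a) = ent X b b'" for a b b'
  proof -
    have "ftr (fE a b * X * fE b' a) = ftr (fE b' a * (fE a b * X))" by (rule ftr_comm)
    also have "fE b' a * (fE a b * X) = fE b' b * X"
    proof -
      have "fE b' a * fE a b = fE b' b"
        by (rule fm_eqI) (auto simp: ent_multL[OF crn_fE[of b' "Suc b'" a "Suc a"]] if_distrib[of "\<lambda>x. x * _"] cong: if_cong)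
      then show ?thesis by (simp flip: mult.assoc)
    qed
    finally show ?thesis by (simp add: ftr_fE)
  qed
  have d0: "0 \<le> Re (ent X i i)" for i using fpsdD[OF X, of "fE i i"] by (simp add: c0)
  obtain n where n: "X \<in> crn n n" "i < n" "j < n"
    by (metis crn_ex crn_mono lessI less_max_iff_disj max.cobounded1)
  have t1: "Re (ent X i i) + Re (ent X j j) \<le> Re (ftr X)" if "i \<noteq> j"
  proof -
    have "(\<Sum>k\<in>{i,j}. Re (ent X k k)) \<le> (\<Sum>k<n. Re (ent X k k))"
      by (rule sum_mono2) (use n d0 in auto)
    then show ?thesis using that by (simp add: ftr_crn[OF n(1)] Re_sum)
  qed
  have t2: "Re (ent X i i) \<le> Re (ftr X)"
  proof -
    have "(\<Sum>k\<in>{i}. Re (ent X k k)) \<le> (\<Sum>k<n. Re (ent X k k))"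
      by (rule sum_mono2) (use n d0 in auto)
    then show ?thesis by (simp add: ftr_crn[OF n(1)] Re_sum)
  qed
  have adj: "ent X b a = cnj (ent X a b)" for a b using XX by (metis ent_fadj)
  have im: "Im (ent X i i) = 0" using adj[of i i] by (metis Im_complex_of_real Reals_cnj_iff complex_is_Real_iff)
  show ?thesis
  proof (cases "i = j")
    case True then show ?thesis using im d0[of i] t2 by (simp add: cmod_eq_Re)
  next
    case False
    define x where "x = ent X i j"
    \<comment> \<open>The phase c turns the entry x into - |x|, so that the nonnegative test value
      is the sum of two diagonal entries minus 2 |x|.\<close>
    obtain c where cc: "cmod c = 1" "c * x = - of_real (cmod x)"
    proof (cases "x = 0")
      case True then show ?thesis using that[of 1] by simp
    next
      case False
      have "cmod (- cnj x / of_real (cmod x)) = 1" using False by (simp add: norm_divide)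
      moreover have "x * cnj x = of_real (cmod x) * of_real (cmod x)"
        unfolding complex_norm_square[symmetric] by (simp add: power2_eq_square)
      then have "(- cnj x / of_real (cmod x)) * x = - of_real (cmod x)"
        using False by (simp add: mult.commute)
      ultimately show ?thesis by (rule that)
    qed
    have "0 \<le> Re (ftr (fadj (fE i i + c *. fE j i) * X * (fE i i + c *. fE j i)))" using X by (rule fpsdD)
    also have "ftr (fadj (fE i i + c *. fE j i) * X * (fE i i + c *. fE j i)) =
        ent X i i + c * x + cnj (c * x) + c * cnj c * ent X j j"
      by (simp add: fadj_simps ring_distribs ftr_simps c0[unfolded mult.assoc] x_def adj[of j i] algebra_simps)
    also have "c * cnj c = 1" using cc(1) complex_norm_square[of c] by simp
    finally have "2 * cmod x \<le> Re (ent X i i) + Re (ent X j j)" unfolding cc(2) by simp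
    moreover have "cmod x \<ge> 0" by simp
    ultimately show ?thesis using t1[OF False] unfolding x_def by linarith
  qed
qed

lemma fpsd_tr_nonneg: "fpsd X ==> Re (ftr X) \<ge> 0" using fpsd_ent[of X 0 0] norm_ge_zero by (meson order_trans)
lemma fpsd_tr_Im: "fpsd X ==> Im (ftr X) = 0"
  using ftr_fadj[of X] by (simp add: fpsd_adj complex_eq_iff)
text \<open>The positive factor enters through its trace alone, and a channel preserves the trace.
  This is the source of the estimates that hold for every number of steps.\<close>

lemma fpsd_tr: "fpsd X ==> cmod (ftr (X * Y)) \<le> Re (ftr X) * nrm Y"
proof -
  assume X: "fpsd X"
  obtain n where n: "X \<in> crn n n" "Y \<in> crn n n" using crn_ex2 by blast
  have "cmod (ftr (X * Y)) \<le> (\<Sum>i<n. \<Sum>k<n. cmod (ent X i k) * cmod (ent Y k i))"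
    unfolding ftr_crn[OF crn_mult[OF n]] ent_multL[OF n(1)]
    by (intro order_trans[OF norm_sum] sum_mono) (auto simp: norm_mult intro!: order_trans[OF norm_sum])
  also have "\<dots> \<le> (\<Sum>i<n. \<Sum>k<n. Re (ftr X) * cmod (ent Y k i))"
    by (intro sum_mono mult_right_mono fpsd_ent X) auto
  also have "\<dots> = Re (ftr X) * nrm Y"
    unfolding nrm_crn[OF n(2)] by (subst sum.swap) (simp add: sum_distrib_left)
  finally show ?thesis .
qed

section \<open>Linear maps on a finite-dimensional corner\<close>

text \<open>A vector of the span outside the image, added to the image of the basis, would give an
  independent set with more elements than the basis.\<close>

lemma lin_inj_surj:
  assumes T: "finite T" "fm.independent T" and f: "Vector_Spaces.linear smul smul f"
    and inj: "inj_on f (fm.span T)" and sub: "f ` fm.span T \<subseteq> fm.span T"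
  shows "f ` fm.span T = fm.span T"
proof (rule subset_antisym[OF sub], rule subsetI, rule ccontr)
  interpret f: Vector_Spaces.linear smul smul f by fact
  fix y assume y: "y \<in> fm.span T" "y \<notin> f ` fm.span T"
  have "fm.independent (f ` T)"
    using f.independent_injective_image[OF T(2) inj] .
  moreover have sp: "fm.span (f ` T) = f ` fm.span T" by (rule f.span_image)
  ultimately have ind: "fm.independent (insert y (f ` T))" using y(2) by (simp add: fm.independent_insert)
  have "insert y (f ` T) \<subseteq> fm.span T" using y(1) sub fm.span_superset[of T] by auto
  then have "card (insert y (f ` T)) \<le> card T" using fm.independent_span_bound[OF T(1) ind] by simp
  moreover have "card (f ` T) = card T"
    using inj fm.span_superset[of T] by (meson card_image inj_on_subset)
  moreover have "y \<notin> f ` T" using y(2) fm.span_superset[of T] by auto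
  ultimately show False using T(1) by simp
qed

definition fbas :: "nat => nat => fm set" where "fbas m n = (\<lambda>(a,b). fE a b) ` ({..<m} \<times> {..<n})"

lemma finite_fbas: "finite (fbas m n)" by (simp add: fbas_def)
lemma independent_fbas: "fm.independent (fbas m n)"
proof (rule fm.independent_if_scalars_zero[OF finite_fbas])
  fix f X assume s: "(\<Sum>x\<in>fbas m n. f x *. x) = 0" and X: "X \<in> fbas m n"
  then obtain a b where ab: "X = fE a b" "a < m" "b < n" by (auto simp: fbas_def)
  have "0 = ent (\<Sum>x\<in>fbas m n. f x *. x) a b" using s by simp
  also have "\<dots> = (\<Sum>x\<in>fbas m n. if x = X then f X else 0)"
    unfolding ent_sum
    by (rule sum.cong) (auto simp: fbas_def ab split: if_splits)
  also have "\<dots> = f X" using X by (simp add: finite_fbas)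
  finally show "f X = 0" by simp
qed
lemma crn_subspace: "fm.subspace (crn m n)" by (auto simp: fm.subspace_def)
lemma span_fbas: "fm.span (fbas m n) = crn m n"
proof
  show "fm.span (fbas m n) \<subseteq> crn m n"
    by (rule fm.span_minimal[OF _ crn_subspace]) (auto simp: fbas_def)
  show "crn m n \<subseteq> fm.span (fbas m n)"
  proof
    fix X assume "X \<in> crn m n"
    then have "X = (\<Sum>a<m. \<Sum>b<n. ent X a b *. fE a b)" by (rule fm_eq_fE)
    also have "\<dots> \<in> fm.span (fbas m n)"
      by (intro fm.span_sum fm.span_scale fm.span_base) (auto simp: fbas_def)
    finally show "X \<in> fm.span (fbas m n)" .
  qed
qed

text \<open>The linear equations of the development are solved through this form of rank-nullity:
  uniqueness is checked, existence follows. It is also used backwards, to refute injectivity when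
  some vector cannot be attained.\<close>

lemma crn_inj_surj:
  assumes f: "\<And>X Y. f (X + Y) = f X + f Y" "\<And>c X. f (c *. X) = c *. f X"
    and sub: "\<And>X. X \<in> crn m n ==> f X \<in> crn m n"
    and ker: "\<And>X. X \<in> crn m n ==> f X = 0 ==> X = 0"
    and Y: "Y \<in> crn m n"
  obtains X where "X \<in> crn m n" "f X = Y"
proof -
  have lin: "Vector_Spaces.linear smul smul f"
    unfolding Vector_Spaces.linear_iff using smul_vs f by blast
  interpret f: Vector_Spaces.linear smul smul f by fact
  have "inj_on f (crn m n)"
  proof (rule inj_onI)
    fix X Y assume "X \<in> crn m n" "Y \<in> crn m n" "f X = f Y"
    then have "X - Y = 0" using ker[of "X - Y"] f.diff[of X Y] by simp
    then show "X = Y" by simp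
  qed
  then have "f ` crn m n = crn m n"
    using lin_inj_surj[OF finite_fbas[of m n] independent_fbas lin] sub by (auto simp: span_fbas)
  then show ?thesis using Y that by (metis imageE)
qed

section \<open>Diagonalization of Hermitian matrices\<close>

definition fdiag :: "nat => (nat => complex) => fm" where
  "fdiag n l = mk n n (\<lambda>i j. if i = j then l i else 0)"

lemma ent_fdiag [simp]: "ent (fdiag n l) i j = (if i = j \<and> i < n then l i else 0)"
  unfolding fdiag_def by auto
lemma crn_fdiag [simp]: "fdiag n l \<in> crn n n" by (simp add: fdiag_def)
lemma fdiag_mult: "fdiag n l * fdiag n m = fdiag n (\<lambda>i. l i * m i)"
proof (rule fm_eqI)
  fix i j
  have "ent (fdiag n l * fdiag n m) i j = (\<Sum>k<n. if i = k then (if k = j then l i * m i else 0) else 0)"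
    unfolding ent_multL[OF crn_fdiag] by (rule sum.cong) auto
  then show "ent (fdiag n l * fdiag n m) i j = ent (fdiag n (\<lambda>i. l i * m i)) i j" by auto
qed
lemma fadj_fdiag: "fadj (fdiag n l) = fdiag n (\<lambda>i. cnj (l i))" by (rule fm_eqI) auto
lemma fdiag_one: "fdiag n (\<lambda>_. 1) = fid n" by (rule fm_eqI) auto
lemma fdiag_diff: "fdiag n l - fdiag n m = fdiag n (\<lambda>i. l i - m i)" by (rule fm_eqI) auto
lemma smul_fdiag: "c *. fdiag n l = fdiag n (\<lambda>i. c * l i)" by (rule fm_eqI) auto
lemma fE_mult: "fE a b * fE c e = (if b = c then fE a e else 0)"
proof (rule fm_eqI)
  fix i j
  have "ent (fE a b * fE c e) i j = (\<Sum>k<Suc b. if k = b then (if i = a \<and> b = c \<and> j = e then 1 else 0) else 0)"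
    unfolding ent_multL[OF crn_fE[OF lessI lessI]] by (rule sum.cong) auto
  then show "ent (fE a b * fE c e) i j = ent (if b = c then fE a e else 0) i j" by auto
qed
lemma fdiag_fE: "fdiag n l * fE a b = (if a < n then l a *. fE a b else 0)"
proof (rule fm_eqI)
  fix i j
  have "ent (fdiag n l * fE a b) i j = (\<Sum>k<n. if i = k then (if i = a \<and> j = b then l i else 0) else 0)"
    unfolding ent_multL[OF crn_fdiag] by (rule sum.cong) auto
  then show "ent (fdiag n l * fE a b) i j = ent (if a < n then l a *. fE a b else 0) i j" by auto
qed
lemma fE_fdiag: "fE a b * fdiag n l = (if b < n then l b *. fE a b else 0)"
proof -
  have "fadj (fE a b * fdiag n l) = fadj (if b < n then l b *. fE a b else 0)"
    by (simp add: fadj_simps fadj_fdiag fdiag_fE)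
  then show ?thesis by (metis fadj_fadj)
qed
lemma fid_fE: "a < n ==> fid n * fE a b = fE a b" by (rule fid_multL[OF crn_fE[OF _ lessI]])

section \<open>Existence of eigenvectors\<close>

primrec hpow :: "fm => nat => fm => fm" where
  "hpow H 0 w = w" | "hpow H (Suc n) w = H * hpow H n w"

text \<open>Horner evaluation of p(H) w. A ring without unit has no p(H), but the constant
  coefficient makes sense once the polynomial acts on w.\<close>

definition pap :: "fm => complex poly => fm => fm" where
  "pap H p w = foldr (\<lambda>a x. a *. w + H * x) (coeffs p) 0"

lemma pap_0 [simp]: "pap H 0 w = 0" by (simp add: pap_def)
lemma pap_pCons [simp]: "pap H (pCons a p) w = a *. w + H * pap H p w"
  by (cases "p = 0 \<and> a = 0") (auto simp: pap_def)
lemma pap_add: "pap H (p + q) w = pap H p w + pap H q w"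
  by (induction p q rule: poly_induct2) (simp_all add: algebra_simps fm.scale_left_distrib)
lemma pap_smult: "pap H (Polynomial.smult c p) w = c *. pap H p w"
  by (induction p) (simp_all add: algebra_simps fm.scale_right_distrib)
lemma pap_sum: "pap H (sum f A) w = (\<Sum>a\<in>A. pap H (f a) w)"
  by (induction A rule: infinite_finite_induct) (auto simp: pap_add)
lemma pap_monom: "pap H (monom c n) w = c *. hpow H n w"
  by (induction n) (auto simp: monom_0 monom_Suc)
lemma pap_linear_factor: "pap H ([:- z, 1:] * r) w = H * pap H r w - z *. pap H r w"
proof -
  have "[:- z, 1:] * r = pCons 0 r + Polynomial.smult (- z) r" by simp
  then show ?thesis by (simp only: pap_add pap_smult pap_pCons) simp
qed

lemma hpow_crn: "H \<in> crn d d ==> w \<in> crn d m ==> hpow H n w \<in> crn d m"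
  by (induction n) auto

text \<open>The d + 1 vectors w, H w, ..., H^d w lie in a space of dimension d. Without a relation
  between them the map from coefficients to combinations would be injective, hence onto.\<close>

lemma annihilating_poly:
  assumes H: "H \<in> crn d d" and w: "w \<in> crn d (Suc 0)"
  shows "\<exists>p. p \<noteq> 0 \<and> pap H p w = 0"
proof (rule ccontr)
  assume n: "\<not> ?thesis"
  define f where "f X = (\<Sum>i\<le>d. ent X i 0 *. hpow H i w)" for X
  have fc: "f X \<in> crn d (Suc 0)" for X unfolding f_def by (intro crn_sum crn_smul hpow_crn H w)
  \<comment> \<open>Source and target are both columns of length d + 1, so that dimensions can be
    compared; since all values have length d, the last unit vector \<open>fE d 0\<close> is not
    attained.\<close>
  obtain X where "X \<in> crn (Suc d) (Suc 0)" "f X = fE d 0"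
  proof (rule crn_inj_surj[of f "Suc d" "Suc 0" "fE d 0"])
    show "f (X + Y) = f X + f Y" for X Y by (simp add: f_def fm.scale_left_distrib sum.distrib)
    show "f (c *. X) = c *. f X" for c X by (simp add: f_def smul_sum_right fm.scale_scale)
    show "f X \<in> crn (Suc d) (Suc 0)" for X using fc[of X] by (rule crn_mono) auto
    show "X = 0" if X: "X \<in> crn (Suc d) (Suc 0)" and 0: "f X = 0" for X
    proof -
      define p where "p = (\<Sum>i\<le>d. monom (ent X i 0) i)"
      have "pap H p w = 0" using 0 by (simp add: p_def pap_sum pap_monom f_def)
      then have "p = 0" using n by blast
      then have "ent X i 0 = 0" if "i \<le> d" for i
      proof -
        have "coeff p i = (\<Sum>k\<le>d. if k = i then ent X k 0 else 0)"
          unfolding p_def coeff_sum by (rule sum.cong) (auto simp: coeff_monom)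
        then show ?thesis using that \<open>p = 0\<close> by simp
      qed
      then show "X = 0" using crnD1[OF X] crnD2[OF X]
        by (intro fm_eqI) (metis ent_0 less_Suc0 not_less not_less_eq_eq)
    qed
  qed auto
  then have "fE d 0 \<in> crn d (Suc 0)" using fc by metis
  then show False using crnD1[of "fE d 0" d "Suc 0" d 0] by simp
qed

text \<open>A linear factor with root z is split off: either r(H) w is nonzero and then an
  eigenvector for z, or r is an annihilating polynomial of smaller degree.\<close>

lemma eigenvector_in_cyclic:
  assumes "p \<noteq> 0" "pap H p w = 0" "w \<noteq> 0"
  shows "\<exists>z r. pap H r w \<noteq> 0 \<and> H * pap H r w = z *. pap H r w"
  using assms(1,2)
proof (induction "degree p" arbitrary: p rule: less_induct)
  case less
  show ?case
  proof (cases "degree p = 0")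
    case True
    then obtain a where "p = [:a:]" using degree_eq_zeroE by blast
    then have "a *. w = 0" "a \<noteq> 0" using less.prems by auto
    then show ?thesis using assms(3) by simp
  next
    case False
    then have "\<not> constant (poly p)" by (simp add: constant_degree)
    then obtain z where "poly p z = 0" using fundamental_theorem_of_algebra by blast
    then obtain r where r: "p = [:- z, 1:] * r" by (auto simp: poly_eq_0_iff_dvd dvd_def)
    have r0: "r \<noteq> 0" using r less.prems(1) by auto
    have "H * pap H r w - z *. pap H r w = 0" using less.prems(2) unfolding r pap_linear_factor .
    then have e: "H * pap H r w = z *. pap H r w" by simp
    show ?thesis
    proof (cases "pap H r w = 0")
      case True
      have "degree p = degree [:- z, 1:] + degree r" unfolding r by (rule degree_mult_eq) (use r0 in auto)
      then have "degree r < degree p" by simp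
      then show ?thesis using less.hyps r0 True by blast
    qed (use e in blast)
  qed
qed

lemma crn11: "X \<in> crn (Suc 0) (Suc 0) ==> X = ftr X *. fid (Suc 0)"
proof (rule fm_eqI)
  fix i j assume X: "X \<in> crn (Suc 0) (Suc 0)"
  show "ent X i j = ent (ftr X *. fid (Suc 0)) i j"
    using crnD1[OF X, of i j] crnD2[OF X, of j i] by (cases "i = 0"; cases "j = 0") (auto simp: ftr_crn[OF X])
qed

text \<open>One orthonormal eigenvector is added at a time. The orthogonal complement of those found
  is invariant because H is Hermitian, and the cyclic space of a vector in it contains an
  eigenvector.\<close>

lemma herm_partial_diag:
  assumes H: "H \<in> crn d d" "fadj H = H"
  shows "k \<le> d ==> \<exists>V l. V \<in> crn d k \<and> fadj V * V = fid k \<and> H * V = V * fdiag k (\<lambda>i. of_real (l i))"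
proof (induction k)
  case 0
  have "fid 0 = 0" by (rule fm_eqI) simp
  then show ?case by (intro exI[of _ 0]) auto
next
  case (Suc k)
  then obtain V l where V: "V \<in> crn d k" "fadj V * V = fid k" "H * V = V * fdiag k (\<lambda>i. of_real (l i))" by auto
  have kd: "k < d" using Suc.prems by simp
  have Vc: "fadj V \<in> crn k d" using V by simp
  \<comment> \<open>With k < d columns there is a nonzero orthogonal vector: otherwise
    \<open>fadj V\<close> would be injective on columns of length d and hence onto, while its values
    have length k and miss \<open>fE k 0\<close>.\<close>
  have "\<exists>w. w \<in> crn d (Suc 0) \<and> fadj V * w = 0 \<and> w \<noteq> 0"
  proof (rule ccontr)
    assume n: "\<not> ?thesis"
    obtain X where "X \<in> crn d (Suc 0)" "fadj V * X = fE k 0"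
    proof (rule crn_inj_surj[of "\<lambda>X. fadj V * X" d "Suc 0" "fE k 0"])
      show "X \<in> crn d (Suc 0) ==> fadj V * X \<in> crn d (Suc 0)" for X
        using crn_mult[OF Vc, of X d "Suc 0"] kd by (auto elim: crn_mono)
    qed (use n kd in \<open>auto simp: ring_distribs\<close>)
    moreover have "fadj V * X \<in> crn k (Suc 0)" using crn_mult[OF Vc] \<open>X \<in> _\<close> by blast
    ultimately show False using crnD1[of "fE k 0" k "Suc 0" k 0] by simp
  qed
  then obtain w where w: "w \<in> crn d (Suc 0)" "fadj V * w = 0" "w \<noteq> 0" by blast
  obtain p where "p \<noteq> 0" "pap H p w = 0" using annihilating_poly[OF H(1) w(1)] by blast
  then obtain z r where zr: "pap H r w \<noteq> 0" "H * pap H r w = z *. pap H r w"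
    using eigenvector_in_cyclic w(3) by blast
  have VH: "fadj V * H = fdiag k (\<lambda>i. of_real (l i)) * fadj V"
  proof -
    have "fadj (H * V) = fadj (V * fdiag k (\<lambda>i. of_real (l i)))" using V(3) by simp
    then show ?thesis by (simp add: fadj_mult H(2) fadj_fdiag)
  qed
  have inv: "pap H r w \<in> crn d (Suc 0) \<and> fadj V * pap H r w = 0" for r
  proof (induction r)
    case (pCons a r)
    have "fadj V * (H * pap H r w) = fdiag k (\<lambda>i. of_real (l i)) * (fadj V * pap H r w)"
      by (simp add: VH flip: mult.assoc)
    then show ?case using pCons w H(1) by (auto simp: ring_distribs)
  qed simp
  define u where "u = pap H r w"
  define c where "c = sqrt (Re (ftr (fadj u * u)))"
  have u: "u \<in> crn d (Suc 0)" "fadj V * u = 0" "u \<noteq> 0" "H * u = z *. u"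
    using inv zr by (auto simp: u_def)
  have cpos: "Re (ftr (fadj u * u)) > 0" using u(3) ftr_sq_Re[of u] ftr_sq_0[of u] by linarith
  then have c: "c > 0" "c * c = Re (ftr (fadj u * u))" by (auto simp: c_def)
  define v where "v = of_real (1/c) *. u"
  have v: "v \<in> crn d (Suc 0)" "fadj V * v = 0" "H * v = z *. v"
    using u by (auto simp: v_def fm.scale_left_commute)
  have trv: "ftr (fadj v * v) = 1"
  proof -
    have "ftr (fadj u * u) = of_real (c * c)" using c(2) ftr_sq_Im[of u] by (simp add: complex_eq_iff)
    then show ?thesis using c(1) by (simp add: v_def fadj_smul ftr_smul)
  qed
  have vv: "fadj v * v = fid (Suc 0)"
    using crn11[of "fadj v * v"] v(1) trv by (simp add: crn_mult[OF crn_fadj])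
  have "z *. fid (Suc 0) = fadj v * (H * v)" by (simp add: v(3) vv)
  also have "\<dots> = fadj (fadj v * (H * v))" by (simp add: fadj_mult H(2) mult.assoc)
  also have "\<dots> = cnj z *. fid (Suc 0)" by (simp add: v(3) vv fadj_smul)
  finally have "ent (z *. fid (Suc 0)) 0 0 = ent (cnj z *. fid (Suc 0)) 0 0"
    by (rule arg_cong)
  then have z: "z = of_real (Re z)" by (simp add: complex_eq_iff)
  \<comment> \<open>Multiplication by \<open>fE 0 k\<close> places the single column v into position
    k.\<close>
  define V' where "V' = V + v * fE 0 k"
  have vV: "fadj v * V = 0" using v(2) by (metis fadj_0 fadj_fadj fadj_mult)
  have e1: "fid k * fE k k = 0" using fdiag_fE[of k "\<lambda>_. 1" k k] by (simp add: fdiag_one)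
  have Vk: "V * fE k k = 0"
  proof -
    have "V * fE k k = (V * fid k) * fE k k" using V(1) by simp
    then show ?thesis by (simp only: mult.assoc e1) simp
  qed
  define D where "D = fdiag k (\<lambda>i. complex_of_real (l i))"
  have D': "fdiag (Suc k) (\<lambda>i. complex_of_real ((l(k := Re z)) i)) = D + z *. fE k k"
    unfolding D_def by (rule fm_eqI) (use z in \<open>auto simp: less_Suc_eq\<close>)
  have kD: "fE 0 k * D = 0" by (simp add: D_def fE_fdiag)
  show ?case
  proof (intro exI conjI)
    show "V' \<in> crn d (Suc k)" unfolding V'_def
      by (intro crn_add crn_mult[OF v(1) crn_fE[of 0 1]] crn_mono[OF V(1)]) auto
    have "fadj V' * V' = fadj V * V + (fadj V * v) * fE 0 k + fE k 0 * (fadj v * V) + fE k 0 * (fadj v * v) * fE 0 k"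
      by (simp add: V'_def fadj_simps algebra_simps)
    also have "\<dots> = fid k + fE k k"
      using fid_multR[of "fE k 0" "Suc k" "Suc 0"] by (simp add: V(2) v(2) vV vv fE_mult)
    also have "\<dots> = fid (Suc k)" by (rule fm_eqI) auto
    finally show "fadj V' * V' = fid (Suc k)" .
    have "V' * (D + z *. fE k k) = V * D + z *. (V * fE k k) + v * (fE 0 k * D) + z *. (v * (fE 0 k * fE k k))"
      by (simp add: V'_def algebra_simps)
    also have "\<dots> = V * D + z *. (v * fE 0 k)" by (simp add: Vk kD fE_mult)
    also have "\<dots> = H * V + (H * v) * fE 0 k" by (simp add: V(3) D_def v(3))
    also have "\<dots> = H * V'" by (simp add: V'_def ring_distribs mult.assoc)
    finally show "H * V' = V' * fdiag (Suc k) (\<lambda>i. complex_of_real ((l(k := Re z)) i))" unfolding D' by simp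
  qed
qed

lemma left_inverse_right_inverse:
  assumes V: "V \<in> crn d d" "W \<in> crn d d" "W * V = fid d" shows "V * W = fid d"
proof -
  obtain X where X: "X \<in> crn d d" "V * X = fid d"
  proof (rule crn_inj_surj[of "\<lambda>X. V * X" d d "fid d"])
    fix X assume X: "X \<in> crn d d" "V * X = 0"
    have "X = (W * V) * X" using V X by simp
    then show "X = 0" using X(2) by (simp add: mult.assoc)
  qed (use V in \<open>auto simp: ring_distribs\<close>)
  have "X = (W * V) * X" using V X by simp
  also have "\<dots> = W * (V * X)" by (rule mult.assoc)
  also have "\<dots> = W" using X V by simp
  finally show ?thesis using X by simp
qed

definition unitary :: "nat => fm => bool" where
  "unitary d U \<longleftrightarrow> U \<in> crn d d \<and> U * fadj U = fid d \<and> fadj U * U = fid d"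

theorem herm_diag:
  assumes H: "H \<in> crn d d" "fadj H = H"
  obtains U l where "unitary d U" "H = U * fdiag d (\<lambda>i. of_real (l i)) * fadj U"
proof -
  obtain V l where V: "V \<in> crn d d" "fadj V * V = fid d" "H * V = V * fdiag d (\<lambda>i. of_real (l i))"
    using herm_partial_diag[OF H order_refl] by blast
  have VV: "V * fadj V = fid d" using left_inverse_right_inverse[OF V(1) crn_fadj[OF V(1)] V(2)] .
  have "H = H * (V * fadj V)" using H VV by simp
  also have "\<dots> = V * fdiag d (\<lambda>i. of_real (l i)) * fadj V" by (simp add: V(3) flip: mult.assoc)
  finally show ?thesis using that V VV by (auto simp: unitary_def)
qed

lemma fpsd_fdiag: assumes "\<And>i. i < n ==> 0 \<le> l i" shows "fpsd (fdiag n (\<lambda>i. of_real (l i)))"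
proof -
  have "fdiag n (\<lambda>i. of_real (sqrt (l i))) * fadj (fdiag n (\<lambda>i. of_real (sqrt (l i)))) = fdiag n (\<lambda>i. of_real (l i))"
    unfolding fadj_fdiag fdiag_mult by (rule fm_eqI) (use assms in \<open>auto simp flip: of_real_mult\<close>)
  then show ?thesis using fpsd_sq by metis
qed

text \<open>Shifting by the smallest eigenvalue gives a matrix that is positive and singular at
  once. The positivity gap of a faithful state and the ergodicity of irreducible channels both start
  from such a shift.\<close>

lemma min_eigenvalue:
  assumes X: "X \<in> crn d d" "fadj X = X" and d: "d > 0"
  obtains m V where "V \<in> crn d d" "V \<noteq> 0" "fpsd (X - of_real m *. fid d)"
    "(X - of_real m *. fid d) * V = 0"
proof -
  obtain U l where U: "unitary d U" "X = U * fdiag d (\<lambda>i. of_real (l i)) * fadj U"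
    using herm_diag[OF X] by blast
  have Uc: "U \<in> crn d d" "U * fadj U = fid d" "fadj U * U = fid d" using U by (auto simp: unitary_def)
  have "\<exists>i\<in>{..<d}. \<forall>j\<in>{..<d}. l i \<le> l j"
  proof -
    have "Min (l ` {..<d}) \<in> l ` {..<d}" using d by (intro Min_in) auto
    then obtain i where "i < d" "l i = Min (l ` {..<d})" by auto
    then show ?thesis by (intro bexI[of _ i]) auto
  qed
  then obtain i where i: "i < d" "\<And>j. j < d ==> l i \<le> l j" by auto
  have e: "X - of_real (l i) *. fid d = U * fdiag d (\<lambda>j. of_real (l j - l i)) * fadj U"
  proof -
    have "U * fdiag d (\<lambda>j. of_real (l j - l i)) * fadj U =
        U * (fdiag d (\<lambda>j. of_real (l j)) - of_real (l i) *. fid d) * fadj U"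
      by (simp add: fdiag_diff smul_fdiag flip: fdiag_one)
    also have "\<dots> = X - of_real (l i) *. (U * fid d * fadj U)" unfolding U(2) by (simp add: algebra_simps)
    finally show ?thesis using Uc by simp
  qed
  show ?thesis
  proof
    show "fpsd (X - of_real (l i) *. fid d)" unfolding e by (intro fpsd_conj fpsd_fdiag) (use i in auto)
    show c: "U * fE i i \<in> crn d d" using Uc i by (intro crn_mult[of _ d d _ d]) auto
    have "(X - of_real (l i) *. fid d) * (U * fE i i) = U * (fdiag d (\<lambda>j. of_real (l j - l i)) * ((fadj U * U) * fE i i))"
      unfolding e by (simp add: mult.assoc)
    then show "(X - of_real (l i) *. fid d) * (U * fE i i) = 0" using i by (simp add: Uc fid_fE fdiag_fE)
    show "U * fE i i \<noteq> 0"
    proof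
      assume "U * fE i i = 0"
      then have "(fadj U * U) * fE i i = 0" by (simp add: mult.assoc)
      then have "ent (fE i i) i i = 0" using i by (simp add: Uc fid_fE)
      then show False by simp
    qed
  qed
qed

text \<open>If the smallest eigenvalue were 0, the kernel of the shifted matrix would be a kernel of
  r itself. The resulting lower bound is what a small perturbation respects.\<close>

lemma fpsd_gap:
  assumes r: "r \<in> crn d d" "fpsd r" and d: "d > 0" and f: "\<And>V. V \<in> crn d d ==> r * V = 0 ==> V = 0"
  obtains \<epsilon> where "\<epsilon> > 0" "fpsd (r - of_real \<epsilon> *. fid d)"
proof -
  obtain m V where V: "V \<in> crn d d" "V \<noteq> 0" "fpsd (r - of_real m *. fid d)" "(r - of_real m *. fid d) * V = 0"
    by (rule min_eigenvalue[OF r(1) fpsd_adj[OF r(2)] d])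
  have "r * V = of_real m *. V" using V by (simp add: left_diff_distrib)
  then have "ftr (fadj V * r * V) = of_real m * ftr (fadj V * V)" by (simp add: mult.assoc ftr_smul)
  then have e: "Re (ftr (fadj V * r * V)) = m * Re (ftr (fadj V * V))" by simp
  have p: "Re (ftr (fadj V * V)) > 0" using ftr_sq_Re[of V] ftr_sq_0[of V] V(2) by linarith
  have "Re (ftr (fadj V * r * V)) \<noteq> 0" using fpsd_ker[OF r(2), of V] f[OF V(1)] V(2) by blast
  then have "m * Re (ftr (fadj V * V)) > 0" using e fpsdD[OF r(2), of V] by linarith
  then have "m > 0" using p by (simp add: zero_less_mult_iff)
  then show ?thesis using V that by blast
qed

lemma fpsd_near:
  assumes r: "fpsd (r - of_real \<epsilon> *. fid d)" and Z: "Z \<in> crn d d" "fadj Z = Z" "r \<in> crn d d"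
    and n: "nrm (Z - r) \<le> \<epsilon>"
  shows "fpsd Z"
  unfolding fpsd_def
proof (intro conjI allI)
  fix V
  \<comment> \<open>V has arbitrary size; Z and r see only its part inside the corner.\<close>
  define W where "W = fid d * V"
  have W: "fid d * W = W" by (simp add: W_def fid_multL[OF crn_fid] flip: mult.assoc)
  have "fadj V * Z * V = fadj W * Z * W"
    using fid_multL[OF Z(1)] fid_multR[OF Z(1)] by (simp add: W_def fadj_mult flip: mult.assoc) (metis mult.assoc)
  also have "\<dots> = fadj W * (r - of_real \<epsilon> *. fid d) * W + of_real \<epsilon> *. (fadj W * (fid d * W)) + fadj W * ((Z - r) * W)"
    by (simp add: algebra_simps)
  finally have e: "Re (ftr (fadj V * Z * V)) = Re (ftr (fadj W * (r - of_real \<epsilon> *. fid d) * W))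
      + \<epsilon> * Re (ftr (fadj W * W)) + Re (ftr (fadj W * ((Z - r) * W)))"
    unfolding W by (simp add: ftr_simps)
  have "ftr (fadj W * ((Z - r) * W)) = ftr (W * fadj W * (Z - r))"
    by (metis ftr_comm mult.assoc)
  then have "\<bar>Re (ftr (fadj W * ((Z - r) * W)))\<bar> \<le> Re (ftr (W * fadj W)) * nrm (Z - r)"
    using fpsd_tr[OF fpsd_sq[of W], of "Z - r"] abs_Re_le_cmod order_trans by metis
  also have "\<dots> \<le> Re (ftr (W * fadj W)) * \<epsilon>"
    using n fpsd_tr_nonneg[OF fpsd_sq[of W]] by (rule mult_left_mono)
  also have "ftr (W * fadj W) = ftr (fadj W * W)" by (rule ftr_comm)
  finally show "0 \<le> Re (ftr (fadj V * Z * V))" unfolding e using fpsdD[OF r, of W] by (simp add: mult.commute)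
qed (rule Z)

section \<open>Channels with labelled Kraus operators\<close>

text \<open>The weight of a Kraus operator is an arbitrary complex function of the outgoing label b'
  and the incoming label b. Gibbs weights give the channel, Gibbs weights times phases its tilted
  version, Gibbs weights times increments the flux; \<open>Mm\<close> is the dual for the trace
  pairing.\<close>

definition Lm :: "'b set => ('b => 'b => fm) => ('b => 'b => complex) => fm => fm" where
  "Lm B K \<phi> X = (\<Sum>b\<in>B. \<Sum>b'\<in>B. \<phi> b' b *. (K b' b * X * fadj (K b' b)))"

definition Mm :: "'b set => ('b => 'b => fm) => ('b => 'b => complex) => fm => fm" where
  "Mm B K \<phi> X = (\<Sum>b\<in>B. \<Sum>b'\<in>B. \<phi> b' b *. (fadj (K b' b) * X * K b' b))"

lemma Lm_add: "Lm B K \<phi> (X + Y) = Lm B K \<phi> X + Lm B K \<phi> Y"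
  by (simp add: Lm_def algebra_simps fm.scale_right_distrib sum.distrib)
lemma Lm_smul: "Lm B K \<phi> (c *. X) = c *. Lm B K \<phi> X"
  by (simp add: Lm_def smul_sum_right mult.commute)
lemma Lm_diff: "Lm B K \<phi> (X - Y) = Lm B K \<phi> X - Lm B K \<phi> Y"
  by (simp add: Lm_def algebra_simps fm.scale_right_diff_distrib sum_subtractf)
lemma Lm_0 [simp]: "Lm B K \<phi> 0 = 0" by (simp add: Lm_def)
lemma Mm_add: "Mm B K \<phi> (X + Y) = Mm B K \<phi> X + Mm B K \<phi> Y"
  by (simp add: Mm_def algebra_simps fm.scale_right_distrib sum.distrib)
lemma Mm_smul: "Mm B K \<phi> (c *. X) = c *. Mm B K \<phi> X"
  by (simp add: Mm_def smul_sum_right mult.commute)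
lemma Mm_diff: "Mm B K \<phi> (X - Y) = Mm B K \<phi> X - Mm B K \<phi> Y"
  by (simp add: Mm_def algebra_simps fm.scale_right_diff_distrib sum_subtractf)
lemma Mm_add_wt: "Mm B K (\<lambda>b' b. \<phi> b' b + \<psi> b' b) X = Mm B K \<phi> X + Mm B K \<psi> X"
  by (simp add: Mm_def fm.scale_left_distrib sum.distrib)
lemma Mm_diff_wt: "Mm B K (\<lambda>b' b. \<phi> b' b - \<psi> b' b) X = Mm B K \<phi> X - Mm B K \<psi> X"
  by (simp add: Mm_def fm.scale_left_diff_distrib sum_subtractf)
lemma Mm_smul_wt: "Mm B K (\<lambda>b' b. c * \<phi> b' b) X = c *. Mm B K \<phi> X"
  by (simp add: Mm_def smul_sum_right fm.scale_scale)
lemma Lm_add_wt: "Lm B K (\<lambda>b' b. \<phi> b' b + \<psi> b' b) X = Lm B K \<phi> X + Lm B K \<psi> X"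
  by (simp add: Lm_def fm.scale_left_distrib sum.distrib)
lemma Lm_diff_wt: "Lm B K (\<lambda>b' b. \<phi> b' b - \<psi> b' b) X = Lm B K \<phi> X - Lm B K \<psi> X"
  by (simp add: Lm_def fm.scale_left_diff_distrib sum_subtractf)
lemma Lm_smul_wt: "Lm B K (\<lambda>b' b. c * \<phi> b' b) X = c *. Lm B K \<phi> X"
  by (simp add: Lm_def smul_sum_right fm.scale_scale)
lemma Lm_cong: "(\<And>b b'. b \<in> B ==> b' \<in> B ==> \<phi> b' b = \<psi> b' b) ==> Lm B K \<phi> X = Lm B K \<psi> X"
  by (simp add: Lm_def cong: sum.cong)
lemma Mm_cong: "(\<And>b b'. b \<in> B ==> b' \<in> B ==> \<phi> b' b = \<psi> b' b) ==> Mm B K \<phi> X = Mm B K \<psi> X"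
  by (simp add: Mm_def cong: sum.cong)

lemma tr_Lm_Mm: "ftr (Lm B K \<phi> X * Y) = ftr (X * Mm B K \<phi> Y)"
proof -
  have "ftr (K b' b * X * fadj (K b' b) * Y) = ftr (X * (fadj (K b' b) * Y * K b' b))" for b b'
    by (metis ftr_comm mult.assoc)
  then show ?thesis by (simp add: Lm_def Mm_def sum_distrib_left sum_distrib_right ftr_simps)
qed

lemma tr_Lm: "ftr (Lm B K \<phi> X) = (\<Sum>b\<in>B. \<Sum>b'\<in>B. \<phi> b' b * ftr (K b' b * X * fadj (K b' b)))"
  by (simp add: Lm_def ftr_simps)

lemma fadj_Lm: "fadj (Lm B K \<phi> X) = Lm B K (\<lambda>b' b. cnj (\<phi> b' b)) (fadj X)"
  by (simp add: Lm_def fadj_simps mult.assoc)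
lemma fadj_Mm: "fadj (Mm B K \<phi> X) = Mm B K (\<lambda>b' b. cnj (\<phi> b' b)) (fadj X)"
  by (simp add: Mm_def fadj_simps mult.assoc)

lemma fpsd_Lm: "fpsd X ==> (\<And>b b'. b \<in> B ==> b' \<in> B ==> 0 \<le> \<phi> b' b) ==> fpsd (Lm B K (\<lambda>b' b. of_real (\<phi> b' b)) X)"
  unfolding Lm_def by (intro fpsd_sum fpsd_smul fpsd_conj) auto

lemma nrm_Mm_wt: "nrm (Mm B K \<phi> X) \<le> (\<Sum>b\<in>B. \<Sum>b'\<in>B. cmod (\<phi> b' b) * nrm (fadj (K b' b) * X * K b' b))"
  unfolding Mm_def by (intro order_trans[OF nrm_sum] sum_mono) (simp add: nrm_smul)

text \<open>\<^emph>\<open>Detailed balance\<close> \<open>balance\<close> is what the invariance of the system-probe equilibrium state becomes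
  in an eigenbasis of the probe Hamiltonian; \<open>isom\<close> and \<open>coisom\<close> express unitarity of the coupling.\<close>
locale qenv0 =
  fixes d :: nat and B :: "'b set" and w :: "'b => real" and K :: "'b => 'b => fm" and r :: fm
  assumes finB: "finite B" and dpos: "d > 0" and wpos: "b \<in> B ==> w b > 0" and wsum: "(\<Sum>b\<in>B. w b) = 1"
    and Kc: "b' \<in> B ==> b \<in> B ==> K b' b \<in> crn d d"
    and isom: "b \<in> B ==> (\<Sum>b'\<in>B. fadj (K b' b) * K b' b) = fid d"
    and coisom: "b' \<in> B ==> (\<Sum>b\<in>B. K b' b * fadj (K b' b)) = fid d"
    and balance: "b' \<in> B ==> b \<in> B ==> of_real (w b) *. (K b' b * r) = of_real (w b') *. (r * K b' b)"
    and r: "r \<in> crn d d" "fpsd r" "ftr r = 1"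
begin

abbreviation L where "L \<equiv> Lm B K"
abbreviation M where "M \<equiv> Mm B K"
abbreviation w0 :: "'b => 'b => complex" where "w0 \<equiv> \<lambda>b' b. of_real (w b)"

lemma mult_fid [simp]: "X \<in> crn d d ==> X * fid d = X" by (rule fid_multR)
lemma L_crn [simp]: "X \<in> crn d d ==> L \<phi> X \<in> crn d d"
  unfolding Lm_def by (intro crn_sum crn_smul crn_mult[of _ d d _ d] crn_fadj Kc) auto
lemma M_crn [simp]: "X \<in> crn d d ==> M \<phi> X \<in> crn d d"
  unfolding Mm_def by (intro crn_sum crn_smul crn_mult[of _ d d _ d] crn_fadj Kc) auto

lemma M_fid: "M (\<lambda>b' b. f b) (fid d) = (\<Sum>b\<in>B. f b) *. fid d"
proof -
  have "M (\<lambda>b' b. f b) (fid d) = (\<Sum>b\<in>B. f b *. (\<Sum>b'\<in>B. fadj (K b' b) * K b' b))"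
    unfolding Mm_def smul_sum_right
    by (intro sum.cong refl) (simp add: mult.assoc fid_multL[OF Kc])
  then show ?thesis by (simp add: isom smul_sum_left cong: sum.cong)
qed

lemma M_w0_fid: "M w0 (fid d) = fid d"
  using M_fid[of "\<lambda>b. of_real (w b)"] wsum by (simp flip: of_real_sum)

lemma L_in_tr: "X \<in> crn d d ==> ftr (L (\<lambda>b' b. f b) X) = (\<Sum>b\<in>B. f b) * ftr X"
  using tr_Lm_Mm[of B K "\<lambda>b' b. f b" X "fid d"] by (simp add: M_fid ftr_smul)

text \<open>By detailed balance the outgoing label in equilibrium has the law of the incoming one.\<close>
lemma L_out: "L (\<lambda>b' b. of_real (w b) * f b') r = (\<Sum>b\<in>B. of_real (w b) * f b) *. r"
proof -
  have "L (\<lambda>b' b. of_real (w b) * f b') r = (\<Sum>b\<in>B. \<Sum>b'\<in>B. (of_real (w b') * f b') *. (r * (K b' b * fadj (K b' b))))"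
    unfolding Lm_def
  proof (intro sum.cong refl)
    fix b b' assume b: "b \<in> B" "b' \<in> B"
    have "(of_real (w b) * f b') *. (K b' b * r * fadj (K b' b)) = f b' *. ((of_real (w b) *. (K b' b * r)) * fadj (K b' b))"
      by (simp add: fm.scale_scale mult.commute)
    also have "\<dots> = (of_real (w b') * f b') *. (r * (K b' b * fadj (K b' b)))"
      unfolding balance[OF b(2,1)] by (simp add: fm.scale_scale mult.commute mult.assoc)
    finally show "(of_real (w b) * f b') *. (K b' b * r * fadj (K b' b)) = \<dots>" .
  qed
  also have "\<dots> = (\<Sum>b'\<in>B. (of_real (w b') * f b') *. (r * (\<Sum>b\<in>B. K b' b * fadj (K b' b))))"
    by (subst sum.swap) (simp add: smul_sum_right sum_distrib_left)
  also have "\<dots> = (\<Sum>b\<in>B. of_real (w b) * f b) *. r"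
    by (simp add: coisom r smul_sum_left cong: sum.cong)
  finally show ?thesis .
qed

lemma L_r: "L w0 r = r"
  using L_out[of "\<lambda>_. 1"] wsum by (simp flip: of_real_sum)

end

text \<open>What irreducibility contributes: the dual channel fixes only multiples of the identity,
  and the invariant state has no kernel. Both properties are carried over to the time-reversed
  family in \<open>qenv_R\<close>.\<close>

locale qenv = qenv0 d B w K r
  for d :: nat and B :: "'b set" and w :: "'b => real" and K :: "'b => 'b => fm" and r :: fm +
  assumes erg: "X \<in> crn d d ==> Mm B K (\<lambda>b' b. of_real (w b)) X = X ==> \<exists>c. X = c *. fid d"
    and faithful: "X \<in> crn d d ==> r * X = 0 ==> X = 0"
begin

text \<open>Id - M has the scalars as kernel and only values of mean 0. Adding the rank-one term
  tr(r Y) Id makes it injective: a zero of the sum has mean 0, hence is a fixed point of M, hence a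
  scalar of mean 0.\<close>

lemma poisson:
  assumes W: "W \<in> crn d d"
  obtains Y where "Y \<in> crn d d" "Y - M w0 Y = W - ftr (r * W) *. fid d"
proof -
  define f where "f Y = Y - M w0 Y + ftr (r * Y) *. fid d" for Y
  have trM: "ftr (r * M w0 Y) = ftr (r * Y)" for Y using tr_Lm_Mm[of B K w0 r Y] by (simp add: L_r)
  have rf: "ftr (r * f Y) = ftr (r * Y)" for Y
    using r by (simp add: f_def ring_distribs ftr_simps trM)
  obtain Y where Y: "Y \<in> crn d d" "f Y = W"
  proof (rule crn_inj_surj[of f d d W])
    show "f (X + Y) = f X + f Y" for X Y
      by (simp add: f_def Mm_add algebra_simps ftr_add fm.scale_left_distrib)
    show "f (c *. X) = c *. f X" for c X
      by (simp add: f_def Mm_smul algebra_simps ftr_smul fm.scale_right_distrib fm.scale_right_diff_distrib fm.scale_scale)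
    show "X = 0" if X: "X \<in> crn d d" "f X = 0" for X
    proof -
      have 0: "ftr (r * X) = 0" using rf[of X] X(2) by simp
      then have "M w0 X = X" using X(2) by (simp add: f_def)
      then obtain c where c: "X = c *. fid d" using erg X(1) by blast
      then have "c = 0" using 0 r by (simp add: ftr_smul)
      then show ?thesis using c by simp
    qed
  qed (use W in \<open>auto simp: f_def\<close>)
  have "ftr (r * Y) = ftr (r * W)" using rf[of Y] Y(2) by simp
  then have "Y - M w0 Y = W - ftr (r * W) *. fid d" using Y(2) by (simp add: f_def algebra_simps)
  then show ?thesis using Y(1) that by blast
qed

text \<open>Uniqueness of the invariant state by duality: each test observable W splits into its
  mean and a value of Id - M, and the latter pairs to 0 with a fixed point of L.\<close>

lemma fixed_L: assumes X: "X \<in> crn d d" "L w0 X = X" shows "X = ftr X *. r"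
proof (rule ftr_eqI[OF X(1)])
  show "ftr X *. r \<in> crn d d" using r by simp
  fix W assume "W \<in> crn d d"
  then obtain Y where Y: "Y \<in> crn d d" "Y - M w0 Y = W - ftr (r * W) *. fid d" by (rule poisson)
  have "ftr (X * (W - ftr (r * W) *. fid d)) = ftr (X * Y) - ftr (X * M w0 Y)"
    unfolding Y(2)[symmetric] by (simp add: ring_distribs ftr_simps)
  also have "\<dots> = 0" using tr_Lm_Mm[of B K w0 X Y] X by simp
  finally show "ftr (W * X) = ftr (W * (ftr X *. r))" using X
    by (simp add: ring_distribs ftr_simps ftr_comm[of W])
qed

text \<open>The observable \<open>f\<close> of the probe changes by \<open>f b - f b'\<close> when the probe passes from \<open>b\<close> to \<open>b'\<close>;
  \<open>cur f\<close> is the resulting flux operator and \<open>sol f\<close> solves its Poisson equation.\<close>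
definition dx :: "('b => real) => 'b => 'b => complex" where "dx f b' b = of_real (f b - f b')"
definition cur :: "('b => real) => fm" where "cur f = M (\<lambda>b' b. of_real (w b) * dx f b' b) (fid d)"
definition centered :: "('b => real) => bool" where "centered f \<longleftrightarrow> (\<Sum>b\<in>B. w b * f b) = 0"

lemma cur_crn [simp]: "cur f \<in> crn d d" by (simp add: cur_def)
lemma cur_adj: "fadj (cur f) = cur f" by (simp add: cur_def fadj_Mm dx_def)
text \<open>In equilibrium the incoming and the outgoing label have the same law, so no observable
  of the probe changes on average.\<close>

lemma tr_r_cur: "ftr (r * cur f) = 0"
proof -
  have "ftr (r * cur f) = ftr (L (\<lambda>b' b. of_real (w b) * dx f b' b) r)"
    using tr_Lm_Mm[of B K "\<lambda>b' b. of_real (w b) * dx f b' b" r "fid d"] L_crn[OF r(1)] by (simp add: cur_def)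
  also have "L (\<lambda>b' b. of_real (w b) * dx f b' b) r =
      L (\<lambda>b' b. of_real (w b) * of_real (f b)) r - L (\<lambda>b' b. of_real (w b) * of_real (f b')) r"
    by (simp add: dx_def right_diff_distrib flip: Lm_diff_wt)
  finally show ?thesis using L_in_tr[OF r(1), of "\<lambda>b. of_real (w b) * of_real (f b)"] r(3)
    by (simp add: L_out ftr_simps)
qed

lemma ex_sol: "\<exists>Y. Y \<in> crn d d \<and> fadj Y = Y \<and> Y - M w0 Y = cur f"
proof -
  obtain Y where Y: "Y \<in> crn d d" "Y - M w0 Y = cur f - ftr (r * cur f) *. fid d" using cur_crn by (rule poisson)
  have e: "Y - M w0 Y = cur f" using Y(2) by (simp add: tr_r_cur)
  have "fadj (Y - M w0 Y) = cur f" by (simp only: e cur_adj)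
  then have e': "fadj Y - M w0 (fadj Y) = cur f" by (simp add: fadj_diff fadj_Mm)
  \<comment> \<open>The flux is Hermitian and M commutes with the adjoint, so the Hermitian part of
    a solution solves the equation too. Hermitian solutions keep the traces below real.\<close>
  define Z where "Z = (1/2) *. (Y + fadj Y)"
  have "Z - M w0 Z = (1/2) *. ((Y - M w0 Y) + (fadj Y - M w0 (fadj Y)))"
    by (simp add: Z_def Mm_smul Mm_add fm.scale_right_distrib fm.scale_right_diff_distrib)
  also have "\<dots> = (1/2) *. cur f + (1/2) *. cur f" unfolding e e' by (rule fm.scale_right_distrib)
  also have "\<dots> = cur f" by (simp flip: fm.scale_left_distrib)
  finally have "Z - M w0 Z = cur f" .
  moreover have "Z \<in> crn d d" "fadj Z = Z" using Y(1) by (auto simp: Z_def fadj_simps add.commute)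
  ultimately show ?thesis by blast
qed

definition sol :: "('b => real) => fm" where
  "sol f = (SOME Y. Y \<in> crn d d \<and> fadj Y = Y \<and> Y - M w0 Y = cur f)"
lemma sol: "sol f \<in> crn d d" "fadj (sol f) = sol f" "sol f - M w0 (sol f) = cur f"
  using someI_ex[OF ex_sol[of f]] unfolding sol_def by auto

lemma sol_unique: assumes Y: "Y \<in> crn d d" "Y - M w0 Y = cur f"
  shows "\<exists>c. Y = sol f + c *. fid d"
proof -
  have "Y - M w0 Y - (sol f - M w0 (sol f)) = 0" using Y(2) sol(3)[of f] by simp
  then have "M w0 (Y - sol f) = Y - sol f" by (simp add: Mm_diff algebra_simps)
  then obtain c where "Y - sol f = c *. fid d" using erg[of "Y - sol f"] Y sol by auto
  then show ?thesis by (metis add.commute diff_add_cancel)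
qed

text \<open>Formally \<open>sol f\<close> is the sum of M^n \<open>cur f\<close> over n, so
  \<open>cross f g\<close> is a Green-Kubo sum: the correlation of the increment of g in one
  interaction with the increments of f in all later ones. In \<open>kap\<close> the equal-time term
  carries g of the incoming label instead of an increment, as linear response produces it.\<close>

definition cross :: "('b => real) => ('b => real) => complex" where
  "cross f g = ftr (r * M (\<lambda>b' b. of_real (w b) * dx g b' b) (sol f))"
definition kap :: "('b => real) => ('b => real) => complex" where
  "kap f g = cross f g + ftr (L (\<lambda>b' b. of_real (w b) * of_real (g b) * dx f b' b) r)"

text \<open>Solutions differ by scalars, and a scalar contributes a multiple of the mean increment
  of g, which vanishes in equilibrium.\<close>

lemma cross_eq: assumes "Y \<in> crn d d" "Y - M w0 Y = cur f"
  shows "ftr (r * M (\<lambda>b' b. of_real (w b) * dx g b' b) Y) = cross f g"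
proof -
  obtain c where c: "Y = sol f + c *. fid d" using sol_unique[OF assms] by blast
  have "ftr (r * M (\<lambda>b' b. of_real (w b) * dx g b' b) (fid d)) = 0" using tr_r_cur[of g] by (simp add: cur_def)
  then show ?thesis unfolding c by (simp add: Mm_add Mm_smul ring_distribs ftr_simps cross_def)
qed

lemma herm_tr_real: assumes "fadj X = X" "fadj Y = Y" shows "Im (ftr (X * Y)) = 0"
proof -
  have "cnj (ftr (X * Y)) = ftr (X * Y)" by (metis assms ftr_comm ftr_fadj fadj_mult)
  then show ?thesis by (simp add: complex_eq_iff)
qed

lemma cross_Im: "Im (cross f g) = 0"
  unfolding cross_def by (rule herm_tr_real) (simp_all add: fpsd_adj r fadj_Mm sol dx_def)
lemma tr_L_r_Im: "Im (ftr (L (\<lambda>b' b. of_real (\<phi> b' b)) r)) = 0"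
  using herm_tr_real[of "L (\<lambda>b' b. of_real (\<phi> b' b)) r" "fid d"]
  by (simp add: fadj_Lm fpsd_adj r)
lemma kap_Im: "Im (kap f g) = 0"
  using tr_L_r_Im[of "\<lambda>b' b. w b * g b * (f b - f b')"] cross_Im by (simp add: kap_def dx_def)

text \<open>With f, g taken at b and f', g' at b', one has g (f - f') + f (g - g') - (f - f') (g -
  g') = f g - f' g', and the right side has mean 0 in equilibrium. The symmetrized response is
  therefore the asymptotic covariance with its quadratic term.\<close>

lemma kap_sym_sum:
  "kap f g + kap g f = cross f g + cross g f + ftr (L (\<lambda>b' b. of_real (w b) * dx f b' b * dx g b' b) r)"
proof -
  define P where "P = (\<lambda>F. ftr (L (\<lambda>b' b. of_real (w b) * F b' b) r))"
  have Padd: "P (\<lambda>b' b. F b' b + G b' b) = P F + P G" and Pdiff: "P (\<lambda>b' b. F b' b - G b' b) = P F - P G" for F G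
    by (simp_all add: P_def ring_distribs Lm_add_wt Lm_diff_wt ftr_simps)
  have "P (\<lambda>b' b. of_real (g b) * dx f b' b) + P (\<lambda>b' b. of_real (f b) * dx g b' b) - P (\<lambda>b' b. dx f b' b * dx g b' b)
     = P (\<lambda>b' b. of_real (g b) * dx f b' b + of_real (f b) * dx g b' b - dx f b' b * dx g b' b)"
    by (simp add: Padd Pdiff)
  also have "\<dots> = P (\<lambda>b' b. of_real (f b * g b) - of_real (f b' * g b'))"
    by (rule arg_cong[where f = P]) (auto simp: dx_def algebra_simps)
  also have "\<dots> = 0"
    unfolding Pdiff using L_in_tr[OF r(1), of "\<lambda>b. of_real (w b) * of_real (f b * g b)"] r(3)
      L_out[of "\<lambda>b. of_real (f b * g b)"] by (simp add: P_def ftr_smul)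
  finally show ?thesis by (simp add: kap_def P_def mult.assoc)
qed

lemma dx_add: "dx (\<lambda>b. f b + g b) = (\<lambda>b' b. dx f b' b + dx g b' b)"
  by (auto simp: dx_def fun_eq_iff)
lemma dx_smul: "dx (\<lambda>b. c * f b) = (\<lambda>b' b. of_real c * dx f b' b)"
  by (auto simp: dx_def fun_eq_iff algebra_simps)
lemma cur_add: "cur (\<lambda>b. f b + g b) = cur f + cur g"
  by (simp add: cur_def dx_add ring_distribs Mm_add_wt)
lemma cur_smul: "cur (\<lambda>b. c * f b) = of_real c *. cur f"
  by (simp add: cur_def dx_smul mult.left_commute Mm_smul_wt)

lemma cross_add1: "cross (\<lambda>b. f b + f' b) g = cross f g + cross f' g"
proof -
  have "(sol f + sol f') - M w0 (sol f + sol f') = (sol f - M w0 (sol f)) + (sol f' - M w0 (sol f'))"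
    by (simp add: Mm_add)
  then have e: "(sol f + sol f') - M w0 (sol f + sol f') = cur (\<lambda>b. f b + f' b)"
    by (simp only: sol cur_add)
  have "cross (\<lambda>b. f b + f' b) g = ftr (r * M (\<lambda>b' b. of_real (w b) * dx g b' b) (sol f + sol f'))"
    by (rule cross_eq[symmetric])
      (use sol(1)[of f] sol(1)[of f'] e in auto)
  then show ?thesis by (simp add: cross_def Mm_add ring_distribs ftr_add)
qed
lemma cross_smul1: "cross (\<lambda>b. c * f b) g = of_real c * cross f g"
proof -
  have "cross (\<lambda>b. c * f b) g = ftr (r * M (\<lambda>b' b. of_real (w b) * dx g b' b) (of_real c *. sol f))"
    by (rule cross_eq[symmetric])
      (use sol[of f] in \<open>auto simp: Mm_smul cur_smul simp flip: fm.scale_right_diff_distrib\<close>)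
  then show ?thesis by (simp add: cross_def Mm_smul ftr_smul)
qed
lemma cross_add2: "cross f (\<lambda>b. g b + g' b) = cross f g + cross f g'"
  by (simp add: cross_def dx_add ring_distribs Mm_add_wt ftr_add)
lemma cross_smul2: "cross f (\<lambda>b. c * g b) = of_real c * cross f g"
  by (simp add: cross_def dx_smul mult.left_commute Mm_smul_wt ftr_smul)

lemma kap_add1: "kap (\<lambda>b. f b + f' b) g = kap f g + kap f' g"
  by (simp add: kap_def cross_add1 dx_add ring_distribs Lm_add_wt ftr_add)
lemma kap_add2: "kap f (\<lambda>b. g b + g' b) = kap f g + kap f g'"
  by (simp add: kap_def cross_add2 ring_distribs Lm_add_wt ftr_add)
lemma kap_smul1: "kap (\<lambda>b. c * f b) g = of_real c * kap f g"
proof -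
  have "L (\<lambda>b' b. of_real (w b) * of_real (g b) * (of_real c * dx f b' b)) r = of_real c *. L (\<lambda>b' b. of_real (w b) * of_real (g b) * dx f b' b) r"
    by (simp add: mult.left_commute flip: Lm_smul_wt)
  then show ?thesis by (simp add: kap_def cross_smul1 dx_smul ftr_smul ring_distribs)
qed
lemma kap_smul2: "kap f (\<lambda>b. c * g b) = of_real c * kap f g"
proof -
  have "L (\<lambda>b' b. of_real (w b) * of_real (c * g b) * dx f b' b) r = of_real c *. L (\<lambda>b' b. of_real (w b) * of_real (g b) * dx f b' b) r"
    by (simp add: mult.left_commute mult.assoc flip: Lm_smul_wt)
  then show ?thesis by (simp add: kap_def cross_smul2 ftr_smul ring_distribs)
qed
lemma kap_0: "kap (\<lambda>b. 0) g = 0" "kap f (\<lambda>b. 0) = 0"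
  using kap_smul1[of 0] kap_smul2[of _ 0] by simp_all
lemma kap_sum1: "finite A ==> kap (\<lambda>b. \<Sum>a\<in>A. u a * F a b) g = (\<Sum>a\<in>A. of_real (u a) * kap (F a) g)"
  by (induction A rule: finite_induct) (auto simp: kap_0 kap_add1 kap_smul1)
lemma kap_sum2: "finite A ==> kap f (\<lambda>b. \<Sum>a\<in>A. u a * F a b) = (\<Sum>a\<in>A. of_real (u a) * kap f (F a))"
  by (induction A rule: finite_induct) (auto simp: kap_0 kap_add2 kap_smul2)

end

section \<open>Linear response\<close>

context qenv
begin

definition wdist :: "('b => real) => real" where "wdist \<omega> = (\<Sum>b\<in>B. \<bar>\<omega> b - w b\<bar>)"

lemma wdist_nonneg: "wdist \<omega> \<ge> 0" by (auto simp: wdist_def intro: sum_nonneg)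

abbreviation wl :: "('b => real) => 'b => 'b => complex" where "wl \<omega> \<equiv> \<lambda>b' b. of_real (\<omega> b)"

text \<open>The Poisson solution Y of W turns the deviation of a fixed point X of the perturbed
  channel into the trace of X against (M_\<omega> - M) Y, which is linear in the change of the
  weights.\<close>

lemma fixed_perturb_test:
  assumes W: "W \<in> crn d d"
  shows "\<exists>C\<ge>0. \<forall>\<omega> X. X \<in> crn d d \<and> L (wl \<omega>) X = X \<longrightarrow>
    cmod (ftr (W * (X - ftr X *. r))) \<le> C * wdist \<omega> * nrm X"
proof -
  obtain Y where Y: "Y \<in> crn d d" "Y - M w0 Y = W - ftr (r * W) *. fid d" using W by (rule poisson)
  define C where "C = (\<Sum>b\<in>B. \<Sum>b'\<in>B. nrm (fadj (K b' b) * Y * K b' b))"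
  have C0: "C \<ge> 0" unfolding C_def by (intro sum_nonneg nrm_nonneg)
  have "cmod (ftr (W * (X - ftr X *. r))) \<le> C * wdist \<omega> * nrm X" if X: "X \<in> crn d d" "L (wl \<omega>) X = X" for \<omega> X
  proof -
    have "ftr (X * (W - ftr (r * W) *. fid d)) = ftr (X * Y) - ftr (X * M w0 Y)"
      unfolding Y(2)[symmetric] by (simp add: ring_distribs ftr_simps)
    also have "ftr (X * Y) = ftr (X * M (wl \<omega>) Y)" using tr_Lm_Mm[of B K "wl \<omega>" X Y] X by simp
    finally have "ftr (X * (W - ftr (r * W) *. fid d)) = ftr (X * M (\<lambda>b' b. wl \<omega> b' b - w0 b' b) Y)"
      unfolding Mm_diff_wt by (simp add: ring_distribs ftr_simps)
    moreover have "ftr (W * (X - ftr X *. r)) = ftr (X * (W - ftr (r * W) *. fid d))"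
      using X by (simp add: ring_distribs ftr_simps ftr_comm[of W])
    ultimately have 1: "cmod (ftr (W * (X - ftr X *. r))) \<le> nrm X * nrm (M (\<lambda>b' b. wl \<omega> b' b - w0 b' b) Y)"
      using ftr_nrm by metis
    have "nrm (M (\<lambda>b' b. wl \<omega> b' b - w0 b' b) Y) \<le>
        (\<Sum>b\<in>B. \<Sum>b'\<in>B. cmod (wl \<omega> b' b - w0 b' b) * nrm (fadj (K b' b) * Y * K b' b))" by (rule nrm_Mm_wt)
    also have "\<dots> \<le> (\<Sum>b\<in>B. \<Sum>b'\<in>B. wdist \<omega> * nrm (fadj (K b' b) * Y * K b' b))"
    proof (intro sum_mono mult_right_mono nrm_nonneg)
      fix b b' assume "b \<in> B"
      then have "\<bar>\<omega> b - w b\<bar> \<le> wdist \<omega>" unfolding wdist_def by (intro member_le_sum finB) auto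
      then show "cmod (wl \<omega> b' b - w0 b' b) \<le> wdist \<omega>" by (simp flip: of_real_diff)
    qed
    also have "\<dots> = C * wdist \<omega>" by (simp add: C_def mult.commute flip: sum_distrib_left)
    finally have 2: "nrm (M (\<lambda>b' b. wl \<omega> b' b - w0 b' b) Y) \<le> C * wdist \<omega>" .
    show ?thesis using order_trans[OF 1 mult_left_mono[OF 2 nrm_nonneg]] by (simp only: mult_ac)
  qed
  then show ?thesis using C0 by blast
qed

lemma fixed_perturb:
  "\<exists>C>0. \<forall>\<omega> X. X \<in> crn d d \<and> L (wl \<omega>) X = X \<longrightarrow> nrm (X - ftr X *. r) \<le> C * wdist \<omega> * nrm X"
proof -
  have "\<forall>i j. \<exists>C\<ge>0. i < d \<and> j < d \<longrightarrow> (\<forall>\<omega> X. X \<in> crn d d \<and> L (wl \<omega>) X = X \<longrightarrow>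
    cmod (ftr (fE j i * (X - ftr X *. r))) \<le> C * wdist \<omega> * nrm X)"
    using fixed_perturb_test[OF crn_fE] by (metis order_refl)
  then obtain C where C: "\<And>i j. C i j \<ge> 0" "\<And>i j \<omega> X. i < d ==> j < d ==> X \<in> crn d d ==> L (wl \<omega>) X = X ==>
    cmod (ftr (fE j i * (X - ftr X *. r))) \<le> C i j * wdist \<omega> * nrm X" by metis
  \<comment> \<open>The summand 1 makes the constant strictly positive.\<close>
  define D where "D = (\<Sum>i<d. \<Sum>j<d. C i j) + 1"
  have "D > 0" unfolding D_def using C(1) by (intro add_nonneg_pos sum_nonneg) auto
  moreover have "nrm (X - ftr X *. r) \<le> D * wdist \<omega> * nrm X" if X: "X \<in> crn d d" "L (wl \<omega>) X = X" for \<omega> X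
  proof -
    have "nrm (X - ftr X *. r) = (\<Sum>i<d. \<Sum>j<d. cmod (ftr (fE j i * (X - ftr X *. r))))"
      using X r by (subst nrm_crn[of _ d d]) (auto simp: ftr_fE)
    also have "\<dots> \<le> (\<Sum>i<d. \<Sum>j<d. C i j * wdist \<omega> * nrm X)"
      by (intro sum_mono C(2) X) auto
    also have "\<dots> = (D - 1) * (wdist \<omega> * nrm X)" by (simp add: D_def sum_distrib_right mult.assoc)
    also have "\<dots> \<le> D * (wdist \<omega> * nrm X)"
      by (intro mult_right_mono mult_nonneg_nonneg wdist_nonneg nrm_nonneg) auto
    finally show ?thesis by (simp add: mult.assoc)
  qed
  ultimately show ?thesis by blast
qed

definition fixed_state :: "('b => real) => fm => bool" where
  "fixed_state \<omega> X \<longleftrightarrow> X \<in> crn d d \<and> fpsd X \<and> ftr X = 1 \<and> L (wl \<omega>) X = X"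

text \<open>Existence is a dimension count, uniqueness and closeness to r come from
  \<open>fixed_perturb\<close>, and positivity holds because a Hermitian matrix near the faithful
  state r is positive.\<close>

lemma fixed_state_near:
  "\<exists>\<delta>>0. \<exists>C>0. \<forall>\<omega>. wdist \<omega> < \<delta> \<and> (\<Sum>b\<in>B. \<omega> b) = 1 \<longrightarrow> (\<exists>!X. fixed_state \<omega> X) \<and>
      (\<forall>X. fixed_state \<omega> X \<longrightarrow> nrm (X - r) \<le> C * wdist \<omega>)"
proof -
  obtain C where C: "C > 0" "\<And>\<omega> X. X \<in> crn d d ==> L (wl \<omega>) X = X ==> nrm (X - ftr X *. r) \<le> C * wdist \<omega> * nrm X"
    using fixed_perturb by blast
  obtain \<epsilon> where eps: "\<epsilon> > 0" "fpsd (r - of_real \<epsilon> *. fid d)"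
    by (rule fpsd_gap[OF r(1,2) dpos faithful])
  define R where "R = nrm r + 1"
  have R: "R > 0" "nrm r \<le> R" using nrm_nonneg[of r] by (auto simp: R_def)
  \<comment> \<open>The first bound gives \<open>C * wdist \<omega> \<le> 1/2\<close>, so a fixed
    point of trace 0 vanishes and one of trace 1 has norm at most 2 R; the second keeps the latter
    within the positivity gap \<epsilon> of r.\<close>
  define \<delta> where "\<delta> = min (1 / (2 * C)) (\<epsilon> / (2 * C * R))"
  have d0: "\<delta> > 0" using C R eps by (simp add: \<delta>_def)
  have main: "(\<exists>!X. fixed_state \<omega> X) \<and> (\<forall>X. fixed_state \<omega> X \<longrightarrow> nrm (X - r) \<le> 2 * C * R * wdist \<omega>)"
    if \<omega>: "wdist \<omega> < \<delta>" "(\<Sum>b\<in>B. \<omega> b) = 1" for \<omega>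
  proof -
    have half: "C * wdist \<omega> \<le> 1/2" using \<omega>(1) C(1) by (simp add: \<delta>_def field_simps)
    have small: "2 * C * R * wdist \<omega> \<le> \<epsilon>" using \<omega>(1) C(1) R by (simp add: \<delta>_def field_simps)
    have tr0: "X = 0" if "X \<in> crn d d" "L (wl \<omega>) X = X" "ftr X = 0" for X
    proof -
      have "nrm X \<le> C * wdist \<omega> * nrm X" using C(2)[OF that(1,2)] that(3) by simp
      also have "\<dots> \<le> 1/2 * nrm X" using half nrm_nonneg by (intro mult_right_mono) auto
      finally show ?thesis using nrm_nonneg[of X] by (simp add: nrm_0_iff)
    qed
    have near: "nrm (X - r) \<le> 2 * C * R * wdist \<omega>" if "X \<in> crn d d" "L (wl \<omega>) X = X" "ftr X = 1" for X
    proof -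
      have 1: "nrm (X - r) \<le> C * wdist \<omega> * nrm X" using C(2)[OF that(1,2)] that(3) by simp
      also have "\<dots> \<le> 1/2 * nrm X" using half nrm_nonneg by (intro mult_right_mono) auto
      finally have "nrm X \<le> nrm r + 1/2 * nrm X" using nrm_add[of "X - r" r] by simp
      then have "nrm X \<le> 2 * R" using R by simp
      then have "C * wdist \<omega> * nrm X \<le> C * wdist \<omega> * (2 * R)"
        using C(1) wdist_nonneg by (intro mult_left_mono) auto
      then show ?thesis using 1 by (simp add: mult_ac)
    qed
    have uniq: "X = Y" if "X \<in> crn d d" "L (wl \<omega>) X = X" "ftr X = 1" "Y \<in> crn d d" "L (wl \<omega>) Y = Y" "ftr Y = 1" for X Y
      using tr0[of "X - Y"] that by (simp add: Lm_diff ftr_diff)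
    have trL: "ftr (L (wl \<omega>) X) = ftr X" if "X \<in> crn d d" for X
      using L_in_tr[OF that, of "\<lambda>b. of_real (\<omega> b)"] \<omega>(2) by (simp flip: of_real_sum)
    \<comment> \<open>If Id - L were injective it would attain r, but all its values have trace
      0.\<close>
    have "\<exists>Z. Z \<in> crn d d \<and> L (wl \<omega>) Z = Z \<and> Z \<noteq> 0"
    proof (rule ccontr)
      assume n: "\<not> ?thesis"
      obtain X where "X \<in> crn d d" "X - L (wl \<omega>) X = r"
      proof (rule crn_inj_surj[of "\<lambda>X. X - L (wl \<omega>) X" d d r])
        show "X + Y - L (wl \<omega>) (X + Y) = X - L (wl \<omega>) X + (Y - L (wl \<omega>) Y)" for X Y by (simp add: Lm_add)
        show "c *. X - L (wl \<omega>) (c *. X) = c *. (X - L (wl \<omega>) X)" for c X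
          by (simp add: Lm_smul fm.scale_right_diff_distrib)
      qed (use n r in auto)
      then have "ftr r = 0" using trL by (metis cancel_comm_monoid_add_class.diff_cancel ftr_diff)
      then show False using r by simp
    qed
    then obtain Z where Z: "Z \<in> crn d d" "L (wl \<omega>) Z = Z" "Z \<noteq> 0" by blast
    have "ftr Z \<noteq> 0" using tr0 Z by blast
    define Y where "Y = (1 / ftr Z) *. Z"
    have Y: "Y \<in> crn d d" "L (wl \<omega>) Y = Y" "ftr Y = 1" using Z \<open>ftr Z \<noteq> 0\<close> by (auto simp: Y_def Lm_smul ftr_smul)
    have "fadj (L (wl \<omega>) Y) = fadj Y" using Y by simp
    then have "L (wl \<omega>) (fadj Y) = fadj Y" by (simp add: fadj_Lm)
    then have Yh: "fadj Y = Y" using uniq[of "fadj Y" Y] Y by (simp add: ftr_fadj)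
    have "fpsd Y" using fpsd_near[OF eps(2) Y(1) Yh r(1)] near[OF Y] small by simp
    then have "fixed_state \<omega> Y" using Y by (simp add: fixed_state_def)
    then show ?thesis using uniq near unfolding fixed_state_def by metis
  qed
  have c0: "2 * C * R > 0" using C R by simp
  show ?thesis
  proof (rule exI[of _ \<delta>], rule conjI[OF d0], rule exI[of _ "2 * C * R"], rule conjI[OF c0], intro allI impI)
    fix \<omega> assume "wdist \<omega> < \<delta> \<and> (\<Sum>b\<in>B. \<omega> b) = 1"
    then show "(\<exists>!X. fixed_state \<omega> X) \<and> (\<forall>X. fixed_state \<omega> X \<longrightarrow> nrm (X - r) \<le> 2 * C * R * wdist \<omega>)"
      using main by simp
  qed
qed

text \<open>The Poisson equation rewrites the mean flux in the perturbed state exactly, with a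
  factor \<open>Wt t b - w b\<close> in each term (\<open>key\<close>). The derivative at 0 then
  involves only the derivative of the weights and the continuity of the state; g is the logarithmic
  derivative of the weights.\<close>

lemma linear_response:
  fixes Wt :: "real => 'b => real"
  assumes sum1: "\<And>t. (\<Sum>b\<in>B. Wt t b) = 1" and W0: "\<And>b. b \<in> B ==> Wt 0 b = w b"
    and dW: "\<And>b. b \<in> B ==> ((\<lambda>t. Wt t b) has_real_derivative w b * g b) (at 0)" and g: "centered g"
  shows "\<forall>\<^sub>F t in nhds 0. \<exists>!X. fixed_state (Wt t) X"
    and "\<And>R f. \<forall>\<^sub>F t in nhds 0. fixed_state (Wt t) (R t) ==>
      ((\<lambda>t. Re (ftr (R t * M (\<lambda>b' b. of_real (Wt t b) * dx f b' b) (fid d)))) has_real_derivative Re (kap f g)) (at 0)"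
proof -
  from fixed_state_near obtain \<delta> C where dC: "\<delta> > 0" "C > 0" and
    near: "\<forall>\<omega>. wdist \<omega> < \<delta> \<and> (\<Sum>b\<in>B. \<omega> b) = 1 \<longrightarrow> (\<exists>!X. fixed_state \<omega> X) \<and>
      (\<forall>X. fixed_state \<omega> X \<longrightarrow> nrm (X - r) \<le> C * wdist \<omega>)"
    by (elim exE conjE) (rule that)
  note u = conjunct1[OF near[rule_format, OF conjI]]
    and n = conjunct2[OF near[rule_format, OF conjI], rule_format]
  have cont: "((\<lambda>t. Wt t b) \<longlongrightarrow> w b) (at 0)" if "b \<in> B" for b
    using DERIV_isCont[OF dW[OF that]] W0[OF that] by (simp add: isCont_def)
  have "((\<lambda>t. wdist (Wt t)) \<longlongrightarrow> (\<Sum>b\<in>B. \<bar>w b - w b\<bar>)) (at 0)"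
    unfolding wdist_def by (intro tendsto_intros cont)
  then have lim: "((\<lambda>t. wdist (Wt t)) \<longlongrightarrow> 0) (at 0)" by simp
  have ev: "\<forall>\<^sub>F t in at 0. wdist (Wt t) < \<delta>" using lim dC(1) by (rule order_tendstoD)
  moreover have z: "wdist (Wt 0) < \<delta>" using dC W0 by (simp add: wdist_def)
  ultimately have ev': "\<forall>\<^sub>F t in nhds 0. wdist (Wt t) < \<delta>" by (simp add: eventually_nhds_conv_at)
  then show "\<forall>\<^sub>F t in nhds 0. \<exists>!X. fixed_state (Wt t) X"
    by (rule eventually_mono) (use u sum1 in blast)
  fix R f assume R: "\<forall>\<^sub>F t in nhds 0. fixed_state (Wt t) (R t)"
  define Y where "Y = sol f"
  \<comment> \<open>The contribution of the incoming label b: later interactions enter through the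
    Poisson solution, the present one through the increment of f.\<close>
  define G where "G b = (\<Sum>b'\<in>B. fadj (K b' b) * Y * K b' b) + (\<Sum>b'\<in>B. dx f b' b *. (fadj (K b' b) * fid d * K b' b))" for b
  define q where "q t = ftr (R t * M (\<lambda>b' b. of_real (Wt t b) * dx f b' b) (fid d))" for t
  have key: "q t = (\<Sum>b\<in>B. of_real (Wt t b - w b) * ftr (R t * G b))" if "fixed_state (Wt t) (R t)" for t
  proof -
    let ?v = "\<lambda>b' b. complex_of_real (Wt t b - w b)"
    have "q t = ftr (R t * cur f) + ftr (R t * M (\<lambda>b' b. ?v b' b * dx f b' b) (fid d))"
      unfolding q_def cur_def by (simp add: algebra_simps flip: Mm_add_wt ftr_add distrib_left)
    also have "ftr (R t * cur f) = ftr (R t * M (wl (Wt t)) Y) - ftr (R t * M w0 Y)"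
      using tr_Lm_Mm[of B K "wl (Wt t)" "R t" Y] that unfolding sol(3)[of f, symmetric] Y_def
      by (simp add: fixed_state_def ring_distribs ftr_diff)
    also have "\<dots> = ftr (R t * M ?v Y)"
      by (simp add: Mm_diff_wt ring_distribs ftr_diff)
    also have "M ?v Y = (\<Sum>b\<in>B. of_real (Wt t b - w b) *. (\<Sum>b'\<in>B. fadj (K b' b) * Y * K b' b))"
      by (simp add: Mm_def smul_sum_right)
    also have "M (\<lambda>b' b. ?v b' b * dx f b' b) (fid d) =
        (\<Sum>b\<in>B. of_real (Wt t b - w b) *. (\<Sum>b'\<in>B. dx f b' b *. (fadj (K b' b) * fid d * K b' b)))"
      by (simp add: Mm_def smul_sum_right fm.scale_scale)
    finally show ?thesis
      by (simp add: G_def ring_distribs ftr_simps sum_distrib_left sum.distrib)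
  qed
  have q0: "q 0 = 0" using key[of 0] eventually_nhds_x_imp_x[OF R] W0 by simp
  have Rlim: "((\<lambda>t. ftr (R t * A)) \<longlongrightarrow> ftr (r * A)) (at 0)" for A
  proof (rule Lim_transform)
    show "((\<lambda>t. ftr (r * A)) \<longlongrightarrow> ftr (r * A)) (at 0)" by simp
    have "((\<lambda>t. ftr ((R t - r) * A)) \<longlongrightarrow> 0) (at 0)"
    proof (rule Lim_null_comparison)
      show "\<forall>\<^sub>F t in at 0. norm (ftr ((R t - r) * A)) \<le> C * wdist (Wt t) * nrm A"
        using ev eventually_nhds_conv_at[THEN iffD1, OF R, THEN conjunct1]
      proof eventually_elim
        fix t assume "wdist (Wt t) < \<delta>" "fixed_state (Wt t) (R t)"
        then have "nrm (R t - r) \<le> C * wdist (Wt t)" using n sum1 by blast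
        then show "norm (ftr ((R t - r) * A)) \<le> C * wdist (Wt t) * nrm A"
          using ftr_nrm[of "R t - r" A] nrm_nonneg[of A] by (meson mult_right_mono order_trans)
      qed
      show "((\<lambda>t. C * wdist (Wt t) * nrm A) \<longlongrightarrow> 0) (at 0)"
        using tendsto_mult[OF tendsto_mult[OF tendsto_const[of C] lim] tendsto_const[of "nrm A"]] by simp
    qed
    then show "((\<lambda>t. ftr (R t * A) - ftr (r * A)) \<longlongrightarrow> 0) (at 0)" by (simp add: ring_distribs ftr_diff)
  qed
  have "((\<lambda>t. \<Sum>b\<in>B. of_real ((Wt t b - w b) / t) * ftr (R t * G b)) \<longlongrightarrow> (\<Sum>b\<in>B. of_real (w b * g b) * ftr (r * G b))) (at 0)"
  proof (intro tendsto_sum tendsto_mult tendsto_of_real Rlim)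
    fix b assume "b \<in> B"
    then show "((\<lambda>t. (Wt t b - w b) / t) \<longlongrightarrow> w b * g b) (at 0)"
      using dW[of b] W0[of b] by (simp add: DERIV_def)
  qed
  moreover have "(\<Sum>b\<in>B. of_real (w b * g b) * ftr (r * G b)) = kap f g"
  proof -
    let ?wg = "\<lambda>b' b. complex_of_real (w b) * of_real (g b)"
    have "(\<Sum>b\<in>B. of_real (w b * g b) * ftr (r * G b)) = ftr (r * M ?wg Y) + ftr (r * M (\<lambda>b' b. ?wg b' b * dx f b' b) (fid d))"
      by (simp add: Mm_def G_def ring_distribs ftr_simps sum_distrib_left sum.distrib fm.scale_scale mult.assoc)
    also have "ftr (r * M (\<lambda>b' b. ?wg b' b * dx f b' b) (fid d)) = ftr (L (\<lambda>b' b. ?wg b' b * dx f b' b) r)"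
      using tr_Lm_Mm[of B K "\<lambda>b' b. ?wg b' b * dx f b' b" r "fid d"] r by simp
    \<comment> \<open>g of the incoming label is the increment of g plus g of the outgoing label.
      The latter yields tr(r Y) times the mean of g, and this mean is 0.\<close>
    also have "ftr (r * M ?wg Y) = ftr (r * M (\<lambda>b' b. of_real (w b) * dx g b' b) Y) + ftr (r * M (\<lambda>b' b. of_real (w b) * of_real (g b')) Y)"
      by (simp add: dx_def flip: ftr_add distrib_left Mm_add_wt)
    also have "ftr (r * M (\<lambda>b' b. of_real (w b) * of_real (g b')) Y) = 0"
    proof -
      have "(\<Sum>b\<in>B. complex_of_real (w b) * of_real (g b)) = of_real (\<Sum>b\<in>B. w b * g b)" by simp
      then have "(\<Sum>b\<in>B. complex_of_real (w b) * of_real (g b)) = 0" using g by (simp only: centered_def) simp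
      then show ?thesis using L_out[of "\<lambda>b. of_real (g b)"] by (simp add: tr_Lm_Mm[symmetric])
    qed
    finally show ?thesis by (simp add: kap_def cross_def Y_def)
  qed
  ultimately have "((\<lambda>t. \<Sum>b\<in>B. of_real ((Wt t b - w b) / t) * ftr (R t * G b)) \<longlongrightarrow> kap f g) (at 0)" by simp
  then have "((\<lambda>t. Re (\<Sum>b\<in>B. of_real ((Wt t b - w b) / t) * ftr (R t * G b))) \<longlongrightarrow> Re (kap f g)) (at 0)"
    by (rule tendsto_Re)
  then have "((\<lambda>t. (Re (q t) - Re (q 0)) / t) \<longlongrightarrow> Re (kap f g)) (at 0)"
  proof (rule Lim_transform_eventually)
    show "\<forall>\<^sub>F t in at 0. Re (\<Sum>b\<in>B. of_real ((Wt t b - w b) / t) * ftr (R t * G b)) = (Re (q t) - Re (q 0)) / t"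
      using eventually_nhds_conv_at[THEN iffD1, OF R, THEN conjunct1]
    proof eventually_elim
      fix t assume "fixed_state (Wt t) (R t)"
      then show "Re (\<Sum>b\<in>B. of_real ((Wt t b - w b) / t) * ftr (R t * G b)) = (Re (q t) - Re (q 0)) / t"
        by (simp add: key q0 Re_sum sum_divide_distrib)
    qed
  qed
  then show "((\<lambda>t. Re (ftr (R t * M (\<lambda>b' b. of_real (Wt t b) * dx f b' b) (fid d)))) has_real_derivative Re (kap f g)) (at 0)"
    by (simp add: DERIV_def q_def)
qed

end

section \<open>Characteristic functions of the counting process\<close>

lemma nrm_mult: "nrm (X * Y) \<le> nrm X * nrm Y"
proof -
  obtain n where n: "X \<in> crn n n" "Y \<in> crn n n" using crn_ex2 by blast
  have "nrm (X * Y) \<le> (\<Sum>i<n. \<Sum>j<n. \<Sum>k<n. cmod (ent X i k) * cmod (ent Y k j))"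
    unfolding nrm_crn[OF crn_mult[OF n]] ent_multL[OF n(1)]
    by (intro sum_mono) (auto simp: norm_mult intro!: order_trans[OF norm_sum])
  also have "\<dots> = (\<Sum>i<n. \<Sum>k<n. \<Sum>j<n. cmod (ent X i k) * cmod (ent Y k j))"
    by (intro sum.cong refl sum.swap)
  also have "\<dots> \<le> (\<Sum>i<n. \<Sum>k<n. cmod (ent X i k) * nrm Y)"
  proof (intro sum_mono)
    fix i k assume k: "k \<in> {..<n}"
    have "(\<Sum>j<n. cmod (ent Y k j)) \<le> (\<Sum>l<n. \<Sum>j<n. cmod (ent Y l j))"
      using k by (intro member_le_sum[of k "{..<n}" "\<lambda>l. \<Sum>j<n. cmod (ent Y l j)"]) (auto intro: sum_nonneg)
    then show "(\<Sum>j<n. cmod (ent X i k) * cmod (ent Y k j)) \<le> cmod (ent X i k) * nrm Y"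
      unfolding nrm_crn[OF n(2)] sum_distrib_left[symmetric] by (rule mult_left_mono) simp
  qed
  finally show ?thesis by (simp add: nrm_crn[OF n(1)] sum_distrib_right)
qed

lemma Lm_pow_add: "(Lm B K \<phi> ^^ n) (X + Y) = (Lm B K \<phi> ^^ n) X + (Lm B K \<phi> ^^ n) Y"
  by (induction n) (auto simp: Lm_add)
lemma Lm_pow_smul: "(Lm B K \<phi> ^^ n) (c *. X) = c *. (Lm B K \<phi> ^^ n) X"
  by (induction n) (auto simp: Lm_smul)
lemma Lm_pow_0: "(Lm B K \<phi> ^^ n) 0 = 0" by (induction n) auto
lemma Lm_pow_sum: "(Lm B K \<phi> ^^ n) (sum f A) = (\<Sum>a\<in>A. (Lm B K \<phi> ^^ n) (f a))"
  by (induction A rule: infinite_finite_induct) (auto simp: Lm_pow_add Lm_pow_0)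

lemma tr_Lm_pow: "ftr ((Lm B K \<phi> ^^ n) X * Y) = ftr (X * (Mm B K \<phi> ^^ n) Y)"
proof (induction n arbitrary: Y)
  case (Suc n)
  have "ftr ((Lm B K \<phi> ^^ Suc n) X * Y) = ftr ((Lm B K \<phi> ^^ n) X * Mm B K \<phi> Y)" by (simp add: tr_Lm_Mm)
  also have "\<dots> = ftr (X * (Mm B K \<phi> ^^ n) (Mm B K \<phi> Y))" by (rule Suc.IH)
  also have "(Mm B K \<phi> ^^ n) (Mm B K \<phi> Y) = (Mm B K \<phi> ^^ Suc n) Y" by (simp add: funpow_swap1)
  finally show ?case .
qed simp

context qenv
begin

section \<open>Bounds uniform in the number of steps\<close>

definition phs :: "('b => real) => real => 'b => 'b => complex" where
  "phs g s b' b = of_real (w b) * iexp (s * (g b - g b'))"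

lemma phs_0: "phs g 0 = w0" by (simp add: phs_def fun_eq_iff)
lemma norm_phs: "b \<in> B ==> cmod (phs g s b' b) = w b" using wpos[of b] by (simp add: phs_def norm_mult)

text \<open>Each branch of the first interaction keeps X positive, and the phases have modulus 1, so
  the traces of all branches add up to that of the untilted channel, which preserves the
  trace.\<close>

lemma L_pow_bound:
  assumes "X \<in> crn d d" "fpsd X"
  shows "cmod (ftr ((L (phs g s) ^^ n) X * Y)) \<le> Re (ftr X) * nrm Y"
  using assms
proof (induction n arbitrary: X)
  case 0 then show ?case using fpsd_tr by simp
next
  case (Suc n)
  have "(L (phs g s) ^^ Suc n) X = (L (phs g s) ^^ n) (L (phs g s) X)" by (simp add: funpow_swap1)
  also have "L (phs g s) X = (\<Sum>b\<in>B. \<Sum>b'\<in>B. phs g s b' b *. (K b' b * X * fadj (K b' b)))"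
    by (simp only: Lm_def)
  also have "(L (phs g s) ^^ n) \<dots> = (\<Sum>b\<in>B. \<Sum>b'\<in>B. phs g s b' b *. (L (phs g s) ^^ n) (K b' b * X * fadj (K b' b)))"
    by (simp only: Lm_pow_sum Lm_pow_smul)
  finally have "cmod (ftr ((L (phs g s) ^^ Suc n) X * Y)) =
     cmod (\<Sum>b\<in>B. \<Sum>b'\<in>B. phs g s b' b * ftr ((L (phs g s) ^^ n) (K b' b * X * fadj (K b' b)) * Y))"
    by (simp only: sum_distrib_right ftr_sum ftr_smul smul_mult_left)
  also have "\<dots> \<le> (\<Sum>b\<in>B. \<Sum>b'\<in>B. w b * (Re (ftr (K b' b * X * fadj (K b' b))) * nrm Y))"
  proof (intro order_trans[OF norm_sum] sum_mono)
      fix b b' assume b: "b \<in> B" and b': "b' \<in> B"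
      have "cmod (ftr ((L (phs g s) ^^ n) (K b' b * X * fadj (K b' b)) * Y)) \<le> Re (ftr (K b' b * X * fadj (K b' b))) * nrm Y"
        using Suc.prems Kc[OF b' b] by (intro Suc.IH fpsd_conj crn_mult[of _ d d _ d] crn_fadj) auto
      then show "cmod (phs g s b' b * ftr ((L (phs g s) ^^ n) (K b' b * X * fadj (K b' b)) * Y)) \<le>
        w b * (Re (ftr (K b' b * X * fadj (K b' b))) * nrm Y)"
        using b wpos[OF b] by (simp add: norm_mult norm_phs)
  qed
  also have "\<dots> = Re (ftr (L w0 X)) * nrm Y"
    by (simp add: tr_Lm Re_sum sum_distrib_right mult.assoc)
  also have "ftr (L w0 X) = ftr X"
    using L_in_tr[OF Suc.prems(1), of "\<lambda>b. of_real (w b)"] wsum by (simp flip: of_real_sum)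
  finally show ?case .
qed

text \<open>Polarization: a matrix unit is a combination of four positive rank-one matrices, to each
  of which \<open>L_pow_bound\<close> applies.\<close>

lemma fE_pow_bound: assumes i: "i < d" "j < d"
  shows "\<exists>C\<ge>0. \<forall>n s Y. cmod (ftr ((L (phs g s) ^^ n) (fE i j) * Y)) \<le> C * nrm Y"
proof -
  define v where "v \<alpha> = fE i 0 + \<alpha> *. fE j 0" for \<alpha>
  define q where "q \<alpha> = v \<alpha> * fadj (v \<alpha>)" for \<alpha>
  have qc: "q \<alpha> \<in> crn d d" for \<alpha>
    using i unfolding q_def v_def by (intro crn_mult[of _ d 1 _ 1 d] crn_fadj) auto
  have qp: "fpsd (q \<alpha>)" for \<alpha> unfolding q_def by (rule fpsd_sq)
  have qe: "q \<alpha> = fE i i + cnj \<alpha> *. fE i j + \<alpha> *. fE j i + (\<alpha> * cnj \<alpha>) *. fE j j" for \<alpha>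
    by (simp add: q_def v_def fadj_simps ring_distribs fE_mult fm.scale_right_distrib fm.scale_scale add.assoc mult.commute)
  have e: "fE i j = (1/4) *. (q 1 - q (-1) + \<i> *. q \<i> - \<i> *. q (-\<i>))"
    unfolding qe by (rule fm_eqI) (simp add: algebra_simps)
  define C where "C = (Re (ftr (q 1)) + Re (ftr (q (-1))) + Re (ftr (q \<i>)) + Re (ftr (q (-\<i>)))) / 4"
  have "C \<ge> 0" unfolding C_def using fpsd_tr_nonneg[OF qp] by (intro divide_nonneg_pos add_nonneg_nonneg) auto
  moreover have "cmod (ftr ((L (phs g s) ^^ n) (fE i j) * Y)) \<le> C * nrm Y" for n s Y
  proof -
    define T where "T \<alpha> = ftr ((L (phs g s) ^^ n) (q \<alpha>) * Y)" for \<alpha>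
    have Pd: "(L (phs g s) ^^ n) (X - X') = (L (phs g s) ^^ n) X - (L (phs g s) ^^ n) X'" for X X'
      by (induction n) (auto simp: Lm_diff)
    have "ftr ((L (phs g s) ^^ n) (fE i j) * Y) = (1/4) * (T 1 - T (-1) + \<i> * T \<i> - \<i> * T (-\<i>))"
      by (subst e) (simp add: Lm_pow_smul Lm_pow_add Pd ring_distribs ftr_simps T_def)
    also have "cmod \<dots> \<le> (cmod (T 1) + cmod (T (-1)) + cmod (T \<i>) + cmod (T (-\<i>))) / 4"
    proof -
      have "cmod (T 1 - T (-1) + \<i> * T \<i> - \<i> * T (-\<i>)) \<le> cmod (T 1) + cmod (T (-1)) + cmod (\<i> * T \<i>) + cmod (\<i> * T (-\<i>))"
        by (intro order_trans[OF norm_triangle_ineq4] add_mono order_trans[OF norm_triangle_ineq] order_refl)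
      then show ?thesis by (simp add: norm_mult)
    qed
    also have "\<dots> \<le> (Re (ftr (q 1)) * nrm Y + Re (ftr (q (-1))) * nrm Y + Re (ftr (q \<i>)) * nrm Y + Re (ftr (q (-\<i>))) * nrm Y) / 4"
      unfolding T_def by (intro divide_right_mono add_mono L_pow_bound qc qp) auto
    finally show ?thesis by (simp add: C_def algebra_simps)
  qed
  ultimately show ?thesis by blast
qed

lemma M_pow_crn: "X \<in> crn d d ==> (M \<phi> ^^ n) X \<in> crn d d"
  by (induction n) auto

text \<open>Dual to \<open>fE_pow_bound\<close> without tilt, read off entry by entry. It later
  bounds the mean increments independently of the number of steps.\<close>

lemma M_pow_bound: assumes Y: "Y \<in> crn d d"
  shows "\<exists>C\<ge>0. \<forall>n. nrm ((M w0 ^^ n) Y) \<le> C"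
proof -
  have "\<forall>i j. \<exists>C\<ge>0. i < d \<and> j < d \<longrightarrow> (\<forall>n s Y. cmod (ftr ((L (phs (\<lambda>_. 0) s) ^^ n) (fE j i) * Y)) \<le> C * nrm Y)"
    using fE_pow_bound by (metis order_refl)
  then obtain C where C0: "\<And>i j. C i j \<ge> 0" and C: "\<And>i j n s Y. i < d ==> j < d ==> cmod (ftr ((L (phs (\<lambda>_. 0) s) ^^ n) (fE j i) * Y)) \<le> C i j * nrm Y"
    by metis
  have "nrm ((M w0 ^^ n) Y) \<le> (\<Sum>i<d. \<Sum>j<d. C i j * nrm Y)" for n
    unfolding nrm_crn[OF M_pow_crn[OF Y]]
  proof (intro sum_mono)
    fix i j assume ij: "i \<in> {..<d}" "j \<in> {..<d}"
    have "ent ((M w0 ^^ n) Y) i j = ftr ((L (phs (\<lambda>_. 0) 0) ^^ n) (fE j i) * Y)"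
      unfolding phs_0 tr_Lm_pow by (simp add: ftr_fE)
    then show "cmod (ent ((M w0 ^^ n) Y) i j) \<le> C i j * nrm Y" using C ij by simp
  qed
  moreover have "(\<Sum>i<d. \<Sum>j<d. C i j * nrm Y) \<ge> 0" using C0 nrm_nonneg by (intro sum_nonneg mult_nonneg_nonneg)
  ultimately show ?thesis by blast
qed

text \<open>The tilted dual with the Taylor polynomial of degree n of the phase removed. Degree 2
  serves the second-order expansion, degree 0 the comparison of tilted with untilted powers.\<close>

definition phs_rem :: "nat => ('b => real) => real => fm => fm" where
  "phs_rem n g s X = M (\<lambda>b' b. of_real (w b) * (iexp (s * (g b - g b')) - (\<Sum>k\<le>n. (\<i> * of_real (s * (g b - g b')))^k / fact k))) X"

lemma phs_rem_bound: "\<exists>C\<ge>0. \<forall>s X. nrm (phs_rem n g s X) \<le> \<bar>s\<bar> ^ Suc n * C * nrm X"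
proof -
  define c where "c b' b = w b * (\<bar>g b - g b'\<bar> ^ Suc n / fact (Suc n)) * (nrm (fadj (K b' b)) * nrm (K b' b))" for b' b
  have c0: "c b' b \<ge> 0" if "b \<in> B" for b' b unfolding c_def using wpos[OF that] nrm_nonneg
    by (intro mult_nonneg_nonneg divide_nonneg_nonneg) auto
  have "nrm (phs_rem n g s X) \<le> \<bar>s\<bar> ^ Suc n * (\<Sum>b\<in>B. \<Sum>b'\<in>B. c b' b) * nrm X" for s X
  proof -
    have "nrm (phs_rem n g s X) \<le> (\<Sum>b\<in>B. \<Sum>b'\<in>B. \<bar>s\<bar> ^ Suc n * c b' b * nrm X)"
      unfolding phs_rem_def
    proof (intro order_trans[OF nrm_Mm_wt] sum_mono)
      fix b b' assume b: "b \<in> B" "b' \<in> B"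
      have 1: "cmod (iexp (s * (g b - g b')) - (\<Sum>k\<le>n. (\<i> * of_real (s * (g b - g b')))^k / fact k)) \<le> \<bar>s * (g b - g b')\<bar> ^ Suc n / fact (Suc n)"
        by (rule iexp_approx1)
      have 2: "nrm (fadj (K b' b) * X * K b' b) \<le> nrm (fadj (K b' b)) * nrm X * nrm (K b' b)"
        using nrm_mult[of "fadj (K b' b) * X" "K b' b"] nrm_mult[of "fadj (K b' b)" X] nrm_nonneg[of "K b' b"]
        by (meson mult_right_mono order_trans)
      have "cmod (of_real (w b) * (iexp (s * (g b - g b')) - (\<Sum>k\<le>n. (\<i> * of_real (s * (g b - g b')))^k / fact k))) *
          nrm (fadj (K b' b) * X * K b' b) \<le> (w b * (\<bar>s * (g b - g b')\<bar> ^ Suc n / fact (Suc n))) * (nrm (fadj (K b' b)) * nrm X * nrm (K b' b))"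
        unfolding norm_mult using wpos[OF b(1)] by (intro mult_mono 1 2 nrm_nonneg) (auto intro: mult_left_mono[OF 1])
      also have "\<dots> = \<bar>s\<bar> ^ Suc n * c b' b * nrm X"
        unfolding c_def abs_mult power_mult_distrib by simp
      finally show "cmod (of_real (w b) * (iexp (s * (g b - g b')) - (\<Sum>k\<le>n. (\<i> * of_real (s * (g b - g b')))^k / fact k))) *
          nrm (fadj (K b' b) * X * K b' b) \<le> \<bar>s\<bar> ^ Suc n * c b' b * nrm X" .
    qed
    then show ?thesis by (simp only: sum_distrib_left sum_distrib_right)
  qed
  moreover have "(\<Sum>b\<in>B. \<Sum>b'\<in>B. c b' b) \<ge> 0" by (intro sum_nonneg c0)
  ultimately show ?thesis by blast
qed

lemma M_phs_0: "M (phs g s) X = M w0 X + phs_rem 0 g s X"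
proof -
  have "M (phs g s) X = M (\<lambda>b' b. of_real (w b) +
      of_real (w b) * (iexp (s * (g b - g b')) - (\<Sum>k\<le>0. (\<i> * of_real (s * (g b - g b')))^k / fact k))) X"
    by (intro Mm_cong) (simp add: phs_def ring_distribs)
  then show ?thesis unfolding Mm_add_wt phs_rem_def .
qed

abbreviation Dx where "Dx g X \<equiv> M (\<lambda>b' b. of_real (w b) * dx g b' b) X"
abbreviation Dxx where "Dxx g X \<equiv> M (\<lambda>b' b. of_real (w b) * dx g b' b * dx g b' b) X"

lemma M_phs_2: "M (phs g s) X = M w0 X + (\<i> * s) *. Dx g X - (of_real (s^2) / 2) *. Dxx g X + phs_rem 2 g s X"
proof -
  have "phs g s b' b = of_real (w b) + (\<i> * s) * (of_real (w b) * dx g b' b)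
      - (of_real (s^2) / 2) * (of_real (w b) * dx g b' b * dx g b' b)
      + of_real (w b) * (iexp (s * (g b - g b')) - (\<Sum>k\<le>2. (\<i> * of_real (s * (g b - g b')))^k / fact k))" for b' b
  proof -
    define E where "E = iexp (s * (g b - g b'))"
    have sk: "(\<Sum>k\<le>2. (\<i> * u)^k / fact k) = 1 + \<i> * u - u * u / 2" for u :: complex
    proof -
      have "\<i> * u * (\<i> * u) = (\<i> * \<i>) * (u * u)" by (simp only: mult_ac)
      then show ?thesis by (simp add: numeral_2_eq_2)
    qed
    show ?thesis unfolding phs_def E_def[symmetric] sk
      by (simp add: dx_def field_simps power2_eq_square)
  qed
  then have "M (phs g s) X = M (\<lambda>b' b. of_real (w b) + (\<i> * s) * (of_real (w b) * dx g b' b)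
      - (of_real (s^2) / 2) * (of_real (w b) * dx g b' b * dx g b' b)
      + of_real (w b) * (iexp (s * (g b - g b')) - (\<Sum>k\<le>2. (\<i> * of_real (s * (g b - g b')))^k / fact k))) X"
    by (intro Mm_cong) auto
  then show ?thesis unfolding Mm_add_wt Mm_diff_wt Mm_smul_wt phs_rem_def .
qed

text \<open>\<open>corr g s\<close> is, to second order in \<open>s\<close>, an eigenvector of the tilted dual channel.\<close>
definition sol2 :: "('b => real) => fm" where
  "sol2 g = (SOME Z. Z \<in> crn d d \<and> Z - M w0 Z = (1/2) *. Dxx g (fid d) + Dx g (sol g) - kap g g *. fid d)"
definition corr :: "('b => real) => real => fm" where
  "corr g s = fid d + (\<i> * s) *. sol g - of_real (s^2) *. sol2 g"

text \<open>The constant is forced: the right side must have mean 0 under r, and by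
  \<open>kap_sym_sum\<close> its first two terms have mean \<open>kap g g\<close>.\<close>

lemma sol2: "sol2 g \<in> crn d d" "sol2 g - M w0 (sol2 g) = (1/2) *. Dxx g (fid d) + Dx g (sol g) - kap g g *. fid d"
proof -
  define W where "W = (1/2) *. Dxx g (fid d) + Dx g (sol g)"
  have W: "W \<in> crn d d" using sol by (simp add: W_def)
  have "ftr (r * Dxx g (fid d)) = ftr (L (\<lambda>b' b. of_real (w b) * dx g b' b * dx g b' b) r)"
    using tr_Lm_Mm[of B K "\<lambda>b' b. of_real (w b) * dx g b' b * dx g b' b" r "fid d"] r by simp
  then have "2 * ftr (r * W) = kap g g + kap g g"
    unfolding kap_sym_sum by (simp add: W_def ring_distribs ftr_simps cross_def)
  then have "ftr (r * W) = kap g g" by simp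
  then have "\<exists>Z. Z \<in> crn d d \<and> Z - M w0 Z = (1/2) *. Dxx g (fid d) + Dx g (sol g) - kap g g *. fid d"
    using poisson[OF W] by (metis W_def)
  from someI_ex[OF this] show "sol2 g \<in> crn d d"
    "sol2 g - M w0 (sol2 g) = (1/2) *. Dxx g (fid d) + Dx g (sol g) - kap g g *. fid d"
    unfolding sol2_def by auto
qed

text \<open>The two Poisson equations cancel the orders s and s^2 for the eigenvalue
  \<open>1 - kap g g * s^2\<close>. What remains is explicit: P and Q collect the orders s^3 and
  s^4, and the rest is the Taylor remainder.\<close>

lemma corr_step:
  "\<exists>C\<ge>0. \<forall>s. \<bar>s\<bar> \<le> 1 \<longrightarrow> nrm (M (phs g s) (corr g s) - (1 - kap g g * of_real (s^2)) *. corr g s) \<le> C * \<bar>s\<bar>^3"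
proof -
  obtain C where C: "C \<ge> 0" "\<And>s X. nrm (phs_rem 2 g s X) \<le> \<bar>s\<bar> ^ Suc 2 * C * nrm X" using phs_rem_bound by blast
  define Y Z c where "Y = sol g" and "Z = sol2 g" and "c = kap g g"
  define P where "P = - (\<i> *. Dx g Z) - (\<i> / 2) *. Dxx g Y + (\<i> * c) *. Y"
  define Q where "Q = (1/2) *. Dxx g Z - c *. Z"
  define nX where "nX = nrm (fid d) + nrm Y + nrm Z"
  have pY: "M w0 Y = Y - Dx g (fid d)" using sol(3)[of g] by (simp add: Y_def cur_def algebra_simps)
  have pZ: "M w0 Z = Z - ((1/2) *. Dxx g (fid d) + Dx g Y - c *. fid d)"
    using sol2(2)[of g] by (simp add: Y_def Z_def c_def algebra_simps)
  have e: "M (phs g s) (corr g s) - (1 - c * of_real (s^2)) *. corr g s =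
      of_real (s^3) *. P + of_real (s^4) *. Q + phs_rem 2 g s (corr g s)" for s
  proof -
    have "M w0 (corr g s) = fid d + (\<i> * s) *. (Y - Dx g (fid d)) - of_real (s^2) *. (Z - ((1/2) *. Dxx g (fid d) + Dx g Y - c *. fid d))"
      by (simp add: corr_def Mm_add Mm_diff Mm_smul M_w0_fid flip: Y_def Z_def pY pZ)
    moreover have "Dx g (corr g s) = Dx g (fid d) + (\<i> * s) *. Dx g Y - of_real (s^2) *. Dx g Z"
      "Dxx g (corr g s) = Dxx g (fid d) + (\<i> * s) *. Dxx g Y - of_real (s^2) *. Dxx g Z"
      by (simp_all add: corr_def Mm_add Mm_diff Mm_smul flip: Y_def Z_def)
    ultimately have "M (phs g s) (corr g s) - (1 - c * of_real (s^2)) *. corr g s - phs_rem 2 g s (corr g s) =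
       (fid d + (\<i> * s) *. (Y - Dx g (fid d)) - of_real (s^2) *. (Z - ((1/2) *. Dxx g (fid d) + Dx g Y - c *. fid d)))
       + (\<i> * s) *. (Dx g (fid d) + (\<i> * s) *. Dx g Y - of_real (s^2) *. Dx g Z)
       - (of_real (s^2) / 2) *. (Dxx g (fid d) + (\<i> * s) *. Dxx g Y - of_real (s^2) *. Dxx g Z)
       - (1 - c * of_real (s^2)) *. (fid d + (\<i> * s) *. Y - of_real (s^2) *. Z)"
      unfolding M_phs_2 by (simp add: corr_def flip: Y_def Z_def)
    also have "\<dots> = of_real (s^3) *. P + of_real (s^4) *. Q"
      unfolding P_def Q_def
      by (rule fm_eqI) (simp add: algebra_simps power2_eq_square power3_eq_cube power4_eq_xxxx)
    finally show ?thesis by (simp add: algebra_simps)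
  qed
  have nc: "nrm (corr g s) \<le> nX" if s: "\<bar>s\<bar> \<le> 1" for s
  proof -
    have "nrm (corr g s) \<le> nrm (fid d) + nrm ((\<i> * s) *. Y) + nrm (of_real (s^2) *. Z)"
      unfolding corr_def Y_def Z_def by (intro order_trans[OF nrm_diff] add_mono order_trans[OF nrm_add] order_refl)
    also have "\<dots> \<le> nrm (fid d) + 1 * nrm Y + 1 * nrm Z"
      unfolding nrm_smul using s by (intro add_mono mult_right_mono nrm_nonneg order_refl)
        (auto simp: norm_mult norm_power abs_square_le_1)
    finally show ?thesis by (simp add: nX_def)
  qed
  define D where "D = nrm P + nrm Q + C * nX"
  have nX0: "nX \<ge> 0" unfolding nX_def using nrm_nonneg by (intro add_nonneg_nonneg) auto
  have "nrm (M (phs g s) (corr g s) - (1 - c * of_real (s^2)) *. corr g s) \<le> D * \<bar>s\<bar>^3" if s: "\<bar>s\<bar> \<le> 1" for s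
  proof -
    have "nrm (M (phs g s) (corr g s) - (1 - c * of_real (s^2)) *. corr g s) \<le>
       nrm (of_real (s^3) *. P) + nrm (of_real (s^4) *. Q) + nrm (phs_rem 2 g s (corr g s))"
      unfolding e by (intro order_trans[OF nrm_add] add_mono order_refl)
    also have "\<dots> \<le> \<bar>s\<bar>^3 * nrm P + \<bar>s\<bar>^3 * nrm Q + \<bar>s\<bar>^3 * C * nX"
    proof (intro add_mono)
      show "nrm (of_real (s^3) *. P) \<le> \<bar>s\<bar>^3 * nrm P" by (simp add: nrm_smul norm_power)
      have "\<bar>s\<bar>^4 \<le> \<bar>s\<bar>^3" using s by (intro power_decreasing) auto
      then show "nrm (of_real (s^4) *. Q) \<le> \<bar>s\<bar>^3 * nrm Q"
        unfolding nrm_smul by (intro mult_right_mono nrm_nonneg) (simp add: norm_power)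
      have "nrm (phs_rem 2 g s (corr g s)) \<le> \<bar>s\<bar> ^ Suc 2 * C * nrm (corr g s)" by (rule C)
      also have "\<dots> \<le> \<bar>s\<bar> ^ Suc 2 * C * nX" using C(1) by (intro mult_left_mono nc s) auto
      finally show "nrm (phs_rem 2 g s (corr g s)) \<le> \<bar>s\<bar>^3 * C * nX" by (simp add: numeral_3_eq_3)
    qed
    also have "\<dots> = D * \<bar>s\<bar>^3" by (simp add: D_def algebra_simps)
    finally show ?thesis .
  qed
  moreover have "D \<ge> 0" unfolding D_def using C(1) nX0 nrm_nonneg by (intro add_nonneg_nonneg) auto
  ultimately show ?thesis unfolding c_def by blast
qed

section \<open>Limit and moments of the characteristic function\<close>

definition cf :: "fm => ('b => real) => nat => real => fm => complex" where
  "cf \<rho> g n s X = ftr ((L (phs g s) ^^ n) \<rho> * X)"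

lemma cf_Suc: "cf \<rho> g (Suc n) s X = cf \<rho> g n s (M (phs g s) X)"
  by (simp add: cf_def tr_Lm_Mm)
lemma cf_add: "cf \<rho> g n s (X + Y) = cf \<rho> g n s X + cf \<rho> g n s Y"
  and cf_diff: "cf \<rho> g n s (X - Y) = cf \<rho> g n s X - cf \<rho> g n s Y"
  and cf_smul: "cf \<rho> g n s (c *. X) = c * cf \<rho> g n s X"
  by (simp_all add: cf_def ring_distribs ftr_simps)

lemma cf_bound:
  assumes "\<rho> \<in> crn d d" "fpsd \<rho>" "ftr \<rho> = 1"
  shows "cmod (cf \<rho> g n s X) \<le> nrm X"
  using L_pow_bound[OF assms(1,2), where g = g and s = s and n = n and Y = X] assms(3) by (simp add: cf_def)

text \<open>The defect of one step is small in norm and stays so under the remaining tilted steps by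
  \<open>cf_bound\<close>. The accumulated error is multiplied by the approximate eigenvalue at each
  step, whose modulus is at most \<open>1 + cmod (kap g g) * s^2\<close>; this base is at least 1,
  so all n defects share one power of it.\<close>

lemma cf_corr_bound:
  assumes \<rho>: "\<rho> \<in> crn d d" "fpsd \<rho>" "ftr \<rho> = 1" and s: "\<bar>s\<bar> \<le> 1"
    and C: "nrm (M (phs g s) (corr g s) - (1 - kap g g * of_real (s^2)) *. corr g s) \<le> C"
  shows "cmod (cf \<rho> g n s (corr g s) - (1 - kap g g * of_real (s^2)) ^ n * cf \<rho> g 0 s (corr g s))
     \<le> real n * C * (1 + cmod (kap g g) * s^2) ^ n"
proof (induction n)
  case (Suc n)
  define a q X where "a = 1 - kap g g * of_real (s^2)" and "q = 1 + cmod (kap g g) * s^2" and "X = corr g s"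
  have q1: "q \<ge> 1" by (simp add: q_def)
  have aq: "cmod a \<le> q" unfolding a_def q_def
    by (rule order_trans[OF norm_triangle_ineq4]) (simp add: norm_mult norm_power)
  have C0: "C \<ge> 0" using C nrm_nonneg order_trans by blast
  have "cf \<rho> g (Suc n) s X - a ^ Suc n * cf \<rho> g 0 s X =
      cf \<rho> g n s (M (phs g s) X - a *. X) + a * (cf \<rho> g n s X - a ^ n * cf \<rho> g 0 s X)"
    by (simp add: cf_Suc cf_diff cf_smul algebra_simps)
  also have "cmod \<dots> \<le> C + q * (real n * C * q ^ n)"
  proof (intro order_trans[OF norm_triangle_ineq] add_mono)
    show "cmod (cf \<rho> g n s (M (phs g s) X - a *. X)) \<le> C"
      using cf_bound[OF \<rho>] C order_trans unfolding a_def X_def by blast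
    show "cmod (a * (cf \<rho> g n s X - a ^ n * cf \<rho> g 0 s X)) \<le> q * (real n * C * q ^ n)"
      unfolding norm_mult using aq Suc.IH q1 unfolding a_def q_def X_def by (intro mult_mono) auto
  qed
  also have "\<dots> \<le> C * q ^ Suc n + q * (real n * C * q ^ n)"
    using q1 C0 mult_left_mono[of 1 "q ^ Suc n" C] one_le_power[OF q1, of "Suc n"] by simp
  also have "\<dots> = real (Suc n) * C * q ^ Suc n" by (simp add: algebra_simps)
  finally show ?case unfolding a_def q_def X_def .
qed simp

lemma cf_fid: "cf \<rho> g n s (fid d) = cf \<rho> g n s (corr g s) - \<i> * s * cf \<rho> g n s (sol g) + of_real (s^2) * cf \<rho> g n s (sol2 g)"
  by (simp add: corr_def cf_add cf_diff cf_smul)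

text \<open>For s of order 1 / sqrt N the accumulated error, of size N |s|^3, vanishes, the power of
  the eigenvalue tends to an exponential, and replacing \<open>fid d\<close> by
  \<open>corr g s\<close> costs O(s).\<close>

theorem cf_clt:
  assumes \<rho>: "\<rho> \<in> crn d d" "fpsd \<rho>" "ftr \<rho> = 1" and \<tau>: "\<tau> > 0"
  shows "(\<lambda>N. cf \<rho> g N (a / sqrt (real N * \<tau>)) (fid d)) \<longlonglongrightarrow> exp (- (kap g g * of_real (a^2 / \<tau>)))"
proof -
  define c where "c = kap g g"
  define s where "s N = a / sqrt (real N * \<tau>)" for N
  obtain C where C: "C \<ge> 0" "\<And>s. \<bar>s\<bar> \<le> 1 ==>
      nrm (M (phs g s) (corr g s) - (1 - kap g g * of_real (s^2)) *. corr g s) \<le> C * \<bar>s\<bar>^3" using corr_step by blast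
  have s0: "s \<longlonglongrightarrow> 0" unfolding s_def using \<tau> by real_asymp
  have s0': "(\<lambda>N. \<bar>s N\<bar>) \<longlonglongrightarrow> 0" using tendsto_rabs[OF s0] by simp
  have ev: "\<forall>\<^sub>F N in sequentially. \<bar>s N\<bar> \<le> 1" using order_tendstoD(2)[OF s0', of 1] by (auto elim: eventually_mono)
  have s2: "real N * (s N)^2 = a^2 / \<tau>" if "N \<ge> 1" for N
    using that \<tau> by (simp add: s_def power_divide)
  \<comment> \<open>Bounds (1 + |c| s^2)^N independently of N, since N s^2 has the constant value
    a^2 / \<tau>.\<close>
  define E where "E = exp (cmod c * (a^2 / \<tau>))"
  define T where "T N = (1 - c * of_real ((s N)^2)) ^ N * cf \<rho> g 0 (s N) (corr g (s N))" for N
  have lim0: "(\<lambda>N. cf \<rho> g N (s N) (fid d) - T N) \<longlonglongrightarrow> 0"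
  proof (rule Lim_null_comparison)
    show "\<forall>\<^sub>F N in sequentially. norm (cf \<rho> g N (s N) (fid d) - T N) \<le>
        (a^2 / \<tau>) * (C * \<bar>s N\<bar> * E) + \<bar>s N\<bar> * nrm (sol g) + (s N)^2 * nrm (sol2 g)"
      using ev eventually_ge_at_top[of 1]
    proof eventually_elim
      fix N :: nat assume sN: "\<bar>s N\<bar> \<le> 1" and N: "N \<ge> 1"
      have "cmod (cf \<rho> g N (s N) (corr g (s N)) - T N) \<le> real N * (C * \<bar>s N\<bar>^3) * (1 + cmod c * (s N)^2) ^ N"
        unfolding T_def c_def by (rule cf_corr_bound[OF \<rho> sN C(2)[OF sN]])
      also have "\<dots> \<le> real N * (C * \<bar>s N\<bar>^3) * E"
      proof (rule mult_left_mono)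
        have "(1 + cmod c * (s N)^2) ^ N \<le> exp (cmod c * (s N)^2) ^ N" by (rule power_mono[OF exp_ge_add_one_self]) simp
        also have "\<dots> = exp (real N * (cmod c * (s N)^2))" by (rule exp_of_nat_mult[symmetric])
        also have "real N * (cmod c * (s N)^2) = cmod c * (real N * (s N)^2)" by simp
        also have "exp \<dots> = E" unfolding s2[OF N] E_def ..
        finally show "(1 + cmod c * (s N)^2) ^ N \<le> E" .
      qed (use C(1) in auto)
      also have "\<dots> = (real N * (s N)^2) * (C * \<bar>s N\<bar> * E)"
        by (simp add: power3_eq_cube power2_eq_square abs_mult_self_eq)
      also have "\<dots> = (a^2 / \<tau>) * (C * \<bar>s N\<bar> * E)" unfolding s2[OF N] ..
      finally have 1: "cmod (cf \<rho> g N (s N) (corr g (s N)) - T N) \<le> (a^2 / \<tau>) * (C * \<bar>s N\<bar> * E)" .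
      have 2: "cmod (\<i> * s N * cf \<rho> g N (s N) (sol g)) \<le> \<bar>s N\<bar> * nrm (sol g)"
        using cf_bound[OF \<rho>, of g N "s N" "sol g"] by (simp add: norm_mult mult_left_mono)
      have 3: "cmod (of_real ((s N)^2) * cf \<rho> g N (s N) (sol2 g)) \<le> (s N)^2 * nrm (sol2 g)"
        using cf_bound[OF \<rho>, of g N "s N" "sol2 g"] by (simp add: norm_mult norm_power mult_left_mono)
      have "cf \<rho> g N (s N) (fid d) - T N = (cf \<rho> g N (s N) (corr g (s N)) - T N)
          - \<i> * s N * cf \<rho> g N (s N) (sol g) + of_real ((s N)^2) * cf \<rho> g N (s N) (sol2 g)"
        by (simp add: cf_fid)
      also have "cmod \<dots> \<le> (a^2 / \<tau>) * (C * \<bar>s N\<bar> * E) + \<bar>s N\<bar> * nrm (sol g) + (s N)^2 * nrm (sol2 g)"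
        by (rule order_trans[OF norm_triangle_ineq], rule add_mono, rule order_trans[OF norm_triangle_ineq4],
          rule add_mono, rule 1, rule 2, rule 3)
      finally show "norm (cf \<rho> g N (s N) (fid d) - T N) \<le> \<dots>" .
    qed
    have "(\<lambda>N. (a^2 / \<tau>) * (C * \<bar>s N\<bar> * E) + \<bar>s N\<bar> * nrm (sol g) + (s N)^2 * nrm (sol2 g)) \<longlonglongrightarrow>
        (a^2 / \<tau>) * (C * 0 * E) + 0 * nrm (sol g) + 0^2 * nrm (sol2 g)"
      by (intro tendsto_intros s0 s0')
    then show "(\<lambda>N. (a^2 / \<tau>) * (C * \<bar>s N\<bar> * E) + \<bar>s N\<bar> * nrm (sol g) + (s N)^2 * nrm (sol2 g)) \<longlonglongrightarrow> 0" by simp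
  qed
  have "T \<longlonglongrightarrow> exp (- (c * of_real (a^2 / \<tau>))) * 1"
    unfolding T_def
  proof (rule tendsto_mult)
    have c: "c = of_real (Re c)" using kap_Im[of g g] by (simp add: c_def complex_eq_iff)
    have "(\<lambda>N. complex_of_real ((1 + (- (Re c * (a^2 / \<tau>))) / real N) ^ N)) \<longlonglongrightarrow> of_real (exp (- (Re c * (a^2 / \<tau>))))"
      by (intro tendsto_of_real tendsto_exp_limit_sequentially)
    moreover have "complex_of_real ((1 + (- (Re c * (a^2 / \<tau>))) / real N) ^ N) = (1 + (- (c * of_real (a^2 / \<tau>))) / of_nat N) ^ N" for N
      by (subst (2) c) simp
    moreover have "complex_of_real (exp (- (Re c * (a^2 / \<tau>)))) = exp (- (c * of_real (a^2 / \<tau>)))"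
      by (subst (2) c) (simp flip: exp_of_real)
    ultimately have "(\<lambda>N. (1 + (- (c * of_real (a^2 / \<tau>))) / of_nat N) ^ N) \<longlonglongrightarrow> exp (- (c * of_real (a^2 / \<tau>)))"
      by simp
    then show "(\<lambda>N. (1 - c * of_real ((s N)^2)) ^ N) \<longlonglongrightarrow> exp (- (c * of_real (a^2 / \<tau>)))"
    proof (rule Lim_transform_eventually)
      show "\<forall>\<^sub>F N in sequentially. (1 + (- (c * of_real (a^2 / \<tau>))) / of_nat N) ^ N = (1 - c * of_real ((s N)^2)) ^ N"
        using eventually_ge_at_top[of 1]
      proof eventually_elim
        fix N :: nat assume N: "N \<ge> 1"
        have "(s N)^2 = (a^2 / \<tau>) / real N" 
        proof -
          have "(s N)^2 = (real N * (s N)^2) / real N" using N by simp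
          then show ?thesis by (simp only: s2[OF N])
        qed
        then show "(1 + (- (c * of_real (a^2 / \<tau>))) / of_nat N) ^ N = (1 - c * of_real ((s N)^2)) ^ N" by simp
      qed
    qed
    have "(\<lambda>N. ftr (\<rho> * fid d) + (\<i> * s N) * ftr (\<rho> * sol g) - of_real ((s N)^2) * ftr (\<rho> * sol2 g)) \<longlonglongrightarrow>
       ftr (\<rho> * fid d) + (\<i> * of_real 0) * ftr (\<rho> * sol g) - of_real (0^2) * ftr (\<rho> * sol2 g)"
      by (intro tendsto_intros s0)
    then show "(\<lambda>N. cf \<rho> g 0 (s N) (corr g (s N))) \<longlonglongrightarrow> 1"
      using \<rho> by (simp add: cf_def corr_def ring_distribs ftr_simps)
  qed
  from tendsto_add[OF lim0 this] show ?thesis by (simp add: s_def c_def)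
qed

text \<open>Valid for all s in (0, 1] with a constant independent of N, this expansion yields the
  exact mean m and a second moment of order N through \<open>moments_from_cf\<close>. A limit along
  s of order 1 / sqrt N contains no such information.\<close>

theorem cf_moments:
  assumes \<rho>: "\<rho> \<in> crn d d" "fpsd \<rho>" "ftr \<rho> = 1"
  shows "\<exists>C. \<forall>N. \<exists>m. \<bar>m\<bar> \<le> C \<and> (\<forall>s. 0 < s \<and> s \<le> 1 \<longrightarrow>
    cmod (cf \<rho> g N s (fid d) - 1 - \<i> * of_real (s * m)) \<le> C * (1 + real N) * s^2)"
proof -
  obtain C1 where C1: "C1 \<ge> 0" "\<And>s. \<bar>s\<bar> \<le> 1 ==>
      nrm (M (phs g s) (corr g s) - (1 - kap g g * of_real (s^2)) *. corr g s) \<le> C1 * \<bar>s\<bar>^3" using corr_step by blast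
  obtain C2 where C2: "C2 \<ge> 0" "\<And>n. nrm ((M w0 ^^ n) (sol g)) \<le> C2" using M_pow_bound[OF sol(1)] by blast
  obtain C3 where C3: "C3 \<ge> 0" "\<And>s X. nrm (phs_rem 0 g s X) \<le> \<bar>s\<bar> ^ Suc 0 * C3 * nrm X" using phs_rem_bound by blast
  define Y Z where "Y = sol g" and "Z = sol2 g"
  define nX where "nX = nrm (fid d) + nrm Y + nrm Z"
  define C4 where "C4 = C1 + cmod (kap g g) * nX"
  have nX0: "nX \<ge> 0" unfolding nX_def using nrm_nonneg by (intro add_nonneg_nonneg) auto
  have nc: "nrm (corr g s) \<le> nX" if s: "\<bar>s\<bar> \<le> 1" for s
  proof -
    have "nrm (corr g s) \<le> nrm (fid d) + nrm ((\<i> * s) *. Y) + nrm (of_real (s^2) *. Z)"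
      unfolding corr_def Y_def Z_def by (intro order_trans[OF nrm_diff] add_mono order_trans[OF nrm_add] order_refl)
    also have "\<dots> \<le> nrm (fid d) + 1 * nrm Y + 1 * nrm Z"
      unfolding nrm_smul using s by (intro add_mono mult_right_mono nrm_nonneg order_refl)
        (auto simp: norm_mult norm_power abs_square_le_1)
    finally show ?thesis by (simp add: nX_def)
  qed
  have step: "nrm (M (phs g s) (corr g s) - corr g s) \<le> C4 * s^2" if s: "\<bar>s\<bar> \<le> 1" for s
  proof -
    define A where "A = M (phs g s) (corr g s) - (1 - kap g g * of_real (s^2)) *. corr g s"
    have "M (phs g s) (corr g s) - corr g s = A - (kap g g * of_real (s^2)) *. corr g s"
      by (simp add: A_def fm.scale_left_diff_distrib)
    then have "nrm (M (phs g s) (corr g s) - corr g s) \<le> nrm A + cmod (kap g g) * s^2 * nrm (corr g s)"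
      using nrm_diff[of A "(kap g g * of_real (s^2)) *. corr g s"] by (simp add: nrm_smul norm_mult norm_power)
    also have "\<dots> \<le> C1 * s^2 + cmod (kap g g) * s^2 * nX"
    proof (intro add_mono mult_left_mono nc s)
      have "\<bar>s\<bar>^3 \<le> \<bar>s\<bar>^2" using s by (intro power_decreasing) auto
      then show "nrm A \<le> C1 * s^2" using C1(2)[OF s] mult_left_mono[of "\<bar>s\<bar>^3" "\<bar>s\<bar>^2" C1] C1(1)
        unfolding A_def power2_abs by linarith
    qed auto
    finally show ?thesis by (simp add: C4_def algebra_simps)
  qed
  have corrN: "cmod (cf \<rho> g n s (corr g s) - cf \<rho> g 0 s (corr g s)) \<le> real n * (C4 * s^2)" if s: "\<bar>s\<bar> \<le> 1" for s n
  proof (induction n)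
    case (Suc n)
    have "cf \<rho> g (Suc n) s (corr g s) - cf \<rho> g 0 s (corr g s) =
       cf \<rho> g n s (M (phs g s) (corr g s) - corr g s) + (cf \<rho> g n s (corr g s) - cf \<rho> g 0 s (corr g s))"
      by (simp add: cf_Suc cf_diff)
    also have "cmod \<dots> \<le> C4 * s^2 + real n * (C4 * s^2)"
      by (intro order_trans[OF norm_triangle_ineq] add_mono Suc.IH order_trans[OF cf_bound[OF \<rho>] step[OF s]])
    finally show ?case by (simp add: algebra_simps)
  qed simp
  \<comment> \<open>Trades tilted steps for untilted ones, k being the number already traded. Each
    costs one remainder of order s, and these are bounded because the untilted powers of
    \<open>sol g\<close> are.\<close>
  have solN: "cmod (cf \<rho> g n s ((M w0 ^^ k) Y) - ftr (\<rho> * (M w0 ^^ (k + n)) Y)) \<le> real n * (\<bar>s\<bar> * C3 * C2)" for s n k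
  proof (induction n arbitrary: k)
    case (Suc n)
    have "cf \<rho> g (Suc n) s ((M w0 ^^ k) Y) - ftr (\<rho> * (M w0 ^^ (k + Suc n)) Y) =
      (cf \<rho> g n s ((M w0 ^^ (Suc k)) Y) - ftr (\<rho> * (M w0 ^^ (Suc k + n)) Y)) + cf \<rho> g n s (phs_rem 0 g s ((M w0 ^^ k) Y))"
      by (simp add: cf_Suc M_phs_0 cf_add)
    also have "cmod \<dots> \<le> real n * (\<bar>s\<bar> * C3 * C2) + \<bar>s\<bar> * C3 * C2"
    proof (intro order_trans[OF norm_triangle_ineq] add_mono Suc.IH order_trans[OF cf_bound[OF \<rho>]])
      have "nrm (phs_rem 0 g s ((M w0 ^^ k) Y)) \<le> \<bar>s\<bar> * C3 * nrm ((M w0 ^^ k) Y)" using C3(2) by simp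
      also have "\<dots> \<le> \<bar>s\<bar> * C3 * C2" unfolding Y_def using C3(1) by (intro mult_left_mono C2) auto
      finally show "nrm (phs_rem 0 g s ((M w0 ^^ k) Y)) \<le> \<bar>s\<bar> * C3 * C2" .
    qed
    finally show ?case by (simp add: algebra_simps)
  qed (simp add: cf_def)
  define C where "C = nrm Y + C2 + C4 + C3 * C2 + 2 * nrm Z"
  have C40: "C4 \<ge> 0" unfolding C4_def using C1 nX0 by simp
  have nY: "nrm Y \<ge> 0" "nrm Z \<ge> 0" by (rule nrm_nonneg)+
  show ?thesis
  proof (rule exI[of _ C], rule allI)
    fix N
    define t where "t = ftr (\<rho> * (M w0 ^^ N) Y)"
    \<comment> \<open>The mean flux summed over N steps telescopes, because the flux operator is Y -
      M Y.\<close>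
    define m where "m = Re (ftr (\<rho> * Y)) - Re t"
    have hN: "fadj ((M w0 ^^ n) Y) = (M w0 ^^ n) Y" for n by (induction n) (simp_all add: Y_def sol fadj_Mm)
    have tr: "Im t = 0" unfolding t_def by (rule herm_tr_real[OF fpsd_adj[OF \<rho>(2)] hN])
    have tY: "Im (ftr (\<rho> * Y)) = 0" by (rule herm_tr_real[OF fpsd_adj[OF \<rho>(2)]]) (simp add: Y_def sol)
    have m: "of_real m = ftr (\<rho> * Y) - t" using tr tY by (simp add: m_def complex_eq_iff)
    have b1: "cmod (ftr (\<rho> * X)) \<le> nrm X" for X using fpsd_tr[OF \<rho>(2), of X] \<rho>(3) by simp
    have "\<bar>m\<bar> = cmod (of_real m)" by simp
    also have "\<dots> \<le> nrm Y + C2" unfolding m t_def Y_def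
      by (intro order_trans[OF norm_triangle_ineq4] add_mono b1 order_trans[OF b1 C2(2)])
    finally have mC: "\<bar>m\<bar> \<le> C" unfolding C_def using C40 mult_nonneg_nonneg[OF C3(1) C2(1)] nY by linarith
    moreover have "cmod (cf \<rho> g N s (fid d) - 1 - \<i> * of_real (s * m)) \<le> C * (1 + real N) * s^2" if s: "0 < s" "s \<le> 1" for s
    proof -
      have s': "\<bar>s\<bar> \<le> 1" using s by simp
      have e0: "cf \<rho> g 0 s (corr g s) = 1 + \<i> * s * ftr (\<rho> * Y) - of_real (s^2) * ftr (\<rho> * Z)"
        using \<rho> by (simp add: cf_def corr_def ring_distribs ftr_simps Y_def Z_def)
      have "cf \<rho> g N s (fid d) - 1 - \<i> * of_real (s * m) =
         (cf \<rho> g N s (corr g s) - cf \<rho> g 0 s (corr g s)) - \<i> * s * (cf \<rho> g N s Y - t)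
         + of_real (s^2) * (cf \<rho> g N s Z - ftr (\<rho> * Z))"
        unfolding cf_fid of_real_mult m e0 by (simp add: Y_def Z_def algebra_simps)
      also have "cmod \<dots> \<le> real N * (C4 * s^2) + s * (real N * (s * C3 * C2)) + s^2 * (nrm Z + nrm Z)"
      proof (rule order_trans[OF norm_triangle_ineq], rule add_mono, rule order_trans[OF norm_triangle_ineq4], rule add_mono)
        show "cmod (cf \<rho> g N s (corr g s) - cf \<rho> g 0 s (corr g s)) \<le> real N * (C4 * s^2)" by (rule corrN[OF s'])
        show "cmod (\<i> * s * (cf \<rho> g N s Y - t)) \<le> s * (real N * (s * C3 * C2))"
          using solN[of N s 0] s by (simp add: norm_mult t_def)
        show "cmod (of_real (s^2) * (cf \<rho> g N s Z - ftr (\<rho> * Z))) \<le> s^2 * (nrm Z + nrm Z)"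
          using order_trans[OF norm_triangle_ineq4 add_mono[OF cf_bound[OF \<rho>, of g N s Z] b1[of Z]]]
          by (simp add: norm_mult norm_power mult_left_mono)
      qed
      also have "\<dots> = (real N * C4 + real N * (C3 * C2) + 2 * nrm Z) * s^2"
        by (simp add: power2_eq_square algebra_simps)
      also have "\<dots> \<le> (C * (1 + real N)) * s^2"
      proof (rule mult_right_mono)
        have "0 \<le> C3 * C2" using C3(1) C2(1) by simp
        then have "C * (1 + real N) - (real N * C4 + real N * (C3 * C2) + 2 * nrm Z) =
          (nrm Y + C2) * (1 + real N) + C4 + C3 * C2 + 2 * nrm Z * real N" by (simp add: C_def algebra_simps)
        moreover have "0 \<le> (nrm Y + C2) * (1 + real N) + C4 + C3 * C2 + 2 * nrm Z * real N"
          using nY C2(1) C3(1) C40 \<open>0 \<le> C3 * C2\<close> by (intro add_nonneg_nonneg mult_nonneg_nonneg) auto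
        ultimately show "real N * C4 + real N * (C3 * C2) + 2 * nrm Z \<le> C * (1 + real N)" by linarith
      qed simp
      finally show ?thesis .
    qed
    ultimately show "\<exists>m. \<bar>m\<bar> \<le> C \<and> (\<forall>s. 0 < s \<and> s \<le> 1 \<longrightarrow>
      cmod (cf \<rho> g N s (fid d) - 1 - \<i> * of_real (s * m)) \<le> C * (1 + real N) * s^2)" by blast
  qed
qed

end

section \<open>Irreducible channels\<close>

lemma ftr_uminus: "ftr (- X) = - ftr X" using ftr_diff[of 0 X] by simp

lemma fpsd_sqrt: assumes Z: "Z \<in> crn d d" "fpsd Z"
  obtains S where "S \<in> crn d d" "Z = S * fadj S"
proof -
  obtain U l where U: "unitary d U" "Z = U * fdiag d (\<lambda>i. of_real (l i)) * fadj U"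
    using herm_diag[OF Z(1) fpsd_adj[OF Z(2)]] by blast
  have Uc: "U \<in> crn d d" "fadj U * U = fid d" using U by (auto simp: unitary_def)
  have l0: "l i \<ge> 0" if "i < d" for i
  proof -
    have "fadj (U * fE i i) * Z * (U * fE i i) = fE i i * ((fadj U * U) * fdiag d (\<lambda>i. of_real (l i)) * ((fadj U * U) * fE i i))"
      unfolding U(2) by (simp add: fadj_mult mult.assoc)
    also have "\<dots> = of_real (l i) *. fE i i"
      using that by (simp add: Uc fid_fE fid_multL[OF crn_fdiag] fdiag_fE fE_mult)
    finally have "Re (ftr (fadj (U * fE i i) * Z * (U * fE i i))) = l i"
      using ftr_fE[of i i "fid d"] fid_fE[OF that] fid_multR[OF crn_fE[OF that that]] that by (simp add: ftr_smul)
    then show ?thesis using fpsdD[OF Z(2), of "U * fE i i"] by simp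
  qed
  define S where "S = U * fdiag d (\<lambda>i. of_real (sqrt (l i)))"
  have e: "fdiag d (\<lambda>i. of_real (sqrt (l i))) * fdiag d (\<lambda>i. of_real (sqrt (l i))) = fdiag d (\<lambda>i. of_real (l i))"
    unfolding fdiag_mult by (rule fm_eqI) (use l0 in \<open>auto simp flip: of_real_mult\<close>)
  have "S * fadj S = U * (fdiag d (\<lambda>i. of_real (sqrt (l i))) * fdiag d (\<lambda>i. of_real (sqrt (l i)))) * fadj U"
    by (simp add: S_def fadj_mult fadj_fdiag mult.assoc)
  then have "Z = S * fadj S" unfolding e U(2) by simp
  moreover have "S \<in> crn d d" unfolding S_def by (rule crn_mult[OF Uc(1) crn_fdiag])
  ultimately show ?thesis using that by blast
qed

text \<open>Irreducibility as a transition property: started from V V*, some iterate is seen by X.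
  The number of steps may depend on X and V, and the property can be verified by comparison with a
  smaller completely positive map.\<close>

definition irreducible_map :: "nat => (fm => fm) => bool" where
  "irreducible_map d F \<longleftrightarrow> (\<forall>X\<in>crn d d. \<forall>V\<in>crn d d. X \<noteq> 0 \<longrightarrow> V \<noteq> 0 \<longrightarrow>
     (\<exists>n. ftr (X * (F ^^ n) (V * fadj V) * fadj X) \<noteq> 0))"

text \<open>If two families of positive weights satisfy $\omega\ge c\omega'$, then
  $\mathcal L_\omega^n-c^n\mathcal L_{\omega'}^n$ is completely positive.\<close>
lemma irreducible_map_weights:
  assumes B: "finite B" and pos: "\<And>b. b \<in> B ==> \<omega> b > 0" "\<And>b. b \<in> B ==> \<omega>' b > 0"
    and irr: "irreducible_map d (Lm B K (\<lambda>b' b. of_real (\<omega>' b)))"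
  shows "irreducible_map d (Lm B K (\<lambda>b' b. of_real (\<omega> b)))"
proof -
  let ?L = "Lm B K (\<lambda>b' b. of_real (\<omega> b))" and ?L' = "Lm B K (\<lambda>b' b. of_real (\<omega>' b))"
  define c where "c = (if B = {} then 1 else Min ((\<lambda>b. \<omega> b / \<omega>' b) ` B))"
  have c0: "c > 0" using B pos by (auto simp: c_def)
  have cb: "c * \<omega>' b \<le> \<omega> b" if "b \<in> B" for b
  proof -
    have "c \<le> \<omega> b / \<omega>' b" using B that by (auto simp: c_def)
    then show ?thesis using pos(2)[OF that] by (simp add: pos_le_divide_eq)
  qed
  have pp: "fpsd ((?L' ^^ n) P)" if "fpsd P" for n P
  proof (induction n)
    case (Suc n)
    then show ?case using fpsd_Lm[where \<phi> = "\<lambda>b' b. \<omega>' b" and B = B and K = K, OF Suc.IH] pos(2) by (simp add: less_imp_le)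
  qed (simp add: that)
  have dom: "fpsd ((?L ^^ n) P - of_real (c^n) *. (?L' ^^ n) P)" if P: "fpsd P" for n P
  proof (induction n)
    case (Suc n)
    have "(?L ^^ Suc n) P - of_real (c^Suc n) *. (?L' ^^ Suc n) P =
       ?L ((?L ^^ n) P - of_real (c^n) *. (?L' ^^ n) P) + of_real (c^n) *. Lm B K (\<lambda>b' b. of_real (\<omega> b - c * \<omega>' b)) ((?L' ^^ n) P)"
      by (simp add: Lm_diff Lm_smul Lm_diff_wt Lm_smul_wt fm.scale_right_diff_distrib fm.scale_scale mult.commute)
    also have "fpsd \<dots>" using Suc c0 cb pos(1) pp[OF P]
      by (intro fpsd_add fpsd_smul fpsd_Lm) (auto intro: less_imp_le)
    finally show ?case .
  qed (simp add: fpsd_0)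
  show ?thesis
    unfolding irreducible_map_def
  proof (intro ballI impI)
    fix X V assume X: "X \<in> crn d d" "V \<in> crn d d" "X \<noteq> 0" "V \<noteq> 0"
    then obtain n where n: "ftr (X * (?L' ^^ n) (V * fadj V) * fadj X) \<noteq> 0"
      using irr unfolding irreducible_map_def by blast
    have q: "fpsd (X * (?L' ^^ n) (V * fadj V) * fadj X)" by (intro fpsd_conj pp fpsd_sq)
    have "Re (ftr (X * (?L' ^^ n) (V * fadj V) * fadj X)) > 0"
      using n fpsd_tr_nonneg[OF q] fpsd_tr_Im[OF q] by (metis complex_eq_iff order_le_less zero_complex.simps)
    moreover have "0 \<le> Re (ftr (X * ((?L ^^ n) (V * fadj V) - of_real (c^n) *. (?L' ^^ n) (V * fadj V)) * fadj X))"
      by (intro fpsd_tr_nonneg fpsd_conj dom fpsd_sq)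
    moreover have "X * ((?L ^^ n) (V * fadj V) - of_real (c^n) *. (?L' ^^ n) (V * fadj V)) * fadj X =
      X * (?L ^^ n) (V * fadj V) * fadj X - of_real (c^n) *. (X * (?L' ^^ n) (V * fadj V) * fadj X)"
      by (simp add: algebra_simps)
    ultimately have "Re (ftr (X * (?L ^^ n) (V * fadj V) * fadj X)) \<ge> c^n * Re (ftr (X * (?L' ^^ n) (V * fadj V) * fadj X))"
      "c^n * Re (ftr (X * (?L' ^^ n) (V * fadj V) * fadj X)) > 0"
      using c0 by (simp_all add: ftr_diff ftr_smul)
    then show "\<exists>n. ftr (X * (?L ^^ n) (V * fadj V) * fadj X) \<noteq> 0" by (intro exI[of _ n]) auto
  qed
qed

text \<open>A Perron-Frobenius argument. A Hermitian fixed point of the dual, shifted by its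
  smallest eigenvalue, is a positive fixed point that annihilates some V; its expectation in every
  iterate of V V* is then 0, against irreducibility unless it vanishes. A kernel of r is excluded in
  the same way, with r itself as initial state.\<close>

lemma (in qenv0) qenv_irreducible:
  assumes irr: "irreducible_map d (L w0)"
  shows "qenv d B w K r"
proof
  have hermitian_case: "\<exists>c. X = c *. fid d" if X: "X \<in> crn d d" "M w0 X = X" "fadj X = X" for X
  proof -
    obtain m V where V: "V \<in> crn d d" "V \<noteq> 0" "fpsd (X - of_real m *. fid d)" "(X - of_real m *. fid d) * V = 0"
      by (rule min_eigenvalue[OF X(1,3) dpos])
    define Z where "Z = X - of_real m *. fid d"
    have Z: "Z \<in> crn d d" "fpsd Z" "Z * V = 0" using V X by (auto simp: Z_def)
    have MZ: "(M w0 ^^ n) Z = Z" for n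
      by (induction n) (simp_all add: Z_def Mm_diff Mm_smul M_w0_fid X)
    obtain S where S: "S \<in> crn d d" "Z = S * fadj S" by (rule fpsd_sqrt[OF Z(1,2)])
    have "ftr (fadj S * (L w0 ^^ n) (V * fadj V) * fadj (fadj S)) = 0" for n
    proof -
      have "ftr (fadj S * (L w0 ^^ n) (V * fadj V) * fadj (fadj S)) = ftr (S * (fadj S * (L w0 ^^ n) (V * fadj V)))"
        by (simp add: ftr_comm[of S])
      also have "\<dots> = ftr (Z * (L w0 ^^ n) (V * fadj V))" by (simp only: S(2) mult.assoc)
      also have "\<dots> = ftr ((L w0 ^^ n) (V * fadj V) * Z)" by (rule ftr_comm)
      also have "\<dots> = ftr (V * fadj V * Z)" unfolding tr_Lm_pow MZ ..
      also have "fadj V * Z = fadj (Z * V)" using fpsd_adj[OF Z(2)] by (simp add: fadj_mult)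
      then have "V * fadj V * Z = 0" by (simp add: Z(3) mult.assoc)
      finally show ?thesis by simp
    qed
    then have "fadj S = 0 \<or> V = 0" using irr S(1) V(1) unfolding irreducible_map_def by (meson crn_fadj)
    then have "fadj S = 0" using V(2) by blast
    then have "Z = 0" using S(2) by simp
    then show ?thesis unfolding Z_def by (intro exI[of _ "of_real m"]) simp
  qed
  fix X assume X: "X \<in> crn d d"
  {
    assume M: "M w0 X = X"
    have M': "M w0 (fadj X) = fadj X" using fadj_Mm[of B K w0 X] M by simp
    obtain c1 where c1: "X + fadj X = c1 *. fid d"
      using hermitian_case[of "X + fadj X"] X M M' by (auto simp: Mm_add fadj_add add.commute)
    obtain c2 where c2: "\<i> *. (X - fadj X) = c2 *. fid d"
      using hermitian_case[of "\<i> *. (X - fadj X)"] X M M'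
      by (auto simp: Mm_diff Mm_smul fadj_simps fm.scale_right_diff_distrib)
    have "2 *. X = (X + fadj X) + (- \<i>) *. (\<i> *. (X - fadj X))"
      by (rule fm_eqI) simp
    also have "\<dots> = (c1 - \<i> * c2) *. fid d" unfolding c1 c2 by (rule fm_eqI) (simp add: algebra_simps)
    finally have "(1/2) *. (2 *. X) = (1/2) *. ((c1 - \<i> * c2) *. fid d)" by simp
    then have "X = ((c1 - \<i> * c2) / 2) *. fid d" by (simp add: fm.scale_scale)
    then show "\<exists>c. X = c *. fid d" by blast
  }
  assume 0: "r * X = 0"
  obtain S where S: "S \<in> crn d d" "r = S * fadj S" by (rule fpsd_sqrt[OF r(1,2)])
  have Ln: "(L w0 ^^ n) r = r" for n by (induction n) (simp_all add: L_r)
  have "ftr (fadj X * (L w0 ^^ n) (S * fadj S) * fadj (fadj X)) = 0" for n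
    unfolding S(2)[symmetric] Ln by (simp add: 0 mult.assoc)
  then have "fadj X = 0 \<or> S = 0" using irr S(1) X unfolding irreducible_map_def by (meson crn_fadj)
  moreover have "S \<noteq> 0" using S(2) r(3) by auto
  ultimately have "fadj X = 0" by blast
  then show "X = 0" by (metis fadj_0 fadj_fadj)
qed

section \<open>Time reversal\<close>

text \<open>T stands for conjugation by an antiunitary involution of the system, reduced to its
  algebraic properties.\<close>

locale trev = qenv +
  fixes T :: "fm => fm"
  assumes Tc: "X \<in> crn d d ==> T X \<in> crn d d"
    and Tadd: "X \<in> crn d d ==> Y \<in> crn d d ==> T (X + Y) = T X + T Y"
    and Tsmul: "X \<in> crn d d ==> T (c *. X) = cnj c *. T X"
    and Tmult: "X \<in> crn d d ==> Y \<in> crn d d ==> T (X * Y) = T X * T Y"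
    and Tadj: "X \<in> crn d d ==> T (fadj X) = fadj (T X)"
    and TT: "X \<in> crn d d ==> T (T X) = X"
    and Ttr: "X \<in> crn d d ==> ftr (T X) = cnj (ftr X)"
begin

text \<open>Running an interaction backwards takes adjoints and exchanges the labels. After the
  application of T the result is again an interaction of the same system with its probes, in another
  eigenbasis (\<open>Tmap_Kop\<close>).\<close>

definition KR where "KR b' b = fadj (T (K b b'))"

lemma T0: "T 0 = 0" using Tsmul[of 0 0] by simp
lemma Tdiff: "X \<in> crn d d ==> Y \<in> crn d d ==> T (X - Y) = T X - T Y"
  using Tadd[of X "(-1) *. Y"] Tsmul[of Y "-1"] by simp
lemma Tsum: "(\<And>a. a \<in> A ==> f a \<in> crn d d) ==> T (sum f A) = (\<Sum>a\<in>A. T (f a))"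
  by (induction A rule: infinite_finite_induct) (auto simp: T0 Tadd)
lemma Tfid: "T (fid d) = fid d"
proof -
  have "T (fid d) = T (fid d * T (fid d))" using fid_multL[OF Tc[OF crn_fid]] TT[OF crn_fid] Tc[OF crn_fid]
    by (metis Tmult TT crn_fid fid_multR)
  then show ?thesis using Tc[OF crn_fid] TT[OF crn_fid] by (metis Tmult fid_multL fid_multR crn_fid)
qed

text \<open>The dual of the reversed family, transported back by T (see \<open>MR_T\<close>). Its
  operators are those of L, but a weight \<open>w b\<close> now belongs to their outgoing
  label.\<close>

definition Nm where "Nm \<phi> V = (\<Sum>b\<in>B. \<Sum>b'\<in>B. \<phi> b' b *. (K b b' * V * fadj (K b b')))"

lemma KVK: "V \<in> crn d d ==> b \<in> B ==> b' \<in> B ==> K b b' * V * fadj (K b b') \<in> crn d d"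
  by (intro crn_mult[of _ d d _ d] crn_fadj Kc) auto

lemma Nm_crn: "V \<in> crn d d ==> Nm \<phi> V \<in> crn d d"
  unfolding Nm_def by (intro crn_sum crn_smul KVK) auto

lemma MR_T: assumes V: "V \<in> crn d d"
  shows "Mm B KR \<phi> (T V) = T (Nm (\<lambda>b' b. cnj (\<phi> b' b)) V)"
proof -
  have "T (Nm (\<lambda>b' b. cnj (\<phi> b' b)) V) = (\<Sum>b\<in>B. \<Sum>b'\<in>B. T (cnj (\<phi> b' b) *. (K b b' * V * fadj (K b b'))))"
    unfolding Nm_def using KVK[OF V] by (simp add: Tsum cong: sum.cong)
  also have "\<dots> = Mm B KR \<phi> (T V)"
    unfolding Mm_def
  proof (intro sum.cong refl)
    fix b b' assume b: "b \<in> B" "b' \<in> B"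
    have "T (K b b' * V * fadj (K b b')) = T (K b b') * T V * fadj (T (K b b'))"
      using Kc[OF b] V by (simp add: Tmult Tadj crn_mult[of _ d d _ d])
    then show "T (cnj (\<phi> b' b) *. (K b b' * V * fadj (K b b'))) = \<phi> b' b *. (fadj (KR b' b) * T V * KR b' b)"
      using KVK[OF V b] by (simp add: Tsmul KR_def)
  qed
  finally show ?thesis by simp
qed

lemma balance_adj: "b' \<in> B ==> b \<in> B ==> of_real (w b) *. (r * fadj (K b' b)) = of_real (w b') *. (fadj (K b' b) * r)"
  using arg_cong[OF balance, of b' b fadj] by (simp add: fadj_simps fpsd_adj[OF r(2)])

text \<open>Detailed balance moves the weight from the outgoing to the incoming label while r passes
  through the operators. Right multiplication by r thus turns the dual of the reversed family into
  the original channel.\<close>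

lemma Nm_r: assumes V: "V \<in> crn d d"
  shows "Nm (\<lambda>b' b. of_real (w b) * \<psi> b' b) V * r = L (\<lambda>b' b. of_real (w b) * \<psi> b b') (V * r)"
proof -
  have "Nm (\<lambda>b' b. of_real (w b) * \<psi> b' b) V * r = (\<Sum>b\<in>B. \<Sum>b'\<in>B. (of_real (w b') * \<psi> b' b) *. (K b b' * (V * r) * fadj (K b b')))"
    unfolding Nm_def sum_distrib_right
  proof (intro sum.cong refl)
    fix b b' assume b: "b \<in> B" "b' \<in> B"
    have "((of_real (w b) * \<psi> b' b) *. (K b b' * V * fadj (K b b'))) * r = \<psi> b' b *. (K b b' * V * (of_real (w b) *. (fadj (K b b') * r)))"
      by (simp add: mult.assoc mult.commute)
    also have "of_real (w b) *. (fadj (K b b') * r) = of_real (w b') *. (r * fadj (K b b'))"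
      using balance_adj[OF b] by simp
    finally show "((of_real (w b) * \<psi> b' b) *. (K b b' * V * fadj (K b b'))) * r = (of_real (w b') * \<psi> b' b) *. (K b b' * (V * r) * fadj (K b b'))"
      by (simp add: mult.assoc mult.commute)
  qed
  also have "\<dots> = L (\<lambda>b' b. of_real (w b) * \<psi> b b') (V * r)"
    unfolding Lm_def by (rule sum.swap)
  finally show ?thesis .
qed

lemma TK: "b \<in> B ==> b' \<in> B ==> T (K b b') \<in> crn d d" by (intro Tc Kc)

lemma qenv0_R: "qenv0 d B w KR (T r)"
proof
  show "finite B" "d > 0" "\<And>b. b \<in> B ==> 0 < w b" "(\<Sum>b\<in>B. w b) = 1" by (fact finB dpos wpos wsum)+
  show "KR b' b \<in> crn d d" if "b' \<in> B" "b \<in> B" for b b' using TK[OF that(2,1)] by (simp add: KR_def)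
  show "(\<Sum>b'\<in>B. fadj (KR b' b) * KR b' b) = fid d" if b: "b \<in> B" for b
  proof -
    have "(\<Sum>b'\<in>B. fadj (KR b' b) * KR b' b) = (\<Sum>b'\<in>B. T (K b b' * fadj (K b b')))"
      by (intro sum.cong refl) (use b in \<open>simp add: KR_def Tmult Tadj Kc\<close>)
    also have "\<dots> = T (\<Sum>b'\<in>B. K b b' * fadj (K b b'))"
      by (intro Tsum[symmetric] crn_mult[of _ d d _ d] crn_fadj Kc) (use b in auto)
    finally show ?thesis by (simp add: coisom[OF b] Tfid)
  qed
  show "(\<Sum>b\<in>B. KR b' b * fadj (KR b' b)) = fid d" if b: "b' \<in> B" for b'
  proof -
    have "(\<Sum>b\<in>B. KR b' b * fadj (KR b' b)) = (\<Sum>b\<in>B. T (fadj (K b b') * K b b'))"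
      by (intro sum.cong refl) (use b in \<open>simp add: KR_def Tmult Tadj Kc\<close>)
    also have "\<dots> = T (\<Sum>b\<in>B. fadj (K b b') * K b b')"
      by (intro Tsum[symmetric] crn_mult[of _ d d _ d] crn_fadj Kc) (use b in auto)
    finally show ?thesis by (simp add: isom[OF b] Tfid)
  qed
  show "of_real (w b) *. (KR b' b * T r) = of_real (w b') *. (T r * KR b' b)" if b: "b' \<in> B" "b \<in> B" for b' b
  proof -
    have "T (of_real (w b') *. (r * fadj (K b b'))) = T (of_real (w b) *. (fadj (K b b') * r))"
      using balance_adj[OF b(2,1)] by simp
    moreover have "r * fadj (K b b') \<in> crn d d" "fadj (K b b') * r \<in> crn d d"
      using Kc[OF b(2,1)] r(1) by (auto intro: crn_mult[of _ d d _ d])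
    ultimately show ?thesis using Kc[OF b(2,1)] r(1) by (simp add: Tsmul Tmult Tadj KR_def)
  qed
  show "T r \<in> crn d d" using r(1) by (rule Tc)
  obtain S where S: "S \<in> crn d d" "r = S * fadj S" by (rule fpsd_sqrt[OF r(1,2)])
  have "T r = T S * fadj (T S)" using S by (simp add: Tmult Tadj)
  then show "fpsd (T r)" using fpsd_sq by simp
  show "ftr (T r) = 1" using Ttr[OF r(1)] r(3) by simp
qed

text \<open>If X is fixed by the reversed dual and V = T X, then V r is fixed by the original
  channel, hence a multiple of r, and faithfulness cancels r. For the reversed cycle this takes the
  place of an ergodicity assumption.\<close>

lemma qenv_R: "qenv d B w KR (T r)"
proof -
  interpret R: qenv0 d B w KR "T r" by (rule qenv0_R)
  show ?thesis
  proof
    fix X assume X: "X \<in> crn d d"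
    {
      assume M: "Mm B KR w0 X = X"
      define V where "V = T X"
      have V: "V \<in> crn d d" "T V = X" using X by (auto simp: V_def Tc TT)
      have "T (Nm w0 V) = T V" using MR_T[OF V(1), of w0] V M by simp
      then have "Nm w0 V = V" using TT[OF Nm_crn[OF V(1), of w0]] TT[OF V(1)] by simp
      then have "V * r = L w0 (V * r)" using Nm_r[OF V(1), of "\<lambda>_ _. 1"] by simp
      then have "V * r = ftr (V * r) *. r" using fixed_L[of "V * r"] V(1) r(1) by simp
      then have "(V - ftr (V * r) *. fid d) * r = 0" using r(1) by (simp add: left_diff_distrib)
      then have "fadj ((V - ftr (V * r) *. fid d) * r) = 0" by simp
      then have "r * fadj (V - ftr (V * r) *. fid d) = 0" by (simp add: fadj_mult fpsd_adj[OF r(2)])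
      then have "fadj (V - ftr (V * r) *. fid d) = 0"
        using faithful[of "fadj (V - ftr (V * r) *. fid d)"] V(1) by simp
      then have "fadj (fadj (V - ftr (V * r) *. fid d)) = fadj 0" by (rule arg_cong)
      then have "V = ftr (V * r) *. fid d" by simp
      then have "X = cnj (ftr (V * r)) *. fid d" using V(2) Tsmul[OF crn_fid] Tfid by metis
      then show "\<exists>c. X = c *. fid d" by blast
    }
    assume "T r * X = 0"
    then have "T (T r * X) = 0" by (simp add: T0)
    then have "r * T X = 0" using X r(1) by (simp add: Tmult Tc TT)
    then have "T X = 0" using faithful[OF Tc[OF X]] by simp
    then have "T (T X) = 0" by (simp add: T0)
    then show "X = 0" using TT[OF X] by simp
  qed
qed

text \<open>T maps the Poisson solution of the reversed family to a matrix V for which V r solves a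
  Poisson equation of the original channel L. Pairing that equation with \<open>sol g\<close>
  exchanges the roles of f and g.\<close>

theorem kap_reversal: "qenv.kap d B w KR (T r) f g = kap g f"
proof -
  interpret R: qenv d B w KR "T r" by (rule qenv_R)
  have w_real: "(\<lambda>b' b. cnj (of_real (w b) * dx f b' b)) = (\<lambda>b' b. of_real (w b) * dx f b' b)" for f
    by (simp add: dx_def)
  define V where "V = T (R.sol f)"
  have V: "V \<in> crn d d" "T V = R.sol f" using R.sol(1)[of f] by (auto simp: V_def Tc TT)
  define A where "A = L (\<lambda>b' b. of_real (w b) * dx f b' b) r"
  have e1: "T (Nm w0 V) = Mm B KR w0 (R.sol f)" using MR_T[OF V(1), of w0] unfolding V(2) by simp
  have e2: "R.cur f = T (Nm (\<lambda>b' b. of_real (w b) * dx f b' b) (fid d))"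
    using MR_T[OF crn_fid, of "\<lambda>b' b. of_real (w b) * dx f b' b"] unfolding w_real Tfid R.cur_def .
  have "T (V - Nm w0 V) = R.cur f"
    unfolding Tdiff[OF V(1) Nm_crn[OF V(1)]] V(2) e1 by (rule R.sol(3))
  then have "T (V - Nm w0 V) = T (Nm (\<lambda>b' b. of_real (w b) * dx f b' b) (fid d))" unfolding e2 .
  then have "V - Nm w0 V = Nm (\<lambda>b' b. of_real (w b) * dx f b' b) (fid d)"
    by (metis TT Nm_crn V(1) crn_diff crn_fid)
  then have "(V - Nm w0 V) * r = Nm (\<lambda>b' b. of_real (w b) * dx f b' b) (fid d) * r" by simp
  \<comment> \<open>Exchanging the labels changes the sign of increments, whence the minus
    sign.\<close>
  then have VA: "V * r - L w0 (V * r) = - A"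
  proof -
    have "L (\<lambda>b' b. of_real (w b) * dx f b b') r = L (\<lambda>b' b. (-1) * (of_real (w b) * dx f b' b)) r"
      by (intro Lm_cong) (simp add: dx_def algebra_simps)
    then have "L (\<lambda>b' b. of_real (w b) * dx f b b') r = - A" unfolding Lm_smul_wt A_def by simp
    then show ?thesis
      using Nm_r[OF V(1), of "\<lambda>_ _. 1"] Nm_r[OF crn_fid, of "dx f"] r(1)
        \<open>(V - Nm w0 V) * r = Nm (\<lambda>b' b. of_real (w b) * dx f b' b) (fid d) * r\<close>
      by (simp add: left_diff_distrib)
  qed
  have tg: "ftr (Nm (\<lambda>b' b. of_real (w b) * dx g b' b) V * r) = cross g f"
  proof -
    have "Nm (\<lambda>b' b. of_real (w b) * dx g b' b) V * r = L (\<lambda>b' b. (-1) * (of_real (w b) * dx g b' b)) (V * r)"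
      unfolding Nm_r[OF V(1)] by (intro Lm_cong) (simp add: dx_def algebra_simps)
    then have "ftr (Nm (\<lambda>b' b. of_real (w b) * dx g b' b) V * r) = - ftr (L (\<lambda>b' b. of_real (w b) * dx g b' b) (V * r))"
      unfolding Lm_smul_wt by (simp add: ftr_smul ftr_uminus)
    also have "ftr (L (\<lambda>b' b. of_real (w b) * dx g b' b) (V * r)) = ftr (V * r * cur g)"
      using tr_Lm_Mm[of B K "\<lambda>b' b. of_real (w b) * dx g b' b" "V * r" "fid d"] V(1) r(1) by (simp add: cur_def)
    also have "\<dots> = ftr (V * r * sol g) - ftr (L w0 (V * r) * sol g)"
      unfolding tr_Lm_Mm sol(3)[of g, symmetric] by (simp add: right_diff_distrib ftr_diff)
    also have "\<dots> = ftr ((V * r - L w0 (V * r)) * sol g)" by (simp add: left_diff_distrib ftr_diff)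
    also have "\<dots> = - ftr (A * sol g)" unfolding VA using ftr_smul[of "-1" "A * sol g"] by simp
    also have "ftr (A * sol g) = cross g f" unfolding A_def tr_Lm_Mm cross_def ..
    finally show ?thesis by simp
  qed
  have c1: "R.cross f g = cross g f"
  proof -
    have "R.cross f g = ftr (T r * T (Nm (\<lambda>b' b. of_real (w b) * dx g b' b) V))"
      unfolding R.cross_def V(2)[symmetric] MR_T[OF V(1)] w_real ..
    also have "\<dots> = cnj (ftr (r * Nm (\<lambda>b' b. of_real (w b) * dx g b' b) V))"
      using r(1) Nm_crn[OF V(1)] Ttr[OF crn_mult[OF r(1) Nm_crn[OF V(1)]]] by (simp add: Tmult[symmetric])
    also have "\<dots> = cnj (cross g f)" by (subst ftr_comm) (simp add: tg)
    finally show ?thesis using cross_Im[of g f] by (simp add: complex_eq_iff)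
  qed
  \<comment> \<open>The equal-time term of the reversed family, rewritten by detailed balance: the
    labels are exchanged, so g is evaluated at the outgoing label and the increment changes
    sign.\<close>
  have c2: "ftr (R.L (\<lambda>b' b. of_real (w b) * of_real (g b) * dx f b' b) (T r)) = - ftr (L (\<lambda>b' b. of_real (w b) * of_real (g b') * dx f b' b) r)"
  proof -
    have "ftr (R.L (\<lambda>b' b. of_real (w b) * of_real (g b) * dx f b' b) (T r)) =
      (\<Sum>b\<in>B. \<Sum>b'\<in>B. cnj (of_real (w b') * of_real (g b) * dx f b' b * ftr (K b b' * r * fadj (K b b'))))"
      unfolding tr_Lm
    proof (intro sum.cong refl)
      fix b b' assume b: "b \<in> B" "b' \<in> B"
      have "KR b' b * T r * fadj (KR b' b) = T (fadj (K b b') * r * K b b')"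
        using Kc[OF b] r(1) by (simp add: KR_def Tmult Tadj crn_mult[of _ d d _ d])
      then have 1: "ftr (KR b' b * T r * fadj (KR b' b)) = cnj (ftr (fadj (K b b') * r * K b b'))"
        using Kc[OF b] r(1) by (simp add: Ttr crn_mult[of _ d d _ d])
      have "of_real (w b) * ftr (fadj (K b b') * r * K b b') = ftr (fadj (K b b') * (of_real (w b) *. (r * K b b')))"
        by (simp add: ftr_smul mult.assoc)
      also have "\<dots> = ftr (fadj (K b b') * (of_real (w b') *. (K b b' * r)))" using balance[OF b] by simp
      also have "\<dots> = of_real (w b') * ftr (K b b' * r * fadj (K b b'))" by (simp add: ftr_smul ftr_comm[of "fadj (K b b')"])
      finally have 2: "of_real (w b) * ftr (fadj (K b b') * r * K b b') = of_real (w b') * ftr (K b b' * r * fadj (K b b'))" .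
      have "of_real (w b) * of_real (g b) * dx f b' b * ftr (KR b' b * T r * fadj (KR b' b)) =
         of_real (g b) * dx f b' b * cnj (of_real (w b) * ftr (fadj (K b b') * r * K b b'))"
        unfolding 1 by simp
      also have "\<dots> = cnj (of_real (w b') * of_real (g b) * dx f b' b * ftr (K b b' * r * fadj (K b b')))"
        unfolding 2 by (simp add: dx_def)
      finally show "of_real (w b) * of_real (g b) * dx f b' b * ftr (KR b' b * T r * fadj (KR b' b)) = \<dots>" .
    qed
    also have "\<dots> = cnj (\<Sum>b\<in>B. \<Sum>b'\<in>B. of_real (w b) * of_real (g b') * dx f b b' * ftr (K b' b * r * fadj (K b' b)))"
      unfolding cnj_sum by (rule sum.swap)
    also have "(\<Sum>b\<in>B. \<Sum>b'\<in>B. of_real (w b) * of_real (g b') * dx f b b' * ftr (K b' b * r * fadj (K b' b)))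
       = ftr (L (\<lambda>b' b. of_real (w b * g b' * (f b' - f b))) r)"
      unfolding tr_Lm by (simp add: dx_def)
    also have "cnj \<dots> = ftr (L (\<lambda>b' b. of_real (w b * g b' * (f b' - f b))) r)"
      using tr_L_r_Im[of "\<lambda>b' b. w b * g b' * (f b' - f b)"] by (simp add: complex_eq_iff)
    also have "L (\<lambda>b' b. of_real (w b * g b' * (f b' - f b))) r = L (\<lambda>b' b. (-1) * (of_real (w b) * of_real (g b') * dx f b' b)) r"
      by (intro Lm_cong) (simp add: dx_def algebra_simps)
    finally show ?thesis unfolding Lm_smul_wt by (simp add: ftr_uminus)
  qed
  \<comment> \<open>With primes for the outgoing label, g' (f - f') + f (g - g') = f g - f' g' has
    mean 0. Hence the equal-time terms of the two families agree after the exchange of f and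
    g.\<close>
  have "ftr (L (\<lambda>b' b. of_real (w b) * of_real (g b') * dx f b' b) r) + ftr (L (\<lambda>b' b. of_real (w b) * of_real (f b) * dx g b' b) r)
     = ftr (L (\<lambda>b' b. of_real (w b) * of_real (f b * g b) - of_real (w b) * of_real (f b' * g b')) r)"
    unfolding ftr_add[symmetric] Lm_add_wt[symmetric]
    by (intro arg_cong[where f = ftr] Lm_cong) (simp add: dx_def algebra_simps)
  also have "\<dots> = 0"
    unfolding Lm_diff_wt using L_in_tr[OF r(1), of "\<lambda>b. of_real (w b) * of_real (f b * g b)"] r(3)
      L_out[of "\<lambda>b. of_real (f b * g b)"] by (simp add: ftr_smul ftr_diff)
  finally show ?thesis unfolding R.kap_def kap_def c1 c2 by (simp only: add_eq_0_iff)
qed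

end

section \<open>From matrices of fixed dimension to matrices of bounded support\<close>

definition emb :: "complex mat => fm" where
  "emb A = mk (dim_row A) (dim_col A) (\<lambda>i j. A $$ (i,j))"
definition unm :: "nat => nat => fm => complex mat" where
  "unm m n X = Matrix.mat m n (\<lambda>(i,j). ent X i j)"

lemma ent_emb: "A \<in> carrier_mat m n ==> ent (emb A) i j = (if i < m \<and> j < n then A $$ (i,j) else 0)"
  by (auto simp: emb_def)
lemma emb_crn: "A \<in> carrier_mat m n ==> emb A \<in> crn m n"
  by (rule crnI) (auto simp: ent_emb)
lemma unm_carrier [simp]: "unm m n X \<in> carrier_mat m n" by (simp add: unm_def)
lemma emb_unm: "X \<in> crn m n ==> emb (unm m n X) = X"
proof (rule fm_eqI)
  fix i j assume X: "X \<in> crn m n"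
  show "ent (emb (unm m n X)) i j = ent X i j"
    unfolding ent_emb[OF unm_carrier] using crnD1[OF X, of i j] crnD2[OF X, of j i]
    by (auto simp: unm_def not_less)
qed
lemma emb_inj: "A \<in> carrier_mat m n ==> B \<in> carrier_mat m n ==> emb A = emb B ==> A = B"
proof (rule eq_matI)
  fix i j assume AB: "A \<in> carrier_mat m n" "B \<in> carrier_mat m n" "emb A = emb B" and ij: "i < dim_row B" "j < dim_col B"
  have "ent (emb A) i j = ent (emb B) i j" using AB(3) by simp
  then show "A $$ (i,j) = B $$ (i,j)" unfolding ent_emb[OF AB(1)] ent_emb[OF AB(2)] using ij AB(1,2) by auto
qed auto

lemma emb_mult: assumes A: "A \<in> carrier_mat m k" and B: "B \<in> carrier_mat k n"
  shows "emb (A * B) = emb A * emb B"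
proof (rule fm_eqI)
  fix i j
  have AB: "A * B \<in> carrier_mat m n" using A B by simp
  show "ent (emb (A * B)) i j = ent (emb A * emb B) i j"
    unfolding ent_multL[OF emb_crn[OF A]] ent_emb[OF AB] ent_emb[OF A] ent_emb[OF B]
    using A B by (auto simp: scalar_prod_def lessThan_atLeast0 intro!: sum.cong)
qed
lemma emb_add: "A \<in> carrier_mat m n ==> B \<in> carrier_mat m n ==> emb (A + B) = emb A + emb B"
  by (rule fm_eqI) (auto simp: emb_def)
lemma emb_diff: "A \<in> carrier_mat m n ==> B \<in> carrier_mat m n ==> emb (A - B) = emb A - emb B"
  by (rule fm_eqI) (auto simp: emb_def)
lemma emb_smult: "emb (c \<cdot>\<^sub>m A) = c *. emb A"
  by (rule fm_eqI) (auto simp: emb_def)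
lemma emb_adj: "emb (adj A) = fadj (emb A)"
  by (rule fm_eqI) (auto simp: emb_def adj_def)
lemma emb_one: "emb (1\<^sub>m n) = fid n"
  by (rule fm_eqI) (auto simp: emb_def)
lemma adj_carrier: "A \<in> carrier_mat m n ==> adj A \<in> carrier_mat n m" by (auto simp: adj_def)
lemma mtrace_emb: "A \<in> carrier_mat n n ==> mtrace A = ftr (emb A)"
  unfolding mtrace_def by (subst ftr_crn[OF emb_crn]) (auto simp: ent_emb)

lemma hermitian_emb: "hermitian d A ==> emb A \<in> crn d d \<and> fadj (emb A) = emb A"
  unfolding hermitian_def using emb_crn emb_adj by metis

lemma ftr_quadratic: assumes V: "V \<in> crn m m" and A: "A \<in> carrier_mat d d" "d \<le> m"
  shows "ftr (fadj V * emb A * V) = (\<Sum>c<m. ip (Matrix.vec d (\<lambda>i. ent V i c)) (A *\<^sub>v Matrix.vec d (\<lambda>i. ent V i c)))"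
proof -
  have Ac: "emb A \<in> crn d d" using A by (intro emb_crn)
  have "ent (fadj V * emb A * V) c c = ip (Matrix.vec d (\<lambda>i. ent V i c)) (A *\<^sub>v Matrix.vec d (\<lambda>i. ent V i c))" for c
  proof -
    have "ent (fadj V * emb A * V) c c = (\<Sum>k<d. (\<Sum>i<d. cnj (ent V i c) * ent (emb A) i k) * ent V k c)"
      unfolding ent_multL[OF crn_mult[OF crn_fadj[OF V] Ac]] ent_multR[OF Ac] by simp
    also have "\<dots> = (\<Sum>k<d. \<Sum>i<d. cnj (ent V i c) * (ent (emb A) i k * ent V k c))"
      by (simp add: sum_distrib_right mult.assoc)
    also have "\<dots> = (\<Sum>i<d. cnj (ent V i c) * (\<Sum>k<d. ent (emb A) i k * ent V k c))"
      by (subst sum.swap) (simp add: sum_distrib_left)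
    also have "\<dots> = ip (Matrix.vec d (\<lambda>i. ent V i c)) (A *\<^sub>v Matrix.vec d (\<lambda>i. ent V i c))"
      unfolding ip_def using A by (auto simp: ent_emb[OF A(1)] scalar_prod_def lessThan_atLeast0 intro!: sum.cong)
    finally show ?thesis .
  qed
  then show ?thesis by (subst ftr_crn[OF crn_mult[OF crn_mult[OF crn_fadj[OF V] Ac] V]]) simp
qed

text \<open>The quadratic form of a matrix V is the sum of those of its columns; conversely a vector
  is a matrix with one nonzero column.\<close>

lemma psd_emb: "psd d A \<longleftrightarrow> A \<in> carrier_mat d d \<and> fpsd (emb A)"
proof
  assume A: "psd d A"
  then have c: "A \<in> carrier_mat d d" by (simp add: psd_def hermitian_def)
  have "0 \<le> Re (ftr (fadj V * emb A * V))" for V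
  proof -
    obtain n where "V \<in> crn n n" using crn_ex by blast
    then have V: "V \<in> crn (max n d) (max n d)" by (rule crn_mono) auto
    show ?thesis unfolding ftr_quadratic[OF V c max.cobounded2] Re_sum
      using A by (intro sum_nonneg) (simp add: psd_def)
  qed
  then show "A \<in> carrier_mat d d \<and> fpsd (emb A)"
    using A c hermitian_emb[of d A] by (auto simp: fpsd_def psd_def)
next
  assume A: "A \<in> carrier_mat d d \<and> fpsd (emb A)"
  then have c: "A \<in> carrier_mat d d" by simp
  have "emb (adj A) = emb A" using A by (simp add: emb_adj fpsd_adj)
  then have "adj A = A" using emb_inj[OF adj_carrier[OF c] c] by simp
  moreover have "0 \<le> Re (ip v (A *\<^sub>v v))" if v: "v \<in> carrier_vec d" for v
  proof -
    define V where "V = mk d 1 (\<lambda>i _. v $ i)"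
    \<comment> \<open>Size d + 1 ensures that column 0 exists even for d = 0.\<close>
    have V: "V \<in> crn (Suc d) (Suc d)" unfolding V_def by (rule crn_mono[OF mk_crn]) auto
    have "0 \<le> Re (ftr (fadj V * emb A * V))" using A by (simp add: fpsdD)
    also have "ftr (fadj V * emb A * V) = (\<Sum>c<Suc d. if c = 0 then ip v (A *\<^sub>v v) else 0)"
      unfolding ftr_quadratic[OF V c le_SucI[OF order_refl]]
    proof (intro sum.cong refl)
      fix c
      have "Matrix.vec d (\<lambda>i. ent V i c) = (if c = 0 then v else 0\<^sub>v d)"
        using v by (auto simp: V_def)
      moreover have "ip (0\<^sub>v d) (A *\<^sub>v 0\<^sub>v d) = 0" by (simp add: ip_def)
      ultimately show "ip (Matrix.vec d (\<lambda>i. ent V i c)) (A *\<^sub>v Matrix.vec d (\<lambda>i. ent V i c)) = (if c = 0 then ip v (A *\<^sub>v v) else 0)"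
        by simp
    qed
    also have "\<dots> = ip v (A *\<^sub>v v)" by (subst sum.delta) auto
    finally show ?thesis .
  qed
  ultimately show "psd d A" using c by (simp add: psd_def hermitian_def)
qed

lemma state_emb: "state d A \<longleftrightarrow> A \<in> carrier_mat d d \<and> fpsd (emb A) \<and> ftr (emb A) = 1"
  unfolding state_def psd_emb using mtrace_emb by auto

lemma conj_fdiag_pow: assumes U: "unitary d U" and A: "emb A = U * fdiag d l * fadj U" "A \<in> carrier_mat d d"
  shows "emb (A ^\<^sub>m k) = U * fdiag d (\<lambda>i. l i ^ k) * fadj U"
proof (induction k)
  case 0 then show ?case using U A fid_multR[of U d d] by (simp add: emb_one fdiag_one unitary_def)
next
  case (Suc k)
  have "emb (A ^\<^sub>m Suc k) = emb (A ^\<^sub>m k) * emb A" using A by (simp add: emb_mult[OF pow_carrier_mat])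
  also have "\<dots> = U * (fdiag d (\<lambda>i. l i ^ k) * ((fadj U * U) * fdiag d l)) * fadj U"
    unfolding Suc A(1) by (simp add: mult.assoc)
  also have "\<dots> = U * fdiag d (\<lambda>i. l i ^ Suc k) * fadj U"
    using U fid_multL[OF crn_fdiag, of d l] by (simp add: unitary_def fdiag_mult mult.commute)
  finally show ?case .
qed

lemma ent_conj_fdiag: "U \<in> crn d d ==> ent (U * fdiag d l * fadj U) i j = (\<Sum>m<d. ent U i m * l m * cnj (ent U j m))"
proof -
  assume U: "U \<in> crn d d"
  have "ent (U * fdiag d l) i m = ent U i m * l m" if "m < d" for m
  proof -
    have "ent (U * fdiag d l) i m = (\<Sum>k<d. if k = m then ent U i m * l m else 0)"
      unfolding ent_multL[OF U] by (rule sum.cong) auto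
    then show ?thesis using that by simp
  qed
  then show ?thesis unfolding ent_multL[OF crn_mult[OF U crn_fdiag]] by simp
qed

text \<open>The exponential is defined by entrywise series, and the eigenbasis reduces each entry to
  a finite combination of scalar exponential series.\<close>

lemma mexp_emb: assumes U: "unitary d U" and A: "emb A = U * fdiag d l * fadj U" "A \<in> carrier_mat d d"
  shows "emb (mexp A) = U * fdiag d (\<lambda>i. exp (l i)) * fadj U" and "mexp A \<in> carrier_mat d d"
proof -
  show c: "mexp A \<in> carrier_mat d d" using A by (simp add: mexp_def)
  have Uc: "U \<in> crn d d" using U by (simp add: unitary_def)
  show "emb (mexp A) = U * fdiag d (\<lambda>i. exp (l i)) * fadj U"
  proof (rule fm_eqI)
    fix i j
    show "ent (emb (mexp A)) i j = ent (U * fdiag d (\<lambda>i. exp (l i)) * fadj U) i j"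
    proof (cases "i < d \<and> j < d")
      case True
      have e: "(A ^\<^sub>m k) $$ (i,j) / of_nat (fact k) = (\<Sum>m<d. ent U i m * (l m ^ k /\<^sub>R fact k) * cnj (ent U j m))" for k
      proof -
        have "(A ^\<^sub>m k) $$ (i,j) = ent (emb (A ^\<^sub>m k)) i j" using True A by (simp add: ent_emb[OF pow_carrier_mat])
        also have "\<dots> = (\<Sum>m<d. ent U i m * l m ^ k * cnj (ent U j m))"
          unfolding conj_fdiag_pow[OF U A] ent_conj_fdiag[OF Uc] ..
        finally show ?thesis by (simp add: sum_divide_distrib scaleR_conv_of_real field_simps)
      qed
      have "(\<lambda>k. \<Sum>m<d. ent U i m * (l m ^ k /\<^sub>R fact k) * cnj (ent U j m)) sums (\<Sum>m<d. ent U i m * exp (l m) * cnj (ent U j m))"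
        by (intro sums_sum sums_mult sums_mult2 exp_converges)
      then have "(\<Sum>k. (A ^\<^sub>m k) $$ (i,j) / of_nat (fact k)) = (\<Sum>m<d. ent U i m * exp (l m) * cnj (ent U j m))"
        unfolding e by (rule sums_unique[symmetric])
      then show ?thesis using True A by (simp add: ent_emb[OF c] ent_conj_fdiag[OF Uc]) (simp add: mexp_def)
    next
      case False
      have Xc: "U * fdiag d (\<lambda>i. exp (l i)) * fadj U \<in> crn d d"
        by (rule crn_mult[OF crn_mult[OF Uc crn_fdiag] crn_fadj[OF Uc]])
      show ?thesis using False crnD1[OF Xc, of i j] crnD2[OF Xc, of j i]
        by (auto simp: ent_emb[OF c] not_less)
    qed
  qed
qed

lemma mexp_smult_emb:
  assumes U: "unitary d U" and A: "emb A = U * fdiag d (\<lambda>i. of_real (l i)) * fadj U" "A \<in> carrier_mat d d"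
  shows "emb (mexp (c \<cdot>\<^sub>m A)) = U * fdiag d (\<lambda>i. exp (c * of_real (l i))) * fadj U" "mexp (c \<cdot>\<^sub>m A) \<in> carrier_mat d d"
proof -
  have e: "emb (c \<cdot>\<^sub>m A) = U * fdiag d (\<lambda>i. c * of_real (l i)) * fadj U"
    by (simp add: emb_smult A smul_fdiag[symmetric])
  have c: "c \<cdot>\<^sub>m A \<in> carrier_mat d d" using A by simp
  show "emb (mexp (c \<cdot>\<^sub>m A)) = U * fdiag d (\<lambda>i. exp (c * of_real (l i))) * fadj U" "mexp (c \<cdot>\<^sub>m A) \<in> carrier_mat d d"
    using mexp_emb[OF U e c] by auto
qed

lemma conj_fdiag_tr: "unitary d U ==> ftr (U * fdiag d l * fadj U) = (\<Sum>i<d. l i)"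
proof -
  assume U: "unitary d U"
  have "ftr (U * fdiag d l * fadj U) = ftr ((fadj U * U) * fdiag d l)" by (metis ftr_comm mult.assoc)
  also have "\<dots> = ftr (fdiag d l)" using U fid_multL[OF crn_fdiag, of d l] by (simp add: unitary_def)
  finally show ?thesis by (simp add: ftr_crn[OF crn_fdiag])
qed

definition gibbs_weight :: "nat => (nat => real) => real => nat => real" where
  "gibbs_weight n e \<beta> b = exp (- \<beta> * e b) / (\<Sum>c<n. exp (- \<beta> * e c))"

lemma gibbs_emb:
  assumes U: "unitary n U" and A: "emb H = U * fdiag n (\<lambda>i. of_real (e i)) * fadj U" "H \<in> carrier_mat n n"
  shows "emb (gibbs H \<beta>) = U * fdiag n (\<lambda>i. of_real (gibbs_weight n e \<beta> i)) * fadj U" "gibbs H \<beta> \<in> carrier_mat n n"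
proof -
  note m = mexp_smult_emb[OF U A, of "complex_of_real (- \<beta>)"]
  have t: "mtrace (mexp (complex_of_real (- \<beta>) \<cdot>\<^sub>m H)) = of_real (\<Sum>c<n. exp (- \<beta> * e c))"
    unfolding mtrace_emb[OF m(2)] m(1) conj_fdiag_tr[OF U] by (simp flip: exp_of_real)
  show "emb (gibbs H \<beta>) = U * fdiag n (\<lambda>i. of_real (gibbs_weight n e \<beta> i)) * fadj U"
  proof -
    have "emb (gibbs H \<beta>) = U * ((1 / of_real (\<Sum>c<n. exp (- \<beta> * e c))) *. fdiag n (\<lambda>i. exp (of_real (- \<beta>) * of_real (e i)))) * fadj U"
      unfolding gibbs_def t emb_smult m(1) by simp
    then show ?thesis unfolding smul_fdiag gibbs_weight_def by (simp add: exp_of_real[symmetric])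
  qed
  show "gibbs H \<beta> \<in> carrier_mat n n" using m(2) by (simp add: gibbs_def)
qed

section \<open>Tensor products\<close>

text \<open>\<open>inc d n m\<close> is the isometry $v\mapsto v\otimes e_m$.\<close>
definition inc :: "nat => nat => nat => fm" where
  "inc d n m = mk (d * n) d (\<lambda>i a. if i div n = a \<and> i mod n = m then 1 else 0)"

lemma inc_crn [simp]: "inc d n m \<in> crn (d * n) d" by (simp add: inc_def)
lemma idx_less: "a < d ==> m < n ==> a * n + m < d * (n::nat)"
proof -
  assume "a < d" "m < n"
  then have "a * n + m < Suc a * n" "Suc a * n \<le> d * n" by (simp, intro mult_le_mono1, simp)
  then show "a * n + m < d * n" by (rule less_le_trans)
qed
lemma idx_inj: assumes "m < n" "m' < (n::nat)" shows "i * n + m = j * n + m' \<longleftrightarrow> i = j \<and> m = m'"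
proof
  assume e: "i * n + m = j * n + m'"
  have "(i * n + m) div n = i" "(j * n + m') div n = j" using assms by simp_all
  then have "i = j" using e by simp
  then show "i = j \<and> m = m'" using e by simp
qed simp
lemma ent_inc: "a < d ==> m < n ==> ent (inc d n m) i a = (if i = a * n + m then 1 else 0)"
  unfolding inc_def using idx_less[of a d m n] by auto

lemma inc_mult: assumes X: "X \<in> crn d k" "m < n"
  shows "ent (inc d n m * X) i j = (if i < d * n \<and> i mod n = m then ent X (i div n) j else 0)"
proof -
  have "ent (inc d n m * X) i j = (\<Sum>a<d. if a = i div n then (if i < d * n \<and> i mod n = m then ent X (i div n) j else 0) else 0)"
    unfolding ent_multL[OF inc_crn] by (rule sum.cong) (auto simp: inc_def)
  also have "\<dots> = (if i < d * n \<and> i mod n = m then ent X (i div n) j else 0)"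
    by (auto simp: less_mult_imp_div_less)
  finally show ?thesis .
qed

lemma mult_inc: assumes X: "X \<in> crn k (d * n)" "m < n"
  shows "ent (X * inc d n m) i a = (if a < d then ent X i (a * n + m) else 0)"
proof (cases "a < d")
  case True
  have "ent (X * inc d n m) i a = (\<Sum>l<d * n. if l = a * n + m then ent X i (a * n + m) else 0)"
    unfolding ent_multL[OF X(1)] by (rule sum.cong) (auto simp: ent_inc[OF True X(2)])
  then show ?thesis using True idx_less[OF True X(2)] by simp
next
  case False
  have Xc: "X * inc d n m \<in> crn k d" by (rule crn_mult[OF X(1) inc_crn])
  show ?thesis using False crnD2[OF Xc, of a i] by simp
qed

lemma inc_adj_mult: assumes X: "X \<in> crn (d * n) k" "m < n"
  shows "ent (fadj (inc d n m) * X) a j = (if a < d then ent X (a * n + m) j else 0)"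
proof -
  have "fadj (inc d n m) * X = fadj (fadj X * inc d n m)" by (simp add: fadj_mult)
  then have "ent (fadj (inc d n m) * X) a j = cnj (ent (fadj X * inc d n m) j a)" by (simp only: ent_fadj)
  then show ?thesis unfolding mult_inc[OF crn_fadj[OF X(1)] X(2)] by simp
qed

lemma inc_isom: assumes "m < n" "m' < n" shows "fadj (inc d n m) * inc d n m' = (if m = m' then fid d else 0)"
proof (rule fm_eqI)
  fix i j
  show "ent (fadj (inc d n m) * inc d n m') i j = ent (if m = m' then fid d else 0) i j"
  proof (cases "i < d \<and> j < d")
    case True
    have "i * n + m = j * n + m' \<longleftrightarrow> i = j \<and> m = m'" 
      using assms by (rule idx_inj)
    then show ?thesis using True assms
      by (auto simp: inc_adj_mult[OF inc_crn assms(1)] ent_inc)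
  next
    case False
    then show ?thesis using crnD2[OF inc_crn[of d n m'], of j] assms by (auto simp: inc_adj_mult[OF inc_crn assms(1)])
  qed
qed

lemma inc_complete: "(\<Sum>m<n. inc d n m * fadj (inc d n m)) = fid (d * n)"
proof (rule fm_eqI)
  fix i j
  have "ent (\<Sum>m<n. inc d n m * fadj (inc d n m)) i j =
     (\<Sum>m<n. if m = i mod n then (if i < d * n \<and> j < d * n \<and> i = j then 1 else 0) else 0)"
    unfolding ent_sum
  proof (intro sum.cong refl)
    fix m assume "m \<in> {..<n}"
    then have m: "m < n" by simp
    have "i mod n = j mod n ==> i div n = j div n ==> i = j" by (metis div_mult_mod_eq)
    moreover have "i < d * n ==> i div n < d" by (rule less_mult_imp_div_less)
    ultimately show "ent (inc d n m * fadj (inc d n m)) i j = (if m = i mod n then (if i < d * n \<and> j < d * n \<and> i = j then 1 else 0) else 0)"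
      unfolding inc_mult[OF crn_fadj[OF inc_crn] m] by (auto simp: inc_def)
  qed
  also have "\<dots> = ent (fid (d * n)) i j"
    by (cases "n = 0") auto
  finally show "ent (\<Sum>m<n. inc d n m * fadj (inc d n m)) i j = ent (fid (d * n)) i j" .
qed

text \<open>A \<otimes> G, expanded in the entries of G with the isometries \<open>inc\<close>;
  products and partial traces then follow from the relations between these isometries.\<close>

definition fkron :: "nat => nat => fm => fm => fm" where
  "fkron d n A G = (\<Sum>m<n. \<Sum>m'<n. ent G m m' *. (inc d n m * A * fadj (inc d n m')))"

lemma fkron_crn [simp]: "fkron d n A G \<in> crn (d * n) (d * n)"
proof -
  obtain p where A: "A \<in> crn p p" using crn_ex by blast
  show ?thesis unfolding fkron_def
    by (intro crn_sum crn_smul crn_mult[OF crn_mult[OF inc_crn A] crn_fadj[OF inc_crn]])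
qed

lemma sum_delta2: fixes n :: nat assumes "a < n" "b < n"
  shows "(\<Sum>m<n. \<Sum>m'<n. if m = a then (if m' = b then x else 0) else 0) = (x :: complex)"
proof -
  have "(\<Sum>m'<n. if m = a then (if m' = b then x else 0) else 0) = (if m = a then x else 0)" for m
    using assms by (cases "m = a") auto
  then show ?thesis using assms by simp
qed

lemma ent_fkron: assumes A: "A \<in> crn d d"
  shows "ent (fkron d n A G) i j = (if i < d * n \<and> j < d * n then ent A (i div n) (j div n) * ent G (i mod n) (j mod n) else 0)"
proof -
  have "ent (fkron d n A G) i j = (\<Sum>m<n. \<Sum>m'<n. if m = i mod n then (if m' = j mod n then
     (if i < d * n \<and> j < d * n then ent A (i div n) (j div n) * ent G (i mod n) (j mod n) else 0) else 0) else 0)"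
    unfolding fkron_def ent_sum
  proof (intro sum.cong refl)
    fix m m' assume m: "m \<in> {..<n}" "m' \<in> {..<n}"
    have "inc d n m * A * fadj (inc d n m') = inc d n m * fadj (inc d n m' * fadj A)" by (simp add: fadj_mult mult.assoc)
    moreover have "fadj (inc d n m' * fadj A) \<in> crn d (d * n)" by (intro crn_fadj crn_mult[OF inc_crn crn_fadj[OF A]])
    ultimately have "ent (inc d n m * A * fadj (inc d n m')) i j = (if i < d * n \<and> i mod n = m then cnj (ent (inc d n m' * fadj A) j (i div n)) else 0)"
      using m by (simp add: inc_mult)
    also have "\<dots> = (if i < d * n \<and> i mod n = m then (if j < d * n \<and> j mod n = m' then ent A (i div n) (j div n) else 0) else 0)"
      using m inc_mult[OF crn_fadj[OF A], of m' n j "i div n"] by simp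
    finally show "ent (ent G m m' *. (inc d n m * A * fadj (inc d n m'))) i j = (if m = i mod n then (if m' = j mod n then
     (if i < d * n \<and> j < d * n then ent A (i div n) (j div n) * ent G (i mod n) (j mod n) else 0) else 0) else 0)"
      by (auto simp: mult.commute)
  qed
  also have "\<dots> = (if i < d * n \<and> j < d * n then ent A (i div n) (j div n) * ent G (i mod n) (j mod n) else 0)"
    by (cases "n = 0", simp, rule sum_delta2) auto
  finally show ?thesis .
qed

lemma kron_carrier: "A \<in> carrier_mat d d' ==> G \<in> carrier_mat n n' ==> kron A G \<in> carrier_mat (d * n) (d' * n')"
  by (auto simp: kron_def)

lemma kron_emb: assumes A: "A \<in> carrier_mat d d" and G: "G \<in> carrier_mat n n"
  shows "emb (kron A G) = fkron d n (emb A) (emb G)"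
proof (rule fm_eqI)
  fix i j
  show "ent (emb (kron A G)) i j = ent (fkron d n (emb A) (emb G)) i j"
    unfolding ent_fkron[OF emb_crn[OF A]] ent_emb[OF kron_carrier[OF A G]]
    using A G by (cases "n = 0") (auto simp: kron_def ent_emb less_mult_imp_div_less)
qed

lemma fkron_mult: assumes A: "A \<in> crn d d" and G: "G \<in> crn n n"
  shows "fkron d n A G * fkron d n C D = fkron d n (A * C) (G * D)"
proof -
  have "fkron d n A G * fkron d n C D = (\<Sum>m<n. \<Sum>m'<n. \<Sum>k<n. \<Sum>k'<n. (ent G m m' * ent D k k') *.
     (inc d n m * A * ((fadj (inc d n m') * inc d n k) * C * fadj (inc d n k'))))"
    unfolding fkron_def sum_distrib_right unfolding sum_distrib_left
    by (intro sum.cong refl) (simp add: fm.scale_scale mult.assoc mult.commute)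
  also have "\<dots> = (\<Sum>m<n. \<Sum>m'<n. \<Sum>k<n. \<Sum>k'<n. if k = m' then (ent G m m' * ent D m' k') *. (inc d n m * (A * C) * fadj (inc d n k')) else 0)"
  proof (intro sum.cong refl)
    fix m m' k k' assume "m \<in> {..<n}" "m' \<in> {..<n}" "k \<in> {..<n}"
    then have "fadj (inc d n m') * inc d n k = (if m' = k then fid d else 0)" by (simp add: inc_isom)
    moreover have "A * (fid d * C) = A * C" using fid_multR[OF A] by (simp flip: mult.assoc)
    ultimately show "(ent G m m' * ent D k k') *. (inc d n m * A * ((fadj (inc d n m') * inc d n k) * C * fadj (inc d n k'))) =
       (if k = m' then (ent G m m' * ent D m' k') *. (inc d n m * (A * C) * fadj (inc d n k')) else 0)"
      by (auto simp: mult.assoc) (metis mult.assoc)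
  qed
  also have "\<dots> = (\<Sum>m<n. \<Sum>m'<n. \<Sum>k'<n. (ent G m m' * ent D m' k') *. (inc d n m * (A * C) * fadj (inc d n k')))"
  proof (rule sum.cong[OF refl], rule sum.cong[OF refl])
    fix m m' assume "m' \<in> {..<n}"
    then show "(\<Sum>k<n. \<Sum>k'<n. if k = m' then (ent G m m' * ent D m' k') *. (inc d n m * (A * C) * fadj (inc d n k')) else 0) =
      (\<Sum>k'<n. (ent G m m' * ent D m' k') *. (inc d n m * (A * C) * fadj (inc d n k')))"
      by (subst sum.swap) simp
  qed
  also have "\<dots> = (\<Sum>m<n. \<Sum>k'<n. \<Sum>m'<n. (ent G m m' * ent D m' k') *. (inc d n m * (A * C) * fadj (inc d n k')))"
    by (intro sum.cong refl sum.swap)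
  also have "\<dots> = fkron d n (A * C) (G * D)"
    by (simp add: fkron_def ent_multL[OF G] smul_sum_left)
  finally show ?thesis .
qed

lemma fkron_fadj: "fadj (fkron d n A G) = fkron d n (fadj A) (fadj G)"
  unfolding fkron_def by (subst sum.swap) (simp add: fadj_simps mult.assoc)
lemma fkron_fid: "fkron d n (fid d) (fid n) = fid (d * n)"
proof -
  have "fkron d n (fid d) (fid n) = (\<Sum>m<n. \<Sum>m'<n. if m = m' then inc d n m * fadj (inc d n m) else 0)"
    unfolding fkron_def by (intro sum.cong refl) (auto simp: fid_multR[OF inc_crn])
  then show ?thesis by (simp add: inc_complete)
qed

lemma ptrace2_emb: assumes X: "X \<in> carrier_mat (d * n) (d * n)"
  shows "emb (ptrace2 d n X) = (\<Sum>m<n. fadj (inc d n m) * emb X * inc d n m)"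
proof (rule fm_eqI)
  fix i j
  have c: "ptrace2 d n X \<in> carrier_mat d d" by (simp add: ptrace2_def)
  have "ent (fadj (inc d n m) * emb X * inc d n m) i j = (if i < d \<and> j < d then X $$ (i*n+m, j*n+m) else 0)" if "m < n" for m
    unfolding mult_inc[OF crn_mult[OF crn_fadj[OF inc_crn] emb_crn[OF X]] that] inc_adj_mult[OF emb_crn[OF X] that]
    by (auto simp: ent_emb[OF X] idx_less that)
  then have "(\<Sum>m<n. ent (fadj (inc d n m) * emb X * inc d n m) i j) = (\<Sum>m<n. if i < d \<and> j < d then X $$ (i*n+m, j*n+m) else 0)"
    by (intro sum.cong refl) auto
  then show "ent (emb (ptrace2 d n X)) i j = ent (\<Sum>m<n. fadj (inc d n m) * emb X * inc d n m) i j"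
    unfolding ent_emb[OF c] ent_sum by (auto simp: ptrace2_def)
qed

section \<open>One system-probe interaction\<close>

text \<open>The isometry v \<mapsto> v \<otimes> f, where f is column b of F. Accordingly
  \<open>Kop\<close> is the block of U from the incoming probe level b to the outgoing level
  b'.\<close>

definition Jinc :: "nat => nat => fm => nat => fm" where
  "Jinc d n F b = (\<Sum>m<n. ent F m b *. inc d n m)"
definition Kop :: "nat => nat => fm => fm => nat => nat => fm" where
  "Kop d n F U b' b = fadj (Jinc d n F b') * U * Jinc d n F b"

lemma Jinc_crn [simp]: "Jinc d n F b \<in> crn (d * n) d"
  unfolding Jinc_def by (intro crn_sum crn_smul inc_crn)

lemma unitary_cols: assumes "unitary n F" "b < n" "b' < n"
  shows "(\<Sum>m<n. cnj (ent F m b) * ent F m b') = (if b = b' then 1 else 0)"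
proof -
  have F: "F \<in> crn n n" "fadj F * F = fid n" using assms by (auto simp: unitary_def)
  have "(\<Sum>m<n. cnj (ent F m b) * ent F m b') = ent (fadj F * F) b b'" unfolding ent_multR[OF F(1)] by simp
  then show ?thesis using assms F by simp
qed
lemma unitary_rows: assumes "unitary n F" "m < n" "m' < n"
  shows "(\<Sum>b<n. ent F m b * cnj (ent F m' b)) = (if m = m' then 1 else 0)"
proof -
  have F: "F \<in> crn n n" "F * fadj F = fid n" using assms by (auto simp: unitary_def)
  have "(\<Sum>b<n. ent F m b * cnj (ent F m' b)) = ent (F * fadj F) m m'" unfolding ent_multL[OF F(1)] by simp
  then show ?thesis using assms F by simp
qed

lemma J_isom: assumes F: "unitary n F" "b < n" "b' < n"
  shows "fadj (Jinc d n F b) * Jinc d n F b' = (if b = b' then fid d else 0)"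
proof -
  have "fadj (Jinc d n F b) * Jinc d n F b' = (\<Sum>m<n. \<Sum>m'<n. (cnj (ent F m b) * ent F m' b') *. (fadj (inc d n m) * inc d n m'))"
    unfolding Jinc_def fadj_sum sum_distrib_right unfolding sum_distrib_left
    by (intro sum.cong refl) (simp add: fadj_smul fm.scale_scale mult.commute)
  also have "\<dots> = (\<Sum>m<n. \<Sum>m'<n. if m' = m then (cnj (ent F m b) * ent F m b') *. fid d else 0)"
    by (intro sum.cong refl) (auto simp: inc_isom)
  also have "\<dots> = (\<Sum>m<n. cnj (ent F m b) * ent F m b') *. fid d"
    by (simp add: smul_sum_left)
  finally show ?thesis unfolding unitary_cols[OF F] by simp
qed

text \<open>Basis independence of the partial trace, from the orthonormality of the rows of
  F.\<close>

lemma J_sandwich: assumes F: "unitary n F"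
  shows "(\<Sum>b<n. fadj (Jinc d n F b) * X * Jinc d n F b) = (\<Sum>m<n. fadj (inc d n m) * X * inc d n m)"
proof -
  have "(\<Sum>b<n. fadj (Jinc d n F b) * X * Jinc d n F b) =
     (\<Sum>b<n. \<Sum>m<n. \<Sum>m'<n. (ent F m' b * cnj (ent F m b)) *. (fadj (inc d n m) * X * inc d n m'))"
    unfolding Jinc_def fadj_sum sum_distrib_right unfolding sum_distrib_left
    by (intro sum.cong refl) (simp add: fadj_smul fm.scale_scale mult.commute)
  also have "\<dots> = (\<Sum>m<n. \<Sum>m'<n. \<Sum>b<n. (ent F m' b * cnj (ent F m b)) *. (fadj (inc d n m) * X * inc d n m'))"
    by (subst sum.swap, rule sum.cong[OF refl], rule sum.swap)
  also have "\<dots> = (\<Sum>m<n. \<Sum>m'<n. if m' = m then fadj (inc d n m) * X * inc d n m else 0)"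
    unfolding smul_sum_left[symmetric]
    by (intro sum.cong refl) (auto simp: unitary_rows[OF F])
  finally show ?thesis by simp
qed

lemma fkron_J_diag: assumes F: "F \<in> crn n n"
  shows "fkron d n A (F * fdiag n p * fadj F) = (\<Sum>b<n. p b *. (Jinc d n F b * A * fadj (Jinc d n F b)))"
proof -
  have "(\<Sum>b<n. p b *. (Jinc d n F b * A * fadj (Jinc d n F b))) =
     (\<Sum>b<n. \<Sum>m<n. \<Sum>m'<n. (ent F m b * p b * cnj (ent F m' b)) *. (inc d n m * A * fadj (inc d n m')))"
    unfolding Jinc_def fadj_sum sum_distrib_right unfolding sum_distrib_left unfolding smul_sum_right
    by (intro sum.cong refl) (simp add: fadj_smul fm.scale_scale mult_ac)
  also have "\<dots> = (\<Sum>m<n. \<Sum>m'<n. \<Sum>b<n. (ent F m b * p b * cnj (ent F m' b)) *. (inc d n m * A * fadj (inc d n m')))"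
    by (subst sum.swap, rule sum.cong[OF refl], rule sum.swap)
  also have "\<dots> = fkron d n A (F * fdiag n p * fadj F)"
    unfolding fkron_def ent_conj_fdiag[OF F] smul_sum_left ..
  finally show ?thesis ..
qed

lemma J_complete: assumes F: "unitary n F"
  shows "(\<Sum>b<n. Jinc d n F b * fadj (Jinc d n F b)) = fid (d * n)"
proof -
  have Fc: "F \<in> crn n n" "F * fadj F = fid n" using F by (auto simp: unitary_def)
  have "F * fdiag n (\<lambda>_. 1) * fadj F = fid n" using Fc by (simp add: fdiag_one)
  then have "(\<Sum>b<n. Jinc d n F b * fid d * fadj (Jinc d n F b)) = fid (d * n)"
    using fkron_J_diag[OF Fc(1), of d "fid d" "\<lambda>_. 1"] by (simp add: fkron_fid)
  then show ?thesis by (simp add: fid_multR[OF Jinc_crn])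
qed

lemma sum_delta_fm: fixes n :: nat assumes "b < n" "\<And>c. c < n ==> c \<noteq> b ==> f c = 0"
  shows "(\<Sum>c<n. f c) = (f b :: fm)"
proof -
  have "(\<Sum>c<n. f c) = (\<Sum>c<n. if c = b then f b else 0)" by (intro sum.cong refl) (use assms in auto)
  then show ?thesis using assms by simp
qed

lemma fkron_J: assumes F: "unitary n F" "b < n" and A: "A \<in> crn d d"
  shows "fkron d n A (F * fdiag n p * fadj F) * Jinc d n F b = p b *. (Jinc d n F b * A)"
    and "fadj (Jinc d n F b) * fkron d n A (F * fdiag n p * fadj F) = p b *. (A * fadj (Jinc d n F b))"
proof -
  have Fc: "F \<in> crn n n" using F by (simp add: unitary_def)
  have "fkron d n A (F * fdiag n p * fadj F) * Jinc d n F b =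
      (\<Sum>c<n. p c *. (Jinc d n F c * A * (fadj (Jinc d n F c) * Jinc d n F b)))"
    unfolding fkron_J_diag[OF Fc] sum_distrib_right by (simp add: mult.assoc)
  also have "\<dots> = p b *. (Jinc d n F b * A * (fadj (Jinc d n F b) * Jinc d n F b))"
    by (rule sum_delta_fm) (use F in \<open>auto simp: J_isom\<close>)
  also have "\<dots> = p b *. (Jinc d n F b * A)" using F fid_multR[OF A] by (simp add: J_isom mult.assoc)
  finally show "fkron d n A (F * fdiag n p * fadj F) * Jinc d n F b = p b *. (Jinc d n F b * A)" .
  have "fadj (Jinc d n F b) * fkron d n A (F * fdiag n p * fadj F) =
      (\<Sum>c<n. p c *. ((fadj (Jinc d n F b) * Jinc d n F c) * A * fadj (Jinc d n F c)))"
    unfolding fkron_J_diag[OF Fc] sum_distrib_left by (simp add: mult.assoc)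
  also have "\<dots> = p b *. ((fadj (Jinc d n F b) * Jinc d n F b) * A * fadj (Jinc d n F b))"
    by (rule sum_delta_fm) (use F in \<open>auto simp: J_isom\<close>)
  also have "\<dots> = p b *. (A * fadj (Jinc d n F b))" using F A by (simp add: J_isom)
  finally show "fadj (Jinc d n F b) * fkron d n A (F * fdiag n p * fadj F) = p b *. (A * fadj (Jinc d n F b))" .
qed

lemma K_crn: "U \<in> crn (d * n) (d * n) ==> Kop d n F U b' b \<in> crn d d"
  unfolding Kop_def by (rule crn_mult[OF crn_mult[OF crn_fadj[OF Jinc_crn]] Jinc_crn])

text \<open>The two sums are blocks of U* U and of U U* in the product eigenbasis, by completeness
  of the isometries \<open>Jinc\<close>.\<close>

lemma K_isom: assumes F: "unitary n F" and U: "unitary (d * n) U" and b: "b < n" "c < n"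
  shows "(\<Sum>b'<n. fadj (Kop d n F U b' c) * Kop d n F U b' b) = (if c = b then fid d else 0)"
    and "(\<Sum>b'<n. Kop d n F U c b' * fadj (Kop d n F U b b')) = (if c = b then fid d else 0)"
proof -
  have Uc: "U \<in> crn (d * n) (d * n)" "fadj U * U = fid (d * n)" "U * fadj U = fid (d * n)" using U by (auto simp: unitary_def)
  let ?J = "Jinc d n F"
  have "(\<Sum>b'<n. fadj (Kop d n F U b' c) * Kop d n F U b' b) = fadj (?J c) * fadj U * (\<Sum>b'<n. ?J b' * fadj (?J b')) * U * ?J b"
    unfolding Kop_def sum_distrib_left sum_distrib_right by (simp add: fadj_mult mult.assoc)
  also have "\<dots> = fadj (?J c) * (fadj U * U) * ?J b"
    unfolding J_complete[OF F] using fid_multL[OF Uc(1)] by (simp add: mult.assoc)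
  also have "\<dots> = fadj (?J c) * ?J b" unfolding Uc using fid_multL[OF Jinc_crn] by (simp add: mult.assoc)
  finally show "(\<Sum>b'<n. fadj (Kop d n F U b' c) * Kop d n F U b' b) = (if c = b then fid d else 0)"
    unfolding J_isom[OF F b(2,1)] .
  have "(\<Sum>b'<n. Kop d n F U c b' * fadj (Kop d n F U b b')) = fadj (?J c) * U * (\<Sum>b'<n. ?J b' * fadj (?J b')) * fadj U * ?J b"
    unfolding Kop_def sum_distrib_left sum_distrib_right by (simp add: fadj_mult mult.assoc)
  also have "\<dots> = fadj (?J c) * (U * fadj U) * ?J b"
    unfolding J_complete[OF F] using fid_multL[OF crn_fadj[OF Uc(1)]] by (simp add: mult.assoc)
  also have "\<dots> = fadj (?J c) * ?J b" unfolding Uc using fid_multL[OF Jinc_crn] by (simp add: mult.assoc)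
  finally show "(\<Sum>b'<n. Kop d n F U c b' * fadj (Kop d n F U b b')) = (if c = b then fid d else 0)"
    unfolding J_isom[OF F b(2,1)] .
qed

text \<open>The block from b to b' of U (A \<otimes> G) = (A \<otimes> G) U, where G is diagonal in
  the basis F, carries one weight on each side.\<close>

lemma K_balance: assumes F: "unitary n F" "b < n" "b' < n" and A: "A \<in> crn d d"
  and c: "U * fkron d n A (F * fdiag n p * fadj F) = fkron d n A (F * fdiag n p * fadj F) * U"
  shows "p b *. (Kop d n F U b' b * A) = p b' *. (A * Kop d n F U b' b)"
proof -
  let ?J = "Jinc d n F" and ?G = "fkron d n A (F * fdiag n p * fadj F)"
  have "p b *. (Kop d n F U b' b * A) = fadj (?J b') * U * (?G * ?J b)"
    unfolding fkron_J(1)[OF F(1,2) A] by (simp add: Kop_def mult.assoc)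
  also have "\<dots> = fadj (?J b') * (U * ?G) * ?J b" by (simp add: mult.assoc)
  also have "\<dots> = (fadj (?J b') * ?G) * U * ?J b" unfolding c by (simp add: mult.assoc)
  also have "\<dots> = p b' *. (A * Kop d n F U b' b)"
    unfolding fkron_J(2)[OF F(1,3) A] by (simp add: Kop_def mult.assoc)
  finally show ?thesis .
qed

lemma channel_Kop: assumes F: "unitary n F"
  shows "(\<Sum>m<n. fadj (inc d n m) * (U * fkron d n X (F * fdiag n p * fadj F) * fadj U) * inc d n m) =
    Lm {..<n} (Kop d n F U) (\<lambda>b' b. p b) X"
proof -
  have Fc: "F \<in> crn n n" using F by (simp add: unitary_def)
  show ?thesis
    unfolding J_sandwich[OF F, symmetric]
    unfolding fkron_J_diag[OF Fc] Lm_def Kop_def sum_distrib_left sum_distrib_right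
    by (subst sum.swap) (simp add: fadj_mult mult.assoc)
qed

lemma flux_Kop: fixes e :: "nat => real" assumes F: "unitary n F" and U: "unitary (d * n) U"
  defines "H \<equiv> fkron d n (fid d) (F * fdiag n (\<lambda>b. of_real (e b)) * fadj F)"
  shows "(\<Sum>m<n. fadj (inc d n m) * (fkron d n (fid d) (F * fdiag n p * fadj F) * (fadj U * H * U - H)) * inc d n m) =
    Mm {..<n} (Kop d n F U) (\<lambda>b' b. p b * of_real (e b' - e b)) (fid d)"
proof -
  have Fc: "F \<in> crn n n" using F by (simp add: unitary_def)
  let ?J = "Jinc d n F"
  have Kid: "fadj (Kop d n F U b' b) * fid d = fadj (Kop d n F U b' b)" for b' b
    using fid_multR[OF crn_fadj[OF K_crn]] U unfolding unitary_def by blast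
  have 1: "fadj (?J b) * (fadj U * H * U) * ?J b = (\<Sum>b'<n. of_real (e b') *. (fadj (Kop d n F U b' b) * Kop d n F U b' b))" for b
    unfolding H_def fkron_J_diag[OF Fc] sum_distrib_left sum_distrib_right Kop_def
    by (intro sum.cong refl) (simp add: fadj_mult mult.assoc fid_multL[OF crn_fadj[OF Jinc_crn]] fid_multR[OF Jinc_crn])
  \<comment> \<open>\<open>K_isom\<close> writes the energy before the interaction as a sum over
    outgoing labels as well, so that it combines with the energy after it.\<close>
  have 2: "fadj (?J b) * H * ?J b = (\<Sum>b'<n. of_real (e b) *. (fadj (Kop d n F U b' b) * Kop d n F U b' b))" if b: "b < n" for b
  proof -
    have "fadj (?J b) * H * ?J b = of_real (e b) *. (fid d * fadj (?J b) * ?J b)"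
      unfolding H_def fkron_J(2)[OF F b crn_fid] by simp
    also have "\<dots> = of_real (e b) *. fid d"
      unfolding fid_multL[OF crn_fadj[OF Jinc_crn]] using J_isom[OF F b b] by simp
    also have "\<dots> = (\<Sum>b'<n. of_real (e b) *. (fadj (Kop d n F U b' b) * Kop d n F U b' b))"
      unfolding smul_sum_right[symmetric] K_isom(1)[OF F U b b] by simp
    finally show ?thesis .
  qed
  have "(\<Sum>m<n. fadj (inc d n m) * (fkron d n (fid d) (F * fdiag n p * fadj F) * (fadj U * H * U - H)) * inc d n m) =
     (\<Sum>b<n. fadj (?J b) * fkron d n (fid d) (F * fdiag n p * fadj F) * (fadj U * H * U - H) * ?J b)"
    unfolding J_sandwich[OF F, symmetric] by (simp add: mult.assoc)
  also have "\<dots> = (\<Sum>b<n. p b *. (fadj (?J b) * (fadj U * H * U) * ?J b - fadj (?J b) * H * ?J b))"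
  proof (intro sum.cong refl)
    fix b assume "b \<in> {..<n}"
    then have e: "fadj (?J b) * fkron d n (fid d) (F * fdiag n p * fadj F) = p b *. fadj (?J b)"
      using fkron_J(2)[OF F _ crn_fid, of b] fid_multL[OF crn_fadj[OF Jinc_crn]] by simp
    show "fadj (?J b) * fkron d n (fid d) (F * fdiag n p * fadj F) * (fadj U * H * U - H) * ?J b =
      p b *. (fadj (?J b) * (fadj U * H * U) * ?J b - fadj (?J b) * H * ?J b)"
      unfolding e by (simp add: left_diff_distrib right_diff_distrib mult.assoc fm.scale_right_diff_distrib)
  qed
  also have "\<dots> = (\<Sum>b<n. \<Sum>b'<n. (p b * of_real (e b' - e b)) *. (fadj (Kop d n F U b' b) * Kop d n F U b' b))"
    by (intro sum.cong refl)
      (simp add: 1 2 sum_subtractf[symmetric] smul_sum_right fm.scale_left_diff_distrib[symmetric] fm.scale_scale)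
  finally show ?thesis unfolding Mm_def Kid .
qed

section \<open>Antiunitary symmetries\<close>

lift_definition fcnj :: "fm => fm" is "\<lambda>f i j. cnj (f i j)" by auto
lemma ent_fcnj [simp]: "ent (fcnj X) i j = cnj (ent X i j)" by transfer simp
lemma fcnj_crn [simp]: "X \<in> crn m n ==> fcnj X \<in> crn m n"
  by (rule crnI) (auto dest: crnD1 crnD2)
lemma fcnj_fcnj [simp]: "fcnj (fcnj X) = X" by (rule fm_eqI) simp
lemma fcnj_add: "fcnj (X + Y) = fcnj X + fcnj Y" by (rule fm_eqI) simp
lemma fcnj_smul: "fcnj (c *. X) = cnj c *. fcnj X" by (rule fm_eqI) simp
lemma fcnj_sum: "fcnj (sum f A) = (\<Sum>a\<in>A. fcnj (f a))" by (rule fm_eqI) simp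
lemma fcnj_fadj: "fcnj (fadj X) = fadj (fcnj X)" by (rule fm_eqI) simp
lemma fcnj_fid [simp]: "fcnj (fid n) = fid n" by (rule fm_eqI) simp
lemma fcnj_inc [simp]: "fcnj (inc d n m) = inc d n m" by (rule fm_eqI) (simp add: inc_def)
lemma fcnj_mult: "fcnj (X * Y) = fcnj X * fcnj Y"
proof (rule fm_eqI)
  fix i j obtain n where X: "X \<in> crn n n" using crn_ex by blast
  then show "ent (fcnj (X * Y)) i j = ent (fcnj X * fcnj Y) i j"
    by (simp add: ent_multL[OF X] ent_multL[OF fcnj_crn[OF X]])
qed
lemma fcnj_fdiag: "fcnj (fdiag n l) = fdiag n (\<lambda>i. cnj (l i))" by (rule fm_eqI) simp
lemma ftr_fcnj: "ftr (fcnj X) = cnj (ftr X)"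
proof -
  obtain n where n: "X \<in> crn n n" using crn_ex by blast
  then show ?thesis by (simp add: ftr_crn[OF n(1)] ftr_crn[OF fcnj_crn[OF n]])
qed

text \<open>The automorphism X \<mapsto> \<theta> X \<theta>^-1 for the antiunitary \<theta> v =
  \<Theta> cnj v.\<close>

definition Tmap :: "fm => fm => fm" where "Tmap \<Theta> X = \<Theta> * fcnj X * fadj \<Theta>"
text \<open>\<open>\<Theta>\<close> is the matrix of the antiunitary involution $v\mapsto\Theta\bar v$.\<close>
definition conjugation :: "nat => fm => bool" where
  "conjugation d \<Theta> \<longleftrightarrow> unitary d \<Theta> \<and> \<Theta> * fcnj \<Theta> = fid d"

lemma Tmap_crn: "conjugation d \<Theta> ==> Tmap \<Theta> X \<in> crn d d"
  unfolding Tmap_def conjugation_def unitary_def using crn_mult crn_fadj crn_ex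
  by (metis (no_types, opaque_lifting) mult.assoc)
lemma Tmap_add: "Tmap \<Theta> (X + Y) = Tmap \<Theta> X + Tmap \<Theta> Y"
  by (simp add: Tmap_def fcnj_add ring_distribs)
lemma Tmap_smul: "Tmap \<Theta> (c *. X) = cnj c *. Tmap \<Theta> X" by (simp add: Tmap_def fcnj_smul)
lemma Tmap_fadj: "Tmap \<Theta> (fadj X) = fadj (Tmap \<Theta> X)" by (simp add: Tmap_def fcnj_fadj fadj_mult mult.assoc)
lemma Tmap_mult: assumes "conjugation d \<Theta>" "X \<in> crn d d" shows "Tmap \<Theta> (X * Y) = Tmap \<Theta> X * Tmap \<Theta> Y"
proof -
  have "Tmap \<Theta> X * Tmap \<Theta> Y = \<Theta> * (fcnj X * (fadj \<Theta> * \<Theta>)) * fcnj Y * fadj \<Theta>" by (simp add: Tmap_def mult.assoc)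
  also have "fadj \<Theta> * \<Theta> = fid d" using assms by (simp add: conjugation_def unitary_def)
  also have "fcnj X * fid d = fcnj X" by (rule fid_multR[OF fcnj_crn[OF assms(2)]])
  finally show ?thesis by (simp add: Tmap_def fcnj_mult mult.assoc)
qed
lemma Tmap_tr: assumes "conjugation d \<Theta>" "X \<in> crn d d" shows "ftr (Tmap \<Theta> X) = cnj (ftr X)"
proof -
  have "ftr (Tmap \<Theta> X) = ftr (fcnj X * (fadj \<Theta> * \<Theta>))" unfolding Tmap_def by (metis ftr_comm mult.assoc)
  also have "fadj \<Theta> * \<Theta> = fid d" using assms by (simp add: conjugation_def unitary_def)
  also have "fcnj X * fid d = fcnj X" by (rule fid_multR[OF fcnj_crn[OF assms(2)]])
  finally show ?thesis by (simp add: ftr_fcnj)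
qed
lemma Tmap_Tmap: assumes "conjugation d \<Theta>" "X \<in> crn d d" shows "Tmap \<Theta> (Tmap \<Theta> X) = X"
proof -
  have 1: "\<Theta> * fcnj \<Theta> = fid d" using assms by (simp add: conjugation_def)
  have "Tmap \<Theta> (Tmap \<Theta> X) = (\<Theta> * fcnj \<Theta>) * X * fadj (\<Theta> * fcnj \<Theta>)"
    by (simp add: Tmap_def fcnj_mult fcnj_fadj fadj_mult mult.assoc)
  then show ?thesis unfolding 1 using assms(2) by (simp add: fid_multR[OF assms(2)])
qed

lemma fkron_fcnj: "fcnj (fkron d n A G) = fkron d n (fcnj A) (fcnj G)"
  by (simp add: fkron_def fcnj_sum fcnj_smul fcnj_mult fcnj_fadj)

lemma conjugation_fkron: assumes "conjugation d \<Theta>" "conjugation n \<Theta>E"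
  shows "conjugation (d * n) (fkron d n \<Theta> \<Theta>E)"
  using assms unfolding conjugation_def unitary_def
  by (simp add: fkron_fadj fkron_fcnj fkron_mult fkron_fid)

lemma Tmap_fkron: assumes "conjugation d \<Theta>" "conjugation n \<Theta>E" "A \<in> crn d d" "G \<in> crn n n"
  shows "Tmap (fkron d n \<Theta> \<Theta>E) (fkron d n A G) = fkron d n (Tmap \<Theta> A) (Tmap \<Theta>E G)"
proof -
  have c: "\<Theta> \<in> crn d d" "\<Theta>E \<in> crn n n" using assms by (auto simp: conjugation_def unitary_def)
  show ?thesis unfolding Tmap_def fkron_fcnj fkron_fadj fkron_mult[OF c]
    by (subst fkron_mult) (use crn_mult[OF c(1) fcnj_crn[OF assms(3)]] crn_mult[OF c(2) fcnj_crn[OF assms(4)]] in auto)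
qed

text \<open>The product antiunitary sends v \<otimes> f to \<theta> v \<otimes> \<theta>E f. A block
  of U in the basis F therefore becomes a block of the reversed U, which is U*, in the image basis
  \<open>\<Theta>E * fcnj F\<close>; the adjoint turns U* back into U and exchanges the
  labels.\<close>

lemma Tmap_Kop: assumes \<Theta>: "conjugation d \<Theta>" "conjugation n \<Theta>E" and F: "unitary n F" and U: "U \<in> crn (d * n) (d * n)"
  and TU: "Tmap (fkron d n \<Theta> \<Theta>E) U = fadj U"
  shows "fadj (Tmap \<Theta> (Kop d n F U b b')) = Kop d n (\<Theta>E * fcnj F) U b' b"
proof -
  define P where "P = fkron d n \<Theta> \<Theta>E"
  have P: "conjugation (d * n) P" unfolding P_def by (rule conjugation_fkron[OF \<Theta>])
  then have PP: "fadj P * P = fid (d * n)" "P \<in> crn (d * n) (d * n)" by (auto simp: conjugation_def unitary_def)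
  have Tc: "\<Theta> \<in> crn d d" "\<Theta> * fadj \<Theta> = fid d" "\<Theta>E \<in> crn n n" using \<Theta> by (auto simp: conjugation_def unitary_def)
  let ?J = "Jinc d n F" and ?G = "Jinc d n (\<Theta>E * fcnj F)"
  have inc: "P * inc d n m = (\<Sum>m'<n. ent \<Theta>E m' m *. (inc d n m' * \<Theta>))" if m: "m < n" for m
  proof -
    have "P * inc d n m = (\<Sum>m'<n. \<Sum>k<n. ent \<Theta>E m' k *. (inc d n m' * \<Theta> * (fadj (inc d n k) * inc d n m)))"
      unfolding P_def fkron_def sum_distrib_right by (simp add: mult.assoc)
    also have "\<dots> = (\<Sum>m'<n. ent \<Theta>E m' m *. (inc d n m' * \<Theta> * (fadj (inc d n m) * inc d n m)))"
      by (intro sum.cong refl sum_delta_fm) (use m in \<open>auto simp: inc_isom\<close>)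
    finally show ?thesis using m by (simp add: inc_isom mult.assoc fid_multR[OF Tc(1)])
  qed
  have J: "P * fcnj (?J b) = ?G b * \<Theta>" for b
  proof -
    have "P * fcnj (?J b) = (\<Sum>m<n. cnj (ent F m b) *. (P * inc d n m))"
      unfolding Jinc_def by (simp add: fcnj_sum fcnj_smul sum_distrib_left)
    also have "\<dots> = (\<Sum>m<n. \<Sum>m'<n. (ent \<Theta>E m' m * cnj (ent F m b)) *. (inc d n m' * \<Theta>))"
      by (intro sum.cong refl) (simp add: inc smul_sum_right fm.scale_scale mult.commute)
    also have "\<dots> = (\<Sum>m'<n. \<Sum>m<n. (ent \<Theta>E m' m * cnj (ent F m b)) *. (inc d n m' * \<Theta>))" by (rule sum.swap)
    also have "\<dots> = ?G b * \<Theta>"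
      unfolding Jinc_def ent_multL[OF Tc(3)] by (simp add: sum_distrib_right smul_sum_left)
    finally show ?thesis .
  qed
  have J': "\<Theta> * fadj (fcnj (?J b)) = fadj (?G b) * P" for b
  proof -
    have "fadj (P * fcnj (?J b)) = fadj (?G b * \<Theta>)" using J by simp
    then have "fadj (fcnj (?J b)) * fadj P = fadj \<Theta> * fadj (?G b)" by (simp add: fadj_mult)
    then have "\<Theta> * (fadj (fcnj (?J b)) * fadj P) * P = \<Theta> * (fadj \<Theta> * fadj (?G b)) * P" by simp
    then have "\<Theta> * (fadj (fcnj (?J b)) * (fadj P * P)) = (\<Theta> * fadj \<Theta>) * fadj (?G b) * P" by (simp add: mult.assoc)
    then show ?thesis unfolding PP Tc
      using fid_multR[OF crn_fadj[OF fcnj_crn[OF Jinc_crn]], of d n F b] fid_multL[OF crn_fadj[OF Jinc_crn]] by simp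
  qed
  have J'': "fcnj (?J b) * fadj \<Theta> = fadj P * ?G b" for b
    using arg_cong[OF J'[of b], of fadj] by (simp add: fadj_mult)
  have "Tmap \<Theta> (Kop d n F U b b') = (\<Theta> * fadj (fcnj (?J b))) * fcnj U * (fcnj (?J b') * fadj \<Theta>)"
    unfolding Tmap_def Kop_def by (simp add: fcnj_mult fcnj_fadj mult.assoc)
  also have "\<dots> = fadj (?G b) * (Tmap P U) * ?G b'"
    unfolding J' J'' by (simp add: Tmap_def mult.assoc)
  also have "\<dots> = fadj (?G b) * fadj U * ?G b'" using TU unfolding P_def by simp
  finally show ?thesis by (simp add: Kop_def fadj_mult mult.assoc)
qed

lemma unitary_mult_fcnj: assumes "conjugation n \<Theta>" "unitary n F" shows "unitary n (\<Theta> * fcnj F)"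
proof -
  have c: "\<Theta> \<in> crn n n" "F \<in> crn n n" using assms by (auto simp: conjugation_def unitary_def)
  have "fcnj F * fadj (fcnj F) = fcnj (F * fadj F)" "fadj (fcnj F) * fcnj F = fcnj (fadj F * F)" by (simp_all add: fcnj_mult fcnj_fadj)
  then have f: "fcnj F * fadj (fcnj F) = fid n" "fadj (fcnj F) * fcnj F = fid n" using assms by (auto simp: unitary_def)
  have "(\<Theta> * fcnj F) * fadj (\<Theta> * fcnj F) = \<Theta> * (fcnj F * fadj (fcnj F)) * fadj \<Theta>"
    "fadj (\<Theta> * fcnj F) * (\<Theta> * fcnj F) = fadj (fcnj F) * (fadj \<Theta> * \<Theta>) * fcnj F" by (simp_all add: fadj_mult mult.assoc)
  moreover have "\<Theta> * fid n = \<Theta>" "fid n * fcnj F = fcnj F" 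
    using fid_multR[OF c(1)] fid_multL[OF fcnj_crn[OF c(2)]] by auto
  ultimately show ?thesis using assms c f crn_mult[OF c(1) fcnj_crn[OF c(2)]]
    unfolding unitary_def conjugation_def by (auto simp: mult.assoc)
qed

lemma Tmap_conj_fdiag: "Tmap \<Theta> (F * fdiag n l * fadj F) = (\<Theta> * fcnj F) * fdiag n (\<lambda>i. cnj (l i)) * fadj (\<Theta> * fcnj F)"
  by (simp add: Tmap_def fcnj_mult fcnj_fdiag fcnj_fadj fadj_mult mult.assoc)

section \<open>Reservoirs\<close>

text \<open>The eigenbasis stays a parameter: time reversal maps it to another eigenbasis with the
  same energies, and quantities defined without a basis may be computed in either.\<close>

definition eigbasis :: "qsys => (nat => fm) => (nat => nat => real) => bool" where
  "eigbasis Q F e \<longleftrightarrow> (\<forall>j\<in>{1..nres Q}. unitary (edim Q j) (F j) \<and>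
     emb (hE Q j) = F j * fdiag (edim Q j) (\<lambda>b. of_real (e j b)) * fadj (F j))"

lemma ex_eigbasis: assumes "standing Q" shows "\<exists>F e. eigbasis Q F e"
proof -
  have "\<forall>j\<in>{1..nres Q}. \<exists>p. unitary (edim Q j) (fst p) \<and>
     emb (hE Q j) = fst p * fdiag (edim Q j) (\<lambda>b. of_real (snd p b)) * fadj (fst p)"
  proof
    fix j assume "j \<in> {1..nres Q}"
    then have "hermitian (edim Q j) (hE Q j)" using assms by (simp add: standing_def)
    then have h: "emb (hE Q j) \<in> crn (edim Q j) (edim Q j)" "fadj (emb (hE Q j)) = emb (hE Q j)"
      using hermitian_emb by auto
    obtain U l where "unitary (edim Q j) U" "emb (hE Q j) = U * fdiag (edim Q j) (\<lambda>i. of_real (l i)) * fadj U"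
      by (rule herm_diag[OF h])
    then show "\<exists>p. unitary (edim Q j) (fst p) \<and>
       emb (hE Q j) = fst p * fdiag (edim Q j) (\<lambda>b. of_real (snd p b)) * fadj (fst p)"
      by (intro exI[of _ "(U, l)"]) simp
  qed
  from bchoice[OF this] obtain p where "\<forall>j\<in>{1..nres Q}. unitary (edim Q j) (fst (p j)) \<and>
     emb (hE Q j) = fst (p j) * fdiag (edim Q j) (\<lambda>b. of_real (snd (p j) b)) * fadj (fst (p j))"
    by (elim exE) (rule that)
  then show ?thesis unfolding eigbasis_def by (intro exI[of _ "\<lambda>j. fst (p j)"] exI[of _ "\<lambda>j. snd (p j)"])
qed

abbreviation KQ where "KQ Q F j \<equiv> Kop (sdim Q) (edim Q j) (F j) (emb (Uop Q j))"
abbreviation pQ where "pQ Q e \<zeta> j \<equiv> gibbs_weight (edim Q j) (e j) (beta Q \<zeta> j)"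

lemma gibbs_weight_pos: "n > 0 ==> gibbs_weight n e \<beta> b > 0"
  unfolding gibbs_weight_def by (intro divide_pos_pos sum_pos) auto
lemma gibbs_weight_sum: "n > 0 ==> (\<Sum>b<n. gibbs_weight n e \<beta> b) = 1"
proof -
  assume "n > 0"
  then have "(\<Sum>c<n. exp (- \<beta> * e c)) > 0" by (intro sum_pos) auto
  then show ?thesis unfolding gibbs_weight_def sum_divide_distrib[symmetric] by simp
qed

text \<open>Lowering \<beta> weights each level by its energy, and the derivative of the partition
  function subtracts the mean energy.\<close>

lemma gibbs_weight_deriv:
  assumes "n > 0"
  shows "((\<lambda>t. gibbs_weight n e (\<beta> - t) b) has_real_derivative
     gibbs_weight n e \<beta> b * (e b - (\<Sum>c<n. gibbs_weight n e \<beta> c * e c))) (at 0)"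
proof -
  define Z where "Z = (\<Sum>c<n. exp (- \<beta> * e c))"
  have Z: "Z > 0" using assms unfolding Z_def by (intro sum_pos) auto
  have "((\<lambda>t. exp (- (\<beta> - t) * e b) / (\<Sum>c<n. exp (- (\<beta> - t) * e c))) has_real_derivative
     (exp (- \<beta> * e b) * e b * Z - exp (- \<beta> * e b) * (\<Sum>c<n. exp (- \<beta> * e c) * e c)) / (Z * Z)) (at 0)"
    using Z unfolding Z_def by (auto intro!: derivative_eq_intros)
  moreover have "(exp (- \<beta> * e b) * e b * Z - exp (- \<beta> * e b) * (\<Sum>c<n. exp (- \<beta> * e c) * e c)) / (Z * Z) =
     gibbs_weight n e \<beta> b * (e b - (\<Sum>c<n. gibbs_weight n e \<beta> c * e c))"
  proof -
    have "(\<Sum>c<n. gibbs_weight n e \<beta> c * e c) = (\<Sum>c<n. exp (- \<beta> * e c) * e c) / Z"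
      unfolding gibbs_weight_def Z_def by (simp add: sum_divide_distrib)
    moreover have "gibbs_weight n e \<beta> b = exp (- \<beta> * e b) / Z" by (simp add: gibbs_weight_def Z_def)
    moreover have "(x * y * Z - x * S) / (Z * Z) = x / Z * (y - S / Z)" for x y S using Z by (simp add: field_simps)
    ultimately show ?thesis by simp
  qed
  ultimately show ?thesis unfolding gibbs_weight_def by simp
qed

locale qs =
  fixes Q :: qsys and F :: "nat => fm" and e :: "nat => nat => real"
  assumes st: "standing Q" and eb: "eigbasis Q F e"
begin

abbreviation d where "d \<equiv> sdim Q"
abbreviation M where "M \<equiv> nres Q"
abbreviation n where "n \<equiv> edim Q"
abbreviation K where "K \<equiv> KQ Q F"
abbreviation p where "p \<equiv> pQ Q e"

lemma dpos: "d > 0" and M2: "M \<ge> 2" using st by (auto simp: standing_def)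
lemma npos: "j \<in> {1..M} ==> n j > 0" using st by (auto simp: standing_def)
lemma Fu: "j \<in> {1..M} ==> unitary (n j) (F j)"
  and Fe: "j \<in> {1..M} ==> emb (hE Q j) = F j * fdiag (n j) (\<lambda>b. of_real (e j b)) * fadj (F j)"
  using eb by (auto simp: eigbasis_def)
lemma hE_c: "j \<in> {1..M} ==> hE Q j \<in> carrier_mat (n j) (n j)"
  using st by (auto simp: standing_def hermitian_def)
lemma hS_c: "hS Q \<in> carrier_mat d d" and V_c: "j \<in> {1..M} ==> vint Q j \<in> carrier_mat (d * n j) (d * n j)"
  using st by (auto simp: standing_def hermitian_def)

definition Htot :: "nat => complex mat" where
  "Htot j = kron (hS Q) (1\<^sub>m (n j)) + kron (1\<^sub>m d) (hE Q j) + vint Q j"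

lemma Htot_c: "j \<in> {1..M} ==> Htot j \<in> carrier_mat (d * n j) (d * n j)"
  unfolding Htot_def using kron_carrier[OF hS_c one_carrier_mat] kron_carrier[OF one_carrier_mat hE_c] V_c by auto

lemma Htot_emb: assumes j: "j \<in> {1..M}"
  shows "emb (Htot j) = fkron d (n j) (emb (hS Q)) (fid (n j)) + fkron d (n j) (fid d) (emb (hE Q j)) + emb (vint Q j)"
proof -
  have "kron (hS Q) (1\<^sub>m (n j)) \<in> carrier_mat (d * n j) (d * n j)" "kron (1\<^sub>m d) (hE Q j) \<in> carrier_mat (d * n j) (d * n j)"
    using kron_carrier[OF hS_c one_carrier_mat] kron_carrier[OF one_carrier_mat hE_c[OF j]] by auto
  then show ?thesis unfolding Htot_def using V_c[OF j]
    by (simp add: emb_add[of _ "d * n j" "d * n j"] kron_emb[OF hS_c one_carrier_mat] kron_emb[OF one_carrier_mat hE_c[OF j]] emb_one)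
qed

lemma Htot_herm: assumes j: "j \<in> {1..M}" shows "fadj (emb (Htot j)) = emb (Htot j)"
proof -
  have "hermitian d (hS Q)" "hermitian (n j) (hE Q j)" "hermitian (d * n j) (vint Q j)"
    using st j by (auto simp: standing_def)
  note this[THEN hermitian_emb, THEN conjunct2]
  then show ?thesis unfolding Htot_emb[OF j] by (simp add: fadj_add fkron_fadj)
qed

lemma Uop_diag: assumes j: "j \<in> {1..M}" and U: "unitary (d * n j) U" "emb (Htot j) = U * fdiag (d * n j) (\<lambda>i. of_real (l i)) * fadj U"
  shows "emb (Uop Q j) = U * fdiag (d * n j) (\<lambda>i. exp (- \<i> * of_real (tau Q j) * of_real (l i))) * fadj U" "Uop Q j \<in> carrier_mat (d * n j) (d * n j)"
  using mexp_smult_emb[OF U Htot_c[OF j], of "- \<i> * complex_of_real (tau Q j)"] unfolding Uop_def Htot_def by auto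

lemma ex_Htot_diag: assumes j: "j \<in> {1..M}"
  obtains U l where "unitary (d * n j) U" "emb (Htot j) = U * fdiag (d * n j) (\<lambda>i. of_real (l i)) * fadj U"
  by (rule herm_diag[OF emb_crn[OF Htot_c[OF j]] Htot_herm[OF j]])

lemma U_c: "j \<in> {1..M} ==> Uop Q j \<in> carrier_mat (d * n j) (d * n j)"
  using Uop_diag ex_Htot_diag by metis

lemma Uu: assumes j: "j \<in> {1..M}" shows "unitary (d * n j) (emb (Uop Q j))"
proof -
  obtain U l where U: "unitary (d * n j) U" "emb (Htot j) = U * fdiag (d * n j) (\<lambda>i. of_real (l i)) * fadj U"
    by (rule ex_Htot_diag[OF j])
  have Uc: "U \<in> crn (d * n j) (d * n j)" "U * fadj U = fid (d * n j)" "fadj U * U = fid (d * n j)" using U by (auto simp: unitary_def)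
  let ?D = "fdiag (d * n j) (\<lambda>i. exp (- \<i> * of_real (tau Q j) * of_real (l i)))"
  have DD: "?D * fadj ?D = fid (d * n j)" "fadj ?D * ?D = fid (d * n j)"
    unfolding fadj_fdiag fdiag_mult fdiag_one[symmetric]
    by (rule fm_eqI; simp add: exp_cnj flip: exp_add)+
  have e: "emb (Uop Q j) = U * ?D * fadj U" by (rule Uop_diag[OF j U])
  have "(U * ?D * fadj U) * fadj (U * ?D * fadj U) = U * (?D * ((fadj U * U) * fadj ?D)) * fadj U"
    "fadj (U * ?D * fadj U) * (U * ?D * fadj U) = U * (fadj ?D * ((fadj U * U) * ?D)) * fadj U"
    by (simp_all add: fadj_mult mult.assoc)
  then show ?thesis
    unfolding unitary_def e using Uc DD fid_multL[OF crn_fdiag] fid_multL[OF crn_fadj[OF crn_fdiag]]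
      crn_mult[OF crn_mult[OF Uc(1) crn_fdiag] crn_fadj[OF Uc(1)]] by (simp add: fid_multR[OF Uc(1)])
qed

lemma rhoE_emb: assumes j: "j \<in> {1..M}"
  shows "emb (rhoE Q \<zeta> j) = F j * fdiag (n j) (\<lambda>b. of_real (p \<zeta> j b)) * fadj (F j)" "rhoE Q \<zeta> j \<in> carrier_mat (n j) (n j)"
  unfolding rhoE_def using gibbs_emb[OF Fu[OF j] Fe[OF j] hE_c[OF j]] by auto

lemma Lch_c: "Lch Q \<zeta> j X \<in> carrier_mat d d" by (simp add: Lch_def ptrace2_def)
lemma Lch_emb: assumes j: "j \<in> {1..M}" and X: "X \<in> carrier_mat d d"
  shows "emb (Lch Q \<zeta> j X) = Lm {..<n j} (K j) (\<lambda>b' b. of_real (p \<zeta> j b)) (emb X)"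
proof -
  have k: "kron X (rhoE Q \<zeta> j) \<in> carrier_mat (d * n j) (d * n j)" by (rule kron_carrier[OF X rhoE_emb(2)[OF j]])
  have "emb (Uop Q j * kron X (rhoE Q \<zeta> j) * adj (Uop Q j)) = emb (Uop Q j) * fkron d (n j) (emb X) (emb (rhoE Q \<zeta> j)) * fadj (emb (Uop Q j))"
    using U_c[OF j] k
    by (simp add: emb_mult[of _ "d * n j" "d * n j" _ "d * n j"] adj_carrier emb_adj kron_emb[OF X rhoE_emb(2)[OF j]])
  moreover have "Uop Q j * kron X (rhoE Q \<zeta> j) * adj (Uop Q j) \<in> carrier_mat (d * n j) (d * n j)"
    by (rule mult_carrier_mat[OF mult_carrier_mat[OF U_c[OF j] k] adj_carrier[OF U_c[OF j]]])
  ultimately show ?thesis unfolding Lch_def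
    by (subst ptrace2_emb) (auto simp: rhoE_emb[OF j] channel_Kop[OF Fu[OF j]])
qed

lemma K_c [simp]: "j \<in> {1..M} ==> K j b' b \<in> crn d d" by (rule K_crn[OF emb_crn[OF U_c]])

lemma Mm_K_c: "j \<in> {1..M} ==> X \<in> crn d d ==> Mm A (K j) \<phi> X \<in> crn d d"
  unfolding Mm_def by (intro crn_sum crn_smul crn_mult[of _ d d _ d] crn_fadj K_c)
lemma Lm_K_c: "j \<in> {1..M} ==> X \<in> crn d d ==> Lm A (K j) \<phi> X \<in> crn d d"
  unfolding Lm_def by (intro crn_sum crn_smul crn_mult[of _ d d _ d] crn_fadj K_c)

text \<open>\<open>dual_map\<close> is defined by a description; nondegeneracy of the trace pairing
  provides its uniqueness.\<close>

lemma Ldual_emb: assumes j: "j \<in> {1..M}" and X: "X \<in> carrier_mat d d"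
  shows "emb (Ldual Q \<zeta> j X) = Mm {..<n j} (K j) (\<lambda>b' b. of_real (p \<zeta> j b)) (emb X)" "Ldual Q \<zeta> j X \<in> carrier_mat d d"
proof -
  define Y where "Y = unm d d (Mm {..<n j} (K j) (\<lambda>b' b. of_real (p \<zeta> j b)) (emb X))"
  have Y: "Y \<in> carrier_mat d d" "emb Y = Mm {..<n j} (K j) (\<lambda>b' b. of_real (p \<zeta> j b)) (emb X)"
    unfolding Y_def using emb_unm[OF Mm_K_c[OF j emb_crn[OF X]]] by auto
  have tr: "mtrace (A * B) = ftr (emb A * emb B)" if "A \<in> carrier_mat d d" "B \<in> carrier_mat d d" for A B
    using that by (simp add: mtrace_emb[of _ d] emb_mult[of _ d d _ d])
  have "Ldual Q \<zeta> j X = Y" unfolding Ldual_def dual_map_def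
  proof (rule the_equality, intro conjI ballI)
    show "mtrace (Lch Q \<zeta> j \<rho> * X) = mtrace (\<rho> * Y)" if "\<rho> \<in> carrier_mat d d" for \<rho>
      unfolding tr[OF Lch_c X] tr[OF that Y(1)] Lch_emb[OF j that] tr_Lm_Mm Y(2) ..
    fix Y' assume Y': "Y' \<in> carrier_mat d d \<and> (\<forall>\<rho>\<in>carrier_mat d d. mtrace (Lch Q \<zeta> j \<rho> * X) = mtrace (\<rho> * Y'))"
    have "emb Y' = emb Y"
    proof (rule ftr_eqI)
      show "emb Y' \<in> crn d d" using Y' emb_crn by blast
      show "emb Y \<in> crn d d" by (rule emb_crn[OF Y(1)])
      fix W assume W: "W \<in> crn d d"
      have "mtrace (unm d d W * Y') = mtrace (Lch Q \<zeta> j (unm d d W) * X)" using Y' by simp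
      also have "\<dots> = mtrace (unm d d W * Y)"
        unfolding tr[OF Lch_c X] tr[OF unm_carrier Y(1)] Lch_emb[OF j unm_carrier] tr_Lm_Mm Y(2) ..
      finally show "ftr (W * emb Y') = ftr (W * emb Y)" using Y' Y by (simp add: tr emb_unm[OF W])
    qed
    then show "Y' = Y" using emb_inj Y Y' by blast
  qed (rule Y)
  then show "emb (Ldual Q \<zeta> j X) = Mm {..<n j} (K j) (\<lambda>b' b. of_real (p \<zeta> j b)) (emb X)" "Ldual Q \<zeta> j X \<in> carrier_mat d d"
    using Y by auto
qed

lemma Phi_c: "Phi Q \<zeta> j \<in> carrier_mat d d" by (simp add: Phi_def ptrace2_def)
text \<open>The minus sign of the flux is absorbed into \<open>e j b - e j b'\<close>, the energy
  that the probe loses.\<close>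

lemma Phi_emb: assumes j: "j \<in> {1..M}"
  shows "emb (Phi Q \<zeta> j) = of_real (1 / Ttot Q) *. Mm {..<n j} (K j) (\<lambda>b' b. of_real (p \<zeta> j b) * of_real (e j b - e j b')) (fid d)"
proof -
  let ?N = "d * n j"
  let ?H = "kron (1\<^sub>m d) (hE Q j)" and ?R = "kron (1\<^sub>m d) (rhoE Q \<zeta> j)"
  have c: "?H \<in> carrier_mat ?N ?N" "?R \<in> carrier_mat ?N ?N"
    by (auto intro: kron_carrier[OF one_carrier_mat hE_c[OF j]] kron_carrier[OF one_carrier_mat rhoE_emb(2)[OF j]])
  have U: "Uop Q j \<in> carrier_mat ?N ?N" "adj (Uop Q j) \<in> carrier_mat ?N ?N" using U_c[OF j] adj_carrier by auto
  have c1: "adj (Uop Q j) * ?H \<in> carrier_mat ?N ?N" by (rule mult_carrier_mat[OF U(2) c(1)])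
  have c2: "adj (Uop Q j) * ?H * Uop Q j \<in> carrier_mat ?N ?N" by (rule mult_carrier_mat[OF c1 U(1)])
  have c3: "adj (Uop Q j) * ?H * Uop Q j - ?H \<in> carrier_mat ?N ?N" using c(1) by (rule minus_carrier_mat)
  have c4: "?R * (adj (Uop Q j) * ?H * Uop Q j - ?H) \<in> carrier_mat ?N ?N" by (rule mult_carrier_mat[OF c(2) c3])
  have "emb (?R * (adj (Uop Q j) * ?H * Uop Q j - ?H)) =
     fkron d (n j) (fid d) (emb (rhoE Q \<zeta> j)) * (fadj (emb (Uop Q j)) * fkron d (n j) (fid d) (emb (hE Q j)) * emb (Uop Q j) - fkron d (n j) (fid d) (emb (hE Q j)))"
    by (simp only: emb_mult[OF c(2) c3] emb_diff[OF c2 c(1)] emb_mult[OF c1 U(1)] emb_mult[OF U(2) c(1)] emb_adj emb_one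
      kron_emb[OF one_carrier_mat rhoE_emb(2)[OF j]] kron_emb[OF one_carrier_mat hE_c[OF j]])
  then have "emb (Phi Q \<zeta> j) = of_real (- 1 / Ttot Q) *. Mm {..<n j} (K j) (\<lambda>b' b. of_real (p \<zeta> j b) * of_real (e j b' - e j b)) (fid d)"
    unfolding Phi_def emb_smult
    by (simp only: ptrace2_emb[OF c4] rhoE_emb[OF j] Fe[OF j] flux_Kop[OF Fu[OF j] Uu[OF j]])
  also have "\<dots> = of_real (1 / Ttot Q) *. ((-1) *. Mm {..<n j} (K j) (\<lambda>b' b. of_real (p \<zeta> j b) * of_real (e j b' - e j b)) (fid d))"
    by (simp add: fm.scale_scale)
  also have "(-1) *. Mm {..<n j} (K j) (\<lambda>b' b. of_real (p \<zeta> j b) * of_real (e j b' - e j b)) (fid d) =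
     Mm {..<n j} (K j) (\<lambda>b' b. of_real (p \<zeta> j b) * of_real (e j b - e j b')) (fid d)"
    unfolding Mm_smul_wt[symmetric] by (intro Mm_cong) (simp add: algebra_simps)
  finally show ?thesis .
qed

text \<open>(NE) at 0 makes the product of a system state and the Gibbs state commute with U. The
  blocks of this relation are given by \<open>K_balance\<close>, with one system state for all
  reservoirs.\<close>

lemma NE_balance: assumes ne: "NE Q"
  obtains r where "r \<in> crn d d" "fpsd r" "ftr r = 1"
    "\<And>j b b'. j \<in> {1..M} ==> b < n j ==> b' < n j ==>
       of_real (p (\<lambda>_. 0) j b) *. (K j b' b * r) = of_real (p (\<lambda>_. 0) j b') *. (r * K j b' b)"
proof -
  obtain \<rho>p where \<rho>p: "\<And>z::real. state d (\<rho>p z)" "\<And>z j. j \<in> {1..M} ==>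
      Uop Q j * kron (\<rho>p z) (gibbs (hE Q j) (bref Q - z)) * adj (Uop Q j) = kron (\<rho>p z) (gibbs (hE Q j) (bref Q - z))"
    using ne unfolding NE_def by blast
  define R where "R = \<rho>p 0"
  have R: "R \<in> carrier_mat d d" "fpsd (emb R)" "ftr (emb R) = 1" using \<rho>p(1)[of 0] by (auto simp: R_def state_emb)
  have "of_real (p (\<lambda>_. 0) j b) *. (K j b' b * emb R) = of_real (p (\<lambda>_. 0) j b') *. (emb R * K j b' b)"
    if j: "j \<in> {1..M}" and b: "b < n j" "b' < n j" for j b b'
  proof -
    let ?N = "d * n j" and ?G = "rhoE Q (\<lambda>_. 0) j"
    have U: "Uop Q j \<in> carrier_mat ?N ?N" "adj (Uop Q j) \<in> carrier_mat ?N ?N" using U_c[OF j] adj_carrier by auto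
    have k: "kron R ?G \<in> carrier_mat ?N ?N" by (rule kron_carrier[OF R(1) rhoE_emb(2)[OF j]])
    have e0: "Uop Q j * kron R ?G * adj (Uop Q j) = kron R ?G" using \<rho>p(2)[OF j, of 0] by (simp add: R_def rhoE_def beta_def)
    have "emb (Uop Q j) * fkron d (n j) (emb R) (emb ?G) * fadj (emb (Uop Q j)) = fkron d (n j) (emb R) (emb ?G)"
      using arg_cong[OF e0, of emb] U k by (simp add: emb_mult[of _ ?N ?N _ ?N] emb_adj kron_emb[OF R(1) rhoE_emb(2)[OF j]] mult.assoc)
    then have "emb (Uop Q j) * fkron d (n j) (emb R) (emb ?G) * (fadj (emb (Uop Q j)) * emb (Uop Q j)) = fkron d (n j) (emb R) (emb ?G) * emb (Uop Q j)"
      by (metis mult.assoc)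
    then have "emb (Uop Q j) * fkron d (n j) (emb R) (emb ?G) = fkron d (n j) (emb R) (emb ?G) * emb (Uop Q j)"
      using Uu[OF j] crn_mult[OF emb_crn[OF U(1)] fkron_crn] by (simp add: unitary_def fid_multR[of _ ?N ?N])
    then show ?thesis
      using K_balance[OF Fu[OF j] b emb_crn[OF R(1)], of "emb (Uop Q j)" "\<lambda>b. of_real (p (\<lambda>_. 0) j b)"]
      unfolding rhoE_emb[OF j] by simp
  qed
  then show ?thesis using that[of "emb R"] R emb_crn by blast
qed

end

section \<open>Successive interactions with several reservoirs\<close>

context qs
begin

text \<open>A list of reservoirs stands for successive interactions, its head being the earliest; a
  word holds one probe label for each of them. The combined family \<open>Kw\<close> obeys the same
  axioms as a single interaction, so a whole cycle is treated as one step.\<close>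

primrec Bw :: "nat list => nat list set" where
  "Bw [] = {[]}"
| "Bw (j # js) = (\<lambda>(b, bs). b # bs) ` ({..<n j} \<times> Bw js)"
primrec Kw :: "nat list => nat list => nat list => fm" where
  "Kw [] b' b = fid d"
| "Kw (j # js) b' b = Kw js (tl b') (tl b) * K j (hd b') (hd b)"
primrec wprod :: "(nat => nat => real) => nat list => nat list => real" where
  "wprod f [] bs = 1"
| "wprod f (j # js) bs = f j (hd bs) * wprod f js (tl bs)"
primrec wphi :: "(nat => nat => nat => complex) => nat list => nat list => nat list => complex" where
  "wphi \<phi> [] b' b = 1"
| "wphi \<phi> (j # js) b' b = \<phi> j (hd b') (hd b) * wphi \<phi> js (tl b') (tl b)"
primrec hsum :: "(nat => nat => real) => nat list => nat list => real" where
  "hsum g [] bs = 0"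
| "hsum g (j # js) bs = g j (hd bs) + hsum g js (tl bs)"

lemma finite_Bw [simp]: "finite (Bw js)" by (induction js) auto

lemma sum_Bw: "(\<Sum>x\<in>Bw (j # js). f x) = (\<Sum>b<n j. \<Sum>bs\<in>Bw js. f (b # bs))"
proof -
  have "inj_on (\<lambda>(b, bs). b # bs) ({..<n j} \<times> Bw js)" by (auto simp: inj_on_def)
  then have "(\<Sum>x\<in>Bw (j # js). f x) = (\<Sum>x\<in>{..<n j} \<times> Bw js. f (fst x # snd x))"
    by (simp add: sum.reindex case_prod_unfold)
  then show ?thesis by (simp add: sum.cartesian_product case_prod_unfold)
qed

lemma Kw_crn: "set js \<subseteq> {1..M} ==> Kw js b' b \<in> crn d d"
proof (induction js arbitrary: b' b)
  case (Cons j js) then show ?case by (auto intro!: crn_mult[of _ d d _ d])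
qed simp

text \<open>The product form of the weights \<open>wphi\<close> lets the sum over words factor into
  one channel after another, the head being applied first. For the dual, in \<open>Mm_Bw\<close>,
  the order is opposite.\<close>

lemma Lm_Bw: "set js \<subseteq> {1..M} ==> X \<in> crn d d ==>
    Lm (Bw js) (Kw js) (wphi \<phi> js) X = foldl (\<lambda>X j. Lm {..<n j} (K j) (\<phi> j) X) X js"
proof (induction js arbitrary: X)
  case Nil
  then show ?case by (simp add: Lm_def fid_multR[of X d d])
next
  case (Cons j js)
  have j: "j \<in> {1..M}" and js: "set js \<subseteq> {1..M}" using Cons.prems by auto
  have "Lm (Bw (j # js)) (Kw (j # js)) (wphi \<phi> (j # js)) X =
     (\<Sum>b<n j. \<Sum>bs\<in>Bw js. \<Sum>b'<n j. \<Sum>bs'\<in>Bw js. (\<phi> j b' b * wphi \<phi> js bs' bs) *.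
       (Kw js bs' bs * (K j b' b * X * fadj (K j b' b)) * fadj (Kw js bs' bs)))"
    unfolding Lm_def sum_Bw by (simp add: fadj_mult mult.assoc)
  also have "\<dots> = (\<Sum>b<n j. \<Sum>b'<n j. \<phi> j b' b *. Lm (Bw js) (Kw js) (wphi \<phi> js) (K j b' b * X * fadj (K j b' b)))"
  proof (rule sum.cong[OF refl])
    fix b
    have "(\<Sum>bs\<in>Bw js. \<Sum>b'<n j. \<Sum>bs'\<in>Bw js. (\<phi> j b' b * wphi \<phi> js bs' bs) *. (Kw js bs' bs * (K j b' b * X * fadj (K j b' b)) * fadj (Kw js bs' bs))) =
      (\<Sum>b'<n j. \<Sum>bs\<in>Bw js. \<Sum>bs'\<in>Bw js. (\<phi> j b' b * wphi \<phi> js bs' bs) *. (Kw js bs' bs * (K j b' b * X * fadj (K j b' b)) * fadj (Kw js bs' bs)))"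
      by (rule sum.swap)
    then show "(\<Sum>bs\<in>Bw js. \<Sum>b'<n j. \<Sum>bs'\<in>Bw js. (\<phi> j b' b * wphi \<phi> js bs' bs) *. (Kw js bs' bs * (K j b' b * X * fadj (K j b' b)) * fadj (Kw js bs' bs))) =
      (\<Sum>b'<n j. \<phi> j b' b *. Lm (Bw js) (Kw js) (wphi \<phi> js) (K j b' b * X * fadj (K j b' b)))"
      by (simp add: Lm_def smul_sum_right fm.scale_scale)
  qed
  also have "\<dots> = Lm (Bw js) (Kw js) (wphi \<phi> js) (Lm {..<n j} (K j) (\<phi> j) X)"
  proof -
    have s: "Lm A k \<psi> (sum f B) = (\<Sum>b\<in>B. Lm A k \<psi> (f b))" for A :: "nat list set" and k \<psi> f and B :: "nat set"
      by (induction B rule: infinite_finite_induct) (auto simp: Lm_add)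
    show ?thesis unfolding Lm_def[of "{..<n j}"] s Lm_smul ..
  qed
  also have "\<dots> = foldl (\<lambda>X j. Lm {..<n j} (K j) (\<phi> j) X) (Lm {..<n j} (K j) (\<phi> j) X) js"
    by (rule Cons.IH[OF js Lm_K_c[OF j Cons.prems(2)]])
  finally show ?case by (simp only: foldl.simps)
qed

lemma Mm_Bw: "set js \<subseteq> {1..M} ==> X \<in> crn d d ==>
    Mm (Bw js) (Kw js) (wphi \<phi> js) X = foldr (\<lambda>j Y. Mm {..<n j} (K j) (\<phi> j) Y) js X"
proof (induction js)
  case Nil
  then show ?case by (simp add: Mm_def fid_multR[of X d d])
next
  case (Cons j js)
  have j: "j \<in> {1..M}" and js: "set js \<subseteq> {1..M}" using Cons.prems by auto
  have "Mm (Bw (j # js)) (Kw (j # js)) (wphi \<phi> (j # js)) X =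
     (\<Sum>b<n j. \<Sum>bs\<in>Bw js. \<Sum>b'<n j. \<Sum>bs'\<in>Bw js. (\<phi> j b' b * wphi \<phi> js bs' bs) *.
       (fadj (K j b' b) * (fadj (Kw js bs' bs) * X * Kw js bs' bs) * K j b' b))"
    unfolding Mm_def sum_Bw by (simp add: fadj_mult mult.assoc)
  also have "\<dots> = (\<Sum>b<n j. \<Sum>b'<n j. \<phi> j b' b *. (fadj (K j b' b) * Mm (Bw js) (Kw js) (wphi \<phi> js) X * K j b' b))"
  proof (rule sum.cong[OF refl])
    fix b
    have "(\<Sum>bs\<in>Bw js. \<Sum>b'<n j. \<Sum>bs'\<in>Bw js. (\<phi> j b' b * wphi \<phi> js bs' bs) *. (fadj (K j b' b) * (fadj (Kw js bs' bs) * X * Kw js bs' bs) * K j b' b)) =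
      (\<Sum>b'<n j. \<Sum>bs\<in>Bw js. \<Sum>bs'\<in>Bw js. (\<phi> j b' b * wphi \<phi> js bs' bs) *. (fadj (K j b' b) * (fadj (Kw js bs' bs) * X * Kw js bs' bs) * K j b' b))"
      by (rule sum.swap)
    then show "(\<Sum>bs\<in>Bw js. \<Sum>b'<n j. \<Sum>bs'\<in>Bw js. (\<phi> j b' b * wphi \<phi> js bs' bs) *. (fadj (K j b' b) * (fadj (Kw js bs' bs) * X * Kw js bs' bs) * K j b' b)) =
      (\<Sum>b'<n j. \<phi> j b' b *. (fadj (K j b' b) * Mm (Bw js) (Kw js) (wphi \<phi> js) X * K j b' b))"
      by (simp add: Mm_def smul_sum_right fm.scale_scale sum_distrib_left sum_distrib_right)
  qed
  also have "\<dots> = Mm {..<n j} (K j) (\<phi> j) (foldr (\<lambda>j Y. Mm {..<n j} (K j) (\<phi> j) Y) js X)"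
    unfolding Cons.IH[OF js Cons.prems(2)] Mm_def[of "{..<n j}"] ..
  finally show ?case by (simp only: foldr.simps comp_def)
qed

lemma wprod_sum: "set js \<subseteq> {1..M} ==> (\<Sum>bs\<in>Bw js. wprod (p \<zeta>) js bs) = 1"
proof (induction js)
  case (Cons j js)
  then have j: "n j > 0" using npos by auto
  have "(\<Sum>bs\<in>Bw (j # js). wprod (p \<zeta>) (j # js) bs) = (\<Sum>b<n j. p \<zeta> j b) * (\<Sum>bs\<in>Bw js. wprod (p \<zeta>) js bs)"
    unfolding sum_Bw by (simp add: sum_product)
  then show ?case using Cons gibbs_weight_sum[OF j] by simp
qed simp

lemma wprod_pos: "set js \<subseteq> {1..M} ==> wprod (p \<zeta>) js bs > 0"
  by (induction js arbitrary: bs) (auto intro!: mult_pos_pos gibbs_weight_pos npos)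

lemma wphi_wprod: "wphi (\<lambda>j b' b. of_real (f j b)) js b' b = of_real (wprod f js b)"
  by (induction js arbitrary: b' b) auto

lemma wphi_phase: "wphi (\<lambda>j b' b. of_real (f j b) * iexp (s * (g j b - g j b'))) js b' b =
    of_real (wprod f js b) * iexp (s * (hsum g js b - hsum g js b'))"
  by (induction js arbitrary: b' b) (auto simp: algebra_simps exp_add exp_diff exp_minus field_simps)

section \<open>Energies as logarithmic derivatives of the Gibbs weights\<close>

definition mean :: "nat => real" where "mean j = (\<Sum>b<n j. p (\<lambda>_. 0) j b * e j b)"
text \<open>Centering leaves increments unchanged and makes \<open>obs k\<close> the derivative of
  log \<open>p\<close> in the k-th component of \<zeta>, on which the weights of other reservoirs do
  not depend.\<close>

definition obs :: "nat => nat => nat => real" where "obs k j b = (if j = k then e j b - mean j else 0)"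

lemma obs_centered: "j \<in> {1..M} ==> (\<Sum>b<n j. p (\<lambda>_. 0) j b * obs k j b) = 0"
proof (cases "j = k")
  case True
  assume "j \<in> {1..M}"
  then have "(\<Sum>b<n j. p (\<lambda>_. 0) j b) = 1" by (intro gibbs_weight_sum npos)
  moreover have "(\<Sum>b<n j. p (\<lambda>_. 0) j b * obs k j b) = (\<Sum>b<n j. p (\<lambda>_. 0) j b * e j b) - (\<Sum>b<n j. p (\<lambda>_. 0) j b) * mean j"
    using True by (simp add: obs_def right_diff_distrib sum_subtractf sum_distrib_right)
  ultimately show ?thesis by (simp add: mean_def)
qed (simp add: obs_def)

lemma hsum_centered: "set js \<subseteq> {1..M} ==> (\<Sum>bs\<in>Bw js. wprod (p (\<lambda>_. 0)) js bs * hsum (obs k) js bs) = 0"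
proof (induction js)
  case (Cons j js)
  have j: "j \<in> {1..M}" and js: "set js \<subseteq> {1..M}" using Cons.prems by auto
  have "(\<Sum>bs\<in>Bw (j # js). wprod (p (\<lambda>_. 0)) (j # js) bs * hsum (obs k) (j # js) bs) =
     (\<Sum>b<n j. \<Sum>bs\<in>Bw js. (p (\<lambda>_. 0) j b * obs k j b) * wprod (p (\<lambda>_. 0)) js bs + p (\<lambda>_. 0) j b * (wprod (p (\<lambda>_. 0)) js bs * hsum (obs k) js bs))"
    unfolding sum_Bw by (simp add: algebra_simps)
  also have "\<dots> = (\<Sum>b<n j. p (\<lambda>_. 0) j b * obs k j b) * (\<Sum>bs\<in>Bw js. wprod (p (\<lambda>_. 0)) js bs) +
      (\<Sum>b<n j. p (\<lambda>_. 0) j b) * (\<Sum>bs\<in>Bw js. wprod (p (\<lambda>_. 0)) js bs * hsum (obs k) js bs)"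
    by (simp add: sum.distrib sum_product)
  finally show ?case using Cons.IH[OF js] obs_centered[OF j] by simp
qed simp

lemma p_deriv: assumes j: "j \<in> {1..M}"
  shows "((\<lambda>t. p ((\<lambda>_. 0)(k := t)) j b) has_real_derivative p (\<lambda>_. 0) j b * obs k j b) (at 0)"
proof (cases "j = k")
  case True
  then show ?thesis using gibbs_weight_deriv[OF npos[OF j], of "e j" "bref Q" b]
    by (simp add: beta_def obs_def mean_def)
next
  case False
  then have "(\<lambda>t. p ((\<lambda>_. 0)(k := t)) j b) = (\<lambda>t. p (\<lambda>_. 0) j b)" by (simp add: beta_def)
  then show ?thesis using False by (simp add: obs_def)
qed

lemma fun_upd_0: "(\<lambda>_. 0)(k := 0) = (\<lambda>_. 0 :: real)" by auto

lemma wprod_deriv: "set js \<subseteq> {1..M} ==>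
  ((\<lambda>t. wprod (p ((\<lambda>_. 0)(k := t))) js bs) has_real_derivative wprod (p (\<lambda>_. 0)) js bs * hsum (obs k) js bs) (at 0)"
proof (induction js arbitrary: bs)
  case (Cons j js)
  have j: "j \<in> {1..M}" and js: "set js \<subseteq> {1..M}" using Cons.prems by auto
  from DERIV_mult[OF p_deriv[OF j] Cons.IH[OF js]] show ?case
    unfolding wprod.simps hsum.simps by (rule DERIV_cong) (simp only: fun_upd_0, simp add: algebra_simps)
qed simp

lemma hsum_notin: "k \<notin> set js ==> hsum (obs k) js b = 0"
  by (induction js arbitrary: b) (auto simp: obs_def)

text \<open>As the reservoirs in the list are distinct, k interacts once, and the increment of
  \<open>hsum (obs k)\<close> along the word is the energy increment of that interaction.\<close>

lemma wphi_flux: "distinct js ==> k \<in> set js ==>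
  wphi (\<lambda>j b' b. if j = k then of_real (p \<zeta> j b) * of_real (e j b - e j b') else of_real (p \<zeta> j b)) js b' b =
  of_real (wprod (p \<zeta>) js b) * of_real (hsum (obs k) js b - hsum (obs k) js b')"
proof (induction js arbitrary: b' b)
  case (Cons j js)
  show ?case
  proof (cases "j = k")
    case True
    then have k: "k \<notin> set js" using Cons.prems by simp
    have "wphi (\<lambda>j b' b. if j = k then of_real (p \<zeta> j b) * of_real (e j b - e j b') else of_real (p \<zeta> j b)) js b' b =
      wphi (\<lambda>j b' b. of_real (p \<zeta> j b)) js b' b" for b' b
      using k by (induction js arbitrary: b' b) auto
    then have w: "wphi (\<lambda>j b' b. if j = k then of_real (p \<zeta> j b) * of_real (e j b - e j b') else of_real (p \<zeta> j b)) js b' b =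
      of_real (wprod (p \<zeta>) js b)" for b' b by (simp add: wphi_wprod)
    have o: "obs k j c = e j c - mean j" for c using True by (simp add: obs_def)
    have h: "hsum (obs k) (j # js) b - hsum (obs k) (j # js) b' = e j (hd b) - e j (hd b')"
      by (simp add: hsum_notin[OF k] o)
    show ?thesis unfolding h wphi.simps w wprod.simps using True by (simp add: mult_ac)
  next
    case False
    then have "obs k j c = 0" for c by (simp add: obs_def)
    then show ?thesis using Cons False by simp
  qed
qed simp

section \<open>Unitarity and detailed balance along words\<close>

lemma fid_conj: "j \<in> {1..M} ==> fadj (K j b' b) * fid d = fadj (K j b' b)"
  by (rule fid_multR[OF crn_fadj[OF K_c]])

lemma Mm_p_fid: assumes j: "j \<in> {1..M}"
  shows "Mm {..<n j} (K j) (\<lambda>b' b. of_real (p \<zeta> j b)) (fid d) = fid d"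
proof -
  have "Mm {..<n j} (K j) (\<lambda>b' b. of_real (p \<zeta> j b)) (fid d) = (\<Sum>b<n j. of_real (p \<zeta> j b) *. (\<Sum>b'<n j. fadj (K j b' b) * K j b' b))"
    unfolding Mm_def fid_conj[OF j] smul_sum_right ..
  also have "\<dots> = of_real (\<Sum>b<n j. p \<zeta> j b) *. fid d"
    using K_isom(1)[OF Fu[OF j] Uu[OF j]] by (simp add: smul_sum_left)
  finally show ?thesis using gibbs_weight_sum[OF npos[OF j]] by simp
qed

lemma isom_words: "set js \<subseteq> {1..M} ==> b \<in> Bw js ==> (\<Sum>b'\<in>Bw js. fadj (Kw js b' b) * Kw js b' b) = fid d"
proof (induction js arbitrary: b)
  case (Cons j js)
  have j: "j \<in> {1..M}" and js: "set js \<subseteq> {1..M}" using Cons.prems by auto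
  obtain c cs where b: "b = c # cs" "c < n j" "cs \<in> Bw js" using Cons.prems by auto
  have "(\<Sum>b'\<in>Bw (j # js). fadj (Kw (j # js) b' b) * Kw (j # js) b' b) =
    (\<Sum>c'<n j. fadj (K j c' c) * (\<Sum>cs'\<in>Bw js. fadj (Kw js cs' cs) * Kw js cs' cs) * K j c' c)"
    unfolding sum_Bw b by (simp add: fadj_mult mult.assoc sum_distrib_left sum_distrib_right)
  also have "\<dots> = (\<Sum>c'<n j. fadj (K j c' c) * K j c' c)"
    unfolding Cons.IH[OF js b(3)] fid_conj[OF j] ..
  finally show ?case using K_isom(1)[OF Fu[OF j] Uu[OF j] b(2) b(2)] by simp
qed (simp add: fid_multL[OF crn_fid])

lemma coisom_words: "set js \<subseteq> {1..M} ==> b' \<in> Bw js ==> (\<Sum>b\<in>Bw js. Kw js b' b * fadj (Kw js b' b)) = fid d"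
proof (induction js arbitrary: b')
  case (Cons j js)
  have j: "j \<in> {1..M}" and js: "set js \<subseteq> {1..M}" using Cons.prems by auto
  obtain c' cs' where b: "b' = c' # cs'" "c' < n j" "cs' \<in> Bw js" using Cons.prems by auto
  have "(\<Sum>b\<in>Bw (j # js). Kw (j # js) b' b * fadj (Kw (j # js) b' b)) =
    (\<Sum>c<n j. \<Sum>cs\<in>Bw js. Kw js cs' cs * (K j c' c * fadj (K j c' c)) * fadj (Kw js cs' cs))"
    unfolding sum_Bw b by (simp add: fadj_mult mult.assoc)
  also have "\<dots> = (\<Sum>cs\<in>Bw js. Kw js cs' cs * (\<Sum>c<n j. K j c' c * fadj (K j c' c)) * fadj (Kw js cs' cs))"
    by (subst sum.swap) (simp add: sum_distrib_left sum_distrib_right)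
  also have "\<dots> = (\<Sum>cs\<in>Bw js. Kw js cs' cs * fadj (Kw js cs' cs))"
    using K_isom(2)[OF Fu[OF j] Uu[OF j] b(2) b(2)] fid_multR[OF Kw_crn[OF js]] by simp
  finally show ?case using Cons.IH[OF js b(3)] by simp
qed (simp add: fid_multL[OF crn_fid])

definition balanced :: "fm => bool" where
  "balanced r \<longleftrightarrow> r \<in> crn d d \<and> fpsd r \<and> ftr r = 1 \<and> (\<forall>j b b'. j \<in> {1..M} \<longrightarrow> b < n j \<longrightarrow> b' < n j \<longrightarrow>
       of_real (p (\<lambda>_. 0) j b) *. (K j b' b * r) = of_real (p (\<lambda>_. 0) j b') *. (r * K j b' b))"

lemma ex_balanced: "NE Q ==> \<exists>r. balanced r"
  unfolding balanced_def using NE_balance by metis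

text \<open>The state r is the same for all reservoirs, so it moves through the factors one at a
  time, each exchanging its own weight.\<close>

lemma balance_words: assumes r: "balanced r"
  shows "set js \<subseteq> {1..M} ==> b' \<in> Bw js ==> b \<in> Bw js ==>
   of_real (wprod (p (\<lambda>_. 0)) js b) *. (Kw js b' b * r) = of_real (wprod (p (\<lambda>_. 0)) js b') *. (r * Kw js b' b)"
proof (induction js arbitrary: b' b)
  case Nil then show ?case using r by (simp add: balanced_def fid_multR[of r d d] fid_multL[of r d d])
next
  case (Cons j js)
  have j: "j \<in> {1..M}" and js: "set js \<subseteq> {1..M}" using Cons.prems by auto
  obtain c cs c' cs' where b: "b = c # cs" "c < n j" "cs \<in> Bw js" "b' = c' # cs'" "c' < n j" "cs' \<in> Bw js"
    using Cons.prems by auto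
  let ?w = "wprod (p (\<lambda>_. 0)) js" and ?p = "p (\<lambda>_. 0) j"
  have 1: "of_real (?p c) *. (K j c' c * r) = of_real (?p c') *. (r * K j c' c)" using r j b by (auto simp: balanced_def)
  have 2: "of_real (?w cs) *. (Kw js cs' cs * r) = of_real (?w cs') *. (r * Kw js cs' cs)" by (rule Cons.IH[OF js b(6,3)])
  have "of_real (?p c * ?w cs) *. (Kw js cs' cs * K j c' c * r) = of_real (?w cs) *. (Kw js cs' cs * (of_real (?p c) *. (K j c' c * r)))"
    by (simp add: fm.scale_scale mult.assoc mult.commute)
  also have "\<dots> = of_real (?p c') *. ((of_real (?w cs) *. (Kw js cs' cs * r)) * K j c' c)"
    unfolding 1 by (simp add: fm.scale_scale mult.assoc mult.commute)
  also have "\<dots> = of_real (?p c' * ?w cs') *. (r * (Kw js cs' cs * K j c' c))"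
    unfolding 2 by (simp add: fm.scale_scale mult.assoc)
  finally show ?case by (simp add: b)
qed

lemma qenv0_words: assumes js: "set js \<subseteq> {1..M}" and r: "balanced r"
  shows "qenv0 d (Bw js) (wprod (p (\<lambda>_. 0)) js) (Kw js) r"
  by unfold_locales
    (use js r dpos wprod_pos wprod_sum Kw_crn isom_words coisom_words balance_words in \<open>auto simp: balanced_def\<close>)

section \<open>Interactions with a random reservoir\<close>

definition Bp :: "(nat \<times> nat) set" where "Bp = Sigma {1..M} (\<lambda>j. {..<n j})"
text \<open>The reservoir drawn at random is part of the probe label and cannot change during an
  interaction. With weights divided by the number of reservoirs, the averaged channel becomes an
  instance of the same axioms.\<close>

definition Kp :: "nat \<times> nat => nat \<times> nat => fm" where
  "Kp x' x = (if fst x' = fst x then K (fst x) (snd x') (snd x) else 0)"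
definition wp :: "(nat => real) => nat \<times> nat => real" where "wp \<zeta> x = p \<zeta> (fst x) (snd x) / real M"
definition hp :: "(nat => nat => real) => nat \<times> nat => real" where "hp g x = g (fst x) (snd x)"

lemma sum_Bp: "(\<Sum>x\<in>Bp. f x) = (\<Sum>j=1..M. \<Sum>b<n j. f (j, b))"
  unfolding Bp_def by (subst sum.Sigma) auto

lemma sum_Bp_diag: fixes f :: "nat \<times> nat => fm" assumes "j \<in> {1..M}" "\<And>k b. k \<noteq> j ==> f (k, b) = 0"
  shows "(\<Sum>x\<in>Bp. f x) = (\<Sum>b<n j. f (j, b))"
proof -
  have "(\<Sum>x\<in>Bp. f x) = (\<Sum>k=1..M. if k = j then (\<Sum>b<n j. f (j, b)) else 0)"
    unfolding sum_Bp by (intro sum.cong refl) (use assms in auto)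
  then show ?thesis using assms(1) by simp
qed

lemma Lm_Bp: "Lm Bp Kp \<phi> X = (\<Sum>j=1..M. Lm {..<n j} (K j) (\<lambda>b' b. \<phi> (j, b') (j, b)) X)"
  unfolding Lm_def
proof (subst sum_Bp, rule sum.cong[OF refl], rule sum.cong[OF refl])
  fix j b assume j: "j \<in> {1..M}"
  show "(\<Sum>b'\<in>Bp. \<phi> b' (j, b) *. (Kp b' (j, b) * X * fadj (Kp b' (j, b)))) = (\<Sum>b'<n j. \<phi> (j, b') (j, b) *. (K j b' b * X * fadj (K j b' b)))"
    by (subst sum_Bp_diag[OF j]) (auto simp: Kp_def)
qed
lemma Mm_Bp: "Mm Bp Kp \<phi> X = (\<Sum>j=1..M. Mm {..<n j} (K j) (\<lambda>b' b. \<phi> (j, b') (j, b)) X)"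
  unfolding Mm_def
proof (subst sum_Bp, rule sum.cong[OF refl], rule sum.cong[OF refl])
  fix j b assume j: "j \<in> {1..M}"
  show "(\<Sum>b'\<in>Bp. \<phi> b' (j, b) *. (fadj (Kp b' (j, b)) * X * Kp b' (j, b))) = (\<Sum>b'<n j. \<phi> (j, b') (j, b) *. (fadj (K j b' b) * X * K j b' b))"
    by (subst sum_Bp_diag[OF j]) (auto simp: Kp_def)
qed

lemma wp_sum: "(\<Sum>x\<in>Bp. wp \<zeta> x) = 1"
proof -
  have "(\<Sum>b<n j. wp \<zeta> (j, b)) = 1 / real M" if "j \<in> {1..M}" for j
    using gibbs_weight_sum[OF npos[OF that]] by (simp add: wp_def sum_divide_distrib[symmetric])
  then show ?thesis unfolding sum_Bp using M2 by simp
qed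
lemma wp_pos: "x \<in> Bp ==> wp \<zeta> x > 0"
  unfolding wp_def Bp_def using M2 by (auto intro!: divide_pos_pos gibbs_weight_pos npos)
lemma hp_centered: "(\<Sum>x\<in>Bp. wp (\<lambda>_. 0) x * hp (obs k) x) = 0"
proof -
  have "(\<Sum>b<n j. wp (\<lambda>_. 0) (j, b) * hp (obs k) (j, b)) = (\<Sum>b<n j. p (\<lambda>_. 0) j b * obs k j b) / real M" for j
    by (simp add: wp_def hp_def sum_divide_distrib)
  then show ?thesis unfolding sum_Bp by (simp add: obs_centered)
qed
lemma wp_deriv: "x \<in> Bp ==> ((\<lambda>t. wp ((\<lambda>_. 0)(k := t)) x) has_real_derivative wp (\<lambda>_. 0) x * hp (obs k) x) (at 0)"
  using DERIV_cdivide[OF p_deriv[of "fst x" k "snd x"], of "real M"] by (auto simp: Bp_def wp_def hp_def)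

lemma qenv0_pairs: assumes r: "balanced r" shows "qenv0 d Bp (wp (\<lambda>_. 0)) Kp r"
proof
  show "finite Bp" by (simp add: Bp_def)
  show "Kp b' b \<in> crn d d" if "b' \<in> Bp" "b \<in> Bp" for b b' using that by (auto simp: Kp_def Bp_def)
  show "(\<Sum>b'\<in>Bp. fadj (Kp b' b) * Kp b' b) = fid d" if b: "b \<in> Bp" for b
  proof -
    obtain j c where j: "b = (j, c)" "j \<in> {1..M}" "c < n j" using b by (auto simp: Bp_def)
    show ?thesis unfolding j(1)
      by (subst sum_Bp_diag[OF j(2)]) (use K_isom(1)[OF Fu[OF j(2)] Uu[OF j(2)] j(3) j(3)] in \<open>auto simp: Kp_def\<close>)
  qed
  show "(\<Sum>b\<in>Bp. Kp b' b * fadj (Kp b' b)) = fid d" if b: "b' \<in> Bp" for b'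
  proof -
    obtain j c where j: "b' = (j, c)" "j \<in> {1..M}" "c < n j" using b by (auto simp: Bp_def)
    show ?thesis unfolding j(1)
      by (subst sum_Bp_diag[OF j(2)]) (use K_isom(2)[OF Fu[OF j(2)] Uu[OF j(2)] j(3) j(3)] in \<open>auto simp: Kp_def\<close>)
  qed
  show "of_real (wp (\<lambda>_. 0) b) *. (Kp b' b * r) = of_real (wp (\<lambda>_. 0) b') *. (r * Kp b' b)" if "b' \<in> Bp" "b \<in> Bp" for b' b
  proof (cases "fst b' = fst b")
    case True
    then have "of_real (p (\<lambda>_. 0) (fst b) (snd b)) *. (K (fst b) (snd b') (snd b) * r) = of_real (p (\<lambda>_. 0) (fst b) (snd b')) *. (r * K (fst b) (snd b') (snd b))"
      using r that by (auto simp: balanced_def Bp_def)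
    then have "(1 / of_real (real M)) *. (of_real (p (\<lambda>_. 0) (fst b) (snd b)) *. (K (fst b) (snd b') (snd b) * r)) =
      (1 / of_real (real M)) *. (of_real (p (\<lambda>_. 0) (fst b) (snd b')) *. (r * K (fst b) (snd b') (snd b)))" by simp
    then show ?thesis using True by (simp add: Kp_def wp_def fm.scale_scale)
  qed (simp add: Kp_def)
qed (use r dpos wp_pos wp_sum in \<open>auto simp: balanced_def\<close>)

end

section \<open>Full counting statistics\<close>

text \<open>Sequences indexed by 1..N with a default value elsewhere, the shape shared by probe
  configurations, measurement records and schedules. Appending the last entry is the recursion used
  for all of them.\<close>

definition finwords :: "(nat => 'a set) => 'a => nat => (nat => 'a) set" where
  "finwords D z N = {b. \<forall>n. (n \<in> {1..N} \<longrightarrow> b n \<in> D n) \<and> (n \<notin> {1..N} \<longrightarrow> b n = z)}"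

lemma finwords_0: "finwords D z 0 = {\<lambda>_. z}" by (auto simp: finwords_def)
lemma bij_finwords: "bij_betw (\<lambda>(b, x). b(Suc N := x)) (finwords D z N \<times> D (Suc N)) (finwords D z (Suc N))"
proof (rule bij_betw_byWitness[where f' = "\<lambda>b. (b(Suc N := z), b (Suc N))"])
  show "\<forall>a\<in>finwords D z N \<times> D (Suc N). (\<lambda>b. (b(Suc N := z), b (Suc N))) (case a of (b, x) => b(Suc N := x)) = a"
    by (auto simp: finwords_def fun_eq_iff)
  show "\<forall>a'\<in>finwords D z (Suc N). (case (a'(Suc N := z), a' (Suc N)) of (b, x) => b(Suc N := x)) = a'"
    by auto
  show "(\<lambda>(b, x). b(Suc N := x)) ` (finwords D z N \<times> D (Suc N)) \<subseteq> finwords D z (Suc N)"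
    by (auto simp: finwords_def)
  show "(\<lambda>b. (b(Suc N := z), b (Suc N))) ` finwords D z (Suc N) \<subseteq> finwords D z N \<times> D (Suc N)"
    by (auto simp: finwords_def)
qed
lemma finite_finwords: "(\<And>n. 1 \<le> n ==> n \<le> N ==> finite (D n)) ==> finite (finwords D z N)"
proof (induction N)
  case (Suc N)
  then have "finite (finwords D z N \<times> D (Suc N))" by auto
  then show ?case using bij_betw_finite[OF bij_finwords[where D = D and z = z and N = N]] by simp
qed (simp add: finwords_0)
lemma sum_finwords_Suc:
  "(\<Sum>b\<in>finwords D z (Suc N). f b) = (\<Sum>b\<in>finwords D z N. \<Sum>x\<in>D (Suc N). f (b(Suc N := x)))"
proof -
  have "(\<Sum>b\<in>finwords D z (Suc N). f b) = (\<Sum>a\<in>finwords D z N \<times> D (Suc N). f ((\<lambda>(b, x). b(Suc N := x)) a))"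
    by (rule sum.reindex_bij_betw[OF bij_finwords, symmetric])
  then show ?thesis by (simp add: sum.cartesian_product case_prod_unfold)
qed

lemma sum_kron_index: "(\<Sum>i<d * (n::nat). f i) = (\<Sum>a<d. \<Sum>m<n. f (a * n + m))"
proof -
  have "(\<Sum>i<d * n. f i) = (\<Sum>a<d. sum f {a * n..<a * n + n})" by (rule sum.nat_group[symmetric])
  also have "\<dots> = (\<Sum>a<d. \<Sum>m<n. f (a * n + m))"
  proof (rule sum.cong[OF refl])
    fix a show "sum f {a * n..<a * n + n} = (\<Sum>m<n. f (a * n + m))"
      using sum.shift_bounds_nat_ivl[of f 0 "a * n" n] by (simp add: add.commute lessThan_atLeast0)
  qed
  finally show ?thesis .
qed

lemma ent_sandwich: assumes "X \<in> crn (d * n) (d * n)" "x < n" "y < n" "a < d" "a' < d"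
  shows "ent (fadj (inc d n x) * X * inc d n y) a a' = ent X (a * n + x) (a' * n + y)"
  using assms by (simp add: mult_inc[OF crn_mult[OF crn_fadj[OF inc_crn] assms(1)] assms(3)] inc_adj_mult[OF assms(1,2)])

context qs
begin

section \<open>Operators acting on the system and one probe\<close>

lemma idxset_eq: "idxset Q js N = {..<d} \<times> finwords (\<lambda>m. {..<n (js m)}) 0 N"
  by (auto simp: idxset_def finwords_def)

text \<open>X acts on the system and probe k, and as the identity on the other probes. Interactions
  and measurements are both of this form (\<open>lop_liftU\<close>, \<open>lop_liftE\<close>), so
  their products can be formed on a single probe.\<close>

definition lop :: "(nat => nat) => nat => fm => op" where
  "lop js k X = (\<lambda>(a, b) (a', b'). if \<forall>m. m \<noteq> k \<longrightarrow> b m = b' m then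
     ent X (a * n (js k) + b k) (a' * n (js k) + b' k) else 0)"

text \<open>Only configurations that agree with b away from probe k contribute, so the sum over the
  whole index set collapses to the system index and one probe level.\<close>

lemma opmul_lop:
  assumes k: "k \<in> {1..N}" and b: "(a, b) \<in> idxset Q js N"
  shows "opmul (idxset Q js N) (lop js k X) B (a, b) y =
    (\<Sum>a''<d. \<Sum>c<n (js k). ent X (a * n (js k) + b k) (a'' * n (js k) + c) * B (a'', b(k := c)) y)"
proof -
  let ?I = "idxset Q js N" and ?h = "\<lambda>(a'', c). (a'', b(k := c))"
  have fI: "finite ?I" unfolding idxset_eq by (auto intro: finite_finwords)
  have inj: "inj_on ?h ({..<d} \<times> {..<n (js k)})" by (auto simp: inj_on_def dest: fun_upd_eqD)
  have sub: "?h ` ({..<d} \<times> {..<n (js k)}) \<subseteq> ?I" using b k by (auto simp: idxset_def)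
  have "opmul ?I (lop js k X) B (a, b) y = (\<Sum>z\<in>?h ` ({..<d} \<times> {..<n (js k)}). lop js k X (a, b) z * B z y)"
    unfolding opmul_def
  proof (rule sum.mono_neutral_right[OF fI sub], intro ballI)
    fix z assume z: "z \<in> ?I - ?h ` ({..<d} \<times> {..<n (js k)})"
    obtain a' b' where ab: "z = (a', b')" by (cases z)
    have "\<not> (\<forall>m. m \<noteq> k \<longrightarrow> b m = b' m)"
    proof
      assume "\<forall>m. m \<noteq> k \<longrightarrow> b m = b' m"
      then have "b' = b(k := b' k)" by auto
      moreover have "a' < d" "b' k < n (js k)" using z ab k by (auto simp: idxset_def)
      ultimately have "z \<in> ?h ` ({..<d} \<times> {..<n (js k)})" unfolding ab by force
      then show False using z by blast
    qed
    then show "lop js k X (a, b) z * B z y = 0" unfolding ab lop_def prod.case by (simp only: if_False mult_zero_left)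
  qed
  also have "\<dots> = (\<Sum>(a'', c)\<in>{..<d} \<times> {..<n (js k)}. lop js k X (a, b) (a'', b(k := c)) * B (a'', b(k := c)) y)"
    unfolding sum.reindex[OF inj] by (intro sum.cong) auto
  finally show ?thesis by (simp add: lop_def sum.cartesian_product)
qed

lemma opmul_lop_lop:
  assumes k: "k \<in> {1..N}" and b: "x \<in> idxset Q js N" and X: "X \<in> crn (d * n (js k)) (d * n (js k))"
  shows "opmul (idxset Q js N) (lop js k X) (opmul (idxset Q js N) (lop js k Y) B) x y =
    opmul (idxset Q js N) (lop js k (X * Y)) B x y"
proof -
  obtain a b where x: "x = (a, b)" by (cases x)
  let ?n = "n (js k)"
  have i: "(a'', b(k := c)) \<in> idxset Q js N" if "a'' < d" "c < ?n" for a'' c using b x k that by (auto simp: idxset_def)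
  have "opmul (idxset Q js N) (lop js k X) (opmul (idxset Q js N) (lop js k Y) B) x y =
    (\<Sum>a''<d. \<Sum>c<?n. ent X (a * ?n + b k) (a'' * ?n + c) * (\<Sum>a3<d. \<Sum>c'<?n. ent Y (a'' * ?n + c) (a3 * ?n + c') * B (a3, b(k := c')) y))"
    unfolding x opmul_lop[OF k b[unfolded x]]
    by (intro sum.cong refl) (use i in \<open>simp add: opmul_lop[OF k]\<close>)
  also have "\<dots> = (\<Sum>i<d * ?n. \<Sum>a3<d. \<Sum>c'<?n. ent X (a * ?n + b k) i * (ent Y i (a3 * ?n + c') * B (a3, b(k := c')) y))"
    unfolding sum_kron_index by (simp add: sum_distrib_left)
  also have "\<dots> = (\<Sum>a3<d. \<Sum>c'<?n. \<Sum>i<d * ?n. ent X (a * ?n + b k) i * (ent Y i (a3 * ?n + c') * B (a3, b(k := c')) y))"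
    by (subst sum.swap, rule sum.cong[OF refl], rule sum.swap)
  also have "\<dots> = opmul (idxset Q js N) (lop js k (X * Y)) B x y"
    unfolding x opmul_lop[OF k b[unfolded x]] ent_multL[OF X] by (simp add: sum_distrib_right mult.assoc)
  finally show ?thesis .
qed

lemma opmul_cong: "(\<And>z. z \<in> I ==> A x z = A' x z) ==> (\<And>z. z \<in> I ==> B z y = B' z y) ==> opmul I A B x y = opmul I A' B' x y"
  unfolding opmul_def by (intro sum.cong) auto

section \<open>Spectra and spectral projections of the measured entropies\<close>

abbreviation SP where "SP \<zeta> j \<equiv> specproj (n j) (complex_of_real (beta Q \<zeta> j) \<cdot>\<^sub>m hE Q j)"
definition chi :: "(nat => real) => nat => real => nat => real" where
  "chi \<zeta> j s b = (if beta Q \<zeta> j * e j b = s then 1 else 0)"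

lemma fE_col: "X \<in> crn m k ==> i < k ==> ent (X * fE i 0) l 0 = ent X l i"
proof -
  assume X: "X \<in> crn m k" and i: "i < k"
  have "ent (X * fE i 0) l 0 = (\<Sum>q<k. if q = i then ent X l i else 0)"
    unfolding ent_multL[OF X] by (rule sum.cong) auto
  then show ?thesis using i by simp
qed

lemma vec_col: assumes A: "A \<in> carrier_mat m m" and v: "v \<in> carrier_vec m"
  shows "emb A * mk m (Suc 0) (\<lambda>i _. v $ i) = mk m (Suc 0) (\<lambda>i _. (A *\<^sub>v v) $ i)"
proof (rule fm_eqI)
  fix i j
  show "ent (emb A * mk m (Suc 0) (\<lambda>i _. v $ i)) i j = ent (mk m (Suc 0) (\<lambda>i _. (A *\<^sub>v v) $ i)) i j"
    unfolding ent_multL[OF emb_crn[OF A]] ent_emb[OF A]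
    using A v by (auto simp: scalar_prod_def lessThan_atLeast0 intro!: sum.cong)
qed

text \<open>Transfers the eigenvector condition in the description of \<open>specproj\<close> from
  vectors to one-column elements of \<open>fm\<close>.\<close>

lemma vec_fixed_iff: assumes A: "A \<in> carrier_mat m m" and P: "P \<in> carrier_mat m m"
  shows "(\<forall>v\<in>carrier_vec m. P *\<^sub>v v = v \<longleftrightarrow> A *\<^sub>v v = c \<cdot>\<^sub>v v) \<longleftrightarrow>
    (\<forall>V\<in>crn m (Suc 0). emb P * V = V \<longleftrightarrow> emb A * V = c *. V)"
proof -
  have eq: "mk m (Suc 0) (\<lambda>i _. v $ i) = mk m (Suc 0) (\<lambda>i _. u $ i) \<longleftrightarrow> v = u" if "v \<in> carrier_vec m" "u \<in> carrier_vec m" for u v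
  proof
    assume h: "mk m (Suc 0) (\<lambda>i _. v $ i) = mk m (Suc 0) (\<lambda>i _. u $ i)"
    show "v = u"
    proof (rule eq_vecI)
      fix i assume "i < dim_vec u"
      then show "v $ i = u $ i" using arg_cong[OF h, of "\<lambda>X. ent X i 0"] that by simp
    qed (use that in auto)
  qed simp
  have sm: "c *. mk m (Suc 0) (\<lambda>i _. v $ i) = mk m (Suc 0) (\<lambda>i _. (c \<cdot>\<^sub>v v) $ i)" if "v \<in> carrier_vec m" for v
    by (rule fm_eqI) (use that in auto)
  have one: "(P *\<^sub>v v = v \<longleftrightarrow> A *\<^sub>v v = c \<cdot>\<^sub>v v) \<longleftrightarrow>
     (emb P * mk m (Suc 0) (\<lambda>i _. v $ i) = mk m (Suc 0) (\<lambda>i _. v $ i) \<longleftrightarrow> emb A * mk m (Suc 0) (\<lambda>i _. v $ i) = c *. mk m (Suc 0) (\<lambda>i _. v $ i))"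
    if v: "v \<in> carrier_vec m" for v
  proof -
    have "P *\<^sub>v v \<in> carrier_vec m" "A *\<^sub>v v \<in> carrier_vec m" "c \<cdot>\<^sub>v v \<in> carrier_vec m" using A P v by auto
    then show ?thesis unfolding vec_col[OF P v] vec_col[OF A v] sm[OF v] using eq v by auto
  qed
  have all: "\<exists>v\<in>carrier_vec m. V = mk m (Suc 0) (\<lambda>i _. v $ i)" if V: "V \<in> crn m (Suc 0)" for V
  proof (rule bexI[of _ "Matrix.vec m (\<lambda>i. ent V i 0)"])
    show "V = mk m (Suc 0) (\<lambda>i _. Matrix.vec m (\<lambda>i. ent V i 0) $ i)"
    proof (rule fm_eqI)
      fix i j show "ent V i j = ent (mk m (Suc 0) (\<lambda>i _. Matrix.vec m (\<lambda>i. ent V i 0) $ i)) i j"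
        using crnD1[OF V, of i j] crnD2[OF V, of j i] by (cases "i < m"; cases "j = 0") auto
    qed
  qed simp
  show ?thesis
  proof
    assume l: "\<forall>v\<in>carrier_vec m. P *\<^sub>v v = v \<longleftrightarrow> A *\<^sub>v v = c \<cdot>\<^sub>v v"
    show "\<forall>V\<in>crn m (Suc 0). emb P * V = V \<longleftrightarrow> emb A * V = c *. V"
    proof
      fix V assume "V \<in> crn m (Suc 0)"
      then obtain v where v: "v \<in> carrier_vec m" "V = mk m (Suc 0) (\<lambda>i _. v $ i)" using all by blast
      show "emb P * V = V \<longleftrightarrow> emb A * V = c *. V" unfolding v(2) using one[OF v(1)] l v(1) by blast
    qed
  next
    assume r: "\<forall>V\<in>crn m (Suc 0). emb P * V = V \<longleftrightarrow> emb A * V = c *. V"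
    show "\<forall>v\<in>carrier_vec m. P *\<^sub>v v = v \<longleftrightarrow> A *\<^sub>v v = c \<cdot>\<^sub>v v"
      using one r mk_crn by blast
  qed
qed

lemma conj_mult: assumes F: "unitary m G" shows "(G * X * fadj G) * (G * Y * fadj G) = G * (X * (fid m * Y)) * fadj G"
  using F by (simp add: unitary_def mult.assoc) (metis mult.assoc)

lemma eig_col_iff: assumes G: "unitary m G" and V: "V \<in> crn m (Suc 0)"
  shows "(G * fdiag m l * fadj G) * V = c *. V \<longleftrightarrow> (\<forall>i<m. (l i - c) * ent (fadj G * V) i 0 = 0)"
proof -
  have Gc: "G \<in> crn m m" "G * fadj G = fid m" "fadj G * G = fid m" using G by (auto simp: unitary_def)
  define y where "y = fadj G * V"
  have y: "y \<in> crn m (Suc 0)" unfolding y_def by (rule crn_mult[OF crn_fadj[OF Gc(1)] V])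
  have Vy: "V = G * y" using V by (simp add: y_def Gc flip: mult.assoc)
  have "(G * fdiag m l * fadj G) * V = c *. V \<longleftrightarrow> fdiag m l * y = c *. y"
  proof
    assume "(G * fdiag m l * fadj G) * V = c *. V"
    then have "fadj G * (G * (fdiag m l * y)) = fadj G * (c *. V)" by (simp add: y_def mult.assoc)
    then have "(fadj G * G) * (fdiag m l * y) = c *. y" by (simp add: y_def mult.assoc)
    then show "fdiag m l * y = c *. y" using Gc fid_multL[OF crn_mult[OF crn_fdiag y]] by simp
  next
    assume "fdiag m l * y = c *. y"
    then have "G * (fdiag m l * y) = c *. V" by (simp add: Vy)
    then show "(G * fdiag m l * fadj G) * V = c *. V" by (simp add: y_def mult.assoc)
  qed
  also have "\<dots> \<longleftrightarrow> (\<forall>i<m. (l i - c) * ent y i 0 = 0)"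
  proof -
    have en: "ent (fdiag m l * y) i j = (if i < m then l i * ent y i j else 0)" for i j
    proof -
      have "ent (fdiag m l * y) i j = (\<Sum>k<m. if k = i then l i * ent y i j else 0)"
        unfolding ent_multL[OF crn_fdiag] by (rule sum.cong) auto
      then show ?thesis by simp
    qed
    show ?thesis
    proof
      assume h: "fdiag m l * y = c *. y"
      show "\<forall>i<m. (l i - c) * ent y i 0 = 0"
      proof (intro allI impI)
        fix i assume "i < m"
        moreover have "ent (fdiag m l * y) i 0 = ent (c *. y) i 0" using h by simp
        ultimately show "(l i - c) * ent y i 0 = 0" by (simp add: en left_diff_distrib)
      qed
    next
      assume h: "\<forall>i<m. (l i - c) * ent y i 0 = 0"
      show "fdiag m l * y = c *. y"
      proof (rule fm_eqI)
        fix i j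
        show "ent (fdiag m l * y) i j = ent (c *. y) i j"
          using h crnD1[OF y, of i j] crnD2[OF y, of j i]
          by (cases "j = 0"; cases "i < m") (auto simp: en left_diff_distrib not_less)
      qed
    qed
  qed
  finally show ?thesis by (simp add: y_def)
qed

text \<open>The candidate is diagonal in the eigenbasis, with entries \<open>chi\<close> that single
  out the levels of entropy s. It satisfies the description, and a self-adjoint projection is
  determined by the vectors that it fixes.\<close>

lemma SP_emb: assumes j: "j \<in> {1..M}"
  shows "emb (SP \<zeta> j s) = F j * fdiag (n j) (\<lambda>b. of_real (chi \<zeta> j s b)) * fadj (F j)" "SP \<zeta> j s \<in> carrier_mat (n j) (n j)"
proof -
  let ?m = "n j" and ?G = "F j" and ?A = "complex_of_real (beta Q \<zeta> j) \<cdot>\<^sub>m hE Q j"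
  have G: "unitary ?m ?G" by (rule Fu[OF j])
  then have Gc: "?G \<in> crn ?m ?m" "fadj ?G * ?G = fid ?m" by (auto simp: unitary_def)
  define P where "P = unm ?m ?m (?G * fdiag ?m (\<lambda>b. of_real (chi \<zeta> j s b)) * fadj ?G)"
  have Ac: "?A \<in> carrier_mat ?m ?m" using hE_c[OF j] by simp
  have Ae: "emb ?A = ?G * fdiag ?m (\<lambda>b. of_real (beta Q \<zeta> j * e j b)) * fadj ?G"
    by (simp add: emb_smult Fe[OF j] smul_fdiag[symmetric])
  have P: "P \<in> carrier_mat ?m ?m" "emb P = ?G * fdiag ?m (\<lambda>b. of_real (chi \<zeta> j s b)) * fadj ?G"
    unfolding P_def using emb_unm[OF crn_mult[OF crn_mult[OF Gc(1) crn_fdiag] crn_fadj[OF Gc(1)]]] by auto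
  have pp: "P * P = P"
  proof (rule emb_inj)
    show "emb (P * P) = emb P"
      unfolding emb_mult[OF P(1) P(1)] P(2) conj_mult[OF G] fid_multL[OF crn_fdiag] fdiag_mult
      by (intro arg_cong[where f = "\<lambda>l. ?G * fdiag ?m l * fadj ?G"]) (auto simp: chi_def)
  qed (use P in auto)
  have pa: "adj P = P"
    by (rule emb_inj[OF adj_carrier[OF P(1)] P(1)]) (simp add: emb_adj P(2) fadj_mult fadj_fdiag mult.assoc)
  have pe: "\<forall>V\<in>crn ?m (Suc 0). emb P * V = V \<longleftrightarrow> emb ?A * V = of_real s *. V"
  proof
    fix V assume V: "V \<in> crn ?m (Suc 0)"
    have "emb P * V = V \<longleftrightarrow> emb P * V = 1 *. V" by simp
    also have "\<dots> \<longleftrightarrow> emb ?A * V = of_real s *. V"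
      unfolding P(2) Ae eig_col_iff[OF G V] by (auto simp: chi_def simp flip: of_real_mult of_real_diff)
    finally show "emb P * V = V \<longleftrightarrow> emb ?A * V = of_real s *. V" .
  qed
  have "SP \<zeta> j s = P" unfolding specproj_def
  proof (rule the_equality)
    show "P \<in> carrier_mat ?m ?m \<and> P * P = P \<and> adj P = P \<and> (\<forall>v\<in>carrier_vec ?m. P *\<^sub>v v = v \<longleftrightarrow> ?A *\<^sub>v v = complex_of_real s \<cdot>\<^sub>v v)"
      using P(1) pp pa pe vec_fixed_iff[OF Ac P(1)] by simp
    fix P' assume "P' \<in> carrier_mat ?m ?m \<and> P' * P' = P' \<and> adj P' = P' \<and> (\<forall>v\<in>carrier_vec ?m. P' *\<^sub>v v = v \<longleftrightarrow> ?A *\<^sub>v v = complex_of_real s \<cdot>\<^sub>v v)"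
    then have P': "P' \<in> carrier_mat ?m ?m" "P' * P' = P'" "adj P' = P'"
      and pe': "\<forall>V\<in>crn ?m (Suc 0). emb P' * V = V \<longleftrightarrow> emb ?A * V = of_real s *. V"
      using vec_fixed_iff[OF Ac] by auto
    \<comment> \<open>If A fixes every vector fixed by the projection B, then A B = B, column by
      column. Used in both directions and combined with adjoints this gives P' = P.\<close>
    have key: "emb A * emb B = emb B" if A: "A \<in> carrier_mat ?m ?m" and B: "B \<in> carrier_mat ?m ?m" "B * B = B"
      and AB: "\<And>V. V \<in> crn ?m (Suc 0) ==> emb B * V = V ==> emb A * V = V" for A B
    proof (rule fm_eqI)
      fix l i
      have Bc: "emb B \<in> crn ?m ?m" "emb A \<in> crn ?m ?m" using A B emb_crn by auto
      show "ent (emb A * emb B) l i = ent (emb B) l i"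
      proof (cases "i < ?m")
        case True
        have V: "emb B * fE i 0 \<in> crn ?m (Suc 0)" by (rule crn_mult[OF Bc(1) crn_fE[OF True lessI]])
        have "emb B * (emb B * fE i 0) = emb B * fE i 0"
          using emb_mult[OF B(1) B(1)] B(2) by (simp flip: mult.assoc)
        from AB[OF V this] have "ent ((emb A * emb B) * fE i 0) l 0 = ent (emb B * fE i 0) l 0" by (simp add: mult.assoc)
        then show ?thesis unfolding fE_col[OF Bc(1) True] fE_col[OF crn_mult[OF Bc(2,1)] True] .
      next
        case False
        then show ?thesis using crnD2[OF Bc(1), of i l] crnD2[OF crn_mult[OF Bc(2,1)], of i l] by simp
      qed
    qed
    have "emb P * emb P' = emb P'" by (rule key) (use P P' pe pe' in auto)
    moreover have "emb P' * emb P = emb P" by (rule key) (use P P' pp pe pe' in auto)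
    then have "fadj (emb P' * emb P) = fadj (emb P)" by simp
    then have "emb P * emb P' = emb P" using pa P'(3) by (metis emb_adj fadj_mult)
    ultimately show "P' = P" using emb_inj[OF P'(1) P(1)] by simp
  qed
  then show "emb (SP \<zeta> j s) = F j * fdiag (n j) (\<lambda>b. of_real (chi \<zeta> j s b)) * fadj (F j)" "SP \<zeta> j s \<in> carrier_mat (n j) (n j)"
    using P by auto
qed

lemma spec_eq: assumes j: "j \<in> {1..M}"
  shows "spec (n j) (complex_of_real (beta Q \<zeta> j) \<cdot>\<^sub>m hE Q j) = (\<lambda>b. beta Q \<zeta> j * e j b) ` {..<n j}"
proof -
  let ?m = "n j" and ?G = "F j" and ?A = "complex_of_real (beta Q \<zeta> j) \<cdot>\<^sub>m hE Q j"
  have G: "unitary ?m ?G" by (rule Fu[OF j])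
  then have Gc: "?G \<in> crn ?m ?m" "fadj ?G * ?G = fid ?m" "?G * fadj ?G = fid ?m" by (auto simp: unitary_def)
  have Ac: "?A \<in> carrier_mat ?m ?m" using hE_c[OF j] by simp
  have Ae: "emb ?A = ?G * fdiag ?m (\<lambda>b. of_real (beta Q \<zeta> j * e j b)) * fadj ?G"
    by (simp add: emb_smult Fe[OF j] smul_fdiag[symmetric])
  show ?thesis
  proof (intro subset_antisym subsetI)
    fix s assume "s \<in> spec ?m ?A"
    then obtain v where v: "v \<in> carrier_vec ?m" "v \<noteq> 0\<^sub>v ?m" "?A *\<^sub>v v = complex_of_real s \<cdot>\<^sub>v v" by (auto simp: spec_def)
    define V where "V = mk ?m (Suc 0) (\<lambda>i _. v $ i)"
    have V: "V \<in> crn ?m (Suc 0)" by (simp add: V_def)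
    have "emb ?A * V = of_real s *. V" unfolding V_def vec_col[OF Ac v(1)] v(3) by (rule fm_eqI) (use v in auto)
    then have z: "\<forall>i<?m. (of_real (beta Q \<zeta> j * e j i) - of_real s) * ent (fadj ?G * V) i 0 = 0"
      unfolding Ae eig_col_iff[OF G V] .
    have "fadj ?G * V \<noteq> 0"
    proof
      assume "fadj ?G * V = 0"
      then have "?G * (fadj ?G * V) = 0" by simp
      then have "V = 0" using Gc fid_multL[OF V] by (simp flip: mult.assoc)
      have "v = 0\<^sub>v ?m"
      proof (rule eq_vecI)
        fix i assume "i < dim_vec (0\<^sub>v ?m :: complex vec)"
        then show "v $ i = 0\<^sub>v ?m $ i" using arg_cong[OF \<open>V = 0\<close>, of "\<lambda>X. ent X i 0"] by (simp add: V_def)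
      qed (use v in auto)
      then show False using v by simp
    qed
    moreover have "fadj ?G * V \<in> crn ?m (Suc 0)" by (rule crn_mult[OF crn_fadj[OF Gc(1)] V])
    ultimately obtain i where "i < ?m" "ent (fadj ?G * V) i 0 \<noteq> 0"
      by (metis crnD1 crnD2 ent_0 fm_eqI less_Suc0 not_less)
    then have "beta Q \<zeta> j * e j i = s" using z by (metis mult_eq_0_iff of_real_eq_iff right_minus_eq)
    then show "s \<in> (\<lambda>b. beta Q \<zeta> j * e j b) ` {..<?m}" using \<open>i < ?m\<close> by auto
  next
    fix s assume "s \<in> (\<lambda>b. beta Q \<zeta> j * e j b) ` {..<?m}"
    then obtain i where i: "i < ?m" "s = beta Q \<zeta> j * e j i" by auto
    define V where "V = ?G * fE i 0"
    have V: "V \<in> crn ?m (Suc 0)" unfolding V_def by (rule crn_mult[OF Gc(1) crn_fE[OF i(1) lessI]])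
    have GV: "fadj ?G * V = fE i 0" using Gc i by (simp add: V_def fid_fE flip: mult.assoc)
    define v where "v = Matrix.vec ?m (\<lambda>k. ent V k 0)"
    have v: "v \<in> carrier_vec ?m" by (simp add: v_def)
    have Vv: "V = mk ?m (Suc 0) (\<lambda>k _. v $ k)"
    proof (rule fm_eqI)
      fix k l show "ent V k l = ent (mk ?m (Suc 0) (\<lambda>k _. v $ k)) k l"
        using crnD1[OF V, of k l] crnD2[OF V, of l k] by (cases "k < ?m"; cases "l = 0") (auto simp: v_def)
    qed
    have "emb ?A * V = of_real s *. V" unfolding Ae eig_col_iff[OF G V] GV using i by auto
    then have h: "mk ?m (Suc 0) (\<lambda>k _. (?A *\<^sub>v v) $ k) = of_real s *. V" using vec_col[OF Ac v] Vv by simp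
    have "?A *\<^sub>v v = complex_of_real s \<cdot>\<^sub>v v"
    proof (rule eq_vecI)
      fix k assume "k < dim_vec (complex_of_real s \<cdot>\<^sub>v v)"
      then show "(?A *\<^sub>v v) $ k = (complex_of_real s \<cdot>\<^sub>v v) $ k"
        using arg_cong[OF h, of "\<lambda>X. ent X k 0"] v by (simp add: v_def)
    qed (use Ac v in auto)
    moreover have "v \<noteq> 0\<^sub>v ?m"
    proof
      assume "v = 0\<^sub>v ?m"
      then have "V = 0" unfolding Vv by (intro fm_eqI) auto
      then have "ent (fE i 0) i 0 = 0" using GV by simp
      then show False by simp
    qed
    ultimately show "s \<in> spec ?m ?A" using v by (auto simp: spec_def)
  qed
qed

lemma lop_liftU: assumes k: "k \<in> {1..N}" "js k \<in> {1..M}" and x: "x \<in> idxset Q js N" "y \<in> idxset Q js N"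
  shows "liftU Q js k (Uop Q (js k)) x y = lop js k (emb (Uop Q (js k))) x y"
proof -
  obtain a b a' b' where ab: "x = (a, b)" "y = (a', b')" by (cases x, cases y)
  have "a * n (js k) + b k < d * n (js k)" "a' * n (js k) + b' k < d * n (js k)"
    using x k by (auto simp: ab idxset_def intro!: idx_less)
  then show ?thesis unfolding ab liftU_def lop_def prod.case ent_emb[OF U_c[OF k(2)]]
    by (simp only: simp_thms if_True)
qed

lemma lop_liftE: assumes k: "k \<in> {1..N}" and P: "P \<in> carrier_mat (n (js k)) (n (js k))"
    and x: "x \<in> idxset Q js N" "y \<in> idxset Q js N"
  shows "liftE k P x y = lop js k (fkron d (n (js k)) (fid d) (emb P)) x y"
proof -
  obtain a b a' b' where ab: "x = (a, b)" "y = (a', b')" by (cases x, cases y)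
  have 1: "a < d" "a' < d" "b k < n (js k)" "b' k < n (js k)" using x k by (auto simp: ab idxset_def)
  then have 2: "a * n (js k) + b k < d * n (js k)" "a' * n (js k) + b' k < d * n (js k)" by (auto intro!: idx_less)
  show ?thesis unfolding ab using 1 2
    by (auto simp: liftE_def lop_def ent_fkron[OF crn_fid] ent_emb[OF P])
qed

text \<open>The measured evolution of probe \<open>k\<close>: project on \<open>fst \<sigma>\<close>, interact, project on \<open>snd \<sigma>\<close>.\<close>
definition Wm :: "(nat => real) => nat => real \<times> real => fm" where
  "Wm \<zeta> j \<sigma> = fkron d (n j) (fid d) (emb (SP \<zeta> j (snd \<sigma>))) * (emb (Uop Q j) * fkron d (n j) (fid d) (emb (SP \<zeta> j (fst \<sigma>))))"
text \<open>Blocks of the measured evolution in the standard basis of the probe, which is the basis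
  that indexes the total space; \<open>Wp\<close> multiplies them along the probes, from
  configuration b' to b.\<close>

definition Wb where "Wb \<zeta> j \<sigma> x y = fadj (inc d (n j) x) * Wm \<zeta> j \<sigma> * inc d (n j) y"
primrec Wp :: "(nat => real) => (nat => nat) => (nat => real \<times> real) => nat => (nat => nat) => (nat => nat) => fm" where
  "Wp \<zeta> js s 0 b b' = fid d"
| "Wp \<zeta> js s (Suc k) b b' = Wb \<zeta> (js (Suc k)) (s (Suc k)) (b (Suc k)) (b' (Suc k)) * Wp \<zeta> js s k b b'"

lemma Wm_crn: "j \<in> {1..M} ==> Wm \<zeta> j \<sigma> \<in> crn (d * n j) (d * n j)"
  unfolding Wm_def by (rule crn_mult[OF fkron_crn crn_mult[OF emb_crn[OF U_c] fkron_crn]])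
lemma Wb_crn: "j \<in> {1..M} ==> Wb \<zeta> j \<sigma> x y \<in> crn d d"
  unfolding Wb_def by (rule crn_mult[OF crn_mult[OF crn_fadj[OF inc_crn] Wm_crn] inc_crn])
lemma Wp_crn: "(\<And>m. m \<in> {1..k} ==> js m \<in> {1..M}) ==> Wp \<zeta> js s k b b' \<in> crn d d"
proof (induction k)
  case (Suc k)
  have "Wb \<zeta> (js (Suc k)) (s (Suc k)) (b (Suc k)) (b' (Suc k)) \<in> crn d d" using Suc.prems by (intro Wb_crn) simp
  moreover have "Wp \<zeta> js s k b b' \<in> crn d d" using Suc by simp
  ultimately show ?case by (simp add: crn_mult[of _ d d _ d])
qed simp
lemma Wp_cong: "(\<And>m. m \<in> {1..k} ==> b m = c m \<and> b' m = c' m) ==> Wp \<zeta> js s k b b' = Wp \<zeta> js s k c c'"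
  by (induction k) auto

text \<open>After k interactions the probes beyond k have not been touched, so the operator is
  diagonal in their configurations; on the others it is a product of blocks.\<close>

lemma Ucal_eq:
  assumes js: "\<And>m. m \<in> {1..N} ==> js m \<in> {1..M}"
  shows "k \<le> N ==> (a, b) \<in> idxset Q js N ==> (a', b') \<in> idxset Q js N ==>
    Ucal Q \<zeta> js N s k (a, b) (a', b') = (if \<forall>m. m \<notin> {1..k} \<longrightarrow> b m = b' m then ent (Wp \<zeta> js s k b b') a a' else 0)"
proof (induction k arbitrary: a b)
  case 0
  then have "a < d" by (simp add: idxset_def)
  then show ?case by (auto simp: opid_def fun_eq_iff)
next
  case (Suc k)
  let ?I = "idxset Q js N" and ?k = "Suc k" and ?j = "js (Suc k)" and ?n = "n (js (Suc k))"
  have k: "?k \<in> {1..N}" using Suc.prems by simp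
  have j: "?j \<in> {1..M}" by (rule js[OF k])
  have PP: "PiS Q \<zeta> js ?k t x y = lop js ?k (fkron d ?n (fid d) (emb (SP \<zeta> ?j t))) x y" if "x \<in> ?I" "y \<in> ?I" for t x y
    unfolding PiS_def Sn_def using lop_liftE[OF k SP_emb(2)[OF j] that] .
  have Uc: "emb (Uop Q ?j) \<in> crn (d * ?n) (d * ?n)" by (rule emb_crn[OF U_c[OF j]])
  have "Ucal Q \<zeta> js N s ?k (a, b) (a', b') =
    opmul ?I (lop js ?k (fkron d ?n (fid d) (emb (SP \<zeta> ?j (snd (s ?k))))))
      (opmul ?I (lop js ?k (emb (Uop Q ?j))) (opmul ?I (lop js ?k (fkron d ?n (fid d) (emb (SP \<zeta> ?j (fst (s ?k)))))) (Ucal Q \<zeta> js N s k))) (a, b) (a', b')"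
    unfolding Ucal.simps
    by (rule opmul_cong, rule PP[OF Suc.prems(2)], assumption, rule opmul_cong, rule lop_liftU[where N = N and js = js and k = "Suc k", OF k j],
        assumption, assumption, rule opmul_cong, rule PP, assumption, assumption, rule refl)
  also have "\<dots> = opmul ?I (lop js ?k (fkron d ?n (fid d) (emb (SP \<zeta> ?j (snd (s ?k))))))
      (opmul ?I (lop js ?k (emb (Uop Q ?j) * fkron d ?n (fid d) (emb (SP \<zeta> ?j (fst (s ?k)))))) (Ucal Q \<zeta> js N s k)) (a, b) (a', b')"
    by (rule opmul_cong, rule refl, rule opmul_lop_lop[where js = js and k = "Suc k", OF k _ Uc], assumption)
  also have "\<dots> = opmul ?I (lop js ?k (Wm \<zeta> ?j (s ?k))) (Ucal Q \<zeta> js N s k) (a, b) (a', b')"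
    unfolding Wm_def by (rule opmul_lop_lop[where js = js and k = "Suc k", OF k Suc.prems(2) fkron_crn])
  also have "\<dots> = (\<Sum>a''<d. \<Sum>c<?n. ent (Wm \<zeta> ?j (s ?k)) (a * ?n + b ?k) (a'' * ?n + c) * Ucal Q \<zeta> js N s k (a'', b(?k := c)) (a', b'))"
    by (rule opmul_lop[where js = js and k = "Suc k", OF k Suc.prems(2)])
  also have "\<dots> = (\<Sum>a''<d. \<Sum>c<?n. if c = b' ?k then
      (if \<forall>m. m \<notin> {1..?k} \<longrightarrow> b m = b' m then ent (Wb \<zeta> ?j (s ?k) (b ?k) (b' ?k)) a a'' * ent (Wp \<zeta> js s k b b') a'' a' else 0) else 0)"
  proof (rule sum.cong[OF refl], rule sum.cong[OF refl])
    fix a'' c assume c: "a'' \<in> {..<d}" "c \<in> {..<?n}"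
    have i: "(a'', b(?k := c)) \<in> ?I" using c Suc.prems k by (auto simp: idxset_def)
    have "a < d" "b ?k < ?n" using Suc.prems k by (auto simp: idxset_def)
    then have w: "ent (Wb \<zeta> ?j (s ?k) (b ?k) c) a a'' = ent (Wm \<zeta> ?j (s ?k)) (a * ?n + b ?k) (a'' * ?n + c)"
      unfolding Wb_def using c by (intro ent_sandwich Wm_crn[OF j]) auto
    \<comment> \<open>The next factor changes the level of probe k + 1 only. Untouched so far, that
      probe entered in the level given by b', which selects a single term of the sum over c.\<close>
    have q: "(\<forall>m. m \<notin> {1..k} \<longrightarrow> (b(?k := c)) m = b' m) \<longleftrightarrow> c = b' ?k \<and> (\<forall>m. m \<notin> {1..?k} \<longrightarrow> b m = b' m)" (is "?l \<longleftrightarrow> ?r")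
    proof
      assume l: ?l
      have "(b(?k := c)) ?k = b' ?k" using l[rule_format, of ?k] by simp
      moreover have "b m = b' m" if "m \<notin> {1..?k}" for m
      proof -
        have "m \<notin> {1..k}" "m \<noteq> ?k" using that by auto
        then show ?thesis using l[rule_format, of m] by simp
      qed
      ultimately show ?r by simp
    next
      assume r: ?r
      show ?l
      proof (intro allI impI)
        fix m assume m: "m \<notin> {1..k}"
        show "(b(?k := c)) m = b' m"
        proof (cases "m = ?k")
          case False
          then have "m \<notin> {1..?k}" using m by auto
          then show ?thesis using r False by simp
        qed (use r in simp)
      qed
    qed
    have gen: "x * (if c = t \<and> A then y else 0) = (if c = t then (if A then z * y else 0) else 0)"
      if "c = t ==> x = z" for x y z :: complex and t A using that by simp
    have p: "Wp \<zeta> js s k (b(?k := c)) b' = Wp \<zeta> js s k b b'" by (rule Wp_cong) auto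
    show "ent (Wm \<zeta> ?j (s ?k)) (a * ?n + b ?k) (a'' * ?n + c) * Ucal Q \<zeta> js N s k (a'', b(?k := c)) (a', b') =
      (if c = b' ?k then
      (if \<forall>m. m \<notin> {1..?k} \<longrightarrow> b m = b' m then ent (Wb \<zeta> ?j (s ?k) (b ?k) (b' ?k)) a a'' * ent (Wp \<zeta> js s k b b') a'' a' else 0) else 0)"
      unfolding Suc.IH[OF Suc_leD[OF Suc.prems(1)] i Suc.prems(3)] q p w[symmetric] by (rule gen) simp
  qed
  also have "\<dots> = (\<Sum>a''<d. if \<forall>m. m \<notin> {1..?k} \<longrightarrow> b m = b' m then ent (Wb \<zeta> ?j (s ?k) (b ?k) (b' ?k)) a a'' * ent (Wp \<zeta> js s k b b') a'' a' else 0)"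
  proof -
    have "b' ?k < ?n" using Suc.prems(3) k by (auto simp: idxset_def)
    then show ?thesis by simp
  qed
  also have "\<dots> = (if \<forall>m. m \<notin> {1..?k} \<longrightarrow> b m = b' m then ent (Wp \<zeta> js s ?k b b') a a' else 0)"
  proof (cases "\<forall>m. m \<notin> {1..?k} \<longrightarrow> b m = b' m")
    case True show ?thesis unfolding if_P[OF True] Wp.simps ent_multL[OF Wb_crn[OF j]] ..
  next
    case False show ?thesis unfolding if_not_P[OF False] by (rule sum.neutral_const)
  qed
  finally show ?case .
qed

definition rE where "rE \<zeta> js N b b' = (\<Prod>m\<in>{1..N}. rhoE Q \<zeta> (js m) $$ (b m, b' m))"
text \<open>The unnormalized state of the system after N interactions with outcomes s: the probes
  start in the product state \<open>rE\<close> and are traced out at the end. Its trace is the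
  probability of s.\<close>

definition Rw :: "(nat => real) => (nat => nat) => (nat => real \<times> real) => fm => nat => fm" where
  "Rw \<zeta> js s R N = (\<Sum>b\<in>finwords (\<lambda>m. {..<n (js m)}) 0 N. \<Sum>b1\<in>finwords (\<lambda>m. {..<n (js m)}) 0 N. \<Sum>b2\<in>finwords (\<lambda>m. {..<n (js m)}) 0 N.
     rE \<zeta> js N b1 b2 *. (Wp \<zeta> js s N b b1 * R * fadj (Wp \<zeta> js s N b b2)))"

lemma prob_Rw:
  assumes js: "\<And>m. m \<in> {1..N} ==> js m \<in> {1..M}" and \<rho>: "\<rho> \<in> carrier_mat d d"
  shows "prob Q \<zeta> \<rho> js N s = Re (ftr (Rw \<zeta> js s (emb \<rho>) N))"
proof -
  let ?I = "idxset Q js N" and ?D = "finwords (\<lambda>m. {..<n (js m)}) 0 N"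
  have sI: "(\<Sum>x\<in>?I. f x) = (\<Sum>a<d. \<Sum>b\<in>?D. f (a, b))" for f :: "_ => complex"
    unfolding idxset_eq by (simp add: sum.cartesian_product)
  have U: "Ucal Q \<zeta> js N s N (a, b) (a', b') = ent (Wp \<zeta> js s N b b') a a'" if "a < d" "b \<in> ?D" "a' < d" "b' \<in> ?D" for a b a' b'
  proof -
    have i: "(a, b) \<in> ?I" "(a', b') \<in> ?I" using that by (auto simp: idxset_eq)
    have h: "\<forall>m. m \<notin> {1..N} \<longrightarrow> b m = b' m" using that by (auto simp: finwords_def)
    have "Ucal Q \<zeta> js N s N (a, b) (a', b') = (if \<forall>m. m \<notin> {1..N} \<longrightarrow> b m = b' m then ent (Wp \<zeta> js s N b b') a a' else 0)"
      by (rule Ucal_eq[OF _ order_refl i]) (rule js)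
    then show ?thesis unfolding if_P[OF h] .
  qed
  have Wc: "Wp \<zeta> js s N b b' \<in> crn d d" for b b' by (rule Wp_crn[OF js])
  have Rc: "emb \<rho> \<in> crn d d" by (rule emb_crn[OF \<rho>])
  have "optr ?I (opmul ?I (opmul ?I (Ucal Q \<zeta> js N s N) (rho_tot Q \<zeta> js N \<rho>)) (opadj (Ucal Q \<zeta> js N s N))) =
    (\<Sum>a<d. \<Sum>b\<in>?D. \<Sum>a2<d. \<Sum>b2\<in>?D. (\<Sum>a1<d. \<Sum>b1\<in>?D. ent (Wp \<zeta> js s N b b1) a a1 * (ent (emb \<rho>) a1 a2 * rE \<zeta> js N b1 b2)) * cnj (ent (Wp \<zeta> js s N b b2) a a2))"
    unfolding optr_def opmul_def opadj_def sI
    by (intro sum.cong refl) (simp add: U rho_tot_def rE_def ent_emb[OF \<rho>])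
  also have "\<dots> = (\<Sum>b\<in>?D. \<Sum>b1\<in>?D. \<Sum>b2\<in>?D. rE \<zeta> js N b1 b2 * ftr (Wp \<zeta> js s N b b1 * emb \<rho> * fadj (Wp \<zeta> js s N b b2)))"
  proof -
    have t: "ftr (Wp \<zeta> js s N b b1 * emb \<rho> * fadj (Wp \<zeta> js s N b b2)) =
       (\<Sum>a<d. \<Sum>a2<d. \<Sum>a1<d. ent (Wp \<zeta> js s N b b1) a a1 * ent (emb \<rho>) a1 a2 * cnj (ent (Wp \<zeta> js s N b b2) a a2))" for b b1 b2
      unfolding ftr_crn[OF crn_mult[OF crn_mult[OF Wc Rc] crn_fadj[OF Wc]]] ent_multL[OF crn_mult[OF Wc Rc]] ent_multL[OF Wc] ent_fadj
      by (simp add: sum_distrib_right)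
    have "(\<Sum>a<d. \<Sum>b\<in>?D. \<Sum>a2<d. \<Sum>b2\<in>?D. (\<Sum>a1<d. \<Sum>b1\<in>?D. ent (Wp \<zeta> js s N b b1) a a1 * (ent (emb \<rho>) a1 a2 * rE \<zeta> js N b1 b2)) * cnj (ent (Wp \<zeta> js s N b b2) a a2))
      = (\<Sum>b\<in>?D. \<Sum>a<d. \<Sum>a2<d. \<Sum>b2\<in>?D. \<Sum>a1<d. \<Sum>b1\<in>?D. ent (Wp \<zeta> js s N b b1) a a1 * (ent (emb \<rho>) a1 a2 * rE \<zeta> js N b1 b2) * cnj (ent (Wp \<zeta> js s N b b2) a a2))"
      unfolding sum_distrib_right by (rule sum.swap)
    also have "\<dots> = (\<Sum>b\<in>?D. \<Sum>b1\<in>?D. \<Sum>b2\<in>?D. \<Sum>a<d. \<Sum>a2<d. \<Sum>a1<d. ent (Wp \<zeta> js s N b b1) a a1 * (ent (emb \<rho>) a1 a2 * rE \<zeta> js N b1 b2) * cnj (ent (Wp \<zeta> js s N b b2) a a2))"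
    proof (rule sum.cong[OF refl])
      fix b
      define G where "G a a2 b2 a1 b1 = ent (Wp \<zeta> js s N b b1) a a1 * (ent (emb \<rho>) a1 a2 * rE \<zeta> js N b1 b2) * cnj (ent (Wp \<zeta> js s N b b2) a a2)" for a a2 b2 a1 b1
      have "(\<Sum>a<d. \<Sum>a2<d. \<Sum>b2\<in>?D. \<Sum>a1<d. \<Sum>b1\<in>?D. G a a2 b2 a1 b1) = (\<Sum>a<d. \<Sum>a2<d. \<Sum>b2\<in>?D. \<Sum>b1\<in>?D. \<Sum>a1<d. G a a2 b2 a1 b1)"
        by (intro sum.cong[OF refl] sum.swap)
      also have "\<dots> = (\<Sum>a<d. \<Sum>a2<d. \<Sum>b1\<in>?D. \<Sum>b2\<in>?D. \<Sum>a1<d. G a a2 b2 a1 b1)"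
        by (rule sum.cong[OF refl], rule sum.cong[OF refl], rule sum.swap)
      also have "\<dots> = (\<Sum>a<d. \<Sum>b1\<in>?D. \<Sum>b2\<in>?D. \<Sum>a2<d. \<Sum>a1<d. G a a2 b2 a1 b1)"
        by (rule sum.cong[OF refl], subst sum.swap, rule sum.cong[OF refl], rule sum.swap)
      also have "\<dots> = (\<Sum>b1\<in>?D. \<Sum>b2\<in>?D. \<Sum>a<d. \<Sum>a2<d. \<Sum>a1<d. G a a2 b2 a1 b1)"
        by (subst sum.swap, rule sum.cong[OF refl], rule sum.swap)
      finally show "(\<Sum>a<d. \<Sum>a2<d. \<Sum>b2\<in>?D. \<Sum>a1<d. \<Sum>b1\<in>?D. ent (Wp \<zeta> js s N b b1) a a1 * (ent (emb \<rho>) a1 a2 * rE \<zeta> js N b1 b2) * cnj (ent (Wp \<zeta> js s N b b2) a a2)) =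
        (\<Sum>b1\<in>?D. \<Sum>b2\<in>?D. \<Sum>a<d. \<Sum>a2<d. \<Sum>a1<d. ent (Wp \<zeta> js s N b b1) a a1 * (ent (emb \<rho>) a1 a2 * rE \<zeta> js N b1 b2) * cnj (ent (Wp \<zeta> js s N b b2) a a2))"
        unfolding G_def .
    qed
    also have "\<dots> = (\<Sum>b\<in>?D. \<Sum>b1\<in>?D. \<Sum>b2\<in>?D. rE \<zeta> js N b1 b2 * ftr (Wp \<zeta> js s N b b1 * emb \<rho> * fadj (Wp \<zeta> js s N b b2)))"
      unfolding t sum_distrib_left by (intro sum.cong[OF refl]) (simp only: mult_ac)
    finally show ?thesis .
  qed
  also have "\<dots> = ftr (Rw \<zeta> js s (emb \<rho>) N)" by (simp add: Rw_def ftr_sum ftr_smul)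
  finally show ?thesis by (simp add: prob_def Let_def)
qed

text \<open>When the partial trace is taken in the eigenbasis (\<open>J_sandwich\<close>), the two
  spectral projections become indicators of the incoming and the outgoing level, and the measured
  interaction is a map of the form \<open>Lm\<close> with restricted weights.\<close>

lemma probe_map: assumes j: "j \<in> {1..M}"
  shows "(\<Sum>x<n j. \<Sum>y<n j. \<Sum>y'<n j. ent (emb (rhoE Q \<zeta> j)) y y' *. (Wb \<zeta> j \<sigma> x y * X * fadj (Wb \<zeta> j \<sigma> x y'))) =
    Lm {..<n j} (K j) (\<lambda>b' b. of_real (p \<zeta> j b * (chi \<zeta> j (fst \<sigma>) b * chi \<zeta> j (snd \<sigma>) b'))) X"
proof -
  let ?n = "n j" and ?G = "F j" and ?U = "emb (Uop Q j)"
  let ?P = "\<lambda>t. ?G * fdiag ?n (\<lambda>b. of_real (chi \<zeta> j t b)) * fadj ?G"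
  have G: "unitary ?n ?G" by (rule Fu[OF j])
  then have Gc: "?G \<in> crn ?n ?n" by (simp add: unitary_def)
  have "(\<Sum>x<?n. \<Sum>y<?n. \<Sum>y'<?n. ent (emb (rhoE Q \<zeta> j)) y y' *. (Wb \<zeta> j \<sigma> x y * X * fadj (Wb \<zeta> j \<sigma> x y'))) =
    (\<Sum>x<?n. fadj (inc d ?n x) * (Wm \<zeta> j \<sigma> * fkron d ?n X (emb (rhoE Q \<zeta> j)) * fadj (Wm \<zeta> j \<sigma>)) * inc d ?n x)"
    unfolding fkron_def Wb_def sum_distrib_left sum_distrib_right
    by (intro sum.cong[OF refl]) (simp add: fadj_mult mult.assoc)
  also have "\<dots> = (\<Sum>b'<?n. fadj (Jinc d ?n ?G b') * (Wm \<zeta> j \<sigma> * fkron d ?n X (emb (rhoE Q \<zeta> j)) * fadj (Wm \<zeta> j \<sigma>)) * Jinc d ?n ?G b')"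
    by (rule J_sandwich[OF G, symmetric])
  also have "\<dots> = (\<Sum>b'<?n. \<Sum>b<?n. of_real (p \<zeta> j b * (chi \<zeta> j (fst \<sigma>) b * chi \<zeta> j (snd \<sigma>) b')) *. (K j b' b * X * fadj (K j b' b)))"
  proof (rule sum.cong[OF refl])
    fix b' assume b': "b' \<in> {..<?n}"
    have JW: "fadj (Jinc d ?n ?G b') * Wm \<zeta> j \<sigma> * Jinc d ?n ?G b = of_real (chi \<zeta> j (fst \<sigma>) b * chi \<zeta> j (snd \<sigma>) b') *. K j b' b" if b: "b < ?n" for b
    proof -
      have "fadj (Jinc d ?n ?G b') * Wm \<zeta> j \<sigma> * Jinc d ?n ?G b =
        (fadj (Jinc d ?n ?G b') * fkron d ?n (fid d) (?P (snd \<sigma>))) * ?U * (fkron d ?n (fid d) (?P (fst \<sigma>)) * Jinc d ?n ?G b)"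
        unfolding Wm_def SP_emb(1)[OF j] by (simp add: mult.assoc)
      also have "\<dots> = of_real (chi \<zeta> j (fst \<sigma>) b * chi \<zeta> j (snd \<sigma>) b') *. K j b' b"
        unfolding fkron_J(2)[OF G _ crn_fid, of b'] fkron_J(1)[OF G b crn_fid]
        using fkron_J(2)[OF G _ crn_fid, of b'] b'
        by (simp add: Kop_def fid_multL[OF crn_fadj[OF Jinc_crn]] fid_multR[OF Jinc_crn] fm.scale_scale mult.commute mult.assoc)
      finally show ?thesis .
    qed
    have "fadj (Jinc d ?n ?G b') * (Wm \<zeta> j \<sigma> * fkron d ?n X (emb (rhoE Q \<zeta> j)) * fadj (Wm \<zeta> j \<sigma>)) * Jinc d ?n ?G b' =
      (\<Sum>b<?n. of_real (p \<zeta> j b) *. ((fadj (Jinc d ?n ?G b') * Wm \<zeta> j \<sigma> * Jinc d ?n ?G b) * X * fadj (fadj (Jinc d ?n ?G b') * Wm \<zeta> j \<sigma> * Jinc d ?n ?G b)))"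
      unfolding rhoE_emb(1)[OF j] fkron_J_diag[OF Gc] sum_distrib_left sum_distrib_right
      by (intro sum.cong[OF refl]) (simp add: fadj_mult mult.assoc)
    also have "\<dots> = (\<Sum>b<?n. of_real (p \<zeta> j b * (chi \<zeta> j (fst \<sigma>) b * chi \<zeta> j (snd \<sigma>) b')) *. (K j b' b * X * fadj (K j b' b)))"
    proof (rule sum.cong[OF refl])
      fix b assume "b \<in> {..<?n}"
      then have b: "b < ?n" by simp
      show "of_real (p \<zeta> j b) *. ((fadj (Jinc d ?n ?G b') * Wm \<zeta> j \<sigma> * Jinc d ?n ?G b) * X * fadj (fadj (Jinc d ?n ?G b') * Wm \<zeta> j \<sigma> * Jinc d ?n ?G b)) =
        of_real (p \<zeta> j b * (chi \<zeta> j (fst \<sigma>) b * chi \<zeta> j (snd \<sigma>) b')) *. (K j b' b * X * fadj (K j b' b))"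
        unfolding JW[OF b] fadj_smul by (auto simp: chi_def)
    qed
    finally show "fadj (Jinc d ?n ?G b') * (Wm \<zeta> j \<sigma> * fkron d ?n X (emb (rhoE Q \<zeta> j)) * fadj (Wm \<zeta> j \<sigma>)) * Jinc d ?n ?G b' = \<dots>" .
  qed
  finally show ?thesis unfolding Lm_def by (subst sum.swap)
qed

primrec Rs :: "(nat => real) => (nat => nat) => (nat => real \<times> real) => fm => nat => fm" where
  "Rs \<zeta> js s R 0 = R"
| "Rs \<zeta> js s R (Suc N) = Lm {..<n (js (Suc N))} (K (js (Suc N)))
     (\<lambda>b' b. of_real (p \<zeta> (js (Suc N)) b * (chi \<zeta> (js (Suc N)) (fst (s (Suc N))) b * chi \<zeta> (js (Suc N)) (snd (s (Suc N))) b'))) (Rs \<zeta> js s R N)"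

text \<open>Each probe takes part in one interaction only and starts uncorrelated, so it can be
  traced out as soon as its interaction is over.\<close>

lemma Rw_Rs: "(\<And>m. m \<in> {1..N} ==> js m \<in> {1..M}) ==> R \<in> crn d d ==> Rw \<zeta> js s R N = Rs \<zeta> js s R N"
proof (induction N)
  case 0
  then show ?case by (simp add: Rw_def finwords_0 rE_def fid_multR[of R d d] fid_multL[of R d d])
next
  case (Suc N)
  have j: "js (Suc N) \<in> {1..M}" using Suc.prems by simp
  let ?k = "Suc N" and ?D = "finwords (\<lambda>m. {..<n (js m)}) 0 N" and ?n = "n (js (Suc N))" and ?j = "js (Suc N)"
  have Wu: "Wp \<zeta> js s ?k (b(?k := x)) (b'(?k := y)) = Wb \<zeta> ?j (s ?k) x y * Wp \<zeta> js s N b b'" for b b' x y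
    using Wp_cong[of N "b(?k := x)" b "b'(?k := y)" b'] by simp
  have ru: "rE \<zeta> js ?k (b(?k := x)) (b'(?k := y)) = rE \<zeta> js N b b' * ent (emb (rhoE Q \<zeta> ?j)) x y" if "x < ?n" "y < ?n" for b b' x y
  proof -
    have "(\<Prod>m\<in>{1..N}. rhoE Q \<zeta> (js m) $$ ((b(?k := x)) m, (b'(?k := y)) m)) = rE \<zeta> js N b b'"
      unfolding rE_def by (rule prod.cong) auto
    then show ?thesis unfolding rE_def using that by (simp add: ent_emb[OF rhoE_emb(2)[OF j]] mult.commute)
  qed
  define A where "A b b1 b2 = rE \<zeta> js N b1 b2 *. (Wp \<zeta> js s N b b1 * R * fadj (Wp \<zeta> js s N b b2))" for b b1 b2
  define P where "P x y1 y2 Z = ent (emb (rhoE Q \<zeta> ?j)) y1 y2 *. (Wb \<zeta> ?j (s ?k) x y1 * Z * fadj (Wb \<zeta> ?j (s ?k) x y2))" for x y1 y2 Z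
  have Psum: "P x y1 y2 (sum f S) = (\<Sum>a\<in>S. P x y1 y2 (f a))" for x y1 y2 f and S :: "(nat => nat) set"
    by (simp add: P_def sum_distrib_left sum_distrib_right smul_sum_right)
  have "Rw \<zeta> js s R ?k = (\<Sum>b\<in>?D. \<Sum>x<?n. \<Sum>b1\<in>?D. \<Sum>y1<?n. \<Sum>b2\<in>?D. \<Sum>y2<?n. P x y1 y2 (A b b1 b2))"
    unfolding Rw_def sum_finwords_Suc
    by (intro sum.cong[OF refl])
      (simp add: Wu ru P_def A_def fadj_mult mult.assoc fm.scale_scale mult.commute del: Wp.simps fun_upd_apply)
  also have "\<dots> = (\<Sum>x<?n. \<Sum>y1<?n. \<Sum>y2<?n. \<Sum>b\<in>?D. \<Sum>b1\<in>?D. \<Sum>b2\<in>?D. P x y1 y2 (A b b1 b2))"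
  proof -
    have "(\<Sum>b\<in>?D. \<Sum>x<?n. \<Sum>b1\<in>?D. \<Sum>y1<?n. \<Sum>b2\<in>?D. \<Sum>y2<?n. P x y1 y2 (A b b1 b2)) =
       (\<Sum>x<?n. \<Sum>b\<in>?D. \<Sum>b1\<in>?D. \<Sum>y1<?n. \<Sum>b2\<in>?D. \<Sum>y2<?n. P x y1 y2 (A b b1 b2))" by (rule sum.swap)
    also have "\<dots> = (\<Sum>x<?n. \<Sum>b\<in>?D. \<Sum>y1<?n. \<Sum>b1\<in>?D. \<Sum>b2\<in>?D. \<Sum>y2<?n. P x y1 y2 (A b b1 b2))"
      by (rule sum.cong[OF refl], rule sum.cong[OF refl], rule sum.swap)
    also have "\<dots> = (\<Sum>x<?n. \<Sum>y1<?n. \<Sum>b\<in>?D. \<Sum>b1\<in>?D. \<Sum>b2\<in>?D. \<Sum>y2<?n. P x y1 y2 (A b b1 b2))"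
      by (rule sum.cong[OF refl], rule sum.swap)
    also have "\<dots> = (\<Sum>x<?n. \<Sum>y1<?n. \<Sum>b\<in>?D. \<Sum>b1\<in>?D. \<Sum>y2<?n. \<Sum>b2\<in>?D. P x y1 y2 (A b b1 b2))"
      by (rule sum.cong[OF refl], rule sum.cong[OF refl], rule sum.cong[OF refl], rule sum.cong[OF refl], rule sum.swap)
    also have "\<dots> = (\<Sum>x<?n. \<Sum>y1<?n. \<Sum>b\<in>?D. \<Sum>y2<?n. \<Sum>b1\<in>?D. \<Sum>b2\<in>?D. P x y1 y2 (A b b1 b2))"
      by (rule sum.cong[OF refl], rule sum.cong[OF refl], rule sum.cong[OF refl], rule sum.swap)
    also have "\<dots> = (\<Sum>x<?n. \<Sum>y1<?n. \<Sum>y2<?n. \<Sum>b\<in>?D. \<Sum>b1\<in>?D. \<Sum>b2\<in>?D. P x y1 y2 (A b b1 b2))"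
      by (rule sum.cong[OF refl], rule sum.cong[OF refl], rule sum.swap)
    finally show ?thesis .
  qed
  also have "\<dots> = (\<Sum>x<?n. \<Sum>y1<?n. \<Sum>y2<?n. P x y1 y2 (Rw \<zeta> js s R N))"
    unfolding Rw_def Psum A_def ..
  also have "\<dots> = Rs \<zeta> js s R ?k"
    using Suc by (simp add: P_def probe_map[OF j])
  finally show ?case .
qed

lemma Rs_psd: "fpsd R ==> (\<And>m. m \<in> {1..N} ==> js m \<in> {1..M}) ==> fpsd (Rs \<zeta> js s R N)"
proof (induction N)
  case (Suc N)
  have j: "js (Suc N) \<in> {1..M}" using Suc.prems by simp
  show ?case unfolding Rs.simps
  proof (rule fpsd_Lm)
    show "fpsd (Rs \<zeta> js s R N)" using Suc by simp
    fix b b'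
    show "0 \<le> p \<zeta> (js (Suc N)) b * (chi \<zeta> (js (Suc N)) (fst (s (Suc N))) b * chi \<zeta> (js (Suc N)) (snd (s (Suc N))) b')"
      using gibbs_weight_pos[OF npos[OF j], of "e (js (Suc N))"] by (auto simp: chi_def less_imp_le)
  qed
qed simp

lemma prob_Rs: assumes js: "\<And>m. m \<in> {1..N} ==> js m \<in> {1..M}" and \<rho>: "state d \<rho>"
  shows "complex_of_real (prob Q \<zeta> \<rho> js N s) = ftr (Rs \<zeta> js s (emb \<rho>) N)" "prob Q \<zeta> \<rho> js N s \<ge> 0"
proof -
  have r: "\<rho> \<in> carrier_mat d d" "fpsd (emb \<rho>)" using \<rho> by (auto simp: state_emb)
  have e: "prob Q \<zeta> \<rho> js N s = Re (ftr (Rs \<zeta> js s (emb \<rho>) N))"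
  proof -
    have "Rw \<zeta> js s (emb \<rho>) N = Rs \<zeta> js s (emb \<rho>) N" by (rule Rw_Rs[OF _ emb_crn[OF r(1)]]) (rule js)
    moreover have "prob Q \<zeta> \<rho> js N s = Re (ftr (Rw \<zeta> js s (emb \<rho>) N))" by (rule prob_Rw[OF _ r(1)]) (rule js)
    ultimately show ?thesis by simp
  qed
  have psd: "fpsd (Rs \<zeta> js s (emb \<rho>) N)" by (rule Rs_psd[OF r(2) js])
  show "complex_of_real (prob Q \<zeta> \<rho> js N s) = ftr (Rs \<zeta> js s (emb \<rho>) N)"
    unfolding e using fpsd_tr_Im[OF psd] by (simp add: complex_eq_iff)
  show "prob Q \<zeta> \<rho> js N s \<ge> 0" unfolding e by (rule fpsd_tr_nonneg[OF psd])
qed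

definition sp where "sp \<zeta> j = (\<lambda>b. beta Q \<zeta> j * e j b) ` {..<n j}"

lemma Sset_eq: assumes js: "\<And>m. m \<in> {1..N} ==> js m \<in> {1..M}"
  shows "Sset Q \<zeta> js N = finwords (\<lambda>m. sp \<zeta> (js m) \<times> sp \<zeta> (js m)) (0, 0) N"
  unfolding Sset_def finwords_def Sn_def sp_def using js by (auto simp: spec_eq mem_Times_iff)

text \<open>Summing over the outcomes of a probe measurement, weighted by a phase, turns the conditional
  evolution into the tilted channel.\<close>
lemma sum_outcomes: assumes j: "j \<in> {1..M}"
  shows "(\<Sum>\<sigma>\<in>sp \<zeta> j \<times> sp \<zeta> j. c \<sigma> *. Lm {..<n j} (K j) (\<lambda>b' b. of_real (p \<zeta> j b * (chi \<zeta> j (fst \<sigma>) b * chi \<zeta> j (snd \<sigma>) b'))) X) =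
    Lm {..<n j} (K j) (\<lambda>b' b. of_real (p \<zeta> j b) * c (beta Q \<zeta> j * e j b, beta Q \<zeta> j * e j b')) X"
proof -
  let ?S = "sp \<zeta> j \<times> sp \<zeta> j"
  have fS: "finite ?S" by (simp add: sp_def)
  have "(\<Sum>\<sigma>\<in>?S. c \<sigma> *. Lm {..<n j} (K j) (\<lambda>b' b. of_real (p \<zeta> j b * (chi \<zeta> j (fst \<sigma>) b * chi \<zeta> j (snd \<sigma>) b'))) X) =
    (\<Sum>b<n j. \<Sum>b'<n j. \<Sum>\<sigma>\<in>?S. (c \<sigma> * of_real (p \<zeta> j b * (chi \<zeta> j (fst \<sigma>) b * chi \<zeta> j (snd \<sigma>) b'))) *. (K j b' b * X * fadj (K j b' b)))"
    unfolding Lm_def smul_sum_right fm.scale_scale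
    by (subst sum.swap, rule sum.cong[OF refl], rule sum.swap)
  also have "\<dots> = (\<Sum>b<n j. \<Sum>b'<n j. (of_real (p \<zeta> j b) * c (beta Q \<zeta> j * e j b, beta Q \<zeta> j * e j b')) *. (K j b' b * X * fadj (K j b' b)))"
  proof (rule sum.cong[OF refl], rule sum.cong[OF refl])
    fix b b' assume b: "b \<in> {..<n j}" "b' \<in> {..<n j}"
    let ?t = "(beta Q \<zeta> j * e j b, beta Q \<zeta> j * e j b')"
    have "(\<Sum>\<sigma>\<in>?S. c \<sigma> * of_real (p \<zeta> j b * (chi \<zeta> j (fst \<sigma>) b * chi \<zeta> j (snd \<sigma>) b'))) =
      (\<Sum>\<sigma>\<in>?S. if \<sigma> = ?t then of_real (p \<zeta> j b) * c ?t else 0)"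
      by (intro sum.cong[OF refl]) (auto simp: chi_def)
    also have "\<dots> = of_real (p \<zeta> j b) * c ?t"
    proof -
      have "?t \<in> ?S" using b by (auto simp: sp_def)
      then show ?thesis using fS by simp
    qed
    finally show "(\<Sum>\<sigma>\<in>?S. (c \<sigma> * of_real (p \<zeta> j b * (chi \<zeta> j (fst \<sigma>) b * chi \<zeta> j (snd \<sigma>) b'))) *. (K j b' b * X * fadj (K j b' b))) =
      (of_real (p \<zeta> j b) * c ?t) *. (K j b' b * X * fadj (K j b' b))"
      unfolding smul_sum_left[symmetric] by simp
  qed
  finally show ?thesis by (simp add: Lm_def)
qed

section \<open>Generating functions of the counting process\<close>

primrec Gs :: "(nat => nat => nat => complex) => (nat => nat) => fm => nat => fm" where
  "Gs \<phi> js R 0 = R"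
| "Gs \<phi> js R (Suc N) = Lm {..<n (js (Suc N))} (K (js (Suc N))) (\<phi> (js (Suc N))) (Gs \<phi> js R N)"

lemma Rs_upd: "Rs \<zeta> js (s(Suc N := \<sigma>)) R N = Rs \<zeta> js s R N"
proof -
  have "k \<le> N ==> Rs \<zeta> js (s(Suc N := \<sigma>)) R k = Rs \<zeta> js s R k" for k by (induction k) auto
  then show ?thesis by simp
qed

text \<open>A weight that is a product over the interactions can be summed one pair of outcomes at a
  time, starting from the last.\<close>

lemma sum_Sset_Rs:
  "(\<And>m. m \<in> {1..N} ==> js m \<in> {1..M}) ==>
   (\<Sum>s\<in>finwords (\<lambda>m. sp \<zeta> (js m) \<times> sp \<zeta> (js m)) (0, 0) N. (\<Prod>m\<in>{1..N}. c (js m) (s m)) *. Rs \<zeta> js s R N) =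
   Gs (\<lambda>j b' b. of_real (p \<zeta> j b) * c j (beta Q \<zeta> j * e j b, beta Q \<zeta> j * e j b')) js R N"
proof (induction N)
  case 0 then show ?case by (simp add: finwords_0)
next
  case (Suc N)
  let ?j = "js (Suc N)" and ?D = "\<lambda>N. finwords (\<lambda>m. sp \<zeta> (js m) \<times> sp \<zeta> (js m)) (0, 0) N"
  have j: "?j \<in> {1..M}" using Suc.prems by simp
  let ?L = "\<lambda>\<sigma>. Lm {..<n ?j} (K ?j) (\<lambda>b' b. of_real (p \<zeta> ?j b * (chi \<zeta> ?j (fst \<sigma>) b * chi \<zeta> ?j (snd \<sigma>) b')))"
  have pr: "(\<Prod>m\<in>{1..Suc N}. c (js m) ((s(Suc N := \<sigma>)) m)) = (\<Prod>m\<in>{1..N}. c (js m) (s m)) * c ?j \<sigma>" for s \<sigma>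
  proof -
    have "(\<Prod>m\<in>{1..N}. c (js m) ((s(Suc N := \<sigma>)) m)) = (\<Prod>m\<in>{1..N}. c (js m) (s m))" by (rule prod.cong) auto
    then show ?thesis by (simp add: mult.commute)
  qed
  have "(\<Sum>s\<in>?D (Suc N). (\<Prod>m\<in>{1..Suc N}. c (js m) (s m)) *. Rs \<zeta> js s R (Suc N)) =
    (\<Sum>s\<in>?D N. (\<Prod>m\<in>{1..N}. c (js m) (s m)) *. (\<Sum>\<sigma>\<in>sp \<zeta> ?j \<times> sp \<zeta> ?j. c ?j \<sigma> *. ?L \<sigma> (Rs \<zeta> js s R N)))"
    unfolding sum_finwords_Suc pr by (simp add: Rs_upd smul_sum_right fm.scale_scale)
  also have "\<dots> = (\<Sum>s\<in>?D N. (\<Prod>m\<in>{1..N}. c (js m) (s m)) *. Lm {..<n ?j} (K ?j) (\<lambda>b' b. of_real (p \<zeta> ?j b) * c ?j (beta Q \<zeta> ?j * e ?j b, beta Q \<zeta> ?j * e ?j b')) (Rs \<zeta> js s R N))"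
    unfolding sum_outcomes[OF j] ..
  also have "\<dots> = Lm {..<n ?j} (K ?j) (\<lambda>b' b. of_real (p \<zeta> ?j b) * c ?j (beta Q \<zeta> ?j * e ?j b, beta Q \<zeta> ?j * e ?j b'))
     (\<Sum>s\<in>?D N. (\<Prod>m\<in>{1..N}. c (js m) (s m)) *. Rs \<zeta> js s R N)"
  proof -
    have s: "Lm A k \<psi> (sum f B) = (\<Sum>b\<in>B. Lm A k \<psi> (f b))" for A :: "nat set" and k \<psi> f and B :: "(nat => real \<times> real) set"
      by (induction B rule: infinite_finite_induct) (auto simp: Lm_add)
    show ?thesis unfolding s Lm_smul ..
  qed
  finally show ?case using Suc by simp
qed

end

section \<open>Convergence in distribution from characteristic functions\<close>

text \<open>Real trigonometric polynomials in the coordinates 1..M; the free phase lets cosines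
  cover sines. They form an algebra, and their expectations are determined by the characteristic
  function.\<close>

inductive_set trigpoly :: "nat => ((nat => real) => real) set" for M where
  wave: "(\<lambda>x. c * cos ((\<Sum>j=1..M. u j * x j) + \<theta>)) \<in> trigpoly M"
| add: "f \<in> trigpoly M ==> g \<in> trigpoly M ==> (\<lambda>x. f x + g x) \<in> trigpoly M"

lemma trigpoly_const: "(\<lambda>x. c) \<in> trigpoly M"
  using trigpoly.wave[where u = "\<lambda>_. 0" and \<theta> = 0 and c = c and M = M] by simp

lemma trigpoly_mult_wave:
  "f \<in> trigpoly M ==> (\<lambda>x. f x * (c * cos ((\<Sum>j=1..M. u j * x j) + \<theta>))) \<in> trigpoly M"
proof (induction rule: trigpoly.induct)
  case (wave c' u' \<theta>')
  have "(c' * cos ((\<Sum>j=1..M. u' j * x j) + \<theta>')) * (c * cos ((\<Sum>j=1..M. u j * x j) + \<theta>)) =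
     (c' * c / 2) * cos ((\<Sum>j=1..M. (u' j - u j) * x j) + (\<theta>' - \<theta>)) + (c' * c / 2) * cos ((\<Sum>j=1..M. (u' j + u j) * x j) + (\<theta>' + \<theta>))" for x
  proof -
    define A B where "A = (\<Sum>j=1..M. u' j * x j) + \<theta>'" and "B = (\<Sum>j=1..M. u j * x j) + \<theta>"
    have AB: "(\<Sum>j=1..M. (u' j - u j) * x j) + (\<theta>' - \<theta>) = A - B" "(\<Sum>j=1..M. (u' j + u j) * x j) + (\<theta>' + \<theta>) = A + B"
      by (simp_all add: A_def B_def algebra_simps sum_subtractf sum.distrib)
    show ?thesis unfolding AB A_def[symmetric] B_def[symmetric] by (simp add: cos_times_cos field_simps)
  qed
  then show ?case by (simp only:) (intro trigpoly.intros)
next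
  case (add f g) then show ?case by (simp add: ring_distribs trigpoly.add)
qed

lemma trigpoly_mult: "g \<in> trigpoly M ==> f \<in> trigpoly M ==> (\<lambda>x. f x * g x) \<in> trigpoly M"
proof (induction rule: trigpoly.induct)
  case (add g h) then show ?case by (simp add: ring_distribs trigpoly.add)
qed (rule trigpoly_mult_wave)

lemma trigpoly_bounded: "f \<in> trigpoly M ==> \<exists>B. \<forall>x. \<bar>f x\<bar> \<le> B"
proof (induction rule: trigpoly.induct)
  case (wave c u \<theta>)
  have "\<bar>c * cos ((\<Sum>j=1..M. u j * x j) + \<theta>)\<bar> \<le> \<bar>c\<bar>" for x :: "nat => real"
    using mult_left_mono[OF abs_cos_le_one[of "(\<Sum>j=1..M. u j * x j) + \<theta>"], of "\<bar>c\<bar>"] by (simp add: abs_mult)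
  then show ?case by blast
next
  case (add f g)
  then obtain B B' where "\<forall>x. \<bar>f x\<bar> \<le> B" "\<forall>x. \<bar>g x\<bar> \<le> B'" by blast
  then have "\<bar>f x + g x\<bar> \<le> B + B'" for x by (meson abs_triangle_ineq add_mono order_trans)
  then show ?case by blast
qed
lemma trigpoly_cont: "f \<in> trigpoly M ==> continuous_on S f"
proof (induction rule: trigpoly.induct)
  case (wave c u \<theta>)
  have "continuous_on S (\<lambda>x :: nat => real. x j)" for j by (rule continuous_on_product_coordinates[THEN continuous_on_subset]) simp
  then show ?case by (intro continuous_intros)
qed (intro continuous_intros)

text \<open>Approximate on the box by Stone-Weierstrass, then truncate by a polynomial in the
  (globally bounded) approximant, so that the bound on \<open>g\<close> survives outside the box.\<close>
lemma trigpoly_approx: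
  assumes g: "continuous_on (RM M) g" and b: "\<And>x. x \<in> RM M ==> \<bar>g x\<bar> \<le> C" and \<epsilon>: "\<epsilon> > 0" and R: "R \<ge> 0"
  shows "\<exists>f\<in>trigpoly M. (\<forall>x\<in>RM M. (\<forall>j\<in>{1..M}. \<bar>x j\<bar> \<le> R) \<longrightarrow> \<bar>g x - f x\<bar> < \<epsilon>) \<and> (\<forall>x. \<bar>f x\<bar> \<le> C + \<epsilon>)"
proof -
  define S where "S = {x \<in> RM M. \<forall>j\<in>{1..M}. \<bar>x j\<bar> \<le> R}"
  \<comment> \<open>On \<open>RM\<close> the coordinates outside 1..M are 0, so the box is a product
    of compact sets over all coordinates and hence compact.\<close>
  have S_eq: "S = PiE UNIV (\<lambda>j. if j \<in> {1..M} then {-R..R} else {0})"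
    unfolding S_def RM_def by (auto simp: PiE_def Pi_def abs_le_iff split: if_splits) (metis atLeastAtMost_iff neg_le_iff_le minus_minus abs_le_D2 abs_le_D1 | fastforce)+
  have "compactin (product_topology (\<lambda>_. euclidean) UNIV) S"
    unfolding S_eq compactin_PiE by auto
  then have S: "compact S" by (simp add: euclidean_product_topology)
  have C0: "C \<ge> 0" using b[of "\<lambda>_. 0"] by (auto simp: RM_def)
  interpret ring: function_ring_on "trigpoly M" S
  proof
    fix x y assume xy: "x \<in> S" "y \<in> S" "x \<noteq> y"
    then obtain j where j: "x j \<noteq> y j" by blast
    then have jM: "j \<in> {1..M}" using xy by (auto simp: S_def RM_def)
    \<comment> \<open>With this scaling both arguments lie in [-1, 1], inside an interval on which
      the sine is injective; the phase -pi/2 below turns the cosine into a sine.\<close>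
    define t where "t = 1 / (\<bar>x j\<bar> + \<bar>y j\<bar> + 1)"
    have t: "t > 0" "\<bar>t * x j\<bar> \<le> 1" "\<bar>t * y j\<bar> \<le> 1" by (auto simp: t_def abs_mult field_simps)
    have s: "(\<Sum>i=1..M. (if i = j then t else 0) * z i) = t * z j" for z :: "nat => real"
    proof -
      have "(\<Sum>i=1..M. (if i = j then t else 0) * z i) = (\<Sum>i=1..M. if i = j then t * z j else 0)" by (intro sum.cong) auto
      then show ?thesis using jM by simp
    qed
    let ?f = "\<lambda>x. 1 * cos ((\<Sum>i=1..M. (if i = j then t else 0) * x i) + - (pi / 2))"
    have "?f \<in> trigpoly M" by (rule trigpoly.wave)
    moreover have "?f z = sin (t * z j)" for z unfolding s by (simp add: cos_diff)
    moreover have "sin (t * x j) \<noteq> sin (t * y j)"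
    proof
      assume si: "sin (t * x j) = sin (t * y j)"
      have "1 \<le> pi / 2" using pi_ge_two by simp
      then have "- (pi / 2) \<le> t * x j" "t * x j \<le> pi / 2" "- (pi / 2) \<le> t * y j" "t * y j \<le> pi / 2"
        using t by linarith+
      from sin_inj_pi[OF this si] have "t * x j = t * y j" .
      then show False using j t by simp
    qed
    ultimately show "\<exists>f\<in>trigpoly M. f x \<noteq> f y" by (intro bexI[of _ ?f]) auto
  next
    show "compact S" by (rule S)
    show "continuous_on S f" if "f \<in> trigpoly M" for f using that by (rule trigpoly_cont)
    show "(\<lambda>x. f x + g x) \<in> trigpoly M" if "f \<in> trigpoly M" "g \<in> trigpoly M" for f g using that by (rule trigpoly.add)
    show "(\<lambda>x. f x * g x) \<in> trigpoly M" if "f \<in> trigpoly M" "g \<in> trigpoly M" for f g using that(2,1) by (rule trigpoly_mult)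
    show "(\<lambda>_. c) \<in> trigpoly M" for c by (rule trigpoly_const)
  qed
  have "continuous_on S g" using g by (rule continuous_on_subset) (auto simp: S_def)
  then obtain f where f: "f \<in> trigpoly M" "\<And>x. x \<in> S ==> \<bar>g x - f x\<bar> < \<epsilon> / 2"
    using ring.Stone_Weierstrass_basic[of g "\<epsilon> / 2"] \<epsilon> by auto
  obtain B where B: "\<And>x. \<bar>f x\<bar> \<le> B" using trigpoly_bounded[OF f(1)] by blast
  define cl where "cl y = max (- C) (min C y)" for y
  have "continuous_on {-B..B} cl" unfolding cl_def by (intro continuous_intros)
  then obtain q :: "real => real" where q: "real_polynomial_function q" "\<And>y. y \<in> {-B..B} ==> \<bar>cl y - q y\<bar> < \<epsilon> / 2"
    using Stone_Weierstrass_real_polynomial_function[of "{-B..B}" cl "\<epsilon> / 2"] \<epsilon> by auto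
  have qf: "(\<lambda>x. q (f x)) \<in> trigpoly M"
    using q(1)
  proof (induction rule: real_polynomial_function.induct)
    case (linear h)
    then interpret h: bounded_linear h .
    have e: "h (f x) = f x * h 1" for x using h.scaleR[of "f x" 1] by simp
    show ?case unfolding e by (rule trigpoly_mult[OF trigpoly_const f(1)])
  next
    case (const c) show ?case by (rule trigpoly_const)
  next
    case (add q1 q2) then show ?case by (intro trigpoly.add)
  next
    case (mult q1 q2) then show ?case by (intro trigpoly_mult)
  qed
  show ?thesis
  proof (intro bexI[OF _ qf] conjI ballI allI impI)
    fix x
    have fB: "f x \<in> {-B..B}" using B[of x] by (simp add: abs_le_iff)
    have "\<bar>cl (f x)\<bar> \<le> C" using C0 by (simp add: cl_def)
    then show "\<bar>q (f x)\<bar> \<le> C + \<epsilon>" using q(2)[OF fB] \<epsilon> by linarith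
    assume x: "x \<in> RM M" "\<forall>j\<in>{1..M}. \<bar>x j\<bar> \<le> R"
    then have "x \<in> S" by (simp add: S_def)
    then have "\<bar>g x - f x\<bar> < \<epsilon> / 2" by (rule f(2))
    moreover have "\<bar>g x - cl (f x)\<bar> \<le> \<bar>g x - f x\<bar>" using b[OF x(1)] by (simp add: cl_def abs_le_iff min_def max_def) linarith
    ultimately show "\<bar>g x - q (f x)\<bar> < \<epsilon>" using q(2)[OF fB] by linarith
  qed
qed

text \<open>Bounded second moments make the laws tight by Chebyshev's inequality. Inside a large box
  g is replaced by a trigonometric polynomial, whose expectation converges by the assumption on
  characteristic functions; outside, both functions are bounded and the mass is small.\<close>

lemma char_fn_convergence:
  fixes P :: "nat => 'w => real" and X :: "nat => 'w => nat => real" and Y :: "'v => nat => real"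
  assumes fin: "\<And>N. finite (\<Omega> N)" and pos: "\<And>N \<omega>. \<omega> \<in> \<Omega> N ==> P N \<omega> \<ge> 0" and one: "\<And>N. (\<Sum>\<omega>\<in>\<Omega> N. P N \<omega>) = 1"
    and XR: "\<And>N \<omega>. X N \<omega> \<in> RM M"
    and mom: "\<And>j. j \<in> {1..M} ==> \<exists>C. \<forall>\<^sub>F N in sequentially. (\<Sum>\<omega>\<in>\<Omega> N. P N \<omega> * (X N \<omega> j)\<^sup>2) \<le> C"
    and pr: "prob_space \<mu>" and YR: "\<And>v. Y v \<in> RM M" and Ym: "Y \<in> borel_measurable \<mu>"
    and Yj: "\<And>j. (\<lambda>v. Y v j) \<in> borel_measurable \<mu>"
    and cf: "\<And>u. (\<lambda>N. \<Sum>\<omega>\<in>\<Omega> N. complex_of_real (P N \<omega>) * iexp (\<Sum>j=1..M. u j * X N \<omega> j)) \<longlonglongrightarrow> (CLINT v|\<mu>. iexp (\<Sum>j=1..M. u j * Y v j))"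
    and g: "continuous_on (RM M) g" and bd: "bounded (g ` RM M)"
  shows "(\<lambda>N. \<Sum>\<omega>\<in>\<Omega> N. P N \<omega> * g (X N \<omega>)) \<longlonglongrightarrow> (LINT v|\<mu>. g (Y v))"
proof -
  interpret prob_space \<mu> by (rule pr)
  have trig: "(\<lambda>N. \<Sum>\<omega>\<in>\<Omega> N. P N \<omega> * f (X N \<omega>)) \<longlonglongrightarrow> (LINT v|\<mu>. f (Y v)) \<and> integrable \<mu> (\<lambda>v. f (Y v))" if "f \<in> trigpoly M" for f
    using that
  proof (induction rule: trigpoly.induct)
    case (wave c u \<theta>)
    have m: "(\<lambda>v. \<Sum>j=1..M. u j * Y v j) \<in> borel_measurable \<mu>" using Yj by measurable
    have i: "integrable \<mu> (\<lambda>v. iexp (\<Sum>j=1..M. u j * Y v j))"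
    proof (rule integrable_const_bound[of _ 1])
      show "(\<lambda>v. iexp (\<Sum>j=1..M. u j * Y v j)) \<in> borel_measurable \<mu>"
        by (rule measurable_compose[OF m, of "\<lambda>t. iexp t"]) simp
    qed (simp del: of_real_sum)
    have e: "c * cos (a + \<theta>) = Re ((of_real c * cis \<theta>) * iexp a)" for a
      by (simp add: cis_conv_exp cos_add Re_exp Im_exp algebra_simps flip: cis_conv_exp)
    have "(\<lambda>N. Re ((of_real c * cis \<theta>) * (\<Sum>\<omega>\<in>\<Omega> N. complex_of_real (P N \<omega>) * iexp (\<Sum>j=1..M. u j * X N \<omega> j)))) \<longlonglongrightarrow>
        Re ((of_real c * cis \<theta>) * (CLINT v|\<mu>. iexp (\<Sum>j=1..M. u j * Y v j)))"
      by (intro tendsto_intros cf)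
    moreover have "Re ((of_real c * cis \<theta>) * (\<Sum>\<omega>\<in>\<Omega> N. complex_of_real (P N \<omega>) * iexp (\<Sum>j=1..M. u j * X N \<omega> j))) =
       (\<Sum>\<omega>\<in>\<Omega> N. P N \<omega> * (c * cos ((\<Sum>j=1..M. u j * X N \<omega> j) + \<theta>)))" for N
      unfolding sum_distrib_left Re_sum
    proof (rule sum.cong[OF refl])
      fix \<omega>
      have "(of_real c * cis \<theta>) * (complex_of_real (P N \<omega>) * iexp (\<Sum>j=1..M. u j * X N \<omega> j)) =
        complex_of_real (P N \<omega>) * ((of_real c * cis \<theta>) * iexp (\<Sum>j=1..M. u j * X N \<omega> j))" by (simp only: mult_ac)
      then show "Re ((of_real c * cis \<theta>) * (complex_of_real (P N \<omega>) * iexp (\<Sum>j=1..M. u j * X N \<omega> j))) =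
        P N \<omega> * (c * cos ((\<Sum>j=1..M. u j * X N \<omega> j) + \<theta>))" unfolding e by (simp only: Re_complex_of_real Im_complex_of_real times_complex.simps)
    qed
    moreover have "(LINT v|\<mu>. c * cos ((\<Sum>j=1..M. u j * Y v j) + \<theta>)) = Re ((of_real c * cis \<theta>) * (CLINT v|\<mu>. iexp (\<Sum>j=1..M. u j * Y v j)))"
    proof -
      have "integrable \<mu> (\<lambda>v. (of_real c * cis \<theta>) * iexp (\<Sum>j=1..M. u j * Y v j))" using i by (rule integrable_mult_right)
      from integral_Re[OF this] show ?thesis unfolding e integral_mult_right_zero .
    qed
    moreover have "integrable \<mu> (\<lambda>v. c * cos ((\<Sum>j=1..M. u j * Y v j) + \<theta>))"
    proof -
      have "integrable \<mu> (\<lambda>v. (of_real c * cis \<theta>) * iexp (\<Sum>j=1..M. u j * Y v j))" using i by (rule integrable_mult_right)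
      from integrable_Re[OF this] show ?thesis unfolding e .
    qed
    ultimately show ?case by simp
  next
    case (add f h)
    then show ?case by (auto simp: ring_distribs sum.distrib intro!: tendsto_add)
  qed
  obtain C where C: "\<And>x. x \<in> RM M ==> \<bar>g x\<bar> \<le> C" using bd by (auto simp: bounded_iff)
  have C0: "C \<ge> 0" using C[of "\<lambda>_. 0"] by (auto simp: RM_def)
  have RMc: "closed (RM M)"
  proof -
    have "RM M = (\<Inter>i\<in>-{1..M}. {x. x i = 0})" by (auto simp: RM_def)
    moreover have "closed {x :: nat => real. x i = 0}" for i
      by (intro closed_Collect_eq continuous_on_product_coordinates continuous_on_const)
    ultimately show ?thesis by auto
  qed
  \<comment> \<open>g is continuous on the closed set \<open>RM\<close> only, so measurability is
    obtained for its extension by 0.\<close>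
  have gY: "(\<lambda>v. g (Y v)) \<in> borel_measurable \<mu>"
  proof -
    have "(\<lambda>x. indicat_real (RM M) x *\<^sub>R g x) \<in> borel_measurable borel"
      by (rule borel_measurable_continuous_on_indicator[OF _ g]) (use RMc in auto)
    from measurable_compose[OF Ym this] have "(\<lambda>v. indicat_real (RM M) (Y v) *\<^sub>R g (Y v)) \<in> borel_measurable \<mu>" .
    then show ?thesis using YR by simp
  qed
  have gi: "integrable \<mu> (\<lambda>v. g (Y v))"
    by (rule integrable_const_bound[of _ C]) (use C YR gY in auto)
  define out where "out R x = (if \<exists>j\<in>{1..M}. \<bar>x j\<bar> > R then 1 else 0 :: real)" for R :: real and x :: "nat => real"
  have om: "(\<lambda>v. out R (Y v)) \<in> borel_measurable \<mu>" for R unfolding out_def using Yj by measurable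
  have tailY: "(\<lambda>k. LINT v|\<mu>. out (real k) (Y v)) \<longlonglongrightarrow> 0"
  proof -
    have "(\<lambda>k. LINT v|\<mu>. out (real k) (Y v)) \<longlonglongrightarrow> (LINT v|\<mu>. 0)"
    proof (rule integral_dominated_convergence[where w = "\<lambda>_. 1"])
      show "AE v in \<mu>. (\<lambda>k. out (real k) (Y v)) \<longlonglongrightarrow> 0"
      proof (rule AE_I2)
        fix v
        have "\<forall>\<^sub>F k in sequentially. out (real k) (Y v) = 0"
          unfolding eventually_sequentially
        proof (intro exI allI impI)
          fix k assume k: "nat \<lceil>\<Sum>j=1..M. \<bar>Y v j\<bar>\<rceil> \<le> k"
          have "\<bar>Y v j\<bar> \<le> real k" if "j \<in> {1..M}" for j
          proof -
            have "\<bar>Y v j\<bar> \<le> (\<Sum>j=1..M. \<bar>Y v j\<bar>)" using that by (intro member_le_sum) auto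
            also have "\<dots> \<le> real k" using k by linarith
            finally show ?thesis .
          qed
          then show "out (real k) (Y v) = 0" by (force simp: out_def)
        qed
        then show "(\<lambda>k. out (real k) (Y v)) \<longlonglongrightarrow> 0" by (rule tendsto_eventually)
      qed
    qed (use om in \<open>auto simp: out_def\<close>)
    then show ?thesis by simp
  qed
  have "\<forall>j. \<exists>D. j \<in> {1..M} \<longrightarrow> (\<forall>\<^sub>F N in sequentially. (\<Sum>\<omega>\<in>\<Omega> N. P N \<omega> * (X N \<omega> j)\<^sup>2) \<le> D)" using mom by blast
  from choice[OF this] obtain D where
    D: "\<forall>j. j \<in> {1..M} \<longrightarrow> (\<forall>\<^sub>F N in sequentially. (\<Sum>\<omega>\<in>\<Omega> N. P N \<omega> * (X N \<omega> j)\<^sup>2) \<le> D j)"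
    by (elim exE) (rule that)
  define DD where "DD = \<bar>\<Sum>j=1..M. D j\<bar>"
  have tailX: "\<forall>\<^sub>F N in sequentially. (\<Sum>\<omega>\<in>\<Omega> N. P N \<omega> * out R (X N \<omega>)) \<le> DD / R\<^sup>2" if R: "R > 0" for R
  proof -
    have "\<forall>\<^sub>F N in sequentially. \<forall>j\<in>{1..M}. (\<Sum>\<omega>\<in>\<Omega> N. P N \<omega> * (X N \<omega> j)\<^sup>2) \<le> D j"
      using D by (intro eventually_ball_finite) auto
    then show ?thesis
    proof eventually_elim
      case (elim N)
      have o: "out R x \<le> (\<Sum>j=1..M. (x j)\<^sup>2) / R\<^sup>2" for x
      proof (cases "\<exists>j\<in>{1..M}. \<bar>x j\<bar> > R")
        case True
        then obtain j where j: "j \<in> {1..M}" "\<bar>x j\<bar> > R" by blast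
        have "R\<^sup>2 \<le> \<bar>x j\<bar>\<^sup>2" using j R by (intro power_mono) auto
        also have "\<dots> = (x j)\<^sup>2" by simp
        also have "\<dots> \<le> (\<Sum>j=1..M. (x j)\<^sup>2)" using j by (intro member_le_sum) auto
        finally show ?thesis using True R by (simp add: out_def)
      qed (simp add: out_def sum_nonneg)
      have "(\<Sum>\<omega>\<in>\<Omega> N. P N \<omega> * out R (X N \<omega>)) \<le> (\<Sum>\<omega>\<in>\<Omega> N. P N \<omega> * ((\<Sum>j=1..M. (X N \<omega> j)\<^sup>2) / R\<^sup>2))"
        by (intro sum_mono mult_left_mono o pos)
      also have "\<dots> = (\<Sum>j=1..M. \<Sum>\<omega>\<in>\<Omega> N. P N \<omega> * (X N \<omega> j)\<^sup>2) / R\<^sup>2"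
        by (subst sum.swap) (simp add: sum_distrib_left sum_divide_distrib)
      also have "\<dots> \<le> (\<Sum>j=1..M. D j) / R\<^sup>2" using elim by (intro divide_right_mono sum_mono) auto
      also have "\<dots> \<le> DD / R\<^sup>2" by (intro divide_right_mono) (auto simp: DD_def)
      finally show ?case .
    qed
  qed
  show ?thesis
  proof (rule LIMSEQ_I)
    fix \<epsilon>0 :: real assume e0: "\<epsilon>0 > 0"
    \<comment> \<open>The final sum consists of two errors (2 C + 2) \<epsilon>, one for the finite
      sums and one for the integral, and of one \<epsilon> for the convergence of the trigonometric
      polynomial; the factor 4 keeps it strictly below \<epsilon>0. The cap at 1 bounds the
      approximant by C + 1.\<close>
    define \<epsilon> where "\<epsilon> = min 1 (\<epsilon>0 / (4 * (2 * C + 2)))"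
    have \<epsilon>: "\<epsilon> > 0" "\<epsilon> \<le> 1" "4 * ((2 * C + 2) * \<epsilon>) \<le> \<epsilon>0"
    proof -
      have "\<epsilon> \<le> \<epsilon>0 / (4 * (2 * C + 2))" by (simp add: \<epsilon>_def)
      then have "\<epsilon> * (4 * (2 * C + 2)) \<le> \<epsilon>0" using C0 by (subst (asm) pos_le_divide_eq) auto
      then show "4 * ((2 * C + 2) * \<epsilon>) \<le> \<epsilon>0" by (simp only: mult_ac)
      show "\<epsilon> > 0" "\<epsilon> \<le> 1" using e0 C0 by (auto simp: \<epsilon>_def)
    qed
    obtain k0 where k0: "\<And>k. k \<ge> k0 ==> (LINT v|\<mu>. out (real k) (Y v)) < \<epsilon>"
      using order_tendstoD(2)[OF tailY \<epsilon>(1)] unfolding eventually_sequentially by blast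
    \<comment> \<open>From k0 on the tail of the limit is below \<epsilon>, and from DD / \<epsilon>
      on the Chebyshev bound DD / k^2 is at most \<epsilon>; the successor makes k positive.\<close>
    define k where "k = Suc (max k0 (nat \<lceil>DD / \<epsilon>\<rceil>))"
    have k: "k \<ge> k0" "real k > 0" "DD / \<epsilon> \<le> real k" by (auto simp: k_def) linarith
    have k2: "DD / (real k)\<^sup>2 \<le> \<epsilon>"
    proof -
      have "real k \<ge> 1" by (simp add: k_def)
      then have "real k * \<epsilon> \<le> (real k)\<^sup>2 * \<epsilon>" using \<epsilon>(1) by (simp add: power2_eq_square)
      moreover have "DD \<le> real k * \<epsilon>" using k(3) \<epsilon>(1) by (simp add: pos_divide_le_eq)
      ultimately have "DD \<le> \<epsilon> * (real k)\<^sup>2" by (simp add: mult.commute)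
      then show ?thesis using k(2) by (simp add: pos_divide_le_eq)
    qed
    obtain f where f: "f \<in> trigpoly M" "\<And>x. x \<in> RM M ==> \<forall>j\<in>{1..M}. \<bar>x j\<bar> \<le> real k ==> \<bar>g x - f x\<bar> < \<epsilon>" "\<And>x. \<bar>f x\<bar> \<le> C + \<epsilon>"
      using trigpoly_approx[OF g C \<epsilon>(1), of "real k"] by auto
    have near: "\<bar>g x - f x\<bar> \<le> \<epsilon> + (2 * C + 1) * out (real k) x" if x: "x \<in> RM M" for x
    proof (cases "\<exists>j\<in>{1..M}. \<bar>x j\<bar> > real k")
      case True
      then show ?thesis using C[OF x] f(3)[of x] \<epsilon> by (simp add: out_def)
    next
      case False
      then show ?thesis using f(2)[OF x] by (force simp: out_def not_less)
    qed
    have I: "\<bar>(LINT v|\<mu>. g (Y v)) - (LINT v|\<mu>. f (Y v))\<bar> \<le> (2 * C + 2) * \<epsilon>"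
    proof -
      have fi: "integrable \<mu> (\<lambda>v. f (Y v))" using trig[OF f(1)] by simp
      have oi: "integrable \<mu> (\<lambda>v. out (real k) (Y v))"
        by (rule integrable_const_bound[of _ 1]) (use om in \<open>auto simp: out_def\<close>)
      have "\<bar>(LINT v|\<mu>. g (Y v)) - (LINT v|\<mu>. f (Y v))\<bar> = \<bar>LINT v|\<mu>. g (Y v) - f (Y v)\<bar>" using gi fi by simp
      also have "\<dots> \<le> (LINT v|\<mu>. \<bar>g (Y v) - f (Y v)\<bar>)" by (rule integral_abs_bound)
      also have "\<dots> \<le> (LINT v|\<mu>. \<epsilon> + (2 * C + 1) * out (real k) (Y v))"
        by (intro integral_mono integrable_abs Bochner_Integration.integrable_diff Bochner_Integration.integrable_add gi fi integrable_mult_right oi near YR) auto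
      also have "\<dots> = \<epsilon> + (2 * C + 1) * (LINT v|\<mu>. out (real k) (Y v))" using oi by (simp add: prob_space)
      also have "\<dots> \<le> \<epsilon> + (2 * C + 1) * \<epsilon>" using k0[OF k(1)] C0 by (intro add_left_mono mult_left_mono) auto
      finally show ?thesis by (simp add: algebra_simps)
    qed
    have "\<forall>\<^sub>F N in sequentially. \<bar>(\<Sum>\<omega>\<in>\<Omega> N. P N \<omega> * f (X N \<omega>)) - (LINT v|\<mu>. f (Y v))\<bar> < \<epsilon>"
      using tendstoD[OF trig[OF f(1), THEN conjunct1] \<epsilon>(1)] by (simp add: dist_real_def)
    then have "\<forall>\<^sub>F N in sequentially. norm ((\<Sum>\<omega>\<in>\<Omega> N. P N \<omega> * g (X N \<omega>)) - (LINT v|\<mu>. g (Y v))) < \<epsilon>0"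
      using tailX[OF k(2)]
    proof eventually_elim
      case (elim N)
      have "\<bar>(\<Sum>\<omega>\<in>\<Omega> N. P N \<omega> * g (X N \<omega>)) - (\<Sum>\<omega>\<in>\<Omega> N. P N \<omega> * f (X N \<omega>))\<bar> = \<bar>\<Sum>\<omega>\<in>\<Omega> N. P N \<omega> * (g (X N \<omega>) - f (X N \<omega>))\<bar>"
        by (simp add: right_diff_distrib sum_subtractf)
      also have "\<dots> \<le> (\<Sum>\<omega>\<in>\<Omega> N. P N \<omega> * (\<epsilon> + (2 * C + 1) * out (real k) (X N \<omega>)))"
        by (rule order_trans[OF sum_abs], rule sum_mono) (use near XR pos in \<open>simp add: abs_mult mult_left_mono\<close>)
      also have "\<dots> = (\<Sum>\<omega>\<in>\<Omega> N. P N \<omega>) * \<epsilon> + (2 * C + 1) * (\<Sum>\<omega>\<in>\<Omega> N. P N \<omega> * out (real k) (X N \<omega>))"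
        by (simp add: ring_distribs sum.distrib sum_distrib_left sum_distrib_right mult_ac)
      also have "\<dots> \<le> \<epsilon> + (2 * C + 1) * \<epsilon>"
        unfolding one using elim(2) k2 C0 by (intro add_mono mult_left_mono) auto
      finally have "\<bar>(\<Sum>\<omega>\<in>\<Omega> N. P N \<omega> * g (X N \<omega>)) - (\<Sum>\<omega>\<in>\<Omega> N. P N \<omega> * f (X N \<omega>))\<bar> \<le> (2 * C + 2) * \<epsilon>" by (simp add: algebra_simps)
      moreover have "\<epsilon> \<le> (2 * C + 2) * \<epsilon>" using \<epsilon>(1) C0 mult_right_mono[of 1 "2 * C + 2" \<epsilon>] by simp
      ultimately show ?case using elim(1) I \<epsilon>(3) e0 unfolding real_norm_def by linarith
    qed
    then show "\<exists>no. \<forall>N\<ge>no. norm ((\<Sum>\<omega>\<in>\<Omega> N. P N \<omega> * g (X N \<omega>)) - (LINT v|\<mu>. g (Y v))) < \<epsilon>0"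
      by (simp add: eventually_sequentially)
  qed
qed

section \<open>Primitive channels are irreducible\<close>

lemma word_set_Suc: "{w. length w = Suc n \<and> set w \<subseteq> {..<m}} = (\<lambda>(i, w). i # w) ` ({..<m} \<times> {w. length w = n \<and> set w \<subseteq> {..<m :: nat}})"
proof (intro subset_antisym subsetI)
  fix w assume w: "w \<in> {w. length w = Suc n \<and> set w \<subseteq> {..<m}}"
  then obtain i w' where "w = i # w'" by (cases w) auto
  then show "w \<in> (\<lambda>(i, w). i # w) ` ({..<m} \<times> {w. length w = n \<and> set w \<subseteq> {..<m}})" using w by auto
qed auto

lemma kraus_iterate:
  assumes Ks: "set Ks \<subseteq> carrier_mat d d" and P: "P \<in> crn d d"
    and G: "\<And>X. X \<in> crn d d ==> G X = (\<Sum>i<length Ks. emb (Ks ! i) * X * fadj (emb (Ks ! i)))"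
  shows "(G ^^ n) P \<in> crn d d \<and> (G ^^ n) P =
    (\<Sum>w\<in>{w. length w = n \<and> set w \<subseteq> {..<length Ks}}. emb (word_prod d Ks w) * P * fadj (emb (word_prod d Ks w)))"
proof (induction n)
  case 0
  have "{w. length w = 0 \<and> set w \<subseteq> {..<length Ks}} = {[]}" by auto
  then show ?case using P by (simp add: word_prod_def emb_one fid_multR[OF P])
next
  case (Suc n)
  let ?W = "{w. length w = n \<and> set w \<subseteq> {..<length Ks}}"
  have k: "Ks ! i \<in> carrier_mat d d" if "i < length Ks" for i using Ks that by (meson nth_mem subsetD)
  have wc: "word_prod d Ks w \<in> carrier_mat d d" if "set w \<subseteq> {..<length Ks}" for w
    using that by (induction w) (auto simp: word_prod_def intro!: mult_carrier_mat[OF k])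
  have fc: "(G ^^ Suc n) P = (\<Sum>i<length Ks. emb (Ks ! i) * (G ^^ n) P * fadj (emb (Ks ! i)))" using G[OF conjunct1[OF Suc.IH]] by (simp only: funpow.simps o_apply)
  have "inj_on (\<lambda>(i, w). i # w) ({..<length Ks} \<times> ?W)" by (auto simp: inj_on_def)
  then have "(\<Sum>w\<in>{w. length w = Suc n \<and> set w \<subseteq> {..<length Ks}}. emb (word_prod d Ks w) * P * fadj (emb (word_prod d Ks w))) =
    (\<Sum>(i, w)\<in>{..<length Ks} \<times> ?W. emb (word_prod d Ks (i # w)) * P * fadj (emb (word_prod d Ks (i # w))))"
    unfolding word_set_Suc by (simp add: sum.reindex case_prod_unfold)
  also have "\<dots> = (\<Sum>i<length Ks. \<Sum>w\<in>?W. emb (Ks ! i) * (emb (word_prod d Ks w) * P * fadj (emb (word_prod d Ks w))) * fadj (emb (Ks ! i)))"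
    unfolding sum.cartesian_product[symmetric]
  proof (intro sum.cong[OF refl])
    fix i w assume "i \<in> {..<length Ks}" "w \<in> ?W"
    then have "emb (word_prod d Ks (i # w)) = emb (Ks ! i) * emb (word_prod d Ks w)"
      using emb_mult[OF k wc] by (simp add: word_prod_def)
    then show "emb (word_prod d Ks (i # w)) * P * fadj (emb (word_prod d Ks (i # w))) =
      emb (Ks ! i) * (emb (word_prod d Ks w) * P * fadj (emb (word_prod d Ks w))) * fadj (emb (Ks ! i))"
      by (simp add: fadj_mult mult.assoc)
  qed
  also have "\<dots> = (G ^^ Suc n) P" unfolding fc Suc.IH[THEN conjunct2] by (simp add: sum_distrib_left sum_distrib_right)
  finally have "(G ^^ Suc n) P = (\<Sum>w\<in>{w. length w = Suc n \<and> set w \<subseteq> {..<length Ks}}. emb (word_prod d Ks w) * P * fadj (emb (word_prod d Ks w)))" by simp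
  moreover have "(G ^^ Suc n) P \<in> crn d d" unfolding fc
    using Suc.IH by (intro crn_sum crn_mult[of _ d d _ d] crn_fadj emb_crn k) auto
  ultimately show ?case by simp
qed

text \<open>The conjugation by X of the n-th iterate of V V* is the sum of Z Z* with Z = X w V over
  the Kraus words w of length n. If its trace vanishes, every X w V does, and as the words span all
  matrices, so does X A V for every A; a suitable matrix unit A contradicts this.\<close>

lemma primitive_irreducible:
  assumes prim: "primitive d L" and LG: "\<And>X. X \<in> carrier_mat d d ==> emb (L X) = G (emb X)"
  shows "irreducible_map d G"
  unfolding irreducible_map_def
proof (intro ballI impI)
  fix X V assume X: "X \<in> crn d d" and V: "V \<in> crn d d" and ne: "X \<noteq> 0" "V \<noteq> 0"
  obtain Ks n where fam: "kraus_family d L Ks" and span: "\<forall>A\<in>carrier_mat d d. \<exists>c :: nat list => complex.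
        \<forall>r<d. \<forall>s<d. A $$ (r,s) = (\<Sum>w\<in>{w. length w = n \<and> set w \<subseteq> {..<length Ks}}. c w * word_prod d Ks w $$ (r,s))"
    using prim unfolding primitive_def by blast
  let ?W = "{w. length w = n \<and> set w \<subseteq> {..<length Ks}}"
  have Ks: "set Ks \<subseteq> carrier_mat d d" using fam by (simp add: kraus_family_def)
  have k: "Ks ! i \<in> carrier_mat d d" if "i < length Ks" for i using Ks that by (meson nth_mem subsetD)
  have wc: "word_prod d Ks w \<in> carrier_mat d d" if "set w \<subseteq> {..<length Ks}" for w
    using that by (induction w) (auto simp: word_prod_def intro!: mult_carrier_mat[OF k])
  have G: "G Y = (\<Sum>i<length Ks. emb (Ks ! i) * Y * fadj (emb (Ks ! i)))" if Y: "Y \<in> crn d d" for Y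
  proof -
    define A where "A = unm d d Y"
    have A: "A \<in> carrier_mat d d" "emb A = Y" using emb_unm[OF Y] by (auto simp: A_def)
    have LA: "L A \<in> carrier_mat d d" "\<And>r c. r < d ==> c < d ==> L A $$ (r,c) = (\<Sum>i<length Ks. (Ks!i * A * adj (Ks!i)) $$ (r,c))"
      using fam A unfolding kraus_family_def by auto
    have t: "Ks ! i * A * adj (Ks ! i) \<in> carrier_mat d d" "emb (Ks ! i * A * adj (Ks ! i)) = emb (Ks ! i) * Y * fadj (emb (Ks ! i))" if "i < length Ks" for i
      using k[OF that] A adj_carrier[OF k[OF that]]
        emb_mult[OF mult_carrier_mat[OF k[OF that] A(1)] adj_carrier[OF k[OF that]]] emb_mult[OF k[OF that] A(1)] by (auto simp: emb_adj)
    have "emb (L A) = (\<Sum>i<length Ks. emb (Ks ! i) * Y * fadj (emb (Ks ! i)))"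
    proof (rule fm_eqI)
      fix r c
      have "(\<Sum>i<length Ks. ent (emb (Ks ! i) * Y * fadj (emb (Ks ! i))) r c) = (\<Sum>i<length Ks. if r < d \<and> c < d then (Ks ! i * A * adj (Ks ! i)) $$ (r,c) else 0)"
        by (intro sum.cong[OF refl]) (use t in \<open>auto simp: ent_emb simp flip: t(2)\<close>)
      then show "ent (emb (L A)) r c = ent (\<Sum>i<length Ks. emb (Ks ! i) * Y * fadj (emb (Ks ! i))) r c"
        using LA by (auto simp: ent_emb)
    qed
    then show ?thesis using LG[OF A(1)] A(2) by simp
  qed
  show "\<exists>n. ftr (X * (G ^^ n) (V * fadj V) * fadj X) \<noteq> 0"
  proof (rule ccontr)
    assume "\<not> ?thesis"
    then have z: "ftr (X * (G ^^ n) (V * fadj V) * fadj X) = 0" by blast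
    have P: "V * fadj V \<in> crn d d" by (rule crn_mult[OF V crn_fadj[OF V]])
    have fin: "finite ?W" using finite_lists_length_eq[of "{..<length Ks}" n] by (simp add: conj_commute)
    define Z where "Z w = X * emb (word_prod d Ks w) * V" for w
    have ki: "(G ^^ n) (V * fadj V) = (\<Sum>w\<in>?W. emb (word_prod d Ks w) * (V * fadj V) * fadj (emb (word_prod d Ks w)))"
      by (rule conjunct2[OF kraus_iterate[OF Ks P]]) (rule G)
    have Gn: "X * (G ^^ n) (V * fadj V) * fadj X = (\<Sum>w\<in>?W. Z w * fadj (Z w))"
      unfolding ki sum_distrib_left sum_distrib_right Z_def
      by (intro sum.cong[OF refl]) (simp add: fadj_mult mult.assoc)
    have "(\<Sum>w\<in>?W. Re (ftr (fadj (Z w) * Z w))) = 0"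
      using z unfolding Gn by (simp add: ftr_sum ftr_comm[of "Z _"] flip: Re_sum)
    then have "\<forall>w\<in>?W. Re (ftr (fadj (Z w) * Z w)) = 0"
      using fin ftr_sq_Re by (subst (asm) sum_nonneg_eq_0_iff) auto
    then have Z0: "Z w = 0" if "w \<in> ?W" for w using ftr_sq_0[of "Z w"] that by blast
    have all0: "X * emb A * V = 0" if A: "A \<in> carrier_mat d d" for A
    proof -
      obtain c where c: "\<forall>r<d. \<forall>s<d. A $$ (r,s) = (\<Sum>w\<in>?W. c w * word_prod d Ks w $$ (r,s))" using span A by blast
      have "emb A = (\<Sum>w\<in>?W. c w *. emb (word_prod d Ks w))"
      proof (rule fm_eqI)
        fix i j
        have "(\<Sum>w\<in>?W. c w * ent (emb (word_prod d Ks w)) i j) = (\<Sum>w\<in>?W. if i < d \<and> j < d then c w * word_prod d Ks w $$ (i,j) else 0)"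
          by (intro sum.cong[OF refl]) (auto simp: ent_emb[OF wc])
        then show "ent (emb A) i j = ent (\<Sum>w\<in>?W. c w *. emb (word_prod d Ks w)) i j" using c by (auto simp: ent_emb[OF A])
      qed
      then have "X * emb A * V = (\<Sum>w\<in>?W. c w *. Z w)" by (simp add: Z_def sum_distrib_left sum_distrib_right)
      then show ?thesis using Z0 by simp
    qed
    obtain i k where ik: "ent X k i \<noteq> 0" using ne(1) by (metis ent_0 fm_eqI)
    obtain j l where jl: "ent V j l \<noteq> 0" using ne(2) by (metis ent_0 fm_eqI)
    have b: "i < d" "j < d" using ik jl X V unfolding crn_def by blast+
    have "ent (X * fE i j) k j = ent X k i"
    proof -
      have "ent (X * fE i j) k j = (\<Sum>q<d. if q = i then ent X k i else 0)" unfolding ent_multL[OF X] by (rule sum.cong) auto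
      then show ?thesis using b by simp
    qed
    moreover have "ent (X * fE i j) k q = 0" if "q \<noteq> j" for q unfolding ent_multL[OF X] using that by simp
    ultimately have "ent (X * fE i j * V) k l = (\<Sum>q<d. if q = j then ent X k i * ent V j l else 0)"
      unfolding ent_multR[OF V] by (intro sum.cong) auto
    then have "ent (X * fE i j * V) k l = ent X k i * ent V j l" using b by simp
    moreover have "X * fE i j * V = 0" using all0[OF unm_carrier[of d d "fE i j"]] b by (simp add: emb_unm)
    ultimately show False using ik jl by simp
  qed
qed

section \<open>Gaussian limits\<close>

text \<open>Cholesky factorization by induction on the size: the last coordinate is split off and
  the Schur complement is again positive. A vanishing pivot is treated separately, since a
  covariance may be degenerate.\<close>

lemma psd_factor:
  fixes D :: "nat => nat => real"
  shows "(\<And>j k. j \<in> {1..M} ==> k \<in> {1..M} ==> D j k = D k j) ==>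
    (\<And>u. 0 \<le> (\<Sum>j=1..M. \<Sum>k=1..M. u j * u k * D j k)) ==>
    \<exists>A :: nat => nat => real. \<forall>j\<in>{1..M}. \<forall>k\<in>{1..M}. (\<Sum>l=1..M. A j l * A k l) = D j k"
proof (induction M arbitrary: D)
  case (Suc M)
  let ?m = "Suc M"
  define q where "q u = (\<Sum>j=1..M. \<Sum>k=1..M. u j * u k * D j k)" for u :: "nat => real"
  define s where "s u = (\<Sum>j=1..M. u j * D j ?m)" for u :: "nat => real"
  have full: "0 \<le> q u + 2 * t * s u + t\<^sup>2 * D ?m ?m" for u t
  proof -
    let ?v = "u(?m := t)"
    have "0 \<le> (\<Sum>j=1..?m. \<Sum>k=1..?m. ?v j * ?v k * D j k)" by (rule Suc.prems(2))
    also have "\<dots> = (\<Sum>j=1..M. (\<Sum>k=1..M. u j * u k * D j k) + u j * t * D j ?m) + ((\<Sum>k=1..M. t * u k * D ?m k) + t * t * D ?m ?m)"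
      by (simp add: sum.distrib)
    also have "(\<Sum>k=1..M. t * u k * D ?m k) = t * s u"
      unfolding s_def sum_distrib_left by (intro sum.cong[OF refl]) (use Suc.prems(1) in simp)
    also have "(\<Sum>j=1..M. (\<Sum>k=1..M. u j * u k * D j k) + u j * t * D j ?m) = q u + t * s u"
      unfolding q_def s_def sum.distrib sum_distrib_left by (simp add: mult_ac)
    finally show ?thesis by (simp add: power2_eq_square algebra_simps)
  qed
  define a where "a = D ?m ?m"
  have a0: "a \<ge> 0" using full[of "\<lambda>_. 0" 1] by (simp add: q_def s_def a_def)
  define c where "c j = (if a = 0 then 0 else D j ?m / sqrt a)" for j
  have cross: "D j ?m = c j * sqrt a" if j: "j \<in> {1..M}" for j
  proof (cases "a = 0")
    case True
    let ?u = "\<lambda>k. if k = j then 1 else 0 :: real"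
    have su: "s ?u = D j ?m"
    proof -
      have "s ?u = (\<Sum>k=1..M. if k = j then D j ?m else 0)" unfolding s_def by (rule sum.cong) auto
      then show ?thesis using j by simp
    qed
    have "D j ?m = 0"
    proof (rule ccontr)
      assume n: "D j ?m \<noteq> 0"
      \<comment> \<open>For this t the quadratic form would have the value -1.\<close>
      define t where "t = - (q ?u + 1) / (2 * D j ?m)"
      have "2 * t * s ?u = - (q ?u + 1)" using n by (simp add: t_def su)
      then show False using full[of ?u t] True by (simp add: a_def)
    qed
    then show ?thesis using True by simp
  next
    case False
    then show ?thesis using a0 by (simp add: c_def)
  qed
  have cs: "(\<Sum>j=1..M. u j * c j) * sqrt a = s u" for u
    unfolding s_def sum_distrib_right by (intro sum.cong[OF refl]) (simp add: cross mult.assoc)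
  have "\<exists>A :: nat => nat => real. \<forall>j\<in>{1..M}. \<forall>k\<in>{1..M}. (\<Sum>l=1..M. A j l * A k l) = D j k - c j * c k"
  proof (rule Suc.IH)
    show "D j k - c j * c k = D k j - c k * c j" if "j \<in> {1..M}" "k \<in> {1..M}" for j k using Suc.prems(1) that by simp
    fix u
    have e: "(\<Sum>j=1..M. \<Sum>k=1..M. u j * u k * (D j k - c j * c k)) = q u - (\<Sum>j=1..M. u j * c j)\<^sup>2"
      unfolding q_def power2_eq_square sum_product sum_subtractf[symmetric]
      by (intro sum.cong[OF refl]) (simp add: algebra_simps)
    show "0 \<le> (\<Sum>j=1..M. \<Sum>k=1..M. u j * u k * (D j k - c j * c k))"
    proof (cases "a = 0")
      case True
      then have "(\<Sum>j=1..M. u j * c j) = 0" by (simp add: c_def)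
      then show ?thesis using full[of u 0] unfolding e by simp
    next
      case False
      \<comment> \<open>The minimizer of the quadratic form in the last coordinate; the minimal
        value is the form of the Schur complement.\<close>
      define t where "t = - (\<Sum>j=1..M. u j * c j) / sqrt a"
      have sa: "sqrt a > 0" "sqrt a * sqrt a = a" using a0 False by auto
      have "t * s u = - (\<Sum>j=1..M. u j * c j)\<^sup>2" using sa(1) by (simp add: t_def cs[symmetric] power2_eq_square)
      moreover have "t\<^sup>2 * a = (\<Sum>j=1..M. u j * c j)\<^sup>2" using sa a0 False by (simp add: t_def power_divide)
      ultimately show ?thesis using full[of u t] unfolding e a_def[symmetric] by (simp add: mult.assoc)
    qed
  qed
  then obtain A where A: "\<And>j k. j \<in> {1..M} ==> k \<in> {1..M} ==> (\<Sum>l=1..M. A j l * A k l) = D j k - c j * c k" by blast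
  define B where "B j l = (if j = ?m then (if l = ?m then sqrt a else 0) else if l = ?m then c j else A j l)" for j l
  have "(\<Sum>l=1..?m. B j l * B k l) = D j k" if jk: "j \<in> {1..?m}" "k \<in> {1..?m}" for j k
  proof -
    have e: "(\<Sum>l=1..?m. B j l * B k l) = (\<Sum>l=1..M. B j l * B k l) + B j ?m * B k ?m" by simp
    consider "j = ?m" "k = ?m" | "j = ?m" "k \<in> {1..M}" | "j \<in> {1..M}" "k = ?m" | "j \<in> {1..M}" "k \<in> {1..M}"
      using jk by (auto simp: le_Suc_eq)
    then show ?thesis
    proof cases
      case 1 then show ?thesis unfolding e using a0 by (simp add: B_def a_def)
    next
      case 2 then show ?thesis unfolding e using cross[OF 2(2)] Suc.prems(1)[OF jk] by (auto simp: B_def)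
    next
      case 3 then show ?thesis unfolding e using cross[OF 3(1)] by (auto simp: B_def)
    next
      case 4
      then have "(\<Sum>l=1..M. B j l * B k l) = (\<Sum>l=1..M. A j l * A k l)" by (intro sum.cong) (auto simp: B_def)
      then show ?thesis unfolding e using A[OF 4] 4 by (auto simp: B_def)
    qed
  qed
  then show ?case by blast
qed simp

lemma tendsto_sin_quot: "((\<lambda>s. sin (s * q) / s) \<longlongrightarrow> q) (at_right (0::real))"
proof -
  have "((\<lambda>s. sin (s * q)) has_real_derivative q) (at 0)" by (auto intro!: derivative_eq_intros)
  then have "((\<lambda>s. sin (s * q) / s) \<longlongrightarrow> q) (at 0)" by (simp add: DERIV_def)
  then show ?thesis by (rule tendsto_mono[rotated]) (simp add: at_le)
qed

text \<open>Divided by s, the imaginary part gives the mean as s tends to 0. The real part of the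
  characteristic function is 1 minus the mean of 2 sin^2 (s q / 2), and this mean divided by s^2
  tends to half the second moment; hence the factor 2.\<close>

lemma moments_from_cf:
  assumes fin: "finite \<Omega>" and one: "(\<Sum>\<omega>\<in>\<Omega>. P \<omega>) = 1"
    and cf: "\<And>s. 0 < s ==> s \<le> 1 ==> cmod ((\<Sum>\<omega>\<in>\<Omega>. complex_of_real (P \<omega>) * iexp (s * q \<omega>)) - 1 - \<i> * of_real (s * m)) \<le> C * s\<^sup>2"
  shows "(\<Sum>\<omega>\<in>\<Omega>. P \<omega> * q \<omega>) = m" "(\<Sum>\<omega>\<in>\<Omega>. P \<omega> * (q \<omega>)\<^sup>2) \<le> 2 * C"
proof -
  define Z where "Z s = (\<Sum>\<omega>\<in>\<Omega>. complex_of_real (P \<omega>) * iexp (s * q \<omega>)) - 1 - \<i> * of_real (s * m)" for s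
  have Im: "Im (Z s) = (\<Sum>\<omega>\<in>\<Omega>. P \<omega> * sin (s * q \<omega>)) - s * m" for s
    by (simp add: Z_def Im_sum Im_exp)
  have Re: "Re (Z s) = (\<Sum>\<omega>\<in>\<Omega>. P \<omega> * cos (s * q \<omega>)) - 1" for s
    by (simp add: Z_def Re_sum Re_exp)
  have small: "\<forall>\<^sub>F s in at_right (0::real). 0 < s \<and> s \<le> 1"
    using eventually_at_right_less[of 0] eventually_at_right_real[of 0 1] by (auto elim: eventually_elim2)
  have l1: "((\<lambda>s. (\<Sum>\<omega>\<in>\<Omega>. P \<omega> * (sin (s * q \<omega>) / s)) - m) \<longlongrightarrow> (\<Sum>\<omega>\<in>\<Omega>. P \<omega> * q \<omega>) - m) (at_right 0)"
    by (intro tendsto_intros tendsto_sin_quot)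
  have "((\<lambda>s. (\<Sum>\<omega>\<in>\<Omega>. P \<omega> * (sin (s * q \<omega>) / s)) - m) \<longlongrightarrow> 0) (at_right 0)"
  proof (rule Lim_null_comparison)
    show "\<forall>\<^sub>F s in at_right 0. norm ((\<Sum>\<omega>\<in>\<Omega>. P \<omega> * (sin (s * q \<omega>) / s)) - m) \<le> C * s"
      using small
    proof eventually_elim
      case (elim s)
      have "(\<Sum>\<omega>\<in>\<Omega>. P \<omega> * (sin (s * q \<omega>) / s)) - m = Im (Z s) / s"
        unfolding Im using elim by (simp add: diff_divide_distrib sum_divide_distrib)
      then have "norm ((\<Sum>\<omega>\<in>\<Omega>. P \<omega> * (sin (s * q \<omega>) / s)) - m) = \<bar>Im (Z s)\<bar> / s" using elim by simp
      also have "\<dots> \<le> C * s\<^sup>2 / s"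
        using cf[of s] elim abs_Im_le_cmod[of "Z s"] unfolding Z_def[symmetric] by (intro divide_right_mono) auto
      finally show ?case using elim by (simp add: power2_eq_square)
    qed
    have "((\<lambda>s. C * s) \<longlongrightarrow> C * 0) (at_right 0)" by (intro tendsto_intros)
    then show "((\<lambda>s. C * s) \<longlongrightarrow> 0) (at_right 0)" by simp
  qed
  from tendsto_unique[OF _ l1 this] show "(\<Sum>\<omega>\<in>\<Omega>. P \<omega> * q \<omega>) = m" by simp
  have "((\<lambda>s. \<Sum>\<omega>\<in>\<Omega>. P \<omega> * (2 * (sin (s * (q \<omega> / 2)) / s)\<^sup>2)) \<longlongrightarrow> (\<Sum>\<omega>\<in>\<Omega>. P \<omega> * (2 * (q \<omega> / 2)\<^sup>2))) (at_right 0)"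
    by (intro tendsto_intros tendsto_sin_quot)
  moreover have "\<forall>\<^sub>F s in at_right 0. (\<Sum>\<omega>\<in>\<Omega>. P \<omega> * (2 * (sin (s * (q \<omega> / 2)) / s)\<^sup>2)) \<le> C"
    using small
  proof eventually_elim
    case (elim s)
    have "(\<Sum>\<omega>\<in>\<Omega>. P \<omega> * (2 * (sin (s * (q \<omega> / 2)) / s)\<^sup>2)) = (\<Sum>\<omega>\<in>\<Omega>. (P \<omega> - P \<omega> * cos (s * q \<omega>)) / s\<^sup>2)"
    proof (rule sum.cong[OF refl])
      fix \<omega>
      have "cos (s * q \<omega>) = 1 - 2 * (sin (s * (q \<omega> / 2)))\<^sup>2" using cos_double_sin[of "s * (q \<omega> / 2)"] by simp
      then show "P \<omega> * (2 * (sin (s * (q \<omega> / 2)) / s)\<^sup>2) = (P \<omega> - P \<omega> * cos (s * q \<omega>)) / s\<^sup>2"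
        by (simp add: power_divide right_diff_distrib)
    qed
    also have "\<dots> = - Re (Z s) / s\<^sup>2" unfolding Re using one by (simp add: sum_divide_distrib[symmetric] sum_subtractf)
    also have "\<dots> \<le> C * s\<^sup>2 / s\<^sup>2"
      using cf[of s] elim abs_Re_le_cmod[of "Z s"] unfolding Z_def[symmetric] by (intro divide_right_mono) auto
    finally show ?case using elim by simp
  qed
  ultimately have "(\<Sum>\<omega>\<in>\<Omega>. P \<omega> * (2 * (q \<omega> / 2)\<^sup>2)) \<le> C" by (rule tendsto_upperbound) simp
  moreover have "(\<Sum>\<omega>\<in>\<Omega>. P \<omega> * (2 * (q \<omega> / 2)\<^sup>2)) = (\<Sum>\<omega>\<in>\<Omega>. P \<omega> * (q \<omega>)\<^sup>2) / 2"
    by (simp add: power_divide sum_divide_distrib)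
  ultimately show "(\<Sum>\<omega>\<in>\<Omega>. P \<omega> * (q \<omega>)\<^sup>2) \<le> 2 * C" by simp
qed

definition gauss_map :: "nat => (nat => nat => real) => (nat => real) => nat => real" where
  "gauss_map M A z j = (if j \<in> {1..M} then (\<Sum>l=1..M. A j l * z l) else 0)"

lemma gauss_cf:
  "(CLINT z|PiM {1..M} (\<lambda>_. std_normal_distribution). iexp (\<Sum>j=1..M. u j * gauss_map M A z j)) =
    of_real (exp (- (\<Sum>j=1..M. \<Sum>k=1..M. u j * u k * (\<Sum>l=1..M. A j l * A k l)) / 2))"
proof -
  interpret product_prob_space "\<lambda>_ :: nat. std_normal_distribution"
    by (intro product_prob_spaceI prob_space_normal_density) simp
  define t where "t l = (\<Sum>j=1..M. u j * A j l)" for l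
  have e: "(\<Sum>j=1..M. u j * gauss_map M A z j) = (\<Sum>l=1..M. t l * z l)" for z
  proof -
    have "(\<Sum>j=1..M. u j * gauss_map M A z j) = (\<Sum>j=1..M. \<Sum>l=1..M. u j * A j l * z l)"
      by (intro sum.cong[OF refl]) (simp add: gauss_map_def sum_distrib_left mult.assoc)
    also have "\<dots> = (\<Sum>l=1..M. \<Sum>j=1..M. u j * A j l * z l)" by (rule sum.swap)
    finally show ?thesis by (simp add: t_def sum_distrib_right)
  qed
  have i: "integrable std_normal_distribution (\<lambda>x. iexp (t l * x))" for l
    by (rule finite_measure.integrable_const_bound[where B = 1, OF prob_space.finite_measure[OF prob_space_normal_density]])
      (auto simp del: of_real_mult)
  have "(CLINT z|PiM {1..M} (\<lambda>_. std_normal_distribution). iexp (\<Sum>j=1..M. u j * gauss_map M A z j)) =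
    (CLINT z|PiM {1..M} (\<lambda>_. std_normal_distribution). (\<Prod>l\<in>{1..M}. iexp (t l * z l)))"
    unfolding e of_real_sum sum_distrib_left by (intro Bochner_Integration.integral_cong refl exp_sum) simp
  also have "\<dots> = (\<Prod>l\<in>{1..M}. CLINT x|std_normal_distribution. iexp (t l * x))"
    by (rule product_integral_prod) (use i in auto)
  also have "\<dots> = (\<Prod>l\<in>{1..M}. of_real (exp (- (t l)\<^sup>2 / 2)))"
  proof (rule prod.cong[OF refl])
    fix l
    have "(CLINT x|std_normal_distribution. iexp (t l * x)) = char std_normal_distribution (t l)" by (simp add: char_def)
    then show "(CLINT x|std_normal_distribution. iexp (t l * x)) = of_real (exp (- (t l)\<^sup>2 / 2))" by (simp add: char_std_normal_distribution)
  qed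
  also have "\<dots> = of_real (exp (\<Sum>l=1..M. - (t l)\<^sup>2 / 2))" by (simp add: exp_sum)
  also have "(\<Sum>l=1..M. - (t l)\<^sup>2 / 2) = - (\<Sum>l=1..M. (t l)\<^sup>2) / 2" by (simp add: sum_negf sum_divide_distrib[symmetric])
  also have "(\<Sum>l=1..M. (t l)\<^sup>2) = (\<Sum>l=1..M. \<Sum>j=1..M. \<Sum>k=1..M. u j * u k * (A j l * A k l))"
    unfolding t_def power2_eq_square sum_product by (intro sum.cong[OF refl]) (simp add: mult_ac)
  also have "\<dots> = (\<Sum>j=1..M. \<Sum>k=1..M. u j * u k * (\<Sum>l=1..M. A j l * A k l))"
    unfolding sum_distrib_left by (subst sum.swap, rule sum.cong[OF refl], rule sum.swap)
  finally show ?thesis .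
qed

lemma (in qenv) cf_0: assumes "\<rho> \<in> crn d d" shows "cf \<rho> g N 0 (fid d) = ftr \<rho>"
proof -
  have "(L w0 ^^ N) \<rho> \<in> crn d d \<and> ftr ((L w0 ^^ N) \<rho>) = ftr \<rho>"
  proof (induction N)
    case (Suc N)
    then show ?case using L_in_tr[of "(L w0 ^^ N) \<rho>" "\<lambda>b. of_real (w b)"] wsum by (simp flip: of_real_sum)
  qed (simp add: assms)
  then show ?thesis unfolding cf_def phs_0 by simp
qed

text \<open>The Cramer-Wold device: each direction u gives a scalar observable, and only the
  symmetric part of \<open>kap\<close> enters its variance. The moment bounds are used twice, to
  dispose of the centering and for tightness.\<close>

theorem (in qenv) vector_clt:
  fixes h :: "nat => 'b => real" and P :: "nat => 'w => real" and q :: "nat => 'w => nat => real" and D :: "nat => nat => real"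
  assumes \<rho>: "\<rho> \<in> crn d d" "fpsd \<rho>" "ftr \<rho> = 1" and \<tau>: "\<tau> > 0"
    and fin: "\<And>N. finite (\<Omega> N)" and pos: "\<And>N \<omega>. \<omega> \<in> \<Omega> N ==> P N \<omega> \<ge> 0"
    and cfq: "\<And>N u s. (\<Sum>\<omega>\<in>\<Omega> N. complex_of_real (P N \<omega>) * iexp (s * (\<Sum>j=1..m. u j * q N \<omega> j))) =
        cf \<rho> (\<lambda>b. \<Sum>j=1..m. u j * h j b) N s (fid d)"
    and D: "\<And>j k. j \<in> {1..m} ==> k \<in> {1..m} ==> \<tau> * D j k = Re (kap (h j) (h k)) + Re (kap (h k) (h j))"
  shows "\<exists>A :: nat => nat => real. (\<forall>j\<in>{1..m}. \<forall>k\<in>{1..m}. (\<Sum>l=1..m. A j l * A k l) = D j k) \<and>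
     (\<forall>g :: (nat => real) => real. bounded (g ` RM m) \<and> continuous_on (RM m) g \<longrightarrow>
        (\<lambda>N. \<Sum>\<omega>\<in>\<Omega> N. P N \<omega> * g (\<lambda>j. if j \<in> {1..m} then
              (q N \<omega> j - (\<Sum>\<omega>'\<in>\<Omega> N. P N \<omega>' * q N \<omega>' j)) / sqrt (real N * \<tau>) else 0))
        \<longlonglongrightarrow> (\<integral>z. g (\<lambda>j. if j \<in> {1..m} then (\<Sum>l=1..m. A j l * z l) else 0) \<partial>(PiM {1..m} (\<lambda>_. std_normal_distribution))))"
proof -
  have one: "(\<Sum>\<omega>\<in>\<Omega> N. P N \<omega>) = 1" for N
  proof -
    have "complex_of_real (\<Sum>\<omega>\<in>\<Omega> N. P N \<omega>) = 1" using cfq[of N 0 "\<lambda>_. 0"] cf_0[OF \<rho>(1)] \<rho>(3) by simp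
    then show ?thesis by (simp only: of_real_eq_1_iff)
  qed
  define gu where "gu u = (\<lambda>b. \<Sum>j=1..m. u j * h j b)" for u :: "nat => real"
  define mu where "mu N j = (\<Sum>\<omega>\<in>\<Omega> N. P N \<omega> * q N \<omega> j)" for N j
  have sing: "(\<Sum>i=1..m. (if i = j then 1 else 0) * (f i :: real)) = f j" if "j \<in> {1..m}" for j f
  proof -
    have "(\<Sum>i=1..m. (if i = j then 1 else 0) * f i) = (\<Sum>i=1..m. if i = j then f j else 0)" by (rule sum.cong) auto
    then show ?thesis using that by simp
  qed
  have mom: "\<exists>C\<ge>0. \<forall>N. \<bar>mu N j\<bar> \<le> C \<and> (\<Sum>\<omega>\<in>\<Omega> N. P N \<omega> * (q N \<omega> j)\<^sup>2) \<le> C * (1 + real N)" if j: "j \<in> {1..m}" for j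
  proof -
    obtain C where C: "\<forall>N. \<exists>m. \<bar>m\<bar> \<le> C \<and> (\<forall>s. 0 < s \<and> s \<le> 1 \<longrightarrow>
      cmod (cf \<rho> (h j) N s (fid d) - 1 - \<i> * of_real (s * m)) \<le> C * (1 + real N) * s^2)" using cf_moments[OF \<rho>, of "h j"] by (elim exE) (rule that)
    have C0: "C \<ge> 0" using C[rule_format, of 0] by (meson abs_ge_zero order_trans)
    have "\<bar>mu N j\<bar> \<le> 2 * C \<and> (\<Sum>\<omega>\<in>\<Omega> N. P N \<omega> * (q N \<omega> j)\<^sup>2) \<le> 2 * C * (1 + real N)" for N
    proof -
      obtain m' where m': "\<bar>m'\<bar> \<le> C" "\<And>s. 0 < s ==> s \<le> 1 ==> cmod (cf \<rho> (h j) N s (fid d) - 1 - \<i> * of_real (s * m')) \<le> C * (1 + real N) * s^2"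
        using C[rule_format, of N] by auto
      have e: "(\<Sum>\<omega>\<in>\<Omega> N. complex_of_real (P N \<omega>) * iexp (s * q N \<omega> j)) = cf \<rho> (h j) N s (fid d)" for s
        using cfq[where N = N and s = s and u = "\<lambda>i. if i = j then 1 else 0"] unfolding sing[OF j] .
      have "cmod ((\<Sum>\<omega>\<in>\<Omega> N. complex_of_real (P N \<omega>) * iexp (s * q N \<omega> j)) - 1 - \<i> * of_real (s * m')) \<le> C * (1 + real N) * s\<^sup>2"
        if "0 < s" "s \<le> 1" for s unfolding e by (rule m'(2)[OF that])
      note mm = moments_from_cf[where P = "P N" and q = "\<lambda>\<omega>. q N \<omega> j", OF fin one this]
      from mm(1) mm(2) show ?thesis using m'(1) C0 by (simp add: mu_def)
    qed
    then show ?thesis using C0 by (intro exI[of _ "2 * C"]) auto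
  qed
  define X where "X N \<omega> j = (if j \<in> {1..m} then (q N \<omega> j - mu N j) / sqrt (real N * \<tau>) else 0)" for N \<omega> j
  have kapq: "2 * Re (kap (gu u) (gu u)) = \<tau> * (\<Sum>j=1..m. \<Sum>k=1..m. u j * u k * D j k)" for u
  proof -
    have k: "kap (gu u) (gu u) = (\<Sum>j=1..m. \<Sum>k=1..m. of_real (u j * u k) * kap (h j) (h k))"
    proof -
      have "kap (gu u) (gu u) = (\<Sum>j=1..m. of_real (u j) * kap (h j) (gu u))" unfolding gu_def by (rule kap_sum1) simp
      also have "\<dots> = (\<Sum>j=1..m. of_real (u j) * (\<Sum>k=1..m. of_real (u k) * kap (h j) (h k)))"
        unfolding gu_def by (subst kap_sum2) auto
      finally show ?thesis by (simp add: sum_distrib_left mult.assoc)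
    qed
    have r: "Re (kap (gu u) (gu u)) = (\<Sum>j=1..m. \<Sum>k=1..m. u j * u k * Re (kap (h j) (h k)))" unfolding k by (simp add: Re_sum)
    also have "\<dots> = (\<Sum>j=1..m. \<Sum>k=1..m. u j * u k * Re (kap (h k) (h j)))" by (subst sum.swap) (simp add: mult_ac)
    finally have r': "Re (kap (gu u) (gu u)) = (\<Sum>j=1..m. \<Sum>k=1..m. u j * u k * Re (kap (h k) (h j)))" .
    have "2 * Re (kap (gu u) (gu u)) = (\<Sum>j=1..m. \<Sum>k=1..m. u j * u k * Re (kap (h j) (h k))) + (\<Sum>j=1..m. \<Sum>k=1..m. u j * u k * Re (kap (h k) (h j)))"
      using r r' by simp
    also have "\<dots> = (\<Sum>j=1..m. \<Sum>k=1..m. u j * u k * (Re (kap (h j) (h k)) + Re (kap (h k) (h j))))"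
      by (simp add: ring_distribs sum.distrib)
    also have "\<dots> = (\<Sum>j=1..m. \<Sum>k=1..m. u j * u k * (\<tau> * D j k))" by (intro sum.cong[OF refl]) (simp add: D)
    finally show ?thesis by (simp add: sum_distrib_left mult_ac)
  qed
  have lim: "(\<lambda>N. \<Sum>\<omega>\<in>\<Omega> N. complex_of_real (P N \<omega>) * iexp (\<Sum>j=1..m. u j * X N \<omega> j)) \<longlonglongrightarrow>
      of_real (exp (- (\<Sum>j=1..m. \<Sum>k=1..m. u j * u k * D j k) / 2))" for u
  proof -
    \<comment> \<open>The shift by the exact mean multiplies the characteristic function by a phase,
      which tends to 1 because the means are bounded while sqrt N grows.\<close>
    define c where "c N = (\<Sum>j=1..m. u j * mu N j) / sqrt (real N * \<tau>)" for N
    have e: "(\<Sum>\<omega>\<in>\<Omega> N. complex_of_real (P N \<omega>) * iexp (\<Sum>j=1..m. u j * X N \<omega> j)) =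
       iexp (- c N) * cf \<rho> (gu u) N (1 / sqrt (real N * \<tau>)) (fid d)" for N
    proof -
      have x: "(\<Sum>j=1..m. u j * X N \<omega> j) = - c N + 1 / sqrt (real N * \<tau>) * (\<Sum>j=1..m. u j * q N \<omega> j)" for \<omega>
      proof -
        have "(\<Sum>j=1..m. u j * X N \<omega> j) = (\<Sum>j=1..m. u j * q N \<omega> j / sqrt (real N * \<tau>) - u j * mu N j / sqrt (real N * \<tau>))"
          by (intro sum.cong[OF refl]) (simp add: X_def right_diff_distrib diff_divide_distrib)
        then show ?thesis by (simp add: c_def sum_subtractf sum_divide_distrib)
      qed
      have "(\<Sum>\<omega>\<in>\<Omega> N. complex_of_real (P N \<omega>) * iexp (\<Sum>j=1..m. u j * X N \<omega> j)) =
        (\<Sum>\<omega>\<in>\<Omega> N. iexp (- c N) * (complex_of_real (P N \<omega>) * iexp (1 / sqrt (real N * \<tau>) * (\<Sum>j=1..m. u j * q N \<omega> j))))"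
        unfolding x by (intro sum.cong[OF refl]) (simp only: of_real_add distrib_left exp_add mult_ac)
      then show ?thesis unfolding sum_distrib_left[symmetric] cfq gu_def .
    qed
    have c0: "c \<longlonglongrightarrow> 0"
    proof -
      have "(\<lambda>N. u j * mu N j / sqrt (real N * \<tau>)) \<longlonglongrightarrow> 0" if j: "j \<in> {1..m}" for j
      proof -
        obtain C where C: "C \<ge> 0" "\<And>N. \<bar>mu N j\<bar> \<le> C" using mom[OF j] by blast
        show ?thesis
        proof (rule Lim_null_comparison)
          show "\<forall>\<^sub>F N in sequentially. norm (u j * mu N j / sqrt (real N * \<tau>)) \<le> \<bar>u j\<bar> * C / sqrt (real N * \<tau>)"
            using C \<tau> by (intro always_eventually allI) (auto simp: abs_mult intro!: divide_right_mono mult_left_mono)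
          show "(\<lambda>N. \<bar>u j\<bar> * C / sqrt (real N * \<tau>)) \<longlonglongrightarrow> 0" using \<tau> by real_asymp
        qed
      qed
      then have "(\<lambda>N. \<Sum>j=1..m. u j * mu N j / sqrt (real N * \<tau>)) \<longlonglongrightarrow> (\<Sum>j=1..m. 0)" by (intro tendsto_sum) auto
      then show ?thesis by (simp add: c_def[abs_def] sum_divide_distrib)
    qed
    have "(\<lambda>N. iexp (- c N)) \<longlonglongrightarrow> iexp (- 0)" by (intro tendsto_intros c0)
    moreover have "(\<lambda>N. cf \<rho> (gu u) N (1 / sqrt (real N * \<tau>)) (fid d)) \<longlonglongrightarrow> exp (- (kap (gu u) (gu u) * of_real (1\<^sup>2 / \<tau>)))"
      by (rule cf_clt[OF \<rho> \<tau>])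
    ultimately have "(\<lambda>N. iexp (- c N) * cf \<rho> (gu u) N (1 / sqrt (real N * \<tau>)) (fid d)) \<longlonglongrightarrow>
      iexp (- 0) * exp (- (kap (gu u) (gu u) * of_real (1\<^sup>2 / \<tau>)))" by (rule tendsto_mult)
    moreover have "iexp (- 0) * exp (- (kap (gu u) (gu u) * of_real (1\<^sup>2 / \<tau>))) = of_real (exp (- (\<Sum>j=1..m. \<Sum>k=1..m. u j * u k * D j k) / 2))"
    proof -
      have "kap (gu u) (gu u) = of_real (\<tau> * (\<Sum>j=1..m. \<Sum>k=1..m. u j * u k * D j k) / 2)"
        using kapq[of u] kap_Im[of "gu u" "gu u"] by (simp add: complex_eq_iff)
      then have "- (kap (gu u) (gu u) * of_real (1\<^sup>2 / \<tau>)) = of_real (- (\<Sum>j=1..m. \<Sum>k=1..m. u j * u k * D j k) / 2)"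
        using \<tau> by (simp only: of_real_mult[symmetric] of_real_minus[symmetric]) (simp del: of_real_sum)
      then show ?thesis by (simp only: exp_of_real) simp
    qed
    ultimately show ?thesis unfolding e by simp
  qed
  \<comment> \<open>Characteristic functions have modulus at most 1, hence so does the limit exp (-
    u D u / 2) just obtained; this forces D to be positive.\<close>
  have Dpos: "0 \<le> (\<Sum>j=1..m. \<Sum>k=1..m. u j * u k * D j k)" for u
  proof -
    have "cmod (of_real (exp (- (\<Sum>j=1..m. \<Sum>k=1..m. u j * u k * D j k) / 2))) \<le> 1"
    proof (rule tendsto_upperbound[OF tendsto_norm[OF lim]])
      show "\<forall>\<^sub>F N in sequentially. cmod (\<Sum>\<omega>\<in>\<Omega> N. complex_of_real (P N \<omega>) * iexp (\<Sum>j=1..m. u j * X N \<omega> j)) \<le> 1"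
      proof (intro always_eventually allI)
        fix N
        have "cmod (\<Sum>\<omega>\<in>\<Omega> N. complex_of_real (P N \<omega>) * iexp (\<Sum>j=1..m. u j * X N \<omega> j)) \<le> (\<Sum>\<omega>\<in>\<Omega> N. P N \<omega>)"
          by (intro order_trans[OF norm_sum] sum_mono) (use pos in \<open>simp add: norm_mult del: of_real_sum\<close>)
        then show "cmod (\<Sum>\<omega>\<in>\<Omega> N. complex_of_real (P N \<omega>) * iexp (\<Sum>j=1..m. u j * X N \<omega> j)) \<le> 1" by (simp add: one)
      qed
    qed simp
    then have "exp (- (\<Sum>j=1..m. \<Sum>k=1..m. u j * u k * D j k) / 2) \<le> 1" unfolding norm_of_real by (simp only: abs_exp_cancel)
    then show ?thesis by (simp only: exp_le_one_iff)
  qed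
  have Dsym: "D j k = D k j" if "j \<in> {1..m}" "k \<in> {1..m}" for j k
  proof -
    have "\<tau> * D j k = \<tau> * D k j" using D[OF that] D[OF that(2,1)] by simp
    then show ?thesis using \<tau> by simp
  qed
  obtain A :: "nat => nat => real" where A: "\<forall>j\<in>{1..m}. \<forall>k\<in>{1..m}. (\<Sum>l=1..m. A j l * A k l) = D j k"
    using psd_factor[of m D, OF Dsym Dpos] by blast
  show ?thesis
  proof (intro exI[of _ A] conjI allI impI)
    show "\<forall>j\<in>{1..m}. \<forall>k\<in>{1..m}. (\<Sum>l=1..m. A j l * A k l) = D j k" by (rule A)
    fix g :: "(nat => real) => real" assume g: "bounded (g ` RM m) \<and> continuous_on (RM m) g"
    let ?\<mu> = "PiM {1..m} (\<lambda>_. std_normal_distribution)"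
    have "measurable ?\<mu> std_normal_distribution = borel_measurable ?\<mu>" by (rule measurable_cong_sets) simp_all
    then have "(\<lambda>z. z l) \<in> borel_measurable ?\<mu>" if "l \<in> {1..m}" for l
      using measurable_component_singleton[OF that, of "\<lambda>_. std_normal_distribution"] by simp
    then have Yj: "(\<lambda>z. gauss_map m A z j) \<in> borel_measurable ?\<mu>" for j
      unfolding gauss_map_def by (cases "j \<in> {1..m}") (auto intro!: borel_measurable_sum borel_measurable_times)
    have "(\<lambda>N. \<Sum>\<omega>\<in>\<Omega> N. P N \<omega> * g (X N \<omega>)) \<longlonglongrightarrow> (LINT z|?\<mu>. g (gauss_map m A z))"
    proof (rule char_fn_convergence[where X = X and Y = "gauss_map m A" and g = g and M = m and P = P and \<Omega> = \<Omega>])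
      show "finite (\<Omega> N)" "(\<Sum>\<omega>\<in>\<Omega> N. P N \<omega>) = 1" for N by (rule fin, rule one)
      show "P N \<omega> \<ge> 0" if "\<omega> \<in> \<Omega> N" for N \<omega> using that by (rule pos)
      show "X N \<omega> \<in> RM m" for N \<omega> by (auto simp: X_def RM_def)
      show "gauss_map m A z \<in> RM m" for z by (auto simp: gauss_map_def RM_def)
      show "prob_space ?\<mu>" by (intro prob_space_PiM prob_space_normal_density) simp
      show "(\<lambda>z. gauss_map m A z j) \<in> borel_measurable ?\<mu>" for j by (rule Yj)
      then show "gauss_map m A \<in> borel_measurable ?\<mu>" by (rule measurable_coordinatewise_then_product)
      show "continuous_on (RM m) g" "bounded (g ` RM m)" using g by auto
      show "(\<lambda>N. \<Sum>\<omega>\<in>\<Omega> N. complex_of_real (P N \<omega>) * iexp (\<Sum>j=1..m. u j * X N \<omega> j)) \<longlonglongrightarrow>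
         (CLINT z|?\<mu>. iexp (\<Sum>j=1..m. u j * gauss_map m A z j))" for u
      proof -
        have "(\<Sum>j=1..m. \<Sum>k=1..m. u j * u k * (\<Sum>l=1..m. A j l * A k l)) = (\<Sum>j=1..m. \<Sum>k=1..m. u j * u k * D j k)"
          by (intro sum.cong[OF refl]) (use A in simp)
        then show ?thesis unfolding gauss_cf using lim[of u] by simp
      qed
      fix j assume j: "j \<in> {1..m}"
      obtain C where C: "C \<ge> 0" "\<And>N. (\<Sum>\<omega>\<in>\<Omega> N. P N \<omega> * (q N \<omega> j)\<^sup>2) \<le> C * (1 + real N)" using mom[OF j] by blast
      show "\<exists>C. \<forall>\<^sub>F N in sequentially. (\<Sum>\<omega>\<in>\<Omega> N. P N \<omega> * (X N \<omega> j)\<^sup>2) \<le> C"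
      proof (rule exI[of _ "2 * C / \<tau>"], use eventually_ge_at_top[of 1] in eventually_elim)
        fix N :: nat assume N: "N \<ge> 1"
        have "(\<Sum>\<omega>\<in>\<Omega> N. P N \<omega> * (X N \<omega> j)\<^sup>2) = (\<Sum>\<omega>\<in>\<Omega> N. P N \<omega> * (q N \<omega> j)\<^sup>2 - 2 * mu N j * (P N \<omega> * q N \<omega> j) + (mu N j)\<^sup>2 * P N \<omega>) / (real N * \<tau>)"
          unfolding sum_divide_distrib by (intro sum.cong[OF refl]) (use j \<tau> in \<open>simp add: X_def power_divide power2_diff algebra_simps add_divide_distrib diff_divide_distrib\<close>)
        also have "(\<Sum>\<omega>\<in>\<Omega> N. P N \<omega> * (q N \<omega> j)\<^sup>2 - 2 * mu N j * (P N \<omega> * q N \<omega> j) + (mu N j)\<^sup>2 * P N \<omega>) =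
            (\<Sum>\<omega>\<in>\<Omega> N. P N \<omega> * (q N \<omega> j)\<^sup>2) - 2 * mu N j * mu N j + (mu N j)\<^sup>2"
          unfolding sum.distrib sum_subtractf sum_distrib_left[symmetric] one mu_def by simp
        also have "\<dots> / (real N * \<tau>) \<le> (C * (1 + real N)) / (real N * \<tau>)"
        proof (rule divide_right_mono)
          have "- 2 * mu N j * mu N j + (mu N j)\<^sup>2 \<le> 0" by (simp add: power2_eq_square)
          then show "(\<Sum>\<omega>\<in>\<Omega> N. P N \<omega> * (q N \<omega> j)\<^sup>2) - 2 * mu N j * mu N j + (mu N j)\<^sup>2 \<le> C * (1 + real N)" using C(2)[of N] by linarith
        qed (use \<tau> in simp)
        also have "\<dots> \<le> (C * (2 * real N)) / (real N * \<tau>)"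
          using N C(1) \<tau> by (intro divide_right_mono mult_left_mono) auto
        also have "\<dots> = 2 * C / \<tau>" using N \<tau> by (simp add: field_simps)
        finally show "(\<Sum>\<omega>\<in>\<Omega> N. P N \<omega> * (X N \<omega> j)\<^sup>2) \<le> 2 * C / \<tau>" .
      qed
    qed
    then show "(\<lambda>N. \<Sum>\<omega>\<in>\<Omega> N. P N \<omega> * g (\<lambda>j. if j \<in> {1..m} then
              (q N \<omega> j - (\<Sum>\<omega>'\<in>\<Omega> N. P N \<omega>' * q N \<omega>' j)) / sqrt (real N * \<tau>) else 0))
        \<longlonglongrightarrow> (\<integral>z. g (\<lambda>j. if j \<in> {1..m} then (\<Sum>l=1..m. A j l * z l) else 0) \<partial>?\<mu>)"
      unfolding X_def[abs_def] gauss_map_def[abs_def] mu_def .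
  qed
qed

section \<open>Kinetic coefficients\<close>

text \<open>Near \<zeta> = 0 the invariant state is unique by \<open>linear_response\<close>, so the
  description in \<open>rho_plus\<close> denotes it there, which is enough for a derivative at 0.
  The constant c will be the inverse duration of a step.\<close>

lemma (in qenv) kinetic_eq:
  fixes Q :: qsys and Wt :: "real => 'b => real" and k :: nat
  defines "z \<equiv> \<lambda>t. (\<lambda>_. 0)(k := t) :: nat => real"
  assumes dQ: "sdim Q = d"
    and sum1: "\<And>t. (\<Sum>b\<in>B. Wt t b) = 1" and W0: "\<And>b. b \<in> B ==> Wt 0 b = w b"
    and dW: "\<And>b. b \<in> B ==> ((\<lambda>t. Wt t b) has_real_derivative w b * g b) (at 0)" and g: "(\<Sum>b\<in>B. w b * g b) = 0"
    and Lc: "\<And>t X. X \<in> carrier_mat d d ==> Lsh Q sh (z t) X \<in> carrier_mat d d"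
    and LL: "\<And>t X. X \<in> carrier_mat d d ==> emb (Lsh Q sh (z t) X) = L (\<lambda>b' b. of_real (Wt t b)) (emb X)"
    and Pc: "\<And>t. Phish Q sh (z t) j \<in> carrier_mat d d"
    and PP: "\<And>t. emb (Phish Q sh (z t) j) = of_real c *. M (\<lambda>b' b. of_real (Wt t b) * of_real (f b - f b')) (fid d)"
  shows "kinetic Q sh j k = c * Re (kap f g)"
proof -
  have cg: "centered g" using g by (simp add: centered_def)
  have ex: "\<forall>\<^sub>F t in nhds 0. \<exists>!X. fixed_state (Wt t) X" by (rule linear_response(1)[OF sum1 _ _ cg]) (simp_all add: W0 dW)
  define R where "R t = rho_plus Q sh (z t)" for t
  have "\<forall>\<^sub>F t in nhds 0. R t \<in> carrier_mat d d \<and> fixed_state (Wt t) (emb (R t))"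
    using ex
  proof eventually_elim
    case (elim t)
    then obtain X where X: "fixed_state (Wt t) X" and uniq: "\<And>Y. fixed_state (Wt t) Y ==> Y = X" by blast
    define A where "A = unm d d X"
    have A: "A \<in> carrier_mat d d" "emb A = X" using X emb_unm[of X d d] by (auto simp: A_def fixed_state_def)
    have "R t = A" unfolding R_def rho_plus_def
    proof (rule the_equality)
      have "emb (Lsh Q sh (z t) A) = emb A" using X by (simp add: LL A fixed_state_def)
      then have "Lsh Q sh (z t) A = A" by (rule emb_inj[OF Lc[OF A(1)] A(1)])
      then show "state (sdim Q) A \<and> Lsh Q sh (z t) A = A" using X A by (simp add: state_emb dQ fixed_state_def)
      fix A' assume A': "state (sdim Q) A' \<and> Lsh Q sh (z t) A' = A'"
      then have c: "A' \<in> carrier_mat d d" by (simp add: state_emb dQ)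
      have "fixed_state (Wt t) (emb A')" using A' emb_crn[OF c] by (simp add: state_emb dQ fixed_state_def flip: LL[OF c])
      then have "emb A' = emb A" using uniq A(2) by simp
      then show "A' = A" by (rule emb_inj[OF c A(1)])
    qed
    then show ?case using A X by simp
  qed
  then have ev: "\<forall>\<^sub>F t in nhds 0. R t \<in> carrier_mat d d" "\<forall>\<^sub>F t in nhds 0. fixed_state (Wt t) (emb (R t))"
    by (auto simp: eventually_conj_iff)
  have D: "((\<lambda>t. c * Re (ftr (emb (R t) * M (\<lambda>b' b. of_real (Wt t b) * dx f b' b) (fid d)))) has_real_derivative c * Re (kap f g)) (at 0)"
    by (rule DERIV_cmult, rule linear_response(2)[OF sum1 _ _ cg ev(2)]) (simp_all add: W0 dW)
  have "\<forall>\<^sub>F t in nhds 0. c * Re (ftr (emb (R t) * M (\<lambda>b' b. of_real (Wt t b) * dx f b' b) (fid d))) = Re (mtrace (R t * Phish Q sh (z t) j))"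
    using ev(1)
  proof eventually_elim
    case (elim t)
    have "mtrace (R t * Phish Q sh (z t) j) = ftr (emb (R t) * emb (Phish Q sh (z t) j))"
      using mtrace_emb[OF mult_carrier_mat[OF elim Pc]] emb_mult[OF elim Pc] by simp
    then show ?case by (simp add: PP dx_def ftr_smul)
  qed
  from iffD1[OF DERIV_cong_ev[OF refl this refl] D] have "((\<lambda>t. Re (mtrace (R t * Phish Q sh (z t) j))) has_real_derivative c * Re (kap f g)) (at 0)"
    .
  then show ?thesis unfolding kinetic_def z_def[symmetric] R_def by (rule DERIV_imp_deriv)
qed

context qs
begin

lemma Lch_foldl: "set js \<subseteq> {1..M} ==> X \<in> carrier_mat d d ==>
  foldl (\<lambda>r j. Lch Q \<zeta> j r) X js \<in> carrier_mat d d \<and>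
  emb (foldl (\<lambda>r j. Lch Q \<zeta> j r) X js) = Lm (Bw js) (Kw js) (\<lambda>b' b. of_real (wprod (p \<zeta>) js b)) (emb X)"
proof -
  have "set js \<subseteq> {1..M} ==> X \<in> carrier_mat d d ==> foldl (\<lambda>r j. Lch Q \<zeta> j r) X js \<in> carrier_mat d d \<and>
    emb (foldl (\<lambda>r j. Lch Q \<zeta> j r) X js) = foldl (\<lambda>Y j. Lm {..<n j} (K j) (\<lambda>b' b. of_real (p \<zeta> j b)) Y) (emb X) js"
    by (induction js arbitrary: X) (simp_all add: Lch_emb Lch_c)
  then show "set js \<subseteq> {1..M} ==> X \<in> carrier_mat d d ==> ?thesis"
    using Lm_Bw[of js "emb X" "\<lambda>j b' b. of_real (p \<zeta> j b)"] emb_crn[of X d d] by (simp add: wphi_wprod[abs_def])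
qed

text \<open>The flux operator carries the duals of the interactions before j only. The duals of
  those after j fix the identity, so they can be inserted in front of it, and the whole becomes one
  dual map of the full cycle.\<close>

lemma Phi_foldr:
  assumes js: "js = pre @ j # post" "distinct js" "set js \<subseteq> {1..M}"
  shows "foldr (\<lambda>i X. Ldual Q \<zeta> i X) pre (Phi Q \<zeta> j) \<in> carrier_mat d d \<and>
    emb (foldr (\<lambda>i X. Ldual Q \<zeta> i X) pre (Phi Q \<zeta> j)) = of_real (1 / Ttot Q) *.
      Mm (Bw js) (Kw js) (\<lambda>b' b. of_real (wprod (p \<zeta>) js b) * of_real (hsum (obs j) js b - hsum (obs j) js b')) (fid d)"
proof -
  define \<psi> :: "nat => nat => nat => complex" where
    "\<psi> i b' b = (if i = j then of_real (p \<zeta> i b) * of_real (e i b - e i b') else of_real (p \<zeta> i b))" for i b' b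
  have j: "j \<in> {1..M}" using js by auto
  have \<psi>: "\<psi> i = (\<lambda>b' b. of_real (p \<zeta> i b))" if "i \<noteq> j" for i using that by (auto simp: \<psi>_def fun_eq_iff)
  have post: "set xs \<subseteq> {1..M} ==> j \<notin> set xs ==> foldr (\<lambda>i Y. Mm {..<n i} (K i) (\<psi> i) Y) xs (fid d) = fid d" for xs
    by (induction xs) (auto simp: \<psi> Mm_p_fid)
  define Z where "Z = Mm {..<n j} (K j) (\<psi> j) (fid d)"
  have pre: "set xs \<subseteq> {1..M} ==> j \<notin> set xs ==> foldr (\<lambda>i X. Ldual Q \<zeta> i X) xs (Phi Q \<zeta> j) \<in> carrier_mat d d \<and>
    emb (foldr (\<lambda>i X. Ldual Q \<zeta> i X) xs (Phi Q \<zeta> j)) = of_real (1 / Ttot Q) *. foldr (\<lambda>i Y. Mm {..<n i} (K i) (\<psi> i) Y) xs Z" for xs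
  proof (induction xs)
    case Nil
    show ?case using Phi_emb[OF j] by (simp add: Phi_c Z_def \<psi>_def[abs_def])
  next
    case (Cons i xs)
    then show ?case by (auto simp: Ldual_emb \<psi> Mm_smul)
  qed
  have "Mm (Bw js) (Kw js) (wphi \<psi> js) (fid d) = foldr (\<lambda>i Y. Mm {..<n i} (K i) (\<psi> i) Y) pre Z"
    using js post[of post] by (subst Mm_Bw) (auto simp: Z_def)
  moreover have "wphi \<psi> js = (\<lambda>b' b. of_real (wprod (p \<zeta>) js b) * of_real (hsum (obs j) js b - hsum (obs j) js b'))"
    using wphi_flux[of js j \<zeta>] js by (intro ext) (simp add: \<psi>_def[abs_def] cong: if_cong)
  ultimately show ?thesis using pre[of pre] js by auto
qed

lemma Lsh_Ra: assumes X: "X \<in> carrier_mat d d"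
  shows "Lsh Q Ra \<zeta> X \<in> carrier_mat d d" "emb (Lsh Q Ra \<zeta> X) = Lm Bp Kp (\<lambda>x' x. of_real (wp \<zeta> x)) (emb X)"
proof -
  show c: "Lsh Q Ra \<zeta> X \<in> carrier_mat d d" by (simp add: Lsh_def)
  have "Lm Bp Kp (\<lambda>x' x. of_real (wp \<zeta> x)) (emb X) = (\<Sum>j=1..M. of_real (1 / real M) *. emb (Lch Q \<zeta> j X))"
    unfolding Lm_Bp
  proof (rule sum.cong[OF refl])
    fix j assume j: "j \<in> {1..M}"
    have w: "(\<lambda>b' b. complex_of_real (wp \<zeta> (j, b))) = (\<lambda>b' b. of_real (1 / real M) * of_real (p \<zeta> j b))" by (simp add: wp_def fun_eq_iff)
    show "Lm {..<n j} (K j) (\<lambda>b' b. of_real (wp \<zeta> (j, b))) (emb X) = of_real (1 / real M) *. emb (Lch Q \<zeta> j X)"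
      unfolding w Lch_emb[OF j X] by (rule Lm_smul_wt)
  qed
  also have "\<dots> = emb (Lsh Q Ra \<zeta> X)"
    by (rule fm_eqI) (auto simp: ent_emb[OF c] ent_emb[OF Lch_c], simp add: Lsh_def sum_distrib_left sum_divide_distrib)
  finally show "emb (Lsh Q Ra \<zeta> X) = Lm Bp Kp (\<lambda>x' x. of_real (wp \<zeta> x)) (emb X)" by simp
qed

text \<open>The weights \<open>wp\<close> contain the probability 1 / M of drawing reservoir j, for
  which the factor M compensates.\<close>

lemma Phi_Ra: assumes j: "j \<in> {1..M}"
  shows "emb (Phi Q \<zeta> j) = of_real (real M / Ttot Q) *.
    Mm Bp Kp (\<lambda>x' x. of_real (wp \<zeta> x) * of_real (hp (obs j) x - hp (obs j) x')) (fid d)"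
proof -
  have "Mm Bp Kp (\<lambda>x' x. of_real (wp \<zeta> x) * of_real (hp (obs j) x - hp (obs j) x')) (fid d) =
    (\<Sum>i=1..M. if i = j then of_real (1 / real M) *. Mm {..<n j} (K j) (\<lambda>b' b. of_real (p \<zeta> j b) * of_real (e j b - e j b')) (fid d) else 0)"
    unfolding Mm_Bp
  proof (rule sum.cong[OF refl])
    fix i assume "i \<in> {1..M}"
    show "Mm {..<n i} (K i) (\<lambda>b' b. of_real (wp \<zeta> (i, b)) * of_real (hp (obs j) (i, b) - hp (obs j) (i, b'))) (fid d) =
      (if i = j then of_real (1 / real M) *. Mm {..<n j} (K j) (\<lambda>b' b. of_real (p \<zeta> j b) * of_real (e j b - e j b')) (fid d) else 0)"
    proof (cases "i = j")
      case True
      then show ?thesis unfolding Mm_smul_wt[symmetric] by (auto simp: wp_def hp_def obs_def intro!: Mm_cong)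
    next
      case False
      then show ?thesis by (simp add: hp_def obs_def Mm_def)
    qed
  qed
  also have "\<dots> = of_real (1 / real M) *. Mm {..<n j} (K j) (\<lambda>b' b. of_real (p \<zeta> j b) * of_real (e j b - e j b')) (fid d)" using j by simp
  finally show ?thesis unfolding Phi_emb[OF j] using M2 by simp
qed

end

section \<open>Antiunitary involutions of the system\<close>

text \<open>The columns of \<Theta> are the images of the unit vectors. Preservation of inner
  products gives \<Theta>* \<Theta> = 1 and involutivity gives \<Theta> cnj \<Theta> = 1; hence
  \<Theta>* = cnj \<Theta>, and \<Theta> \<Theta>* = 1 as well.\<close>

lemma antiunitary_matrix:
  assumes au: "antiunitary m \<theta>" and iv: "involution m \<theta>"
  obtains \<Theta> where "conjugation m \<Theta>" "\<And>v i. v \<in> carrier_vec m ==> i < m ==> \<theta> v $ i = (\<Sum>a<m. ent \<Theta> i a * cnj (v $ a))"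
    "\<And>a i. a < m ==> i < m ==> \<theta> (unit_vec m a) $ i = ent \<Theta> i a"
proof -
  define \<Theta> where "\<Theta> = mk m m (\<lambda>i a. \<theta> (unit_vec m a) $ i)"
  have lin: "\<theta> (x \<cdot>\<^sub>v u + y \<cdot>\<^sub>v v) = cnj x \<cdot>\<^sub>v \<theta> u + cnj y \<cdot>\<^sub>v \<theta> v" "\<theta> u \<in> carrier_vec m" "ip (\<theta> u) (\<theta> v) = cnj (ip u v)"
    if "u \<in> carrier_vec m" "v \<in> carrier_vec m" for x y u v using au that by (auto simp: antiunitary_def)
  have act: "\<theta> v $ i = (\<Sum>a<m. ent \<Theta> i a * cnj (v $ a))" if v: "v \<in> carrier_vec m" and i: "i < m" for v i
  proof -
    \<comment> \<open>Antilinearity is given for combinations of two vectors, so v is built up from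
      truncations, one coordinate at a time.\<close>
    define vk where "vk k = Matrix.vec m (\<lambda>l. if l < k then v $ l else 0)" for k
    have vc: "vk k \<in> carrier_vec m" for k by (simp add: vk_def)
    have "k \<le> m ==> \<theta> (vk k) $ i = (\<Sum>a<k. ent \<Theta> i a * cnj (v $ a))" for k
    proof (induction k)
      case 0
      have "vk 0 = 0 \<cdot>\<^sub>v vk 0 + 0 \<cdot>\<^sub>v vk 0" by (auto simp: vk_def)
      then have "\<theta> (vk 0) = cnj 0 \<cdot>\<^sub>v \<theta> (vk 0) + cnj 0 \<cdot>\<^sub>v \<theta> (vk 0)" using lin(1)[OF vc vc, of 0 0 0 0] by simp
      then have "\<theta> (vk 0) $ i = (cnj 0 \<cdot>\<^sub>v \<theta> (vk 0) + cnj 0 \<cdot>\<^sub>v \<theta> (vk 0)) $ i" by simp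
      also have "\<dots> = 0" using lin(2)[OF vc[of 0] vc[of 0]] i by simp
      finally show ?case by simp
    next
      case (Suc k)
      have "vk (Suc k) = 1 \<cdot>\<^sub>v vk k + v $ k \<cdot>\<^sub>v unit_vec m k" using Suc.prems by (auto simp: vk_def less_Suc_eq)
      then have "\<theta> (vk (Suc k)) = cnj 1 \<cdot>\<^sub>v \<theta> (vk k) + cnj (v $ k) \<cdot>\<^sub>v \<theta> (unit_vec m k)" using lin(1)[OF vc[of k] unit_vec_carrier[of m k], of 1 "v $ k"] by (simp only:)
      then have "\<theta> (vk (Suc k)) $ i = \<theta> (vk k) $ i + cnj (v $ k) * \<theta> (unit_vec m k) $ i"
        using lin(2)[OF vc vc, of k] lin(2)[OF unit_vec_carrier unit_vec_carrier, of k] i by simp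
      then show ?case using Suc i by (simp add: \<Theta>_def mult.commute)
    qed
    from this[of m] have "\<theta> (vk m) $ i = (\<Sum>a<m. ent \<Theta> i a * cnj (v $ a))" by simp
    moreover have "vk m = v" using v by (auto simp: vk_def)
    ultimately show ?thesis by simp
  qed
  have c: "\<Theta> \<in> crn m m" by (simp add: \<Theta>_def)
  have U1: "fadj \<Theta> * \<Theta> = fid m"
  proof (rule fm_eqI)
    fix a b
    show "ent (fadj \<Theta> * \<Theta>) a b = ent (fid m) a b"
    proof (cases "a < m \<and> b < m")
      case True
      have "ent (fadj \<Theta> * \<Theta>) a b = (\<Sum>i<m. cnj (\<theta> (unit_vec m a) $ i) * \<theta> (unit_vec m b) $ i)"
        unfolding ent_multR[OF c] using True by (intro sum.cong) (auto simp: \<Theta>_def)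
      also have "\<dots> = cnj (ip (unit_vec m a) (unit_vec m b))"
        using lin(3)[OF unit_vec_carrier unit_vec_carrier, of a b] lin(2)[OF unit_vec_carrier unit_vec_carrier, of a] by (simp add: ip_def)
      also have "ip (unit_vec m a) (unit_vec m b) = (\<Sum>i<m. if i = a then (if a = b then 1 else 0) else 0)"
        unfolding ip_def using True by (intro sum.cong) auto
      finally show ?thesis using True by simp
    qed (use crnD1[OF crn_mult[OF crn_fadj[OF c] c], of a b] crnD2[OF crn_mult[OF crn_fadj[OF c] c], of b a] in auto)
  qed
  have I: "\<Theta> * fcnj \<Theta> = fid m"
  proof (rule fm_eqI)
    fix i a
    show "ent (\<Theta> * fcnj \<Theta>) i a = ent (fid m) i a"
    proof (cases "i < m \<and> a < m")
      case True
      have "ent (\<Theta> * fcnj \<Theta>) i a = (\<Sum>k<m. ent \<Theta> i k * cnj (\<theta> (unit_vec m a) $ k))"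
        unfolding ent_multL[OF c] using True by (intro sum.cong) (auto simp: \<Theta>_def)
      also have "\<dots> = \<theta> (\<theta> (unit_vec m a)) $ i" using act[OF lin(2)[OF unit_vec_carrier unit_vec_carrier], of i a] True by simp
      also have "\<dots> = unit_vec m a $ i" using iv by (simp add: involution_def)
      finally show ?thesis using True by auto
    qed (use crnD1[OF crn_mult[OF c fcnj_crn[OF c]], of i a] crnD2[OF crn_mult[OF c fcnj_crn[OF c]], of a i] in auto)
  qed
  have "fadj \<Theta> = fadj \<Theta> * (\<Theta> * fcnj \<Theta>)" unfolding I by (simp add: fid_multR[OF crn_fadj[OF c]])
  also have "\<dots> = fcnj \<Theta>" unfolding mult.assoc[symmetric] U1 by (simp add: fid_multL[OF fcnj_crn[OF c]])
  finally have "conjugation m \<Theta>" using c U1 I by (simp add: conjugation_def unitary_def)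
  then show ?thesis by (rule that) (use act in \<open>auto simp: \<Theta>_def\<close>)
qed

text \<open>In matrix form the commutation reads \<Theta> cnj A = A \<Theta>, which is checked on
  unit vectors.\<close>

lemma commutes_Tmap:
  assumes \<Theta>: "conjugation m \<Theta>" and act: "\<And>v i. v \<in> carrier_vec m ==> i < m ==> \<theta> v $ i = (\<Sum>a<m. ent \<Theta> i a * cnj (v $ a))"
    and car: "\<And>v. v \<in> carrier_vec m ==> \<theta> v \<in> carrier_vec m"
    and com: "commutes m \<theta> A" and A: "A \<in> carrier_mat m m"
  shows "Tmap \<Theta> (emb A) = emb A"
proof -
  have c: "\<Theta> \<in> crn m m" and u: "\<Theta> * fadj \<Theta> = fid m" using \<Theta> by (auto simp: conjugation_def unitary_def)
  have Ac: "emb A \<in> crn m m" by (rule emb_crn[OF A])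
  have ac: "(A *\<^sub>v v) $ i = (\<Sum>k<m. A $$ (i, k) * v $ k)" if "v \<in> carrier_vec m" "i < m" for v i
    using that A by (simp add: scalar_prod_def lessThan_atLeast0)
  have "\<Theta> * fcnj (emb A) = emb A * \<Theta>"
  proof (rule fm_eqI)
    fix i a
    show "ent (\<Theta> * fcnj (emb A)) i a = ent (emb A * \<Theta>) i a"
    proof (cases "i < m \<and> a < m")
      case True
      let ?v = "unit_vec m a :: complex vec"
      have Av: "(A *\<^sub>v ?v) $ k = A $$ (k, a)" if k: "k < m" for k
      proof -
        have "(\<Sum>l<m. A $$ (k, l) * ?v $ l) = (\<Sum>l<m. if l = a then A $$ (k, a) else 0)" by (rule sum.cong) (use True in auto)
        then show ?thesis using ac[OF unit_vec_carrier k, of a] True by simp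
      qed
      have tv: "\<theta> ?v $ k = ent \<Theta> k a" if k: "k < m" for k
      proof -
        have "(\<Sum>l<m. ent \<Theta> k l * cnj (?v $ l)) = (\<Sum>l<m. if l = a then ent \<Theta> k a else 0)" by (rule sum.cong) (use True in auto)
        then show ?thesis using act[OF unit_vec_carrier k, of a] True by simp
      qed
      have "ent (\<Theta> * fcnj (emb A)) i a = (\<Sum>k<m. ent \<Theta> i k * cnj ((A *\<^sub>v ?v) $ k))"
        unfolding ent_multL[OF c] using True by (intro sum.cong) (auto simp: ent_emb[OF A] Av)
      also have "\<dots> = \<theta> (A *\<^sub>v ?v) $ i" using act[OF mult_mat_vec_carrier[OF A unit_vec_carrier], of i a] True by simp
      also have "\<dots> = (A *\<^sub>v \<theta> ?v) $ i" using com by (simp add: commutes_def)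
      also have "\<dots> = ent (emb A * \<Theta>) i a" unfolding ent_multL[OF Ac] using True ac[OF car[OF unit_vec_carrier], of i a]
        by (simp add: ent_emb[OF A] tv)
      finally show ?thesis .
    next
      case False
      then show ?thesis using crnD1[OF crn_mult[OF c fcnj_crn[OF Ac]], of i a] crnD2[OF crn_mult[OF c fcnj_crn[OF Ac]], of a i]
        crnD1[OF crn_mult[OF Ac c], of i a] crnD2[OF crn_mult[OF Ac c], of a i] by auto
    qed
  qed
  then show ?thesis unfolding Tmap_def by (simp add: mult.assoc u fid_multR[OF Ac])
qed

text \<open>The Hamiltonian of each interaction is invariant under time reversal, and antilinearity
  conjugates the phases exp (- i \<tau> l) of the propagator, so U is mapped to U*.\<close>

lemma (in qs) TRI_reversal:
  assumes tri: "TRI Q"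
  shows "\<exists>\<Theta> F'. conjugation d \<Theta> \<and> eigbasis Q F' e \<and> (\<forall>j\<in>{1..M}. \<forall>b b'. fadj (Tmap \<Theta> (K j b b')) = KQ Q F' j b' b)"
proof -
  obtain \<theta> where \<theta>: "antiunitary d \<theta>" "involution d \<theta>" "commutes d \<theta> (hS Q)"
    and E: "\<forall>j\<in>{1..M}. \<exists>\<theta>E. antiunitary (n j) \<theta>E \<and> involution (n j) \<theta>E \<and> commutes (n j) \<theta>E (hE Q j) \<and>
         commutes (d * n j) (tensor_anti d (n j) \<theta> \<theta>E) (vint Q j)"
    using tri unfolding TRI_def by blast
  obtain \<Theta> where \<Theta>: "conjugation d \<Theta>" "\<And>v i. v \<in> carrier_vec d ==> i < d ==> \<theta> v $ i = (\<Sum>a<d. ent \<Theta> i a * cnj (v $ a))"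
    "\<And>a i. a < d ==> i < d ==> \<theta> (unit_vec d a) $ i = ent \<Theta> i a" by (rule antiunitary_matrix[OF \<theta>(1,2)]) blast
  have tS: "Tmap \<Theta> (emb (hS Q)) = emb (hS Q)"
    by (rule commutes_Tmap[OF \<Theta>(1,2) _ \<theta>(3) hS_c]) (use \<theta>(1) in \<open>auto simp: antiunitary_def\<close>)
  have "\<exists>\<Theta>E. conjugation (n j) \<Theta>E \<and> Tmap \<Theta>E (emb (hE Q j)) = emb (hE Q j) \<and> Tmap (fkron d (n j) \<Theta> \<Theta>E) (emb (vint Q j)) = emb (vint Q j)"
    if j: "j \<in> {1..M}" for j
  proof -
    obtain \<theta>E where \<theta>E: "antiunitary (n j) \<theta>E" "involution (n j) \<theta>E" "commutes (n j) \<theta>E (hE Q j)"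
      "commutes (d * n j) (tensor_anti d (n j) \<theta> \<theta>E) (vint Q j)" using E j by blast
    obtain \<Theta>E where \<Theta>E: "conjugation (n j) \<Theta>E" "\<And>v i. v \<in> carrier_vec (n j) ==> i < n j ==> \<theta>E v $ i = (\<Sum>a<n j. ent \<Theta>E i a * cnj (v $ a))"
      "\<And>a i. a < n j ==> i < n j ==> \<theta>E (unit_vec (n j) a) $ i = ent \<Theta>E i a" by (rule antiunitary_matrix[OF \<theta>E(1,2)]) blast
    have tE: "Tmap \<Theta>E (emb (hE Q j)) = emb (hE Q j)"
      by (rule commutes_Tmap[OF \<Theta>E(1,2) _ \<theta>E(3) hE_c[OF j]]) (use \<theta>E(1) in \<open>auto simp: antiunitary_def\<close>)
    have \<Theta>c: "\<Theta> \<in> crn d d" using \<Theta>(1) by (simp add: conjugation_def unitary_def)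
    have "Tmap (fkron d (n j) \<Theta> \<Theta>E) (emb (vint Q j)) = emb (vint Q j)"
    proof (rule commutes_Tmap[OF conjugation_fkron[OF \<Theta>(1) \<Theta>E(1)] _ _ \<theta>E(4) V_c[OF j]])
      fix v i assume i: "i < d * n j"
      then have ii: "i div n j < d" "i mod n j < n j" using npos[OF j] by (auto simp: less_mult_imp_div_less)
      have "tensor_anti d (n j) \<theta> \<theta>E v $ i = (\<Sum>a<d. \<Sum>b<n j. ent (fkron d (n j) \<Theta> \<Theta>E) i (a * n j + b) * cnj (v $ (a * n j + b)))"
        unfolding tensor_anti_def index_vec[OF i]
        by (intro sum.cong[OF refl]) (use i ii in \<open>simp add: \<Theta>(3) \<Theta>E(3) ent_fkron[OF \<Theta>c] idx_less\<close>)
      then show "tensor_anti d (n j) \<theta> \<theta>E v $ i = (\<Sum>a<d * n j. ent (fkron d (n j) \<Theta> \<Theta>E) i a * cnj (v $ a))" by (simp add: sum_kron_index)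
    qed (simp add: tensor_anti_def)
    then show ?thesis using \<Theta>E(1) tE by blast
  qed
  then have "\<exists>\<Theta>E. \<forall>j\<in>{1..M}. conjugation (n j) (\<Theta>E j) \<and> Tmap (\<Theta>E j) (emb (hE Q j)) = emb (hE Q j) \<and>
      Tmap (fkron d (n j) \<Theta> (\<Theta>E j)) (emb (vint Q j)) = emb (vint Q j)" by (intro bchoice ballI)
  then obtain \<Theta>E where cE: "\<And>j. j \<in> {1..M} ==> conjugation (n j) (\<Theta>E j)" and tE: "\<And>j. j \<in> {1..M} ==> Tmap (\<Theta>E j) (emb (hE Q j)) = emb (hE Q j)"
    and tV: "\<And>j. j \<in> {1..M} ==> Tmap (fkron d (n j) \<Theta> (\<Theta>E j)) (emb (vint Q j)) = emb (vint Q j)" by blast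
  have tfid: "Tmap Y (fid m) = fid m" if "conjugation m Y" for Y m
    using that fid_multR[of Y m m] by (simp add: Tmap_def conjugation_def unitary_def)
  define F' where "F' j = \<Theta>E j * fcnj (F j)" for j
  have "eigbasis Q F' e" unfolding eigbasis_def
  proof (intro ballI conjI)
    fix j assume j: "j \<in> {1..nres Q}"
    show "unitary (n j) (F' j)" unfolding F'_def by (rule unitary_mult_fcnj[OF cE[OF j] Fu[OF j]])
    have "emb (hE Q j) = Tmap (\<Theta>E j) (F j * fdiag (n j) (\<lambda>b. of_real (e j b)) * fadj (F j))" using tE[OF j] Fe[OF j] by simp
    then show "emb (hE Q j) = F' j * fdiag (n j) (\<lambda>b. of_real (e j b)) * fadj (F' j)" by (simp add: Tmap_conj_fdiag F'_def)
  qed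
  moreover have "fadj (Tmap \<Theta> (K j b b')) = KQ Q F' j b' b" if j: "j \<in> {1..M}" for j b b'
    unfolding F'_def
  proof (rule Tmap_Kop[OF \<Theta>(1) cE[OF j] Fu[OF j]])
    define W where "W = fkron d (n j) \<Theta> (\<Theta>E j)"
    have W: "conjugation (d * n j) W" unfolding W_def by (rule conjugation_fkron[OF \<Theta>(1) cE[OF j]])
    show "emb (Uop Q j) \<in> crn (d * n j) (d * n j)" by (rule emb_crn[OF U_c[OF j]])
    obtain U l where U: "unitary (d * n j) U" "emb (Htot j) = U * fdiag (d * n j) (\<lambda>i. of_real (l i)) * fadj U" by (rule ex_Htot_diag[OF j])
    have "Tmap W (emb (Htot j)) = emb (Htot j)"
      unfolding Htot_emb[OF j] Tmap_add W_def
      by (simp add: Tmap_fkron[OF \<Theta>(1) cE[OF j]] emb_crn[OF hS_c] emb_crn[OF hE_c[OF j]] tS tE[OF j] tV[OF j] tfid[OF \<Theta>(1)] tfid[OF cE[OF j]])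
    \<comment> \<open>The conjugated eigenbasis diagonalizes the same Hamiltonian with the same
      eigenvalues, so U can be computed in either basis.\<close>
    then have h: "emb (Htot j) = (W * fcnj U) * fdiag (d * n j) (\<lambda>i. of_real (l i)) * fadj (W * fcnj U)"
      unfolding U(2) Tmap_conj_fdiag by simp
    have "fadj (emb (Uop Q j)) = (W * fcnj U) * fdiag (d * n j) (\<lambda>i. cnj (exp (- \<i> * of_real (tau Q j) * of_real (l i)))) * fadj (W * fcnj U)"
      unfolding Uop_diag(1)[OF j unitary_mult_fcnj[OF W U(1)] h] by (simp only: fadj_mult fadj_fadj fadj_fdiag mult.assoc)
    also have "\<dots> = Tmap W (emb (Uop Q j))" unfolding Uop_diag(1)[OF j U] Tmap_conj_fdiag ..
    finally show "Tmap (fkron d (n j) \<Theta> (\<Theta>E j)) (emb (Uop Q j)) = fadj (emb (Uop Q j))" by (simp add: W_def)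
  qed
  ultimately show ?thesis using \<Theta>(1) by blast
qed

lemma (in qenv) trev_Tmap: assumes "conjugation d \<Theta>" shows "trev d B w K r (Tmap \<Theta>)"
  by (intro trev.intro trev_axioms.intro qenv_axioms)
     (use assms in \<open>simp_all add: Tmap_crn Tmap_add Tmap_smul Tmap_mult Tmap_fadj Tmap_Tmap Tmap_tr\<close>)

context qs
begin

section \<open>Words read backwards\<close>

lemma Bw_iff: "b \<in> Bw js \<longleftrightarrow> list_all2 (\<lambda>x j. x < n j) b js"
  by (induction js arbitrary: b) (auto simp: list_all2_Cons2 image_iff)

lemma bij_rev_Bw: "bij_betw rev (Bw js) (Bw (rev js))"
  by (rule bij_betw_byWitness[of _ rev]) (auto simp: Bw_iff list_all2_rev1)

lemma Bw_length: "b \<in> Bw js ==> length b = length js" by (auto simp: Bw_iff list_all2_lengthD)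

lemma wprod_snoc: "length b = length js ==> wprod f (js @ [j]) (b @ [x]) = wprod f js b * f j x"
  and hsum_snoc: "length b = length js ==> hsum g (js @ [j]) (b @ [x]) = hsum g js b + g j x"
  by (induction b js rule: list_induct2) auto

lemma wprod_rev: "length b = length js ==> wprod f (rev js) (rev b) = wprod f js b"
  and hsum_rev: "length b = length js ==> hsum g (rev js) (rev b) = hsum g js b"
  by (induction b js rule: list_induct2) (auto simp: wprod_snoc hsum_snoc)

lemma Kw_snoc: "set js \<subseteq> {1..M} ==> j \<in> {1..M} ==> length b' = length js ==> length b = length js ==>
  Kw (js @ [j]) (b' @ [x']) (b @ [x]) = K j x' x * Kw js b' b"
proof (induction js arbitrary: b b')
  case Nil
  then show ?case using fid_multR[OF K_c[of j x' x]] fid_multL[OF K_c[of j x' x]] by simp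
next
  case (Cons i js)
  then show ?case by (cases b; cases b') (auto simp: mult.assoc)
qed

text \<open>Taking adjoints reverses the order of the factors. The reversed family of the forward
  cycle therefore describes the interactions in opposite order, in the image eigenbasis.\<close>

lemma Kw_rev:
  assumes R: "qs Q F' e" and \<Theta>: "conjugation d \<Theta>" and K': "\<And>j b b'. j \<in> {1..M} ==> fadj (Tmap \<Theta> (K j b b')) = KQ Q F' j b' b"
  shows "set js \<subseteq> {1..M} ==> length b' = length js ==> length b = length js ==>
    qs.Kw Q F' (rev js) (rev b') (rev b) = fadj (Tmap \<Theta> (Kw js b b'))"
proof (induction js arbitrary: b b')
  case Nil
  have "\<Theta> * fadj \<Theta> = fid d" "\<Theta> \<in> crn d d" using \<Theta> by (auto simp: conjugation_def unitary_def)
  then show ?case using Nil fid_multR[of \<Theta> d d] by (simp add: Tmap_def qs.Kw.simps[OF R])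
next
  case (Cons j js)
  interpret R: qs Q F' e by (rule R)
  obtain x bs x' bs' where b: "b = x # bs" "b' = x' # bs'" using Cons.prems by (cases b; cases b') auto
  have "R.Kw (rev (j # js)) (rev b') (rev b) = KQ Q F' j x' x * R.Kw (rev js) (rev bs') (rev bs)"
    unfolding b using R.Kw_snoc[of "rev js" j "rev bs'" "rev bs" x' x] Cons.prems by (simp add: b)
  also have "\<dots> = fadj (Tmap \<Theta> (Kw js bs bs') * Tmap \<Theta> (K j x x'))" using Cons by (simp add: b fadj_mult K')
  also have "\<dots> = fadj (Tmap \<Theta> (Kw (j # js) b b'))" using Tmap_mult[OF \<Theta> Kw_crn[of js bs bs']] Cons.prems by (simp add: b)
  finally show ?case .
qed

text \<open>Labels may be renamed by a bijection f before linear response is applied: f is the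
  identity for the forward cycle and \<open>rev\<close> for the reversed one, whose family is then
  indexed by forward words.\<close>

lemma kinetic_words:
  assumes q: "qenv d (Bw js0) (wprod (p (\<lambda>_. 0)) js0) K0 r0"
    and f: "bij_betw f (Bw js0) (Bw js)" "\<And>b b'. b \<in> Bw js0 ==> b' \<in> Bw js0 ==> Kw js (f b') (f b) = K0 b' b"
      "\<And>b g. b \<in> Bw js0 ==> wprod g js (f b) = wprod g js0 b" "\<And>b g. b \<in> Bw js0 ==> hsum g js (f b) = hsum g js0 b"
    and js: "js = pre @ j # post" "distinct js" "set js \<subseteq> {1..M}" "set js0 \<subseteq> {1..M}"
    and sh: "\<And>\<zeta> X. Lsh Q sh \<zeta> X = foldl (\<lambda>r j. Lch Q \<zeta> j r) X js"
      "\<And>\<zeta>. Phish Q sh \<zeta> j = foldr (\<lambda>i X. Ldual Q \<zeta> i X) pre (Phi Q \<zeta> j)"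
  shows "kinetic Q sh j k = 1 / Ttot Q * Re (qenv.kap d (Bw js0) (wprod (p (\<lambda>_. 0)) js0) K0 r0 (hsum (obs j) js0) (hsum (obs k) js0))"
proof -
  interpret E: qenv d "Bw js0" "wprod (p (\<lambda>_. 0)) js0" K0 r0 by (rule q)
  have Lre: "Lm (Bw js) (Kw js) \<phi> X = Lm (Bw js0) K0 (\<lambda>b' b. \<phi> (f b') (f b)) X" for \<phi> X
    unfolding Lm_def sum.reindex_bij_betw[OF f(1), symmetric] by (intro sum.cong[OF refl]) (simp add: f(2))
  have Mre: "Mm (Bw js) (Kw js) \<phi> X = Mm (Bw js0) K0 (\<lambda>b' b. \<phi> (f b') (f b)) X" for \<phi> X
    unfolding Mm_def sum.reindex_bij_betw[OF f(1), symmetric] by (intro sum.cong[OF refl]) (simp add: f(2))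
  show ?thesis
  proof (rule E.kinetic_eq[where Wt = "\<lambda>t. wprod (p ((\<lambda>_. 0)(k := t))) js0"])
    show "(\<Sum>b\<in>Bw js0. wprod (p (\<lambda>_. 0)) js0 b * hsum (obs k) js0 b) = 0" by (rule hsum_centered[OF js(4)])
    fix t
    show "(\<Sum>b\<in>Bw js0. wprod (p ((\<lambda>_. 0)(k := t))) js0 b) = 1" by (rule wprod_sum[OF js(4)])
    fix b show "((\<lambda>t. wprod (p ((\<lambda>_. 0)(k := t))) js0 b) has_real_derivative wprod (p (\<lambda>_. 0)) js0 b * hsum (obs k) js0 b) (at 0)"
      by (rule wprod_deriv[OF js(4)])
  next
    fix t and X :: "complex mat" assume X: "X \<in> carrier_mat d d"
    show "Lsh Q sh ((\<lambda>_. 0)(k := t)) X \<in> carrier_mat d d" unfolding sh using Lch_foldl[OF js(3) X] by blast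
    show "emb (Lsh Q sh ((\<lambda>_. 0)(k := t)) X) = E.L (\<lambda>b' b. of_real (wprod (p ((\<lambda>_. 0)(k := t))) js0 b)) (emb X)"
      unfolding sh Lch_foldl[OF js(3) X, THEN conjunct2] Lre by (rule Lm_cong) (simp add: f(3))
  next
    fix t
    show "Phish Q sh ((\<lambda>_. 0)(k := t)) j \<in> carrier_mat d d" unfolding sh using Phi_foldr[OF js(1-3)] by blast
    show "emb (Phish Q sh ((\<lambda>_. 0)(k := t)) j) = of_real (1 / Ttot Q) *. E.M (\<lambda>b' b. of_real (wprod (p ((\<lambda>_. 0)(k := t))) js0 b) *
       of_real (hsum (obs j) js0 b - hsum (obs j) js0 b')) (fid d)"
      unfolding sh Phi_foldr[OF js(1-3), THEN conjunct2] Mre by (intro arg_cong[where f = "smul _"] Mm_cong) (simp add: f(3,4))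
  qed (simp_all add: fun_upd_0)
qed

lemma kinetic_Ra:
  assumes q: "qenv d Bp (wp (\<lambda>_. 0)) K0 r0" and K0: "\<And>x x'. x \<in> Bp ==> x' \<in> Bp ==> Kp x' x = K0 x' x" and j: "j \<in> {1..M}"
  shows "kinetic Q Ra j k = real M / Ttot Q * Re (qenv.kap d Bp (wp (\<lambda>_. 0)) K0 r0 (hp (obs j)) (hp (obs k)))"
proof -
  interpret E: qenv d Bp "wp (\<lambda>_. 0)" K0 r0 by (rule q)
  have Lre: "Lm Bp Kp \<phi> X = Lm Bp K0 \<phi> X" and Mre: "Mm Bp Kp \<phi> X = Mm Bp K0 \<phi> X" for \<phi> X
    unfolding Lm_def Mm_def by (intro sum.cong[OF refl]; simp add: K0)+
  show ?thesis
    by (rule E.kinetic_eq[where Wt = "\<lambda>t. wp ((\<lambda>_. 0)(k := t))"])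
       (simp_all add: wp_sum fun_upd_0 wp_deriv hp_centered Lsh_Ra Lre Phish_def Phi_c Phi_Ra[OF j] Mre)
qed

lemma finite_Bp: "finite Bp" by (simp add: Bp_def)

text \<open>Primitivity is available at some \<zeta>, the axioms are wanted at 0. Irreducibility
  passes from one to the other because only the positive weights depend on \<zeta>, not the Kraus
  operators.\<close>

lemma qenv_Cy: assumes r: "balanced r" and er: "ER Q Cy"
  shows "qenv d (Bw [1..<M + 1]) (wprod (p (\<lambda>_. 0)) [1..<M + 1]) (Kw [1..<M + 1]) r"
proof -
  have js: "set [1..<M + 1] \<subseteq> {1..M}" by auto
  obtain \<zeta> where "primitive d (Lsh Q Cy \<zeta>)" using er by (auto simp: ER_def)
  then have "irreducible_map d (Lm (Bw [1..<M + 1]) (Kw [1..<M + 1]) (\<lambda>b' b. of_real (wprod (p \<zeta>) [1..<M + 1] b)))"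
    by (rule primitive_irreducible) (use Lch_foldl[OF js] in \<open>simp add: Lsh_def\<close>)
  then have "irreducible_map d (Lm (Bw [1..<M + 1]) (Kw [1..<M + 1]) (\<lambda>b' b. of_real (wprod (p (\<lambda>_. 0)) [1..<M + 1] b)))"
    by (rule irreducible_map_weights[rotated 3]) (auto intro!: wprod_pos js)
  then show ?thesis by (rule qenv0.qenv_irreducible[OF qenv0_words[OF js r]])
qed

lemma qenv_Ra: assumes r: "balanced r" and er: "ER Q Ra" shows "qenv d Bp (wp (\<lambda>_. 0)) Kp r"
proof -
  obtain \<zeta> where "primitive d (Lsh Q Ra \<zeta>)" using er by (auto simp: ER_def)
  then have "irreducible_map d (Lm Bp Kp (\<lambda>b' b. of_real (wp \<zeta> b)))" by (rule primitive_irreducible) (rule Lsh_Ra)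
  then have "irreducible_map d (Lm Bp Kp (\<lambda>b' b. of_real (wp (\<lambda>_. 0) b)))"
    by (rule irreducible_map_weights[rotated 3]) (auto simp: finite_Bp wp_pos)
  then show ?thesis by (rule qenv0.qenv_irreducible[OF qenv0_pairs[OF r]])
qed

lemma Ttot_pos: "Ttot Q > 0"
  unfolding Ttot_def using st M2 by (intro sum_pos) (auto simp: standing_def)

text \<open>The coefficients of the reversed cycle are computed in the image eigenbasis, where the
  Kraus operators are the time reversals of those of the forward cycle; \<open>kap_reversal\<close>
  then returns them to the forward family with j and k exchanged.\<close>

lemma Dcov_Cy:
  assumes tri: "TRI Q" and r: "balanced r" and er: "ER Q Cy" and j: "j \<in> {1..M}"
  defines "js \<equiv> [1..<M + 1]"
  defines "kp \<equiv> qenv.kap d (Bw js) (wprod (p (\<lambda>_. 0)) js) (Kw js) r"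
  shows "tau_sh Q Cy * Dcov Q Cy j k = Re (kp (hsum (obs j) js) (hsum (obs k) js)) + Re (kp (hsum (obs k) js) (hsum (obs j) js))"
proof -
  interpret E: qenv d "Bw js" "wprod (p (\<lambda>_. 0)) js" "Kw js" r unfolding js_def by (rule qenv_Cy[OF r er])
  obtain \<Theta> F' where \<Theta>: "conjugation d \<Theta>" and F': "eigbasis Q F' e" and K': "\<And>j b b'. j \<in> {1..M} ==> fadj (Tmap \<Theta> (K j b b')) = KQ Q F' j b' b"
    using TRI_reversal[OF tri] by blast
  interpret V: trev d "Bw js" "wprod (p (\<lambda>_. 0)) js" "Kw js" r "Tmap \<Theta>" by (rule E.trev_Tmap[OF \<Theta>])
  have R: "qs Q F' e" by (rule qs.intro[OF st F'])
  have js: "set js \<subseteq> {1..M}" "distinct js" "set (rev js) \<subseteq> {1..M}" "distinct (rev js)" by (auto simp: js_def)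
  have spl: "js = [1..<j] @ j # [j + 1..<M + 1]" unfolding js_def using upt_add_eq_append[of 1 j "M + 1 - j"] upt_conv_Cons[of j "M + 1"] j by simp
  then have spl': "rev js = rev [j + 1..<M + 1] @ j # rev [1..<j]" by simp
  have a: "kinetic Q Cy j k = 1 / Ttot Q * Re (E.kap (hsum (obs j) js) (hsum (obs k) js))"
    by (rule kinetic_words[where f = "\<lambda>b. b", OF E.qenv_axioms _ _ _ _ spl js(2,1,1)])
       (simp_all add: bij_betw_def Lsh_def Phish_def js_def del: upt_Suc)
  have kr: "qs.Kw Q F' (rev js) (rev b') (rev b) = V.KR b' b" if "b \<in> Bw js" "b' \<in> Bw js" for b b'
    unfolding V.KR_def by (rule Kw_rev[OF R \<Theta> _ js(1)]) (simp_all add: K' Bw_length that)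
  have s1: "Lsh Q Rcy \<zeta> X = foldl (\<lambda>r j. Lch Q \<zeta> j r) X (rev js)" for \<zeta> X by (simp only: Lsh_def js_def scheme.case)
  have s2: "Phish Q Rcy \<zeta> j = foldr (\<lambda>i X. Ldual Q \<zeta> i X) (rev [j + 1..<M + 1]) (Phi Q \<zeta> j)" for \<zeta> by (simp only: Phish_def scheme.case)
  have "kinetic Q Rcy j k = 1 / Ttot Q * Re (qenv.kap d (Bw js) (wprod (p (\<lambda>_. 0)) js) V.KR (Tmap \<Theta> r) (hsum (obs j) js) (hsum (obs k) js))"
    by (rule qs.kinetic_words[OF R, where f = rev, OF V.qenv_R bij_rev_Bw _ _ _ spl' js(4,3,1)])
       (rule kr s1 s2 | simp add: Bw_length wprod_rev hsum_rev)+
  then have b: "kinetic Q Rcy j k = 1 / Ttot Q * Re (E.kap (hsum (obs k) js) (hsum (obs j) js))" by (simp only: V.kap_reversal)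
  show ?thesis using Ttot_pos by (simp add: Dcov_def tau_sh_def a b kp_def distrib_left)
qed

text \<open>The same coefficient is computed in both eigenbases. As the random scheme is its own
  reversal, this yields \<open>kap\<close> with its arguments in either order: Onsager symmetry,
  which accounts for the factor 2.\<close>

lemma Dcov_Ra:
  assumes tri: "TRI Q" and r: "balanced r" and er: "ER Q Ra" and j: "j \<in> {1..M}"
  defines "kp \<equiv> qenv.kap d Bp (wp (\<lambda>_. 0)) Kp r"
  shows "tau_sh Q Ra * Dcov Q Ra j k = Re (kp (hp (obs j)) (hp (obs k))) + Re (kp (hp (obs k)) (hp (obs j)))"
proof -
  interpret E: qenv d Bp "wp (\<lambda>_. 0)" Kp r by (rule qenv_Ra[OF r er])
  obtain \<Theta> F' where \<Theta>: "conjugation d \<Theta>" and F': "eigbasis Q F' e" and K': "\<And>j b b'. j \<in> {1..M} ==> fadj (Tmap \<Theta> (K j b b')) = KQ Q F' j b' b"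
    using TRI_reversal[OF tri] by blast
  interpret V: trev d Bp "wp (\<lambda>_. 0)" Kp r "Tmap \<Theta>" by (rule E.trev_Tmap[OF \<Theta>])
  interpret R: qs Q F' e by (rule qs.intro[OF st F'])
  have a: "kinetic Q Ra j k = real M / Ttot Q * Re (E.kap (hp (obs j)) (hp (obs k)))"
    by (rule kinetic_Ra[OF E.qenv_axioms refl j])
  have KR: "R.Kp x' x = V.KR x' x" if "x \<in> Bp" for x x'
    using that by (auto simp: R.Kp_def V.KR_def Kp_def K' Bp_def V.T0)
  have "kinetic Q Ra j k = real M / Ttot Q * Re (qenv.kap d Bp (wp (\<lambda>_. 0)) V.KR (Tmap \<Theta> r) (hp (obs j)) (hp (obs k)))"
    by (rule R.kinetic_Ra[OF V.qenv_R KR j])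
  then have b: "kinetic Q Ra j k = real M / Ttot Q * Re (E.kap (hp (obs k)) (hp (obs j)))" by (simp only: V.kap_reversal)
  have "Ttot Q / real M * kinetic Q Ra j k = Re (E.kap (hp (obs j)) (hp (obs k)))" unfolding a using Ttot_pos M2 by simp
  moreover have "Ttot Q / real M * kinetic Q Ra j k = Re (E.kap (hp (obs k)) (hp (obs j)))" unfolding b using Ttot_pos M2 by simp
  moreover have "tau_sh Q Ra * Dcov Q Ra j k = Ttot Q / real M * kinetic Q Ra j k + Ttot Q / real M * kinetic Q Ra j k"
    by (simp add: Dcov_def tau_sh_def)
  ultimately show ?thesis by (simp only: kp_def)
qed

section \<open>Tilted channels of the two schemes\<close>

definition ph :: "(nat => real) => real => nat => nat => nat => complex" where
  "ph u t j b' b = of_real (p (\<lambda>_. 0) j b) * iexp (t * (u j * e j b - u j * e j b'))"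

text \<open>At equilibrium the entropy of a level is the reference inverse temperature times its
  energy. This factor cancels in \<open>Qvec\<close>, and each probe contributes the energy it loses
  to the count of its reservoir, so the phase is a product over the probes as
  \<open>sum_Sset_Rs\<close> requires.\<close>

lemma fcs_cf:
  assumes js: "\<And>m. m \<in> {1..N} ==> js m \<in> {1..M}" and \<rho>: "state d \<rho>"
  shows "(\<Sum>s\<in>Sset Q (\<lambda>_. 0) js N. complex_of_real (prob Q (\<lambda>_. 0) \<rho> js N s) * iexp (t * (\<Sum>j=1..M. u j * Qvec Q (\<lambda>_. 0) js N s j))) =
    ftr (Gs (ph u t) js (emb \<rho>) N)"
proof -
  have b0: "bref Q \<noteq> 0" "\<And>j. beta Q (\<lambda>_. 0) j = bref Q" using st by (auto simp: standing_def beta_def)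
  have pr: "complex_of_real (prob Q (\<lambda>_. 0) \<rho> js N s) = ftr (Rs (\<lambda>_. 0) js s (emb \<rho>) N)" for s
    by (rule prob_Rs(1)[OF _ \<rho>]) (rule js)
  have Ss: "Sset Q (\<lambda>_. 0) js N = finwords (\<lambda>m. sp (\<lambda>_. 0) (js m) \<times> sp (\<lambda>_. 0) (js m)) (0, 0) N" by (rule Sset_eq) (rule js)
  define c :: "nat => real \<times> real => complex" where "c j \<sigma> = iexp (t * (u j * ((fst \<sigma> - snd \<sigma>) / bref Q)))" for j \<sigma>
  have "(\<Sum>j=1..M. u j * Qvec Q (\<lambda>_. 0) js N s j) = (\<Sum>m\<in>{1..N}. u (js m) * ((fst (s m) - snd (s m)) / bref Q))" for s
  proof -
    have "(\<Sum>j=1..M. u j * Qvec Q (\<lambda>_. 0) js N s j) =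
      (\<Sum>j\<in>{1..M}. \<Sum>m\<in>{m\<in>{1..N}. js m = j}. u (js m) * ((fst (s m) - snd (s m)) / bref Q))"
    proof (rule sum.cong[OF refl])
      fix j assume "j \<in> {1..M}"
      then have "u j * Qvec Q (\<lambda>_. 0) js N s j = (\<Sum>m\<in>{m\<in>{1..N}. js m = j}. u j * (- (1 / bref Q) * (snd (s m) - fst (s m))))"
        by (simp add: Qvec_def b0 sum_distrib_left)
      also have "\<dots> = (\<Sum>m\<in>{m\<in>{1..N}. js m = j}. u (js m) * ((fst (s m) - snd (s m)) / bref Q))"
        by (rule sum.cong) (auto simp: diff_divide_distrib)
      finally show "u j * Qvec Q (\<lambda>_. 0) js N s j = (\<Sum>m\<in>{m\<in>{1..N}. js m = j}. u (js m) * ((fst (s m) - snd (s m)) / bref Q))" .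
    qed
    also have "\<dots> = (\<Sum>m\<in>{1..N}. u (js m) * ((fst (s m) - snd (s m)) / bref Q))" by (rule sum.group) (use js in auto)
    finally show ?thesis .
  qed
  then have ie: "iexp (t * (\<Sum>j=1..M. u j * Qvec Q (\<lambda>_. 0) js N s j)) = (\<Prod>m\<in>{1..N}. c (js m) (s m))" for s
    by (simp only: c_def sum_distrib_left of_real_sum exp_sum finite_atLeastAtMost)
  have "(\<Sum>s\<in>Sset Q (\<lambda>_. 0) js N. complex_of_real (prob Q (\<lambda>_. 0) \<rho> js N s) * iexp (t * (\<Sum>j=1..M. u j * Qvec Q (\<lambda>_. 0) js N s j))) =
    (\<Sum>s\<in>Sset Q (\<lambda>_. 0) js N. ftr ((\<Prod>m\<in>{1..N}. c (js m) (s m)) *. Rs (\<lambda>_. 0) js s (emb \<rho>) N))"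
    unfolding ie by (intro sum.cong[OF refl]) (simp only: pr ftr_smul mult.commute)
  also have "\<dots> = ftr (Gs (\<lambda>j b' b. of_real (p (\<lambda>_. 0) j b) * c j (beta Q (\<lambda>_. 0) j * e j b, beta Q (\<lambda>_. 0) j * e j b')) js (emb \<rho>) N)"
    unfolding ftr_sum[symmetric] Ss by (rule arg_cong[where f = ftr], rule sum_Sset_Rs) (rule js)
  also have "(\<lambda>j b' b. of_real (p (\<lambda>_. 0) j b) * c j (beta Q (\<lambda>_. 0) j * e j b, beta Q (\<lambda>_. 0) j * e j b')) = ph u t"
    using b0(1) by (intro ext) (simp add: ph_def c_def b0(2) diff_divide_distrib right_diff_distrib)
  finally show ?thesis .
qed

lemma jcy_in: "m \<ge> 1 ==> jcy Q m \<in> {1..M}" using M2 by (simp add: jcy_def less_eq_Suc_le[symmetric])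

lemma hsum_const: "hsum (\<lambda>j _. c j) js b = hsum (\<lambda>j _. c j) js b'" by (induction js arbitrary: b b') auto

text \<open>The counted energies differ from the centered ones by a sum that does not depend on the
  word (\<open>hsum_const\<close>) and cancels in increments.\<close>

lemma hsum_obs: "set js \<subseteq> {1..M} ==>
  hsum (\<lambda>j b. u j * e j b) js b = (\<Sum>k=1..M. u k * hsum (obs k) js b) + hsum (\<lambda>j _. u j * mean j) js b"
proof (induction js arbitrary: b)
  case (Cons j js)
  have "(\<Sum>k=1..M. u k * obs k j (hd b)) = (\<Sum>k=1..M. if k = j then u j * (e j (hd b) - mean j) else 0)"
    by (rule sum.cong) (auto simp: obs_def)
  also have "\<dots> = u j * (e j (hd b) - mean j)" using Cons.prems by simp
  finally show ?case using Cons by (simp add: distrib_left sum.distrib right_diff_distrib)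
qed simp

text \<open>The schedule restarts after M probes, so N M interactions amount to the N-th power of
  the tilted channel of one cycle.\<close>

lemma cyclic_cf:
  assumes q: "qenv d (Bw js) (wprod (p (\<lambda>_. 0)) js) (Kw js) r" and \<rho>: "R \<in> crn d d" and js: "js = [1..<M + 1]"
  shows "ftr (Gs (ph u t) (jcy Q) R (N * M)) =
    qenv.cf (Bw js) (wprod (p (\<lambda>_. 0)) js) (Kw js) R (\<lambda>b. \<Sum>j=1..M. u j * hsum (obs j) js b) N t (fid d)"
proof -
  interpret E: qenv d "Bw js" "wprod (p (\<lambda>_. 0)) js" "Kw js" r by (rule q)
  have jsM: "set js \<subseteq> {1..M}" by (auto simp: js)
  define g where "g b = (\<Sum>j=1..M. u j * hsum (obs j) js b)" for b
  have ph: "wphi (ph u t) js = E.phs g t"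
  proof (intro ext)
    fix b' b
    have "hsum (\<lambda>j b. u j * e j b) js b - hsum (\<lambda>j b. u j * e j b) js b' = g b - g b'"
      using hsum_const[of "\<lambda>j. u j * mean j" js b b'] unfolding hsum_obs[OF jsM] g_def by simp
    then show "wphi (ph u t) js b' b = E.phs g t b' b"
      using wphi_phase[of "p (\<lambda>_. 0)" t "\<lambda>j b. u j * e j b" js b' b] by (simp add: E.phs_def ph_def[abs_def])
  qed
  have step: "k \<le> M ==> Gs (ph u t) (jcy Q) R (N * M + k) =
    foldl (\<lambda>X j. Lm {..<n j} (K j) (ph u t j) X) (Gs (ph u t) (jcy Q) R (N * M)) [1..<k + 1]" for N k
  proof (induction k)
    case (Suc k)
    \<comment> \<open>Probes are numbered from 1, hence the shift: probe N M + k + 1 is a copy from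
      reservoir k + 1.\<close>
    have "jcy Q (Suc (N * M + k)) = Suc k" using Suc.prems by (simp add: jcy_def)
    then show ?case using Suc by simp
  qed simp
  have m: "Gs (ph u t) (jcy Q) R (N * M) \<in> crn d d \<and> Gs (ph u t) (jcy Q) R (N * M) = (E.L (E.phs g t) ^^ N) R" for N
  proof (induction N)
    case (Suc N)
    let ?G = "Gs (ph u t) (jcy Q) R (N * M)"
    have c: "?G \<in> crn d d" using Suc by blast
    have "Gs (ph u t) (jcy Q) R (Suc N * M) = foldl (\<lambda>X j. Lm {..<n j} (K j) (ph u t j) X) ?G js"
      using step[of M N] by (simp only: js mult_Suc add.commute order_refl)
    also have "\<dots> = E.L (E.phs g t) ?G" unfolding ph[symmetric] by (rule Lm_Bw[OF jsM c, symmetric])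
    finally show ?case using Suc E.L_crn[OF c] by simp
  qed (simp add: \<rho>)
  have "(E.L (E.phs g t) ^^ N) R \<in> crn d d" using m[of N] by metis
  then show ?thesis unfolding E.cf_def g_def[symmetric] by (simp only: E.mult_fid conjunct2[OF m])
qed

lemma Lm_sum: "Lm B K' \<phi> (sum f A) = (\<Sum>a\<in>A. Lm B K' \<phi> (f a))"
  by (induction A rule: infinite_finite_induct) (simp_all add: Lm_add)

lemma Gs_upd: "m > N ==> Gs \<phi> (js(m := j)) R N = Gs \<phi> js R N" by (induction N) auto

text \<open>The draws are independent and uniform: averaging over the last one turns the conditional
  step into the averaged tilted channel, and the earlier ones are averaged by induction.\<close>

lemma random_cf:
  assumes q: "qenv d Bp (wp (\<lambda>_. 0)) Kp r" and R: "R \<in> crn d d"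
  shows "(\<Sum>js\<in>Jset Q N. complex_of_real (1 / real M ^ N) * ftr (Gs (ph u t) js R N)) =
    qenv.cf Bp (wp (\<lambda>_. 0)) Kp R (\<lambda>b. \<Sum>j=1..M. u j * hp (obs j) b) N t (fid d)"
proof -
  interpret E: qenv d Bp "wp (\<lambda>_. 0)" Kp r by (rule q)
  define g where "g b = (\<Sum>j=1..M. u j * hp (obs j) b)" for b
  have J: "Jset Q N = finwords (\<lambda>_. {1..M}) 0 N" for N by (simp add: Jset_def finwords_def)
  have g: "g (j, b) = u j * (e j b - mean j)" if j: "j \<in> {1..M}" for j b
  proof -
    have "g (j, b) = (\<Sum>k=1..M. if k = j then u j * (e j b - mean j) else 0)" unfolding g_def by (rule sum.cong) (auto simp: hp_def obs_def)
    then show ?thesis using j by simp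
  qed
  have step: "E.L (E.phs g t) X = (\<Sum>j=1..M. of_real (1 / real M) *. Lm {..<n j} (K j) (ph u t j) X)" for X
    unfolding Lm_Bp
  proof (rule sum.cong[OF refl])
    fix j assume j: "j \<in> {1..M}"
    have "(\<lambda>b' b. E.phs g t (j, b') (j, b)) = (\<lambda>b' b. of_real (1 / real M) * ph u t j b' b)"
      by (intro ext) (simp add: E.phs_def ph_def g[OF j] wp_def right_diff_distrib)
    then show "Lm {..<n j} (K j) (\<lambda>b' b. E.phs g t (j, b') (j, b)) X = of_real (1 / real M) *. Lm {..<n j} (K j) (ph u t j) X"
      using Lm_smul_wt[of "{..<n j}" "K j" "of_real (1 / real M)" "ph u t j" X] by simp
  qed
  have main: "(\<Sum>js\<in>Jset Q N. of_real (1 / real M ^ N) *. Gs (ph u t) js R N) = (E.L (E.phs g t) ^^ N) R" for N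
  proof (induction N)
    case (Suc N)
    have "(\<Sum>js\<in>Jset Q (Suc N). of_real (1 / real M ^ Suc N) *. Gs (ph u t) js R (Suc N)) =
      (\<Sum>js\<in>Jset Q N. \<Sum>j=1..M. of_real (1 / real M) *. Lm {..<n j} (K j) (ph u t j) (of_real (1 / real M ^ N) *. Gs (ph u t) js R N))"
      unfolding J sum_finwords_Suc by (intro sum.cong[OF refl]) (simp add: Gs_upd Lm_smul)
    also have "\<dots> = (\<Sum>js\<in>Jset Q N. E.L (E.phs g t) (of_real (1 / real M ^ N) *. Gs (ph u t) js R N))" by (simp only: step)
    also have "\<dots> = E.L (E.phs g t) ((E.L (E.phs g t) ^^ N) R)" by (simp only: Lm_sum[symmetric] Suc)
    finally show ?case by simp
  qed (simp add: J finwords_0)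
  have c: "(E.L (E.phs g t) ^^ N) R \<in> crn d d" for N by (induction N) (simp_all add: R)
  have "(\<Sum>js\<in>Jset Q N. complex_of_real (1 / real M ^ N) * ftr (Gs (ph u t) js R N)) = ftr ((E.L (E.phs g t) ^^ N) R)"
    by (simp add: ftr_sum ftr_smul flip: main)
  then show ?thesis unfolding E.cf_def g_def[symmetric] by (simp add: E.mult_fid[OF c])
qed

lemma finite_Sset: assumes "\<And>m. m \<in> {1..N} ==> js m \<in> {1..M}" shows "finite (Sset Q (\<lambda>_. 0) js N)"
proof -
  have "Sset Q (\<lambda>_. 0) js N = finwords (\<lambda>m. sp (\<lambda>_. 0) (js m) \<times> sp (\<lambda>_. 0) (js m)) (0, 0) N" by (rule Sset_eq) (rule assms)
  then show ?thesis by (simp add: finite_finwords sp_def)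
qed

end

text \<open>Convergence in distribution is expressed by bounded continuous test functions on the
  space of increments. The Gaussian law is the image under A of independent standard normals, a form
  that also covers a degenerate covariance.\<close>

theorem mainTheorem5:
  fixes Q :: qsys and sh :: scheme and \<rho> :: "complex mat"
  assumes "standing Q"
    and "sh \<in> {Cy, Ra}"
    and "ER Q sh" and "NE Q" and "TRI Q"
    and "state (sdim Q) \<rho>"
  shows "\<exists>A :: nat \<Rightarrow> nat \<Rightarrow> real.
     (\<forall>j\<in>{1..nres Q}. \<forall>k\<in>{1..nres Q}. (\<Sum>l=1..nres Q. A j l * A k l) = Dcov Q sh j k) \<and>
     (\<forall>g :: (nat \<Rightarrow> real) \<Rightarrow> real. bounded (g ` RM (nres Q)) \<and> continuous_on (RM (nres Q)) g \<longrightarrow>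
        (\<lambda>N. Exp Q sh (\<lambda>_. 0) \<rho> N
               (\<lambda>q. g (\<lambda>j. if j \<in> {1..nres Q} then
                   (q j - Exp Q sh (\<lambda>_. 0) \<rho> N (\<lambda>q'. q' j)) / sqrt (real N * tau_sh Q sh) else 0)))
        \<longlonglongrightarrow> (\<integral>z. g (\<lambda>j. if j \<in> {1..nres Q} then (\<Sum>l=1..nres Q. A j l * z l) else 0)
                \<partial>(PiM {1..nres Q} (\<lambda>_. std_normal_distribution))))"
proof -
  obtain F e where "eigbasis Q F e" using ex_eigbasis[OF assms(1)] by blast
  then interpret qs Q F e by (rule qs.intro[OF assms(1)])
  obtain r where r: "balanced r" using ex_balanced[OF assms(4)] by blast
  have \<rho>: "emb \<rho> \<in> crn d d" "fpsd (emb \<rho>)" "ftr (emb \<rho>) = 1" using assms(6) emb_crn by (auto simp: state_emb)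
  have \<tau>: "tau_sh Q sh > 0" using Ttot_pos M2 by (cases sh) (auto simp: tau_sh_def)
  show ?thesis
  proof (cases sh)
    case Cy
    define js where "js = [1..<M + 1]"
    have q: "qenv d (Bw js) (wprod (p (\<lambda>_. 0)) js) (Kw js) r" unfolding js_def by (rule qenv_Cy[OF r]) (use assms(3) Cy in simp)
    then interpret E: qenv d "Bw js" "wprod (p (\<lambda>_. 0)) js" "Kw js" r .
    have j: "jcy Q m \<in> {1..M}" if "m \<in> {1..N}" for m N using jcy_in that by simp
    have X: "Exp Q Cy (\<lambda>_. 0) \<rho> N f = (\<Sum>s\<in>Sset Q (\<lambda>_. 0) (jcy Q) (N * M).
        prob Q (\<lambda>_. 0) \<rho> (jcy Q) (N * M) s * f (Qvec Q (\<lambda>_. 0) (jcy Q) (N * M) s))" for N f by (simp add: Exp_def)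
    show ?thesis unfolding Cy X
    proof (rule E.vector_clt[where h = "\<lambda>j. hsum (obs j) js", OF \<rho>])
      show "tau_sh Q Cy > 0" using \<tau> Cy by simp
      show "finite (Sset Q (\<lambda>_. 0) (jcy Q) (N * M))" for N by (rule finite_Sset) (rule j)
      show "prob Q (\<lambda>_. 0) \<rho> (jcy Q) (N * M) s \<ge> 0" for N s by (rule prob_Rs(2)[OF _ assms(6)]) (rule j)
      show "tau_sh Q Cy * Dcov Q Cy i k = Re (E.kap (hsum (obs i) js) (hsum (obs k) js)) + Re (E.kap (hsum (obs k) js) (hsum (obs i) js))"
        if "i \<in> {1..M}" for i k unfolding js_def by (rule Dcov_Cy[OF assms(5) r _ that]) (use assms(3) Cy in simp)
      show "(\<Sum>s\<in>Sset Q (\<lambda>_. 0) (jcy Q) (N * M). complex_of_real (prob Q (\<lambda>_. 0) \<rho> (jcy Q) (N * M) s) *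
          iexp (t * (\<Sum>j=1..M. u j * Qvec Q (\<lambda>_. 0) (jcy Q) (N * M) s j))) = E.cf (emb \<rho>) (\<lambda>b. \<Sum>j=1..M. u j * hsum (obs j) js b) N t (fid d)" for N u t
        unfolding cyclic_cf[OF q \<rho>(1) js_def, symmetric] by (rule fcs_cf[OF _ assms(6)]) (rule j)
    qed
  next
    case Ra
    have q: "qenv d Bp (wp (\<lambda>_. 0)) Kp r" by (rule qenv_Ra[OF r]) (use assms(3) Ra in simp)
    then interpret E: qenv d Bp "wp (\<lambda>_. 0)" Kp r .
    \<comment> \<open>Schedule and measurement record together form one finite sample space, as
      \<open>vector_clt\<close> expects.\<close>
    define \<Omega> where "\<Omega> N = Sigma (Jset Q N) (\<lambda>js. Sset Q (\<lambda>_. 0) js N)" for N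
    define P where "P N \<omega> = 1 / real M ^ N * prob Q (\<lambda>_. 0) \<rho> (fst \<omega>) N (snd \<omega>)" for N and \<omega> :: "(nat => nat) \<times> (nat => real \<times> real)"
    have j: "js m \<in> {1..M}" if "js \<in> Jset Q N" "m \<in> {1..N}" for js m N using that by (auto simp: Jset_def)
    have fJ: "finite (Jset Q N)" for N using finite_finwords[of N "\<lambda>_. {1..M}" 0] by (simp add: Jset_def finwords_def)
    have fS: "finite (Sset Q (\<lambda>_. 0) js N)" if "js \<in> Jset Q N" for js N by (rule finite_Sset) (rule j[OF that])
    have X: "Exp Q Ra (\<lambda>_. 0) \<rho> N f = (\<Sum>\<omega>\<in>\<Omega> N. P N \<omega> * f (Qvec Q (\<lambda>_. 0) (fst \<omega>) N (snd \<omega>)))" for N f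
      unfolding \<Omega>_def P_def using sum.Sigma[of "Jset Q N" "\<lambda>js. Sset Q (\<lambda>_. 0) js N", OF fJ] fS
      by (simp add: Exp_def sum_distrib_left case_prod_unfold mult.assoc)
    show ?thesis unfolding Ra X
    proof (rule E.vector_clt[where h = "\<lambda>j. hp (obs j)", OF \<rho>])
      show "tau_sh Q Ra > 0" using \<tau> Ra by simp
      show "finite (\<Omega> N)" for N unfolding \<Omega>_def by (rule finite_SigmaI[OF fJ fS])
      show "P N \<omega> \<ge> 0" if "\<omega> \<in> \<Omega> N" for N \<omega>
      proof -
        have "fst \<omega> \<in> Jset Q N" using that by (auto simp: \<Omega>_def)
        then show ?thesis unfolding P_def by (intro mult_nonneg_nonneg prob_Rs(2)[OF _ assms(6)] j) auto
      qed
      show "tau_sh Q Ra * Dcov Q Ra i k = Re (E.kap (hp (obs i)) (hp (obs k))) + Re (E.kap (hp (obs k)) (hp (obs i)))"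
        if "i \<in> {1..M}" for i k by (rule Dcov_Ra[OF assms(5) r _ that]) (use assms(3) Ra in simp)
      fix N u t
      have sg: "(\<Sum>js\<in>Jset Q N. \<Sum>s\<in>Sset Q (\<lambda>_. 0) js N. G js s) = (\<Sum>(js, s)\<in>Sigma (Jset Q N) (\<lambda>js. Sset Q (\<lambda>_. 0) js N). G js s)"
        for G :: "_ => _ => complex" by (rule sum.Sigma[OF fJ]) (use fS in blast)
      have "(\<Sum>\<omega>\<in>\<Omega> N. complex_of_real (P N \<omega>) * iexp (t * (\<Sum>j=1..M. u j * Qvec Q (\<lambda>_. 0) (fst \<omega>) N (snd \<omega>) j))) =
        (\<Sum>js\<in>Jset Q N. \<Sum>s\<in>Sset Q (\<lambda>_. 0) js N. of_real (1 / real M ^ N) *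
          (of_real (prob Q (\<lambda>_. 0) \<rho> js N s) * iexp (t * (\<Sum>j=1..M. u j * Qvec Q (\<lambda>_. 0) js N s j))))"
        unfolding \<Omega>_def P_def sg by (intro sum.cong[OF refl]) (simp add: case_prod_unfold mult.assoc del: of_real_sum)
      also have "\<dots> = (\<Sum>js\<in>Jset Q N. of_real (1 / real M ^ N) * ftr (Gs (ph u t) js (emb \<rho>) N))"
        unfolding sum_distrib_left[symmetric] by (intro sum.cong[OF refl] arg_cong[where f = "\<lambda>x. _ * x"] fcs_cf[OF _ assms(6)]) (rule j)
      finally show "(\<Sum>\<omega>\<in>\<Omega> N. complex_of_real (P N \<omega>) * iexp (t * (\<Sum>j=1..M. u j * Qvec Q (\<lambda>_. 0) (fst \<omega>) N (snd \<omega>) j))) =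
        E.cf (emb \<rho>) (\<lambda>b. \<Sum>j=1..M. u j * hp (obs j) b) N t (fid d)" unfolding random_cf[OF q \<rho>(1)] .
    qed
  next
    case Rcy
    then show ?thesis using assms(2) by simp
  qed
qed

end
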